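(* Let $k$ be a field and let $\mathcal{P}$ be a $k$-linear dg-category such that: (a) the set of objects $\mathrm{Ob}(\mathcal{P})$ is finite; (b) for all $E,F\in \mathrm{Ob}(\mathcal{P})$ and all $i\in\mathbb{Z}$, $\mathcal{P}^i(E,F)$ is a finite-dimensional $k$-vector space; (c) there is an integer $m>0$ such that $\mathcal{P}^i(E,F)=0$ for all $E,F\in\mathrm{Ob}(\mathcal{P})$ and all $i<-m$. For each commutative $k$-algebra $B$ put $R(B):=MC(\mathcal{P}\otimes_k B)$ (the dg-category of Maurer-Cartan objects of $\mathcal{P}\otimes_kB$) and $X(B):=NC^{\ast}(R(B))$ (its coherent nerve restricted to simplices all of whose edges are equivalences). Then the simplicial scheme $X_{\cdot}$ satisfies the condition $G.P_{n,k}$ for every $n\ge 1$ and every $0\le k\le n$; that is, $X_{\cdot}$ is a Grothendieck-Pridham simplicial scheme.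
   Context: All dg-categories have differentials of degree $+1$, and $d(fg)=d(f)g+(-1)^{|f|}f\,d(g)$. (In $G.P_{n,k}$ the letter $k$ is an integer index, unrelated to the base field.) Maurer-Cartan objects: for a dg-category $\mathcal{Q}$, $MC(\mathcal{Q})$ is the dg-category whose objects are pairs $(E,\eta)$ with $E\in\mathrm{Ob}(\mathcal{Q})$ and $\eta\in\mathcal{Q}^1(E,E)$ satisfying $d(\eta)+\eta^2=0$. Its morphism complexes are $MC(\mathcal{Q})^i((E,\eta),(F,\zeta))=\mathcal{Q}^i(E,F)$ with differential $f\mapsto d(f)+\zeta f-(-1)^{|f|}f\eta$ and composition that of $\mathcal{Q}$. $\mathcal{P}\otimes_kB$ has the same objects as $\mathcal{P}$ and morphism complexes $\mathcal{P}(E,F)\otimes_kB$. Coherent nerve: for a dg-category $\mathcal{A}$, $NC(\mathcal{A})$ is the simplicial set whose $n$-simplices are the data of objects $X_0,\dots,X_n$ of $\mathcal{A}$ and, for every sequence $0\le i_0\le\cdots\le i_l\le n$ with $l\ge1$, an element $\alpha(i_0,\dots,i_l)\in\mathcal{A}^{1-l}(X_{i_0},X_{i_l})$ such that: (i) $\alpha(i,i)=1_{X_i}$, and if $l\ge2$ and $i_j=i_{j+1}$ for some $j$ then $\alpha(i_0,\dots,i_l)=0$; (ii) $d(\alpha(i_0,\dots,i_l))=\sum_{j=1}^{l-1}(-1)^{l-j-1}\big(\alpha(i_j,\dots,i_l)\,\alpha(i_0,\dots,i_j)-\alpha(i_0,\dots,\widehat{i_j},\dots,i_l)\big)$. For an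 order-preserving map $\theta:\{0,\dots,p\}\to\{0,\dots,n\}$, the simplicial structure is $(\theta^*\alpha)(i_0,\dots,i_l)=\alpha(\theta(i_0),\dots,\theta(i_l))$ with objects $X_{\theta(0)},\dots,X_{\theta(p)}$. For example, a 2-simplex consists of closed degree-$0$ maps $\alpha(0,1),\alpha(1,2),\alpha(0,2)$ and $\alpha(0,1,2)$ of degree $-1$ with $d\alpha(0,1,2)=\alpha(1,2)\alpha(0,1)-\alpha(0,2)$. $NC^{\ast}(\mathcal{A})\subset NC(\mathcal{A})$ is the simplicial subset of those simplices for which every $\alpha(i_0,i_1)\in\mathcal{A}^0(X_{i_0},X_{i_1})$, $i_0\le i_1$, is an equivalence, i.e. its class is invertible in the category $H^0(\mathcal{A})$. Simplicial scheme: $X_n$ is the functor $B\mapsto NC^{\ast}(R(B))_n$ on commutative $k$-algebras, regarded as a scheme of finite type over the field $k$, namely the disjoint union over the finitely many tuples $(E_0,\dots,E_n)$ of underlying objects of $\mathcal{P}$ of the schemes representing the corresponding subfunctors. That these subfunctors are representable is a standing fact. Matching scheme: for a simplicial scheme $X_{\cdot}$, $n\ge1$ and $0\le k\le n$, $Match_{\Lambda^n_k}(X)$ is the scheme of $k$-th horns, i.e. of families $(f_i)_{0\le i\le n,\,i\ne k}$ of points of $X_{n-1}$ such that $\partial_i f_j=\partial_{j-1}f_i$ in $X_{n-2}$ for all $i<j$ with $i,j\neq k$ (for $n=1$ it is $X_0$). There is a natural morphism $\mu:X_n\to Match_{\Lambda^n_k}(X)$, $x\mapsto(\partial_i x)_{i\ne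 k}$. Condition $G.P_{n,k}$: the morphism $\mu:X_n\to Match_{\Lambda^n_k}(X)$ is smooth and surjective. A Grothendieck-Pridham simplicial scheme is a simplicial scheme satisfying $G.P_{n,k}$ for all $n\ge1$ and $0\le k\le n$. *)

theory Defs
  imports "HOL-Algebra.Module" "HOL-Algebra.AbelCoset" "HOL-Algebra.RingHom"
begin

section \<open>Extension of scalars\<close>

text \<open>
  A commutative \<open>K\<close>-algebra is a record \<open>B\<close> with \<open>algebra K B\<close> (the library locale, which
  requires \<open>B\<close> to be a commutative ring). The tensor product of a \<open>K\<close>-module \<open>V\<close> with \<open>B\<close> is
  the free \<open>B\<close>-module on the set \<open>carrier V\<close> modulo the submodule that forces
  \<open>v \<mapsto> [v]\<close> to be \<open>K\<close>-linear; its elements are cosets. The multiplicative fields of the two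
  records are irrelevant.
\<close>

definition free_module :: "('k, 'v) module \<Rightarrow> ('k, 'b) module \<Rightarrow> ('b, 'v \<Rightarrow> 'b) module" where
  "free_module V B =
     \<lparr> carrier = {u. (\<forall>v. u v \<in> carrier B) \<and> (\<forall>v. v \<notin> carrier V \<longrightarrow> u v = \<zero>\<^bsub>B\<^esub>) \<and>
                     finite {v. u v \<noteq> \<zero>\<^bsub>B\<^esub>}},
       mult = undefined, one = undefined,
       zero = (\<lambda>v. \<zero>\<^bsub>B\<^esub>),
       add = (\<lambda>u w v. u v \<oplus>\<^bsub>B\<^esub> w v),
       smult = (\<lambda>b u v. b \<otimes>\<^bsub>B\<^esub> u v) \<rparr>"

definition single :: "('k, 'b) module \<Rightarrow> 'v \<Rightarrow> 'b \<Rightarrow> ('v \<Rightarrow> 'b)" where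
  "single B v b = (\<lambda>w. if w = v then b else \<zero>\<^bsub>B\<^esub>)"

definition tensor_relations ::
    "'k ring \<Rightarrow> ('k, 'v) module \<Rightarrow> ('k, 'b) module \<Rightarrow> ('v \<Rightarrow> 'b) set" where
  "tensor_relations K V B =
     (let F = free_module V B in
        {single B (v \<oplus>\<^bsub>V\<^esub> w) \<one>\<^bsub>B\<^esub> \<ominus>\<^bsub>F\<^esub> (single B v \<one>\<^bsub>B\<^esub> \<oplus>\<^bsub>F\<^esub> single B w \<one>\<^bsub>B\<^esub>) | v w.
           v \<in> carrier V \<and> w \<in> carrier V} \<union>
        {single B (c \<odot>\<^bsub>V\<^esub> v) \<one>\<^bsub>B\<^esub> \<ominus>\<^bsub>F\<^esub> single B v (c \<odot>\<^bsub>B\<^esub> \<one>\<^bsub>B\<^esub>) | c v.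
           c \<in> carrier K \<and> v \<in> carrier V})"

definition tensor_null ::
    "'k ring \<Rightarrow> ('k, 'v) module \<Rightarrow> ('k, 'b) module \<Rightarrow> ('v \<Rightarrow> 'b) set" where
  "tensor_null K V B =
     \<Inter> {N. submodule N B (free_module V B) \<and> tensor_relations K V B \<subseteq> N}"

definition tensor ::
    "'k ring \<Rightarrow> ('k, 'v) module \<Rightarrow> ('k, 'b) module \<Rightarrow> ('b, ('v \<Rightarrow> 'b) set) module" where
  "tensor K V B =
     (let F = free_module V B; N = tensor_null K V B in
     \<lparr> carrier = a_rcosets\<^bsub>F\<^esub> N,
       mult = undefined, one = undefined,
       zero = N,
       add = set_add F,
       smult = (\<lambda>b T. \<Union>u\<in>T. N +>\<^bsub>F\<^esub> (b \<odot>\<^bsub>F\<^esub> u)) \<rparr>)"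

definition pure_tensor ::
    "'k ring \<Rightarrow> ('k, 'v) module \<Rightarrow> ('k, 'b) module \<Rightarrow> 'v \<Rightarrow> 'b \<Rightarrow> ('v \<Rightarrow> 'b) set" where
  "pure_tensor K V B v b = tensor_null K V B +>\<^bsub>free_module V B\<^esub> single B v b"

text \<open>
  The maps \<open>h \<otimes> 1\<close>, \<open>(g \<otimes> b, f \<otimes> c) \<mapsto> h g f \<otimes> b c\<close> and \<open>v \<otimes> b \<mapsto> v \<otimes> \<phi> b\<close>, computed on
  representatives; for linear (bilinear) \<open>h\<close> and an algebra morphism \<open>\<phi>\<close> the result does not
  depend on the representative, so the unions below are unions of equal cosets.
\<close>

definition tensor_lin ::
    "'k ring \<Rightarrow> ('k, 'w) module \<Rightarrow> ('k, 'b) module \<Rightarrow> ('v \<Rightarrow> 'w) \<Rightarrow>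
     ('v \<Rightarrow> 'b) set \<Rightarrow> ('w \<Rightarrow> 'b) set" where
  "tensor_lin K W B h T =
     (\<Union>u\<in>T. finsum (tensor K W B) (\<lambda>v. pure_tensor K W B (h v) (u v)) {v. u v \<noteq> \<zero>\<^bsub>B\<^esub>})"

definition tensor_bilin ::
    "'k ring \<Rightarrow> ('k, 'w) module \<Rightarrow> ('k, 'b) module \<Rightarrow> ('u \<Rightarrow> 'v \<Rightarrow> 'w) \<Rightarrow>
     ('u \<Rightarrow> 'b) set \<Rightarrow> ('v \<Rightarrow> 'b) set \<Rightarrow> ('w \<Rightarrow> 'b) set" where
  "tensor_bilin K W B h S T =
     (\<Union>s\<in>S. \<Union>t\<in>T. finsum (tensor K W B)
        (\<lambda>(x, y). pure_tensor K W B (h x y) (s x \<otimes>\<^bsub>B\<^esub> t y))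
        ({x. s x \<noteq> \<zero>\<^bsub>B\<^esub>} \<times> {y. t y \<noteq> \<zero>\<^bsub>B\<^esub>}))"

definition tensor_base ::
    "'k ring \<Rightarrow> ('k, 'v) module \<Rightarrow> ('k, 'b) module \<Rightarrow> ('k, 'b) module \<Rightarrow> ('b \<Rightarrow> 'b) \<Rightarrow>
     ('v \<Rightarrow> 'b) set \<Rightarrow> ('v \<Rightarrow> 'b) set" where
  "tensor_base K V B C \<phi> T =
     (\<Union>u\<in>T. finsum (tensor K V C) (\<lambda>v. pure_tensor K V C v (\<phi> (u v))) {v. u v \<noteq> \<zero>\<^bsub>B\<^esub>})"

definition fin_dim :: "'k ring \<Rightarrow> ('k, 'v) module \<Rightarrow> bool" where
  "fin_dim K V \<longleftrightarrow>
     (\<exists>S. finite S \<and> S \<subseteq> carrier V \<and>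
        (\<forall>v\<in>carrier V. \<exists>c\<in>S \<rightarrow> carrier K. v = finsum V (\<lambda>s. c s \<odot>\<^bsub>V\<^esub> s) S))"


section \<open>dg-categories\<close>

text \<open>
  \<open>Hom A E F i\<close> is the module of morphisms of degree \<open>i\<close>; the composite \<open>g f\<close> of
  \<open>g\<close> of degree \<open>i\<close> from \<open>F\<close> to \<open>G\<close> with \<open>f\<close> of degree \<open>j\<close> from \<open>E\<close> to \<open>F\<close> is
  \<open>cmp A E F G i j g f\<close>.
\<close>

record ('k, 'o, 'm) dgcat =
  Ob :: "'o set"
  Hom :: "'o \<Rightarrow> 'o \<Rightarrow> int \<Rightarrow> ('k, 'm) module"
  dif :: "'o \<Rightarrow> 'o \<Rightarrow> int \<Rightarrow> 'm \<Rightarrow> 'm"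
  cmp :: "'o \<Rightarrow> 'o \<Rightarrow> 'o \<Rightarrow> int \<Rightarrow> int \<Rightarrow> 'm \<Rightarrow> 'm \<Rightarrow> 'm"
  idn :: "'o \<Rightarrow> 'm"

definition sgn_act :: "('k, 'm) module \<Rightarrow> int \<Rightarrow> 'm \<Rightarrow> 'm" where
  "sgn_act M i x = (if even i then x else \<ominus>\<^bsub>M\<^esub> x)"

locale dg_category =
  fixes R :: "'k ring" and A :: "('k, 'o, 'm) dgcat"
  assumes base_cring: "cring R"
    and hom_module: "\<lbrakk>E \<in> Ob A; F \<in> Ob A\<rbrakk> \<Longrightarrow> module R (Hom A E F i)"
    and dif_closed: "\<lbrakk>E \<in> Ob A; F \<in> Ob A; f \<in> carrier (Hom A E F i)\<rbrakk>
      \<Longrightarrow> dif A E F i f \<in> carrier (Hom A E F (i + 1))"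
    and dif_add: "\<lbrakk>E \<in> Ob A; F \<in> Ob A; f \<in> carrier (Hom A E F i); f' \<in> carrier (Hom A E F i)\<rbrakk>
      \<Longrightarrow> dif A E F i (f \<oplus>\<^bsub>Hom A E F i\<^esub> f') = dif A E F i f \<oplus>\<^bsub>Hom A E F (i + 1)\<^esub> dif A E F i f'"
    and dif_smult: "\<lbrakk>E \<in> Ob A; F \<in> Ob A; c \<in> carrier R; f \<in> carrier (Hom A E F i)\<rbrakk>
      \<Longrightarrow> dif A E F i (c \<odot>\<^bsub>Hom A E F i\<^esub> f) = c \<odot>\<^bsub>Hom A E F (i + 1)\<^esub> dif A E F i f"
    and dif_dif: "\<lbrakk>E \<in> Ob A; F \<in> Ob A; f \<in> carrier (Hom A E F i)\<rbrakk>
      \<Longrightarrow> dif A E F (i + 1) (dif A E F i f) = \<zero>\<^bsub>Hom A E F (i + 2)\<^esub>"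
    and cmp_closed: "\<lbrakk>E \<in> Ob A; F \<in> Ob A; G \<in> Ob A;
        g \<in> carrier (Hom A F G i); f \<in> carrier (Hom A E F j)\<rbrakk>
      \<Longrightarrow> cmp A E F G i j g f \<in> carrier (Hom A E G (i + j))"
    and cmp_add_left: "\<lbrakk>E \<in> Ob A; F \<in> Ob A; G \<in> Ob A;
        g \<in> carrier (Hom A F G i); g' \<in> carrier (Hom A F G i); f \<in> carrier (Hom A E F j)\<rbrakk>
      \<Longrightarrow> cmp A E F G i j (g \<oplus>\<^bsub>Hom A F G i\<^esub> g') f =
          cmp A E F G i j g f \<oplus>\<^bsub>Hom A E G (i + j)\<^esub> cmp A E F G i j g' f"
    and cmp_add_right: "\<lbrakk>E \<in> Ob A; F \<in> Ob A; G \<in> Ob A;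
        g \<in> carrier (Hom A F G i); f \<in> carrier (Hom A E F j); f' \<in> carrier (Hom A E F j)\<rbrakk>
      \<Longrightarrow> cmp A E F G i j g (f \<oplus>\<^bsub>Hom A E F j\<^esub> f') =
          cmp A E F G i j g f \<oplus>\<^bsub>Hom A E G (i + j)\<^esub> cmp A E F G i j g f'"
    and cmp_smult_left: "\<lbrakk>E \<in> Ob A; F \<in> Ob A; G \<in> Ob A; c \<in> carrier R;
        g \<in> carrier (Hom A F G i); f \<in> carrier (Hom A E F j)\<rbrakk>
      \<Longrightarrow> cmp A E F G i j (c \<odot>\<^bsub>Hom A F G i\<^esub> g) f = c \<odot>\<^bsub>Hom A E G (i + j)\<^esub> cmp A E F G i j g f"
    and cmp_smult_right: "\<lbrakk>E \<in> Ob A; F \<in> Ob A; G \<in> Ob A; c \<in> carrier R;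
        g \<in> carrier (Hom A F G i); f \<in> carrier (Hom A E F j)\<rbrakk>
      \<Longrightarrow> cmp A E F G i j g (c \<odot>\<^bsub>Hom A E F j\<^esub> f) = c \<odot>\<^bsub>Hom A E G (i + j)\<^esub> cmp A E F G i j g f"
    and cmp_assoc: "\<lbrakk>E \<in> Ob A; F \<in> Ob A; G \<in> Ob A; H \<in> Ob A;
        h \<in> carrier (Hom A G H l); g \<in> carrier (Hom A F G i); f \<in> carrier (Hom A E F j)\<rbrakk>
      \<Longrightarrow> cmp A E F H (l + i) j (cmp A F G H l i h g) f =
          cmp A E G H l (i + j) h (cmp A E F G i j g f)"
    and idn_closed: "E \<in> Ob A \<Longrightarrow> idn A E \<in> carrier (Hom A E E 0)"
    and idn_left: "\<lbrakk>E \<in> Ob A; F \<in> Ob A; f \<in> carrier (Hom A E F i)\<rbrakk>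
      \<Longrightarrow> cmp A E F F 0 i (idn A F) f = f"
    and idn_right: "\<lbrakk>E \<in> Ob A; F \<in> Ob A; f \<in> carrier (Hom A E F i)\<rbrakk>
      \<Longrightarrow> cmp A E E F i 0 f (idn A E) = f"
    and leibniz: "\<lbrakk>E \<in> Ob A; F \<in> Ob A; G \<in> Ob A;
        g \<in> carrier (Hom A F G i); f \<in> carrier (Hom A E F j)\<rbrakk>
      \<Longrightarrow> dif A E G (i + j) (cmp A E F G i j g f) =
          cmp A E F G (i + 1) j (dif A F G i g) f \<oplus>\<^bsub>Hom A E G (i + j + 1)\<^esub>
          sgn_act (Hom A E G (i + j + 1)) i (cmp A E F G i (j + 1) g (dif A E F j f))"

definition dg_tensor ::
    "'k ring \<Rightarrow> ('k, 'o, 'm) dgcat \<Rightarrow> ('k, 'b) module \<Rightarrow> ('b, 'o, ('m \<Rightarrow> 'b) set) dgcat" where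
  "dg_tensor K P B =
     \<lparr> Ob = Ob P,
       Hom = (\<lambda>E F i. tensor K (Hom P E F i) B),
       dif = (\<lambda>E F i. tensor_lin K (Hom P E F (i + 1)) B (dif P E F i)),
       cmp = (\<lambda>E F G i j. tensor_bilin K (Hom P E G (i + j)) B (cmp P E F G i j)),
       idn = (\<lambda>E. pure_tensor K (Hom P E E 0) B (idn P E) \<one>\<^bsub>B\<^esub>) \<rparr>"

definition MC :: "('k, 'o, 'm) dgcat \<Rightarrow> ('k, 'o \<times> 'm, 'm) dgcat" where
  "MC Q =
     \<lparr> Ob = {(E, \<eta>). E \<in> Ob Q \<and> \<eta> \<in> carrier (Hom Q E E 1) \<and>
               dif Q E E 1 \<eta> \<oplus>\<^bsub>Hom Q E E 2\<^esub> cmp Q E E E 1 1 \<eta> \<eta> = \<zero>\<^bsub>Hom Q E E 2\<^esub>},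
       Hom = (\<lambda>(E, \<eta>) (F, \<zeta>) i. Hom Q E F i),
       dif = (\<lambda>(E, \<eta>) (F, \<zeta>) i f.
         (dif Q E F i f \<oplus>\<^bsub>Hom Q E F (i + 1)\<^esub> cmp Q E F F 1 i \<zeta> f) \<ominus>\<^bsub>Hom Q E F (i + 1)\<^esub>
         sgn_act (Hom Q E F (i + 1)) i (cmp Q E E F i 1 f \<eta>)),
       cmp = (\<lambda>(E, \<eta>) (F, \<zeta>) (G, \<xi>). cmp Q E F G),
       idn = (\<lambda>(E, \<eta>). idn Q E) \<rparr>"

definition cocycle0 :: "('k, 'o, 'm) dgcat \<Rightarrow> 'o \<Rightarrow> 'o \<Rightarrow> 'm set" where
  "cocycle0 A E F = {f \<in> carrier (Hom A E F 0). dif A E F 0 f = \<zero>\<^bsub>Hom A E F 1\<^esub>}"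

definition homologous0 :: "('k, 'o, 'm) dgcat \<Rightarrow> 'o \<Rightarrow> 'o \<Rightarrow> 'm \<Rightarrow> 'm \<Rightarrow> bool" where
  "homologous0 A E F f f' \<longleftrightarrow>
     (\<exists>h\<in>carrier (Hom A E F (-1)). f \<ominus>\<^bsub>Hom A E F 0\<^esub> f' = dif A E F (-1) h)"

definition equivalence :: "('k, 'o, 'm) dgcat \<Rightarrow> 'o \<Rightarrow> 'o \<Rightarrow> 'm \<Rightarrow> bool" where
  "equivalence A E F f \<longleftrightarrow> f \<in> cocycle0 A E F \<and>
     (\<exists>g\<in>cocycle0 A F E. homologous0 A E E (cmp A E F E 0 0 g f) (idn A E) \<and>
                          homologous0 A F F (cmp A F E F 0 0 f g) (idn A F))"


section \<open>The coherent nerve\<close>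

text \<open>
  The sequence \<open>(i\<^sub>0, \<dots>, i\<^sub>l)\<close> is the list \<open>s\<close> of length \<open>l + 1\<close>; hence \<open>drop j s\<close>,
  \<open>take (j + 1) s\<close> and \<open>take j s @ drop (j + 1) s\<close> are \<open>(i\<^sub>j, \<dots>, i\<^sub>l)\<close>, \<open>(i\<^sub>0, \<dots>, i\<^sub>j)\<close> and
  the sequence with \<open>i\<^sub>j\<close> omitted. Both components of a simplex are extensional functions,
  so that equality of simplices is equality of the data.
\<close>

definition nerve_seqs :: "nat \<Rightarrow> nat list set" where
  "nerve_seqs n = {s. 2 \<le> length s \<and> sorted s \<and> set s \<subseteq> {..n}}"

definition seq_deg :: "nat list \<Rightarrow> int" where
  "seq_deg s = 2 - int (length s)"

type_synonym ('o, 'm) simplex = "(nat \<Rightarrow> 'o) \<times> (nat list \<Rightarrow> 'm)"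

definition coherent_nerve :: "('k, 'o, 'm) dgcat \<Rightarrow> nat \<Rightarrow> ('o, 'm) simplex set" where
  "coherent_nerve A n =
     {(X, \<alpha>). X \<in> {..n} \<rightarrow>\<^sub>E Ob A \<and>
        \<alpha> \<in> (\<Pi>\<^sub>E s\<in>nerve_seqs n. carrier (Hom A (X (hd s)) (X (last s)) (seq_deg s))) \<and>
        (\<forall>i\<le>n. \<alpha> [i, i] = idn A (X i)) \<and>
        (\<forall>s\<in>nerve_seqs n. 3 \<le> length s \<and> (\<exists>j. Suc j < length s \<and> s ! j = s ! Suc j) \<longrightarrow>
           \<alpha> s = \<zero>\<^bsub>Hom A (X (hd s)) (X (last s)) (seq_deg s)\<^esub>) \<and>
        (\<forall>s\<in>nerve_seqs n.
           (let l = length s - 1; M = Hom A (X (hd s)) (X (last s)) (seq_deg s + 1) in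
            dif A (X (hd s)) (X (last s)) (seq_deg s) (\<alpha> s) =
            finsum M (\<lambda>j. sgn_act M (int l - int j - 1)
                (cmp A (X (hd s)) (X (s ! j)) (X (last s))
                   (seq_deg (drop j s)) (seq_deg (take (j + 1) s))
                   (\<alpha> (drop j s)) (\<alpha> (take (j + 1) s))
                 \<ominus>\<^bsub>M\<^esub> \<alpha> (take j s @ drop (j + 1) s)))
              {1..<l}))}"

definition coherent_nerve_eq :: "('k, 'o, 'm) dgcat \<Rightarrow> nat \<Rightarrow> ('o, 'm) simplex set" where
  "coherent_nerve_eq A n =
     {(X, \<alpha>) \<in> coherent_nerve A n.
        \<forall>i j. i \<le> j \<and> j \<le> n \<longrightarrow> equivalence A (X i) (X j) (\<alpha> [i, j])}"

definition nerve_pullback ::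
    "nat \<Rightarrow> (nat \<Rightarrow> nat) \<Rightarrow> ('o, 'm) simplex \<Rightarrow> ('o, 'm) simplex" where
  "nerve_pullback p \<theta> x =
     (\<lambda>i\<in>{..p}. fst x (\<theta> i), \<lambda>s\<in>nerve_seqs p. snd x (map \<theta> s))"


section \<open>Functors of points\<close>

text \<open>
  Schemes over \<open>K\<close> are treated through their functors of points on commutative \<open>K\<close>-algebras
  whose carrier lies in a type \<open>'b\<close>. A disjoint union of schemes is represented here by the
  disjoint union of the functors of its components: its \<open>B\<close>-points are the morphisms from
  \<open>Spec B\<close> landing in a single component. Smoothness is local on the source and
  spectra of fields are connected, so testing on such points is testing component by component.
\<close>

definition alg_hom :: "'k ring \<Rightarrow> ('k, 'b) module \<Rightarrow> ('k, 'b) module \<Rightarrow> ('b \<Rightarrow> 'b) set" where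
  "alg_hom K B C =
     {\<phi> \<in> ring_hom B C. \<forall>c\<in>carrier K. \<forall>b\<in>carrier B. \<phi> (c \<odot>\<^bsub>B\<^esub> b) = c \<odot>\<^bsub>C\<^esub> \<phi> b}"

record ('k, 'b, 'x) kfun =
  points :: "('k, 'b) module \<Rightarrow> 'x set"
  pmap :: "('k, 'b) module \<Rightarrow> ('k, 'b) module \<Rightarrow> ('b \<Rightarrow> 'b) \<Rightarrow> 'x \<Rightarrow> 'x"

definition kfunctor :: "'k ring \<Rightarrow> ('k, 'b, 'x) kfun \<Rightarrow> bool" where
  "kfunctor K F \<longleftrightarrow>
     (\<forall>B C \<phi>. algebra K B \<and> algebra K C \<and> \<phi> \<in> alg_hom K B C \<longrightarrow>
        pmap F B C \<phi> \<in> points F B \<rightarrow> points F C) \<and>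
     (\<forall>B x. algebra K B \<and> x \<in> points F B \<longrightarrow> pmap F B B (\<lambda>b. b) x = x) \<and>
     (\<forall>B C D \<phi> \<psi> x. algebra K B \<and> algebra K C \<and> algebra K D \<and>
        \<phi> \<in> alg_hom K B C \<and> \<psi> \<in> alg_hom K C D \<and> x \<in> points F B \<longrightarrow>
        pmap F B D (\<lambda>b. \<psi> (\<phi> b)) x = pmap F C D \<psi> (pmap F B C \<phi> x))"

text \<open>
  Infinitesimal lifting: a surjection \<open>B \<rightarrow> C\<close> with square-zero kernel is a first order
  thickening \<open>Spec C \<rightarrow> Spec B\<close> of affine schemes.
\<close>

definition formally_smooth ::
    "'k ring \<Rightarrow> ('k, 'b, 'x) kfun \<Rightarrow> ('k, 'b, 'y) kfun \<Rightarrow> (('k, 'b) module \<Rightarrow> 'x \<Rightarrow> 'y) \<Rightarrow> bool"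
  where
  "formally_smooth K F G \<mu> \<longleftrightarrow>
     (\<forall>B C \<phi> x y. algebra K B \<and> algebra K C \<and> \<phi> \<in> alg_hom K B C \<and>
        \<phi> ` carrier B = carrier C \<and>
        (\<forall>a\<in>a_kernel B C \<phi>. \<forall>b\<in>a_kernel B C \<phi>. a \<otimes>\<^bsub>B\<^esub> b = \<zero>\<^bsub>B\<^esub>) \<and>
        x \<in> points F C \<and> y \<in> points G B \<and> \<mu> C x = pmap G B C \<phi> y \<longrightarrow>
        (\<exists>z\<in>points F B. pmap F B C \<phi> z = x \<and> \<mu> B z = y))"

definition directed_system ::
    "'k ring \<Rightarrow> 'i set \<Rightarrow> ('i \<Rightarrow> 'i \<Rightarrow> bool) \<Rightarrow> ('i \<Rightarrow> ('k, 'b) module) \<Rightarrow>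
     ('i \<Rightarrow> 'i \<Rightarrow> 'b \<Rightarrow> 'b) \<Rightarrow> bool" where
  "directed_system K I po D f \<longleftrightarrow>
     I \<noteq> {} \<and> (\<forall>i\<in>I. po i i) \<and>
     (\<forall>i\<in>I. \<forall>j\<in>I. \<forall>l\<in>I. po i j \<and> po j l \<longrightarrow> po i l) \<and>
     (\<forall>i\<in>I. \<forall>j\<in>I. \<exists>l\<in>I. po i l \<and> po j l) \<and>
     (\<forall>i\<in>I. algebra K (D i)) \<and>
     (\<forall>i\<in>I. \<forall>j\<in>I. po i j \<longrightarrow> f i j \<in> alg_hom K (D i) (D j)) \<and>
     (\<forall>i\<in>I. \<forall>b\<in>carrier (D i). f i i b = b) \<and>
     (\<forall>i\<in>I. \<forall>j\<in>I. \<forall>l\<in>I. po i j \<and> po j l \<longrightarrow>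
        (\<forall>b\<in>carrier (D i). f j l (f i j b) = f i l b))"

definition directed_colimit ::
    "'k ring \<Rightarrow> 'i set \<Rightarrow> ('i \<Rightarrow> 'i \<Rightarrow> bool) \<Rightarrow> ('i \<Rightarrow> ('k, 'b) module) \<Rightarrow>
     ('i \<Rightarrow> 'i \<Rightarrow> 'b \<Rightarrow> 'b) \<Rightarrow> ('k, 'b) module \<Rightarrow> ('i \<Rightarrow> 'b \<Rightarrow> 'b) \<Rightarrow> bool" where
  "directed_colimit K I po D f B g \<longleftrightarrow>
     algebra K B \<and> (\<forall>i\<in>I. g i \<in> alg_hom K (D i) B) \<and>
     (\<forall>i\<in>I. \<forall>j\<in>I. po i j \<longrightarrow> (\<forall>b\<in>carrier (D i). g j (f i j b) = g i b)) \<and>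
     (\<forall>b\<in>carrier B. \<exists>i\<in>I. \<exists>a\<in>carrier (D i). g i a = b) \<and>
     (\<forall>i\<in>I. \<forall>a\<in>carrier (D i). \<forall>a'\<in>carrier (D i). g i a = g i a' \<longrightarrow>
        (\<exists>j\<in>I. po i j \<and> f i j a = f i j a'))"

text \<open>
  Locally of finite presentation, in the form used for transformations of functors: for every
  \<open>y \<in> G(A)\<close>, the functor on \<open>A\<close>-algebras of points of \<open>F\<close> lying over \<open>y\<close> commutes with
  directed colimits (here \<open>\<sigma> i : A \<rightarrow> D i\<close> and \<open>\<tau> : A \<rightarrow> B\<close> are the structure maps). The type
  argument is the type of the indices of the directed systems.
\<close>

definition locally_fin_pres ::
    "'i itself \<Rightarrow> 'k ring \<Rightarrow> ('k, 'b, 'x) kfun \<Rightarrow> ('k, 'b, 'y) kfun \<Rightarrow>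
     (('k, 'b) module \<Rightarrow> 'x \<Rightarrow> 'y) \<Rightarrow> bool" where
  "locally_fin_pres I_type K F G \<mu> \<longleftrightarrow>
     (\<forall>(I :: 'i set) po D f B g A \<sigma> \<tau> y.
        directed_system K I po D f \<and> directed_colimit K I po D f B g \<and>
        algebra K A \<and> y \<in> points G A \<and> \<tau> \<in> alg_hom K A B \<and>
        (\<forall>i\<in>I. \<sigma> i \<in> alg_hom K A (D i)) \<and>
        (\<forall>i\<in>I. \<forall>j\<in>I. po i j \<longrightarrow> (\<forall>a\<in>carrier A. f i j (\<sigma> i a) = \<sigma> j a)) \<and>
        (\<forall>i\<in>I. \<forall>a\<in>carrier A. g i (\<sigma> i a) = \<tau> a) \<longrightarrow>
        (\<forall>x\<in>points F B. \<mu> B x = pmap G A B \<tau> y \<longrightarrow>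
           (\<exists>i\<in>I. \<exists>z\<in>points F (D i).
              \<mu> (D i) z = pmap G A (D i) (\<sigma> i) y \<and> pmap F (D i) B (g i) z = x)) \<and>
        (\<forall>i\<in>I. \<forall>z\<in>points F (D i). \<forall>z'\<in>points F (D i).
           \<mu> (D i) z = pmap G A (D i) (\<sigma> i) y \<and> \<mu> (D i) z' = pmap G A (D i) (\<sigma> i) y \<and>
           pmap F (D i) B (g i) z = pmap F (D i) B (g i) z' \<longrightarrow>
           (\<exists>j\<in>I. po i j \<and> pmap F (D i) (D j) (f i j) z = pmap F (D i) (D j) (f i j) z')))"

definition smooth_morphism ::
    "'i itself \<Rightarrow> 'k ring \<Rightarrow> ('k, 'b, 'x) kfun \<Rightarrow> ('k, 'b, 'y) kfun \<Rightarrow>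
     (('k, 'b) module \<Rightarrow> 'x \<Rightarrow> 'y) \<Rightarrow> bool" where
  "smooth_morphism I_type K F G \<mu> \<longleftrightarrow>
     locally_fin_pres I_type K F G \<mu> \<and> formally_smooth K F G \<mu>"

text \<open>
  A point of the underlying space is a class of field-valued points, two of them being
  identified when they agree over a common extension field.
\<close>

definition same_point ::
    "'k ring \<Rightarrow> ('k, 'b, 'x) kfun \<Rightarrow> ('k, 'b) module \<Rightarrow> 'x \<Rightarrow> ('k, 'b) module \<Rightarrow> 'x \<Rightarrow> bool" where
  "same_point K F L x L' x' \<longleftrightarrow>
     (\<exists>M \<phi> \<phi>'. field M \<and> algebra K M \<and> \<phi> \<in> alg_hom K L M \<and> \<phi>' \<in> alg_hom K L' M \<and>
        pmap F L M \<phi> x = pmap F L' M \<phi>' x')"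

definition surjective_morphism ::
    "'k ring \<Rightarrow> ('k, 'b, 'x) kfun \<Rightarrow> ('k, 'b, 'y) kfun \<Rightarrow> (('k, 'b) module \<Rightarrow> 'x \<Rightarrow> 'y) \<Rightarrow> bool"
  where
  "surjective_morphism K F G \<mu> \<longleftrightarrow>
     (\<forall>L y. field L \<and> algebra K L \<and> y \<in> points G L \<longrightarrow>
        (\<exists>L' x. field L' \<and> algebra K L' \<and> x \<in> points F L' \<and>
           same_point K G L' (\<mu> L' x) L y))"


section \<open>Simplicial schemes and matching objects\<close>

text \<open>\<open>act n p \<theta> B\<close> is the map from the \<open>n\<close>-simplices to the \<open>p\<close>-simplices over \<open>B\<close> induced
  by the order-preserving map \<open>\<theta> : {0, \<dots>, p} \<rightarrow> {0, \<dots>, n}\<close>.\<close>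

record ('k, 'b, 'x) simplicial_kfun =
  level :: "nat \<Rightarrow> ('k, 'b, 'x) kfun"
  act :: "nat \<Rightarrow> nat \<Rightarrow> (nat \<Rightarrow> nat) \<Rightarrow> ('k, 'b) module \<Rightarrow> 'x \<Rightarrow> 'x"

definition ord_map :: "nat \<Rightarrow> nat \<Rightarrow> (nat \<Rightarrow> nat) set" where
  "ord_map p n = {\<theta> \<in> {..p} \<rightarrow> {..n}. mono_on {..p} \<theta>}"

definition simplicial_kfunctor :: "'k ring \<Rightarrow> ('k, 'b, 'x) simplicial_kfun \<Rightarrow> bool" where
  "simplicial_kfunctor K X \<longleftrightarrow>
     (\<forall>n. kfunctor K (level X n)) \<and>
     (\<forall>n p \<theta> B. \<theta> \<in> ord_map p n \<and> algebra K B \<longrightarrow>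
        act X n p \<theta> B \<in> points (level X n) B \<rightarrow> points (level X p) B) \<and>
     (\<forall>n p \<theta> B C \<phi> x. \<theta> \<in> ord_map p n \<and> algebra K B \<and> algebra K C \<and> \<phi> \<in> alg_hom K B C \<and>
        x \<in> points (level X n) B \<longrightarrow>
        act X n p \<theta> C (pmap (level X n) B C \<phi> x) = pmap (level X p) B C \<phi> (act X n p \<theta> B x)) \<and>
     (\<forall>n \<theta> B x. (\<forall>i\<le>n. \<theta> i = i) \<and> algebra K B \<and> x \<in> points (level X n) B \<longrightarrow>
        act X n n \<theta> B x = x) \<and>
     (\<forall>n p q \<theta> \<rho> B x. \<theta> \<in> ord_map p n \<and> \<rho> \<in> ord_map q p \<and> algebra K B \<and>
        x \<in> points (level X n) B \<longrightarrow>
        act X n q (\<theta> \<circ> \<rho>) B x = act X p q \<rho> B (act X n p \<theta> B x))"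

definition face ::
    "('k, 'b, 'x) simplicial_kfun \<Rightarrow> nat \<Rightarrow> nat \<Rightarrow> ('k, 'b) module \<Rightarrow> 'x \<Rightarrow> 'x" where
  "face X n i = act X n (n - 1) (\<lambda>j. if j < i then j else Suc j)"

definition Match ::
    "('k, 'b, 'x) simplicial_kfun \<Rightarrow> nat \<Rightarrow> nat \<Rightarrow> ('k, 'b, nat \<Rightarrow> 'x) kfun" where
  "Match X n k =
     \<lparr> points = (\<lambda>B. {f \<in> ({..n} - {k}) \<rightarrow>\<^sub>E points (level X (n - 1)) B.
          \<forall>i\<in>{..n} - {k}. \<forall>j\<in>{..n} - {k}. i < j \<longrightarrow>
            face X (n - 1) i B (f j) = face X (n - 1) (j - 1) B (f i)}),
       pmap = (\<lambda>B C \<phi> f. \<lambda>i\<in>{..n} - {k}. pmap (level X (n - 1)) B C \<phi> (f i)) \<rparr>"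

definition match_map ::
    "('k, 'b, 'x) simplicial_kfun \<Rightarrow> nat \<Rightarrow> nat \<Rightarrow> ('k, 'b) module \<Rightarrow> 'x \<Rightarrow> (nat \<Rightarrow> 'x)" where
  "match_map X n k B x = (\<lambda>i\<in>{..n} - {k}. face X n i B x)"

definition GP_condition ::
    "'i itself \<Rightarrow> 'k ring \<Rightarrow> ('k, 'b, 'x) simplicial_kfun \<Rightarrow> nat \<Rightarrow> nat \<Rightarrow> bool" where
  "GP_condition I_type K X n k \<longleftrightarrow>
     smooth_morphism I_type K (level X n) (Match X n k) (match_map X n k) \<and>
     surjective_morphism K (level X n) (Match X n k) (match_map X n k)"

definition Grothendieck_Pridham ::
    "'i itself \<Rightarrow> 'k ring \<Rightarrow> ('k, 'b, 'x) simplicial_kfun \<Rightarrow> bool" where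
  "Grothendieck_Pridham I_type K X \<longleftrightarrow>
     simplicial_kfunctor K X \<and> (\<forall>n\<ge>1. \<forall>k\<le>n. GP_condition I_type K X n k)"


section \<open>The simplicial scheme of Maurer-Cartan objects\<close>

definition R_dgcat ::
    "'k ring \<Rightarrow> ('k, 'o, 'm) dgcat \<Rightarrow> ('k, 'b) module \<Rightarrow>
     ('b, 'o \<times> ('m \<Rightarrow> 'b) set, ('m \<Rightarrow> 'b) set) dgcat" where
  "R_dgcat K P B = MC (dg_tensor K P B)"

definition base_change ::
    "'k ring \<Rightarrow> ('k, 'o, 'm) dgcat \<Rightarrow> nat \<Rightarrow> ('k, 'b) module \<Rightarrow> ('k, 'b) module \<Rightarrow> ('b \<Rightarrow> 'b) \<Rightarrow>
     ('o \<times> ('m \<Rightarrow> 'b) set, ('m \<Rightarrow> 'b) set) simplex \<Rightarrow>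
     ('o \<times> ('m \<Rightarrow> 'b) set, ('m \<Rightarrow> 'b) set) simplex" where
  "base_change K P n B C \<phi> x =
     (\<lambda>i\<in>{..n}. (fst (fst x i),
        tensor_base K (Hom P (fst (fst x i)) (fst (fst x i)) 1) B C \<phi> (snd (fst x i))),
      \<lambda>s\<in>nerve_seqs n.
        tensor_base K (Hom P (fst (fst x (hd s))) (fst (fst x (last s))) (seq_deg s)) B C \<phi>
          (snd x s))"

definition MC_scheme ::
    "'k ring \<Rightarrow> ('k, 'o, 'm) dgcat \<Rightarrow>
     ('k, 'b, ('o \<times> ('m \<Rightarrow> 'b) set, ('m \<Rightarrow> 'b) set) simplex) simplicial_kfun" where
  "MC_scheme K P =
     \<lparr> level = (\<lambda>n. \<lparr> points = (\<lambda>B. coherent_nerve_eq (R_dgcat K P B) n),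
                      pmap = base_change K P n \<rparr>),
       act = (\<lambda>n p \<theta> B. nerve_pullback p \<theta>) \<rparr>"

end

(*
  For n >= 2 a filler of the k-th horn amounts to two elements: the face u opposite to the vertex k
  and the top cell v. They have to solve du = a and dv = b + T u, where T is composition with an
  edge of the horn if k = 0 or k = n, and a sign otherwise. A Bianchi identity for the right hand
  sides of the nerve equations says that the two errors of an approximate solution form a cocycle
  in the cone of T. The edges are equivalences, so this cone is acyclic, both on the full morphism
  complexes (horns have fillers) and on the kernel of the base change along a surjection of
  algebras (fillers lift along it). For n = 1 a Maurer-Cartan element has to be lifted along a
  square-zero extension together with an equivalence to a given object; curvature and failure of
  closedness again form a cocycle in the cone of composition with an equivalence, with values in
  the kernel, and the vanishing of its class corrects both at once. Finite presentation holds
  because each lift involves finitely many elements of and equations in finite-dimensional spaces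
  tensored with the algebra.
*)

theory Submission
  imports Defs
begin

text \<open>The obstacle at \<open>n\<close> = 1 is that only one vertex of the edge is given over
  the larger algebra. An arbitrary lift of the other Maurer-Cartan element has curvature, so that
  the twisted differential no longer squares to zero, and a lifted equivalence is closed and
  invertible only modulo the kernel. Two devices absorb this. Curved categories admit such objects,
  the square of the differential being the commutator with the curvature. And the cone arguments are
  written for two families \<open>N\<close> and \<open>J\<close> annihilating each other: solutions
  are sought in \<open>N\<close>, while the edge is an equivalence only modulo \<open>J\<close>. The
  pair (everything, 0) fills horns and (kernel, 0) lifts fillers, since there the edges of the horn
  are true equivalences; (kernel, kernel) treats \<open>n\<close> = 1, where the square-zero
  condition says that \<open>J\<close> kills \<open>N\<close>. For \<open>n\<close> at least 2 the
  boundary of the top cell is affine in the missing face, and \<open>T\<close> is its linear part;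
  this is where the signs and the exceptional values of \<open>k\<close> come from.\<close>

abbreviation (input) add_in ("(_ \<oplus>[_]/ _)" [65, 0, 66] 65) where "x \<oplus>[M] y \<equiv> x \<oplus>\<^bsub>M\<^esub> y"
abbreviation (input) minus_in ("(_ \<ominus>[_]/ _)" [65, 0, 66] 65) where "x \<ominus>[M] y \<equiv> x \<ominus>\<^bsub>M\<^esub> y"
abbreviation (input) inv_in ("\<ominus>[_] _" [0, 81] 80) where "\<ominus>[M] x \<equiv> \<ominus>\<^bsub>M\<^esub> x"
abbreviation (input) mult_in ("(_ \<otimes>[_]/ _)" [70, 0, 71] 70) where "x \<otimes>[M] y \<equiv> x \<otimes>\<^bsub>M\<^esub> y"
abbreviation (input) smult_in ("(_ \<odot>[_]/ _)" [70, 0, 71] 70) where "x \<odot>[M] y \<equiv> x \<odot>\<^bsub>M\<^esub> y"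
abbreviation (input) zero_in ("\<zero>[_]") where "\<zero>[M] \<equiv> \<zero>\<^bsub>M\<^esub>"
abbreviation (input) one_in ("\<one>[_]") where "\<one>[M] \<equiv> \<one>\<^bsub>M\<^esub>"
abbreviation (input) "hbase K P E F i \<equiv> tensor_base K (Hom P E F i)"
abbreviation (input) "sHom A X s \<equiv> Hom A (X (hd s)) (X (last s))"
abbreviation (input) "smor A X s i \<equiv> carrier (sHom A X s i)"
abbreviation (input) "mor A X Y i \<equiv> carrier (Hom A X Y i)"
abbreviation (input) "tens K V B \<equiv> carrier (tensor K V B)"

section \<open>Additive maps\<close>

text \<open>Lets the \<open>algebra\<close> method normalise in hom groups. These are
  \<open>module\<close> records whose multiplication carries no laws, so the rules for rings do not
  apply; \<open>minus_eq\<close> turns subtraction into addition of a negative.\<close>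

lemmas (in abelian_group) abelian_group_simprules
 [algebra abelian_group "zero G" "add G" "a_inv G" "a_minus G"] =
 a_closed zero_closed a_inv_closed minus_closed a_assoc l_zero l_neg a_comm minus_eq
 r_zero r_neg r_neg2 r_neg1 minus_add minus_minus minus_zero a_lcomm

lemma (in abelian_monoid) finsum_swap:
 assumes "finite A" "finite B" and "!!i j. i : A ==> j : B ==> f i j : carrier G"
 shows "finsum G (%i. finsum G (f i) B) A = finsum G (%j. finsum G (%i. f i j) A) B"
 using assms(1,3)
proof (induction A)
 case (insert a A)
 have "finsum G (%j. finsum G (%i. f i j) (insert a A)) B =
   finsum G (%j. f a j \<oplus> finsum G (%i. f i j) A) B"
  using insert by (intro finsum_cong') (auto intro!: a_closed finsum_closed)
 also have "\<dots> = finsum G (f a) B \<oplus> finsum G (%j. finsum G (%i. f i j) A) B"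
  using insert by (intro finsum_addf) (auto intro!: finsum_closed)
 finally show ?case
  using insert by (subst finsum_insert) (auto intro!: finsum_closed)
qed (simp add: assms)

lemma (in abelian_monoid) finsum_single:
 assumes "finite A" "a : A" "f a : carrier G" "!!i. i : A ==> i ~= a ==> f i = \<zero>"
 shows "finsum G f A = f a"
proof -
 have "finsum G f A = finsum G (%i. if a = i then f a else \<zero>) A"
  using assms by (intro finsum_cong') auto
 also have "\<dots> = f a" using assms by (intro finsum_singleton) auto
 finally show ?thesis .
qed

text \<open>Hom groups over different algebras have to be compared, so scalars are left out. The
  group axioms of both sides are part of the notion, so that one fact yields zero, negatives and
  finite sums.\<close>

definition amap :: "('x, 'y) ring_scheme => ('u, 'v) ring_scheme => ('x => 'u) => bool" where
 "amap G H f \<longleftrightarrow> abelian_group G & abelian_group H & f : carrier G \<rightarrow> carrier H &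
  (\<forall>x\<in>carrier G. \<forall>y\<in>carrier G. f (x \<oplus>[G] y) = f x \<oplus>[H] f y)"

lemma amapI:
 assumes "abelian_group G" "abelian_group H" "!!x. x : carrier G ==> f x : carrier H"
  and "!!x y. x : carrier G ==> y : carrier G ==> f (x \<oplus>[G] y) = f x \<oplus>[H] f y"
 shows "amap G H f"
 using assms by (auto simp: amap_def)

lemma amap_closed: "amap G H f ==> x : carrier G ==> f x : carrier H"
 by (auto simp: amap_def)

lemma amap_add:
 "amap G H f ==> x : carrier G ==> y : carrier G ==> f (x \<oplus>[G] y) = f x \<oplus>[H] f y"
 by (auto simp: amap_def)

lemma amap_zero: assumes "amap G H f" shows "f \<zero>[G] = \<zero>[H]"
proof -
 interpret G: abelian_group G using assms by (simp add: amap_def)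
 interpret H: abelian_group H using assms by (simp add: amap_def)
 have "f \<zero>[G] \<oplus>[H] f \<zero>[G] = f \<zero>[G]"
  using amap_add[OF assms, of "\<zero>[G]" "\<zero>[G]"] by simp
 then show ?thesis using amap_closed[OF assms G.zero_closed] by simp
qed

lemma amap_neg:
 assumes "amap G H f" "x : carrier G" shows "f (\<ominus>[G] x) = \<ominus>[H] f x"
proof -
 interpret G: abelian_group G using assms by (simp add: amap_def)
 interpret H: abelian_group H using assms by (simp add: amap_def)
 have "f (\<ominus>[G] x) \<oplus>[H] f x = \<zero>[H]"
  using amap_add[OF assms(1), of "\<ominus>[G] x" x] assms(2) amap_zero[OF assms(1)]
  by (simp add: G.l_neg)
 then show ?thesis
  using H.minus_equality amap_closed[OF assms(1)] assms(2) by (metis G.a_inv_closed)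
qed

lemma amap_minus:
 assumes "amap G H f" "x : carrier G" "y : carrier G"
 shows "f (x \<ominus>[G] y) = f x \<ominus>[H] f y"
proof -
 interpret G: abelian_group G using assms by (simp add: amap_def)
 show ?thesis
  using assms by (simp add: a_minus_def amap_add[OF assms(1)] amap_neg)
qed

lemma amap_finsum:
 assumes "amap G H f" "!!i. i : I ==> g i : carrier G"
 shows "f (finsum G g I) = finsum H (%i. f (g i)) I"
proof -
 interpret G: abelian_group G using assms by (simp add: amap_def)
 interpret H: abelian_group H using assms by (simp add: amap_def)
 show ?thesis
 proof (cases "finite I")
  case True
  then show ?thesis using assms(2)
  proof (induction I)
   case (insert i I)
   then show ?case using assms(1)
    by (simp add: Pi_def amap_add[OF assms(1)] amap_closed[OF assms(1)])
  qed (simp add: amap_zero[OF assms(1)])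
 qed (simp add: amap_zero[OF assms(1)])
qed

lemma amap_sgn_act:
 "amap G H f ==> x : carrier G ==> f (sgn_act G i x) = sgn_act H i (f x)"
 by (simp add: sgn_act_def amap_neg)

lemma amap_comp:
 "amap G H f ==> amap H L g ==> amap G L (%x. g (f x))"
 by (auto simp: amap_def Pi_def)

lemma amap_id: "abelian_group G ==> amap G G (%x. x)"
 by (auto simp: amap_def)

lemma amap_sum:
 assumes "amap G H f" "amap G H g" shows "amap G H (%x. f x \<oplus>[H] g x)"
proof -
 interpret H: abelian_group H using assms by (simp add: amap_def)
 show ?thesis
 proof (rule amapI)
  fix x y assume xy: "x : carrier G" "y : carrier G"
  note amap_closed[OF assms(1)] amap_closed[OF assms(2)]
  with xy show "f (x \<oplus>[G] y) \<oplus>[H] g (x \<oplus>[G] y) = f x \<oplus>[H] g x \<oplus>[H] (f y \<oplus>[H] g y)"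
   using amap_add[OF assms(1) xy] amap_add[OF assms(2) xy] by (simp add: H.a_ac)
 qed (use assms in \<open>auto simp: amap_def Pi_def\<close>)
qed

context
 fixes M :: "('k, 'm) module"
 assumes M: "abelian_group M"
begin

interpretation M: abelian_group M by (rule M)

lemma sgn_act_closed: "x : carrier M ==> sgn_act M i x : carrier M"
 by (simp add: sgn_act_def)

lemma sgn_act_amap: "amap M M (sgn_act M i)"
 by (rule amapI) (auto simp: M sgn_act_def M.minus_add M.a_comm)

lemma sgn_act_sgn_act: "x : carrier M ==> sgn_act M i (sgn_act M j x) = sgn_act M (i + j) x"
 by (auto simp: sgn_act_def)

lemma amap_minusI: "amap G M f ==> amap G M (%x. \<ominus>[M] f x)"
 using amap_comp[OF _ sgn_act_amap[of 1]] by (simp add: sgn_act_def)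

end

lemma sgn_act_even: "even i ==> sgn_act M i x = x"
 by (simp add: sgn_act_def)

lemma sgn_act_odd: "odd i ==> sgn_act M i x = \<ominus>[M] x"
 by (simp add: sgn_act_def)

lemma sgn_act_cong: "even i = even j ==> sgn_act M i x = sgn_act M j x"
 by (simp add: sgn_act_def)

lemma sgn_act_zero: "abelian_group M ==> sgn_act M i \<zero>[M] = \<zero>[M]"
 by (rule amap_zero[OF sgn_act_amap])

section \<open>Tensor products\<close>

definition lin :: "'k ring => ('k, 'v) module => ('k, 'w) module => ('v => 'w) => bool" where
 "lin K V W h \<longleftrightarrow> amap V W h &
  (\<forall>c\<in>carrier K. \<forall>v\<in>carrier V. h (c \<odot>[V] v) = c \<odot>[W] h v)"

definition lft :: "('k, 'b) module => ('g, 'h) ring_scheme => ('v => 'b => 'g) => ('v => 'b) => 'g" where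
 "lft B G p u = finsum G (%v. p v (u v)) {v. u v ~= \<zero>[B]}"

definition balanced :: "'k ring => ('k, 'v) module => ('k, 'b) module => ('g, 'h) ring_scheme =>
  ('v => 'b => 'g) => bool" where
 "balanced K V B G p \<longleftrightarrow>
  (\<forall>v\<in>carrier V. amap B G (p v)) & (\<forall>b\<in>carrier B. amap V G (%v. p v b)) &
  (\<forall>c\<in>carrier K. \<forall>v\<in>carrier V. \<forall>b\<in>carrier B. p (c \<odot>[V] v) b = p v (c \<odot>[B] b))"

text \<open>The induced map on cosets. The representative is chosen arbitrarily, and
  \<open>tlift_eq\<close> shows that every other one gives the same value.\<close>

definition tlift :: "('k, 'b) module => ('g, 'h) ring_scheme => ('v => 'b => 'g) =>
  ('v => 'b) set => 'g" where
 "tlift B G p T = lft B G p (SOME u. u : T)"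

locale tensor_pair =
 fixes K :: "'k ring" and V :: "('k, 'v) module" and B :: "('k, 'b) module"
 assumes V: "module K V" and B: "algebra K B"
begin

abbreviation "F \<equiv> free_module V B"
abbreviation "N \<equiv> tensor_null K V B"
abbreviation "T \<equiv> tensor K V B"

sublocale V: module K V by (rule V)
sublocale B: algebra K B by (rule B)

lemma F_simps:
 "carrier F = {u. (\<forall>v. u v : carrier B) & (\<forall>v. v \<notin> carrier V --> u v = \<zero>[B]) &
          finite {v. u v ~= \<zero>[B]}}"
 "\<zero>[F] = (%v. \<zero>[B])" "u \<oplus>[F] w = (%v. u v \<oplus>[B] w v)" "b \<odot>[F] u = (%v. b \<otimes>[B] u v)"
 by (simp_all add: free_module_def)

lemma F_group: "abelian_group F"
proof (rule abelian_groupI)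
 fix x assume x: "x : carrier F"
 show "\<exists>y\<in>carrier F. y \<oplus>[F] x = \<zero>[F]"
 proof (rule bexI[of _ "%v. \<ominus>[B] x v"])
  have "{v. \<ominus>[B] x v ~= \<zero>[B]} \<subseteq> {v. x v ~= \<zero>[B]}" by auto
  then show "(%v. \<ominus>[B] x v) : carrier F"
   using x finite_subset by (auto simp: F_simps)
 qed (use x in \<open>auto simp: F_simps B.l_neg\<close>)
next
 fix x y assume "x : carrier F" "y : carrier F"
 then have *: "finite ({v. x v ~= \<zero>[B]} \<union> {v. y v ~= \<zero>[B]})" by (auto simp: F_simps)
 show "x \<oplus>[F] y : carrier F"
  using \<open>x : _\<close> \<open>y : _\<close> by (auto simp: F_simps intro!: finite_subset[OF _ *])
qed (auto simp: F_simps fun_eq_iff B.add.m_ac)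

sublocale F: abelian_group F by (rule F_group)

lemma F_smult_closed: "b : carrier B ==> u : carrier F ==> b \<odot>[F] u : carrier F"
 by (auto simp: F_simps elim!: rev_finite_subset)

lemma single_closed: "v : carrier V ==> b : carrier B ==> single B v b : carrier F"
 by (auto simp: F_simps single_def)

lemma single_add: "b : carrier B ==> c : carrier B ==>
  single B v (b \<oplus>[B] c) = single B v b \<oplus>[F] single B v c"
 by (auto simp: F_simps single_def)

lemma single_smult: "b : carrier B ==> c : carrier B ==>
  b \<odot>[F] single B v c = single B v (b \<otimes>[B] c)"
 by (auto simp: F_simps single_def)

lemma smult_F_add: "b : carrier B ==> u : carrier F ==> w : carrier F ==>
  b \<odot>[F] (u \<oplus>[F] w) = b \<odot>[F] u \<oplus>[F] b \<odot>[F] w"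
 by (auto simp: F_simps B.r_distr)

lemma smult_F_amap: "b : carrier B ==> amap F F (%u. b \<odot>[F] u)"
 by (intro amapI F_group F_smult_closed smult_F_add)

lemma relations_closed: "tensor_relations K V B \<subseteq> carrier F"
 unfolding tensor_relations_def Let_def by (auto intro!: F.minus_closed F.a_closed single_closed)

lemma smult_one_mult: "c : carrier K ==> b : carrier B ==> b \<otimes>[B] (c \<odot>[B] \<one>[B]) = c \<odot>[B] b"
 using B.smult_assoc2[of c "\<one>[B]" b] by (simp add: B.m_comm)

lemma submodule_carrier: "submodule (carrier F) B F"
 by (auto simp: submodule_def submodule_axioms_def F_smult_closed intro!: F.add.subgroup_self)

lemma submodule_null: "submodule N B F"
proof -
 have *: "N = \<Inter> {N. submodule N B F & tensor_relations K V B \<subseteq> N}"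
  by (simp add: tensor_null_def)
 have "subgroup N (add_monoid F)"
  unfolding * using submodule_carrier relations_closed
  by (intro F.add.subgroups_Inter) (auto simp: submodule_def)
 then show ?thesis
  by (auto simp: submodule_def submodule_axioms_def tensor_null_def)
qed

lemma null_least: "submodule Z B F ==> tensor_relations K V B \<subseteq> Z ==> N \<subseteq> Z"
 unfolding tensor_null_def by blast

lemma relations_null: "tensor_relations K V B \<subseteq> N"
 unfolding tensor_null_def by blast

sublocale N: abelian_subgroup N F
 using submodule_null
 by (intro abelian_subgroupI3 F_group additive_subgroupI) (simp add: submodule_def)

lemma T_simps:
 "carrier T = a_rcosets\<^bsub>F\<^esub> N" "\<zero>[T] = N" "X \<oplus>[T] Y = X <+>\<^bsub>F\<^esub> Y"
 by (simp_all add: tensor_def Let_def)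

lemma T_group: "abelian_group T"
proof -
 interpret Q: comm_group "F A_Mod N" by (rule N.a_factorgroup_is_comm_group)
 have Q: "carrier (F A_Mod N) = carrier T" "\<one>[F A_Mod N] = \<zero>[T]"
  "!!X Y. X \<otimes>[F A_Mod N] Y = X \<oplus>[T] Y"
  by (simp_all add: T_simps A_FactGroup_def')
 show ?thesis
 proof (rule abelian_groupI)
  fix X assume X: "X : carrier T"
  show "\<exists>Y\<in>carrier T. Y \<oplus>[T] X = \<zero>[T]"
   using Q.l_inv[unfolded Q, OF X] Q.inv_closed[unfolded Q, OF X] by blast
 qed (fact Q.m_closed[unfolded Q] Q.one_closed[unfolded Q] Q.m_assoc[unfolded Q]
   Q.m_comm[unfolded Q] Q.l_one[unfolded Q])+
qed

sublocale T: abelian_group T by (rule T_group)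

lemma cls_closed: "u : carrier F ==> N +>\<^bsub>F\<^esub> u : carrier T"
 by (simp add: T_simps F.a_rcosetsI N.a_subset)

lemma cls_add: "u : carrier F ==> w : carrier F ==>
  N +>\<^bsub>F\<^esub> (u \<oplus>[F] w) = (N +>\<^bsub>F\<^esub> u) \<oplus>[T] (N +>\<^bsub>F\<^esub> w)"
 by (simp add: T_simps N.a_rcos_sum)

lemma cls_eq_iff:
 assumes "u : carrier F" "w : carrier F"
 shows "N +>\<^bsub>F\<^esub> u = N +>\<^bsub>F\<^esub> w \<longleftrightarrow> u \<ominus>[F] w : N"
proof
 assume "N +>\<^bsub>F\<^esub> u = N +>\<^bsub>F\<^esub> w"
 then have "u : N +>\<^bsub>F\<^esub> w" using N.a_rcos_self assms by blast
 then show "u \<ominus>[F] w : N" using N.a_rcos_module[OF assms(2,1)] by (simp add: a_minus_def)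
next
 assume "u \<ominus>[F] w : N"
 then have "u : N +>\<^bsub>F\<^esub> w" using N.a_rcos_module[OF assms(2,1)] by (simp add: a_minus_def)
 then show "N +>\<^bsub>F\<^esub> u = N +>\<^bsub>F\<^esub> w" using N.a_repr_independence' assms by blast
qed

lemma T_rep:
 assumes "X : carrier T" obtains u where "u : carrier F" "X = N +>\<^bsub>F\<^esub> u"
 using assms by (auto simp: T_simps A_RCOSETS_def')

lemma T_mem:
 assumes "X : carrier T" "u : X" shows "u : carrier F" "X = N +>\<^bsub>F\<^esub> u"
proof -
 obtain w where w: "w : carrier F" "X = N +>\<^bsub>F\<^esub> w" by (rule T_rep[OF assms(1)])
 show "u : carrier F" using assms N.a_rcosets_carrier by (auto simp: T_simps)
 show "X = N +>\<^bsub>F\<^esub> u" using N.a_repr_independence'[of u w] w assms(2) by simp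
qed

lemma T_nonempty: "X : carrier T ==> X ~= {}"
 by (erule T_rep) (use N.a_rcos_self in auto)

lemma pure_closed: "v : carrier V ==> b : carrier B ==> pure_tensor K V B v b : carrier T"
 by (simp add: pure_tensor_def cls_closed single_closed)

lemma pure_balanced: "balanced K V B T (pure_tensor K V B)"
 unfolding balanced_def
proof (intro conjI ballI)
 fix v assume v: "v : carrier V"
 show "amap B T (pure_tensor K V B v)"
  using v by (intro amapI T_group B.abelian_group_axioms)
   (simp_all add: pure_closed, simp add: pure_tensor_def single_add cls_add single_closed)
next
 fix b assume b: "b : carrier B"
 show "amap V T (%v. pure_tensor K V B v b)"
 proof (intro amapI T_group V.abelian_group_axioms)
  fix v w assume vw: "v : carrier V" "w : carrier V"
  \<comment> \<open>The defining relation has coefficient 1. The null submodule is stable under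
    scalars, and multiplying by \<open>b\<close> gives additivity with coefficient
    \<open>b\<close>.\<close>
  let ?r = "single B (v \<oplus>[V] w) \<one>[B] \<ominus>[F] (single B v \<one>[B] \<oplus>[F] single B w \<one>[B])"
  have "?r : N" using relations_null vw by (auto simp: tensor_relations_def Let_def)
  then have "b \<odot>[F] ?r : N" using submodule_null b by (auto intro: submodule.smult_closed)
  moreover have "b \<odot>[F] ?r = single B (v \<oplus>[V] w) b \<ominus>[F] (single B v b \<oplus>[F] single B w b)"
   using vw b
   by (simp add: amap_minus[OF smult_F_amap] amap_add[OF smult_F_amap] single_closed single_smult)
  ultimately show "pure_tensor K V B (v \<oplus>[V] w) b = pure_tensor K V B v b \<oplus>[T] pure_tensor K V B w b"
   using vw b cls_eq_iff[of "single B (v \<oplus>[V] w) b" "single B v b \<oplus>[F] single B w b"]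
   by (simp add: pure_tensor_def cls_add single_closed)
 qed (use b in \<open>auto simp: pure_closed\<close>)
next
 fix c v b assume cvb: "c : carrier K" "v : carrier V" "b : carrier B"
 let ?r = "single B (c \<odot>[V] v) \<one>[B] \<ominus>[F] single B v (c \<odot>[B] \<one>[B])"
 have "?r : N" using relations_null cvb by (auto simp: tensor_relations_def Let_def)
 then have "b \<odot>[F] ?r : N" using submodule_null cvb by (auto intro: submodule.smult_closed)
 moreover have "b \<odot>[F] ?r = single B (c \<odot>[V] v) b \<ominus>[F] single B v (c \<odot>[B] b)"
  using cvb
  by (simp add: amap_minus[OF smult_F_amap] single_closed single_smult smult_one_mult)
 ultimately show "pure_tensor K V B (c \<odot>[V] v) b = pure_tensor K V B v (c \<odot>[B] b)"
  using cvb cls_eq_iff[of "single B (c \<odot>[V] v) b" "single B v (c \<odot>[B] b)"]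
  by (simp add: pure_tensor_def single_closed)
qed

end

lemma (in abelian_monoid) finsum_cartesian:
 assumes "finite A" "finite C" "!!a c. a : A ==> c : C ==> f (a, c) : carrier G"
 shows "finsum G f (A \<times> C) = finsum G (%a. finsum G (%c. f (a, c)) C) A"
 using assms(1,3)
proof (induction A)
 case (insert a A)
 have "finsum G f (insert a A \<times> C) = finsum G f (Pair a ` C \<union> A \<times> C)"
  by (rule arg_cong[where f = "finsum G f"]) auto
 also have "\<dots> = finsum G f (Pair a ` C) \<oplus> finsum G f (A \<times> C)"
  using insert assms(2) by (intro finsum_Un_disjoint) auto
 also have "finsum G f (Pair a ` C) = finsum G (%c. f (a, c)) C"
  using insert by (intro finsum_reindex) (auto simp: inj_on_def)
 finally show ?case
  using insert assms(2) by (subst finsum_insert) (auto intro!: finsum_closed)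
qed simp

lemma (in abelian_group) minus_self: "x : carrier G ==> x \<ominus> x = \<zero>"
 by (simp add: a_minus_def r_neg)

lemma (in abelian_group) minus_zero_iff:
 assumes "x : carrier G" "y : carrier G" shows "x \<ominus> y = \<zero> \<longleftrightarrow> x = y"
proof
 assume "x \<ominus> y = \<zero>"
 then have "(x \<ominus> y) \<oplus> y = y" using assms by simp
 then show "x = y" using assms by (simp add: a_minus_def a_assoc l_neg)
qed (simp add: assms minus_self)

lemma balanced_amap: "balanced K V B G p ==> v : carrier V ==> amap B G (p v)"
 by (simp add: balanced_def)

lemma balanced_amap_left: "balanced K V B G p ==> b : carrier B ==> amap V G (%v. p v b)"
 by (simp add: balanced_def)

lemma balanced_smult: "balanced K V B G p ==> c : carrier K ==> v : carrier V ==> b : carrier B ==>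
  p (c \<odot>[V] v) b = p v (c \<odot>[B] b)"
 by (simp add: balanced_def)

lemma UN_eq_const: "X ~= {} ==> (!!u. u : X ==> f u = c) ==> (\<Union>u\<in>X. f u) = c"
 by auto

section \<open>The universal property of the tensor product\<close>

context tensor_pair
begin

lemma F_supp:
 assumes "u : carrier F"
 shows "finite {v. u v ~= \<zero>[B]}" "{v. u v ~= \<zero>[B]} \<subseteq> carrier V" "u v : carrier B"
 using assms by (auto simp: F_simps)

context
 fixes G :: "('g, 'h) ring_scheme" and p
 assumes p: "balanced K V B G p" and G: "abelian_group G"
begin

interpretation G: abelian_group G by (rule G)

lemma p_closed: "v : carrier V ==> b : carrier B ==> p v b : carrier G"
 using amap_closed[OF balanced_amap[OF p]] .

lemma p_zero: "v : carrier V ==> p v \<zero>[B] = \<zero>[G]"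
 using amap_zero[OF balanced_amap[OF p]] .

lemma lft_superset:
 assumes "u : carrier F" "finite S" "{v. u v ~= \<zero>[B]} \<subseteq> S" "S \<subseteq> carrier V"
 shows "lft B G p u = finsum G (%v. p v (u v)) S"
 unfolding lft_def
proof (rule G.add.finprod_mono_neutral_cong_left)
 show "p i (u i) = \<zero>[G]" if "i : S - {v. u v ~= \<zero>[B]}" for i
  using that assms(4) p_zero[of i] by auto
 show "(%v. p v (u v)) : S \<rightarrow> carrier G"
  using assms F_supp(3)[OF assms(1)] p_closed by blast
qed (use assms in auto)

lemma lft_amap: "amap F G (lft B G p)"
proof (rule amapI)
 fix x assume x: "x : carrier F"
 show "lft B G p x : carrier G"
  unfolding lft_def using F_supp[OF x] p_closed by (intro G.finsum_closed) blast
 fix y assume y: "y : carrier F"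
 let ?S = "{v. x v ~= \<zero>[B]} \<union> {v. y v ~= \<zero>[B]}"
 have S: "finite ?S" "?S \<subseteq> carrier V" "{v. (x \<oplus>[F] y) v ~= \<zero>[B]} \<subseteq> ?S"
  using F_supp[OF x] F_supp[OF y] by (auto simp: F_simps)
 have "lft B G p (x \<oplus>[F] y) = finsum G (%v. p v ((x \<oplus>[F] y) v)) ?S"
  using x y S by (intro lft_superset) auto
 also have "\<dots> = finsum G (%v. p v (x v) \<oplus>[G] p v (y v)) ?S"
 proof (rule G.finsum_cong')
  fix v assume "v : ?S"
  then have v: "v : carrier V" using S by blast
  show "p v ((x \<oplus>[F] y) v) = p v (x v) \<oplus>[G] p v (y v)"
   using amap_add[OF balanced_amap[OF p v]] F_supp(3)[OF x] F_supp(3)[OF y] by (simp add: F_simps)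
 qed (use S p_closed F_supp(3)[OF x] F_supp(3)[OF y] in auto)
 also have "\<dots> = finsum G (%v. p v (x v)) ?S \<oplus>[G] finsum G (%v. p v (y v)) ?S"
  using S p_closed F_supp(3)[OF x] F_supp(3)[OF y] by (intro G.finsum_addf) blast+
 also have "\<dots> = lft B G p x \<oplus>[G] lft B G p y"
  using lft_superset[OF x S(1) _ S(2)] lft_superset[OF y S(1) _ S(2)] by simp
 finally show "lft B G p (x \<oplus>[F] y) = lft B G p x \<oplus>[G] lft B G p y" .
qed (auto simp: F_group G)

lemma lft_single:
 assumes "v : carrier V" "b : carrier B" shows "lft B G p (single B v b) = p v b"
proof -
 have "lft B G p (single B v b) = finsum G (%w. p w (single B v b w)) {v}"
  using assms by (intro lft_superset single_closed) (auto simp: single_def)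
 then show ?thesis using p_closed assms by (simp add: single_def)
qed

text \<open>The null submodule is the least submodule containing the relations, so a submodule
  killed by the map is needed. The target is only a group and the kernel need not be stable under
  \<open>B\<close>; hence \<open>?Z\<close> consists of the elements all of whose
  \<open>B\<close>-multiples are killed.\<close>

lemma lft_null: assumes "u : N" shows "lft B G p u = \<zero>[G]"
proof -
 let ?Z = "{u : carrier F. \<forall>b\<in>carrier B. lft B G p (b \<odot>[F] u) = \<zero>[G]}"
 have am: "amap F G (%u. lft B G p (b \<odot>[F] u))" if "b : carrier B" for b
  using amap_comp[OF smult_F_amap[OF that] lft_amap] .
 have "subgroup ?Z (add_monoid F)"
 proof (rule F.add.subgroupI)
  show "?Z ~= {}" using amap_zero[OF am] by (auto intro!: exI[of _ "\<zero>[F]"])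
 qed (auto simp: amap_add[OF am] amap_neg[OF am] simp del: F_simps)
 then have "submodule ?Z B F"
  unfolding submodule_def submodule_axioms_def
 proof (intro conjI allI impI)
  fix a x assume a: "a : carrier B" and x: "x : ?Z"
  have "b \<odot>[F] (a \<odot>[F] x) = (b \<otimes>[B] a) \<odot>[F] x" if "b : carrier B" for b
   using that a x F_supp(3)[of x] by (auto simp: F_simps B.m_assoc)
  then show "a \<odot>[F] x : ?Z" using a x F_smult_closed by auto
 qed
 moreover have "tensor_relations K V B \<subseteq> ?Z"
 proof
  fix r assume r: "r : tensor_relations K V B"
  have "lft B G p (b \<odot>[F] r) = \<zero>[G]" if b: "b : carrier B" for b
  proof -
   consider (1) v w where "v : carrier V" "w : carrier V"
    "r = single B (v \<oplus>[V] w) \<one>[B] \<ominus>[F] (single B v \<one>[B] \<oplus>[F] single B w \<one>[B])"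
    | (2) c v where "c : carrier K" "v : carrier V"
    "r = single B (c \<odot>[V] v) \<one>[B] \<ominus>[F] single B v (c \<odot>[B] \<one>[B])"
    using r by (auto simp: tensor_relations_def Let_def)
   then show ?thesis
   proof cases
    case 1
    then show ?thesis
     using b amap_add[OF balanced_amap_left[OF p b] 1(1,2)] p_closed G.minus_self
     by (simp add: amap_minus[OF am] amap_add[OF am] single_closed single_smult lft_single)
   next
    case 2
    then show ?thesis
     using b balanced_smult[OF p 2(1,2) b] p_closed G.minus_self
     by (simp add: amap_minus[OF am] single_closed single_smult lft_single smult_one_mult)
   qed
  qed
  then show "r : ?Z" using r relations_closed by blast
 qed
 ultimately have "u : ?Z" using null_least assms by blast
 then have "lft B G p (\<one>[B] \<odot>[F] u) = \<zero>[G]" "u : carrier F" by blast+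
 moreover from this(2) have "\<one>[B] \<odot>[F] u = u" using F_supp(3)[of u] by (simp add: F_simps)
 ultimately show ?thesis by simp
qed

lemma tlift_eq: assumes "X : carrier T" "u : X" shows "lft B G p u = tlift B G p X"
proof -
 let ?w = "SOME u. u : X"
 have w: "?w : X" using someI[of "%u. u : X" u] assms(2) by simp
 note u = T_mem[OF assms(1,2)] and w = T_mem[OF assms(1) w]
 have "u \<ominus>[F] ?w : N" using cls_eq_iff[OF u(1) w(1)] u(2) w(2) by simp
 from lft_null[OF this] have "lft B G p u \<ominus>[G] lft B G p ?w = \<zero>[G]"
  using amap_minus[OF lft_amap u(1) w(1)] by simp
 then show ?thesis
  using amap_closed[OF lft_amap] u(1) w(1) G.minus_zero_iff by (simp add: tlift_def)
qed

lemma tlift_cls: "u : carrier F ==> tlift B G p (N +>\<^bsub>F\<^esub> u) = lft B G p u"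
 using tlift_eq[OF cls_closed N.a_rcos_self] by simp

lemma tlift_amap: "amap T G (tlift B G p)"
proof (rule amapI)
 fix X assume "X : carrier T"
 then obtain u where u: "u : carrier F" "X = N +>\<^bsub>F\<^esub> u" by (rule T_rep)
 then show "tlift B G p X : carrier G" using amap_closed[OF lft_amap] by (simp add: tlift_cls)
 fix Y assume "Y : carrier T"
 then obtain w where w: "w : carrier F" "Y = N +>\<^bsub>F\<^esub> w" by (rule T_rep)
 show "tlift B G p (X \<oplus>[T] Y) = tlift B G p X \<oplus>[G] tlift B G p Y"
  using u w cls_add[OF u(1) w(1)] tlift_cls[OF F.a_closed[OF u(1) w(1)]]
  by (simp add: tlift_cls amap_add[OF lft_amap])
qed (auto simp: T_group G)

lemma tlift_pure: "v : carrier V ==> b : carrier B ==> tlift B G p (pure_tensor K V B v b) = p v b"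
 by (simp add: pure_tensor_def tlift_cls single_closed lft_single)

end

lemma pure_amap: "v : carrier V ==> amap B T (pure_tensor K V B v)"
 using balanced_amap[OF pure_balanced] .

lemma pure_amap_left: "b : carrier B ==> amap V T (%v. pure_tensor K V B v b)"
 using balanced_amap_left[OF pure_balanced] .

text \<open>A representative has finite support, and removing one point of it splits off a pure
  tensor. The zero function is a generator with coefficient zero, so the induction starts at a pure
  tensor and the rule has only two cases.\<close>

lemma tensor_induct [consumes 1, case_names pure add]:
 assumes X: "X : carrier T"
  and pure: "!!v b. v : carrier V ==> b : carrier B ==> P (pure_tensor K V B v b)"
  and add: "!!X Y. X : carrier T ==> Y : carrier T ==> P X ==> P Y ==> P (X \<oplus>[T] Y)"
 shows "P X"
proof -
 have "P (N +>\<^bsub>F\<^esub> u)" if "finite S" "u : carrier F" "{v. u v ~= \<zero>[B]} \<subseteq> S" for S u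
  using that
 proof (induction S arbitrary: u)
  case empty
  then have "u = single B \<zero>[V] \<zero>[B]" by (auto simp: single_def)
  then show ?case using pure[of "\<zero>[V]" "\<zero>[B]"] by (simp add: pure_tensor_def)
 next
  case (insert x S)
  show ?case
  proof (cases "x : carrier V")
   case True
   let ?w = "u(x := \<zero>[B])"
   have w: "?w : carrier F"
    using insert.prems(1) by (auto simp: F_simps elim!: rev_finite_subset)
   have ux: "u x : carrier B" using F_supp(3)[OF insert.prems(1)] .
   have "u = single B x (u x) \<oplus>[F] ?w"
    using F_supp(3)[OF insert.prems(1)] by (auto simp: F_simps single_def)
   then have "N +>\<^bsub>F\<^esub> u = pure_tensor K V B x (u x) \<oplus>[T] (N +>\<^bsub>F\<^esub> ?w)"
    using cls_add[OF single_closed[OF True ux] w] by (simp add: pure_tensor_def)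
   moreover have "P (N +>\<^bsub>F\<^esub> ?w)"
    using insert.prems(2) by (intro insert.IH[OF w]) auto
   ultimately show ?thesis
    using add pure[OF True ux] pure_closed[OF True ux] cls_closed[OF w] by simp
  next
   case False
   then have "u x = \<zero>[B]" using F_supp(2)[OF insert.prems(1)] by blast
   then show ?thesis using insert.prems by (intro insert.IH) auto
  qed
 qed
 moreover obtain u where "u : carrier F" "X = N +>\<^bsub>F\<^esub> u" using X by (rule T_rep)
 ultimately show ?thesis using F_supp(1) by blast
qed

text \<open>Identities between operations on tensors, including the dg axioms after extension of
  scalars, are reduced by this to pure tensors, one argument at a time.\<close>

lemma tensor_ext:
 assumes "X : carrier T" "amap T G f" "amap T G g"
  and "!!v b. v : carrier V ==> b : carrier B ==> f (pure_tensor K V B v b) = g (pure_tensor K V B v b)"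
 shows "f X = g X"
 using assms(1) by (induction rule: tensor_induct) (simp_all add: assms(4) amap_add[OF assms(2)] amap_add[OF assms(3)])

lemma pure_zero: "v : carrier V ==> pure_tensor K V B v \<zero>[B] = \<zero>[T]"
 using amap_zero[OF pure_amap] .

lemma pure_zero_left: "b : carrier B ==> pure_tensor K V B \<zero>[V] b = \<zero>[T]"
 using amap_zero[OF pure_amap_left] .

end

subsection \<open>Maps induced on tensor products\<close>

lemma lin_amap: "lin K V W h ==> amap V W h"
 by (simp add: lin_def)

lemma lin_smult: "lin K V W h ==> c : carrier K ==> v : carrier V ==> h (c \<odot>[V] v) = c \<odot>[W] h v"
 by (simp add: lin_def)

lemma balanced_lin:
 assumes V: "tensor_pair K V B" and h: "lin K V W h" and p: "balanced K W B G p"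
 shows "balanced K V B G (%v. p (h v))"
 unfolding balanced_def
proof (intro conjI ballI)
 interpret V: tensor_pair K V B by (rule V)
 show "amap B G (p (h v))" if "v : carrier V" for v
  using that balanced_amap[OF p] amap_closed[OF lin_amap[OF h]] by simp
 show "amap V G (%v. p (h v) b)" if "b : carrier B" for b
  using amap_comp[OF lin_amap[OF h] balanced_amap_left[OF p that]] .
 show "p (h (c \<odot>[V] v)) b = p (h v) (c \<odot>[B] b)"
  if "c : carrier K" "v : carrier V" "b : carrier B" for c v b
  using that balanced_smult[OF p] amap_closed[OF lin_amap[OF h]] lin_smult[OF h] by simp
qed

lemma balanced_alg:
 assumes p: "balanced K V C G p" and \<phi>: "amap B C \<phi>"
  and s: "!!c b. c : carrier K ==> b : carrier B ==> \<phi> (c \<odot>[B] b) = c \<odot>[C] \<phi> b"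
 shows "balanced K V B G (%v b. p v (\<phi> b))"
 unfolding balanced_def
proof (intro conjI ballI)
 show "amap B G (%b. p v (\<phi> b))" if "v : carrier V" for v
  using amap_comp[OF \<phi> balanced_amap[OF p that]] .
 show "amap V G (%v. p v (\<phi> b))" if "b : carrier B" for b
  using balanced_amap_left[OF p] amap_closed[OF \<phi> that] by simp
 show "p (c \<odot>[V] v) (\<phi> b) = p v (\<phi> (c \<odot>[B] b))"
  if "c : carrier K" "v : carrier V" "b : carrier B" for c v b
  using that balanced_smult[OF p] amap_closed[OF \<phi>] s by simp
qed

lemma alg_hom_amap:
 assumes "algebra K B" "algebra K C" "\<phi> : alg_hom K B C" shows "amap B C \<phi>"
proof -
 interpret B: algebra K B by fact
 interpret C: algebra K C by fact
 show ?thesis using assms(3)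
  by (intro amapI B.M.abelian_group_axioms C.M.abelian_group_axioms)
   (auto simp: alg_hom_def ring_hom_def)
qed

lemma alg_hom_smult: "\<phi> : alg_hom K B C ==> c : carrier K ==> b : carrier B ==> \<phi> (c \<odot>[B] b) = c \<odot>[C] \<phi> b"
 by (simp add: alg_hom_def)

lemma alg_hom_mult: "\<phi> : alg_hom K B C ==> a : carrier B ==> b : carrier B ==> \<phi> (a \<otimes>[B] b) = \<phi> a \<otimes>[C] \<phi> b"
 by (simp add: alg_hom_def ring_hom_def)

lemma alg_hom_one: "\<phi> : alg_hom K B C ==> \<phi> \<one>[B] = \<one>[C]"
 by (simp add: alg_hom_def ring_hom_def)

context
 fixes K :: "'k ring" and V :: "('k, 'v) module" and W :: "('k, 'w) module"
  and B :: "('k, 'b) module" and h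
 assumes V: "module K V" and W: "module K W" and B: "algebra K B" and h: "lin K V W h"
begin

interpretation V: tensor_pair K V B by (rule tensor_pair.intro[OF V B])
interpretation W: tensor_pair K W B by (rule tensor_pair.intro[OF W B])

text \<open>The union over representatives in \<open>tensor_lin\<close> is a union of copies of a
  single coset, the value of the induced map.\<close>

lemma tensor_lin_eq:
 assumes X: "X : tens K V B"
 shows "tensor_lin K W B h X = tlift B (tensor K W B) (%v. pure_tensor K W B (h v)) X"
 unfolding tensor_lin_def
proof (rule UN_eq_const[OF V.T_nonempty[OF X]])
 fix u assume "u : X"
 from V.tlift_eq[OF balanced_lin[OF V.tensor_pair_axioms h W.pure_balanced] W.T_group X this]
 show "finsum (tensor K W B) (%v. pure_tensor K W B (h v) (u v)) {v. u v ~= \<zero>[B]} =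
  tlift B (tensor K W B) (%v. pure_tensor K W B (h v)) X" by (simp add: lft_def)
qed

lemma tensor_lin_amap: "amap (tensor K V B) (tensor K W B) (tensor_lin K W B h)"
proof (rule amapI[OF V.T_group W.T_group])
 note am = V.tlift_amap[OF balanced_lin[OF V.tensor_pair_axioms h W.pure_balanced] W.T_group]
 fix X assume X: "X : tens K V B"
 show "tensor_lin K W B h X : tens K W B"
  using tensor_lin_eq[OF X] amap_closed[OF am X] by simp
 fix Y assume Y: "Y : tens K V B"
 show "tensor_lin K W B h (X \<oplus>[tensor K V B] Y) =
   tensor_lin K W B h X \<oplus>[tensor K W B] tensor_lin K W B h Y"
  using tensor_lin_eq[OF X] tensor_lin_eq[OF Y] tensor_lin_eq[OF V.T.a_closed[OF X Y]]
   amap_add[OF am X Y] by simp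
qed

lemma tensor_lin_pure:
 assumes "v : carrier V" "b : carrier B"
 shows "tensor_lin K W B h (pure_tensor K V B v b) = pure_tensor K W B (h v) b"
 using tensor_lin_eq[OF V.pure_closed[OF assms]] assms
  V.tlift_pure[OF balanced_lin[OF V.tensor_pair_axioms h W.pure_balanced] W.T_group]
 by simp

end

context
 fixes K :: "'k ring" and V :: "('k, 'v) module" and B C :: "('k, 'b) module" and \<phi>
 assumes V: "module K V" and B: "algebra K B" and C: "algebra K C" and \<phi>: "\<phi> : alg_hom K B C"
begin

interpretation B: tensor_pair K V B by (rule tensor_pair.intro[OF V B])
interpretation C: tensor_pair K V C by (rule tensor_pair.intro[OF V C])

private lemma bal: "balanced K V B (tensor K V C) (%v b. pure_tensor K V C v (\<phi> b))"
 by (rule balanced_alg[OF C.pure_balanced alg_hom_amap[OF B C \<phi>] alg_hom_smult[OF \<phi>]])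

lemma tensor_base_eq:
 assumes X: "X : tens K V B"
 shows "tensor_base K V B C \<phi> X = tlift B (tensor K V C) (%v b. pure_tensor K V C v (\<phi> b)) X"
 unfolding tensor_base_def
proof (rule UN_eq_const[OF B.T_nonempty[OF X]])
 fix u assume "u : X"
 from B.tlift_eq[OF bal C.T_group X this]
 show "finsum (tensor K V C) (%v. pure_tensor K V C v (\<phi> (u v))) {v. u v ~= \<zero>[B]} =
  tlift B (tensor K V C) (%v b. pure_tensor K V C v (\<phi> b)) X" by (simp add: lft_def)
qed

lemma tensor_base_amap: "amap (tensor K V B) (tensor K V C) (tensor_base K V B C \<phi>)"
proof (rule amapI[OF B.T_group C.T_group])
 note am = B.tlift_amap[OF bal C.T_group]
 fix X assume X: "X : tens K V B"
 show "tensor_base K V B C \<phi> X : tens K V C"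
  using tensor_base_eq[OF X] amap_closed[OF am X] by simp
 fix Y assume Y: "Y : tens K V B"
 show "tensor_base K V B C \<phi> (X \<oplus>[tensor K V B] Y) =
   tensor_base K V B C \<phi> X \<oplus>[tensor K V C] tensor_base K V B C \<phi> Y"
  using tensor_base_eq[OF X] tensor_base_eq[OF Y] tensor_base_eq[OF B.T.a_closed[OF X Y]]
   amap_add[OF am X Y] by simp
qed

lemma tensor_base_pure:
 assumes "v : carrier V" "b : carrier B"
 shows "tensor_base K V B C \<phi> (pure_tensor K V B v b) = pure_tensor K V C v (\<phi> b)"
 using tensor_base_eq[OF B.pure_closed[OF assms]] assms B.tlift_pure[OF bal C.T_group] by simp

lemma tensor_base_surj:
 assumes "\<phi> ` carrier B = carrier C" "Y : tens K V C"
 shows "\<exists>X\<in>tens K V B. tensor_base K V B C \<phi> X = Y"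
 using assms(2)
proof (induction rule: C.tensor_induct)
 case (pure v b)
 then obtain a where "a : carrier B" "\<phi> a = b" using assms(1) by (metis imageE)
 then show ?case using pure B.pure_closed tensor_base_pure by blast
next
 case (add X Y)
 then show ?case using amap_add[OF tensor_base_amap] B.T.a_closed by metis
qed

end

lemma tensor_base_comp:
 assumes V: "module K V" and B: "algebra K B" and C: "algebra K C" and D: "algebra K D"
  and \<phi>: "\<phi> : alg_hom K B C" and \<psi>: "\<psi> : alg_hom K C D" and \<chi>: "\<chi> : alg_hom K B D"
  and c: "!!b. b : carrier B ==> \<psi> (\<phi> b) = \<chi> b"
  and X: "X : tens K V B"
 shows "tensor_base K V C D \<psi> (tensor_base K V B C \<phi> X) = tensor_base K V B D \<chi> X"
proof -
 interpret B: tensor_pair K V B by (rule tensor_pair.intro[OF V B])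
 show ?thesis
 proof (rule B.tensor_ext[OF X])
  show "amap B.T (tensor K V D) (%X. tensor_base K V C D \<psi> (tensor_base K V B C \<phi> X))"
   using amap_comp[OF tensor_base_amap[OF V B C \<phi>] tensor_base_amap[OF V C D \<psi>]] .
  show "amap B.T (tensor K V D) (tensor_base K V B D \<chi>)" by (rule tensor_base_amap[OF V B D \<chi>])
 qed (use c amap_closed[OF alg_hom_amap[OF B C \<phi>]] in \<open>simp add: tensor_base_pure[OF V B C \<phi>] tensor_base_pure[OF V B D \<chi>]
   tensor_base_pure[OF V C D \<psi>]\<close>)
qed

lemma tensor_base_id:
 assumes V: "module K V" and B: "algebra K B" and \<phi>: "\<phi> : alg_hom K B B"
  and c: "!!b. b : carrier B ==> \<phi> b = b" and X: "X : tens K V B"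
 shows "tensor_base K V B B \<phi> X = X"
proof -
 interpret B: tensor_pair K V B by (rule tensor_pair.intro[OF V B])
 show ?thesis
  by (rule B.tensor_ext[OF X tensor_base_amap[OF V B B \<phi>] amap_id[OF B.T_group]])
   (simp add: tensor_base_pure[OF V B B \<phi>] c)
qed

lemma tensor_base_lin:
 assumes V: "module K V" and W: "module K W" and B: "algebra K B" and C: "algebra K C"
  and \<phi>: "\<phi> : alg_hom K B C" and h: "lin K V W h" and X: "X : tens K V B"
 shows "tensor_base K W B C \<phi> (tensor_lin K W B h X) = tensor_lin K W C h (tensor_base K V B C \<phi> X)"
proof -
 interpret B: tensor_pair K V B by (rule tensor_pair.intro[OF V B])
 show ?thesis
 proof (rule B.tensor_ext[OF X])
  show "amap B.T (tensor K W C) (%X. tensor_base K W B C \<phi> (tensor_lin K W B h X))"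
   using amap_comp[OF tensor_lin_amap[OF V W B h] tensor_base_amap[OF W B C \<phi>]] .
  show "amap B.T (tensor K W C) (%X. tensor_lin K W C h (tensor_base K V B C \<phi> X))"
   using amap_comp[OF tensor_base_amap[OF V B C \<phi>] tensor_lin_amap[OF V W C h]] .
 qed (use amap_closed[OF lin_amap[OF h]] amap_closed[OF alg_hom_amap[OF B C \<phi>]] in
   \<open>simp add: tensor_lin_pure[OF V W B h] tensor_base_pure[OF V B C \<phi>] tensor_base_pure[OF W B C \<phi>]
   tensor_lin_pure[OF V W C h]\<close>)
qed

definition bilin :: "'k ring => ('k, 'u) module => ('k, 'v) module => ('k, 'w) module =>
  ('u => 'v => 'w) => bool" where
 "bilin K U V W h \<longleftrightarrow>
  (\<forall>x\<in>carrier U. lin K V W (h x)) & (\<forall>y\<in>carrier V. lin K U W (%x. h x y))"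

context
 fixes K :: "'k ring" and U :: "('k, 'u) module" and V :: "('k, 'v) module"
  and W :: "('k, 'w) module" and B :: "('k, 'b) module" and h
 assumes U: "module K U" and V: "module K V" and W: "module K W" and B: "algebra K B"
  and h: "bilin K U V W h"
begin

interpretation U: tensor_pair K U B by (rule tensor_pair.intro[OF U B])
interpretation V: tensor_pair K V B by (rule tensor_pair.intro[OF V B])
interpretation W: tensor_pair K W B by (rule tensor_pair.intro[OF W B])

private lemma h_left: "y : carrier V ==> lin K U W (%x. h x y)"
 and h_right: "x : carrier U ==> lin K V W (h x)"
 using h by (simp_all add: bilin_def)

private lemma h_closed: "x : carrier U ==> y : carrier V ==> h x y : carrier W"
 using amap_closed[OF lin_amap[OF h_right]] .

text \<open>Currying: the universal property is used once for each argument. For fixed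
  \<open>x\<close> and \<open>b\<close> this is the map induced in the second tensor;
  \<open>bal_left\<close> shows that it is balanced in \<open>x\<close> and \<open>b\<close>, so it
  induces a map in the first.\<close>

private definition "inner Y x b = tlift B W.T (%y c. pure_tensor K W B (h x y) (b \<otimes>[B] c)) Y"

private lemma mult_amap: "b : carrier B ==> amap B B (%c. b \<otimes>[B] c)"
 by (intro amapI U.B.M.abelian_group_axioms) (simp_all add: U.B.r_distr)

private lemma bal_right:
 assumes "x : carrier U" "b : carrier B"
 shows "balanced K V B W.T (%y c. pure_tensor K W B (h x y) (b \<otimes>[B] c))"
proof (rule balanced_alg[OF _ mult_amap])
 show "balanced K V B W.T (%y. pure_tensor K W B (h x y))"
  by (rule balanced_lin[OF V.tensor_pair_axioms h_right[OF assms(1)] W.pure_balanced])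
 show "b \<otimes>[B] (c \<odot>[B] a) = c \<odot>[B] (b \<otimes>[B] a)"
  if "c : carrier K" "a : carrier B" for c a
  using U.B.smult_assoc2[of c a b] that assms by (simp add: U.B.m_comm)
qed (rule assms(2))

private lemma inner_amap: "x : carrier U ==> b : carrier B ==> amap V.T W.T (%Y. inner Y x b)"
 unfolding inner_def by (rule V.tlift_amap[OF bal_right W.T_group])

private lemma inner_pure: "x : carrier U ==> b : carrier B ==> y : carrier V ==> c : carrier B ==>
  inner (pure_tensor K V B y c) x b = pure_tensor K W B (h x y) (b \<otimes>[B] c)"
 unfolding inner_def by (rule V.tlift_pure[OF bal_right W.T_group])

private lemma bal_left:
 assumes Y: "Y : carrier V.T"
 shows "balanced K U B W.T (inner Y)"
 unfolding balanced_def
proof (intro conjI ballI)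
 fix x assume x: "x : carrier U"
 show "amap B W.T (inner Y x)"
 proof (rule amapI[OF U.B.M.abelian_group_axioms W.T_group])
  fix b b' assume b: "b : carrier B" "b' : carrier B"
  show "inner Y x (b \<oplus>[B] b') = inner Y x b \<oplus>[W.T] inner Y x b'"
  proof (rule V.tensor_ext[OF Y inner_amap amap_sum[OF inner_amap inner_amap]])
   fix y c assume y: "y : carrier V" and c: "c : carrier B"
   show "inner (pure_tensor K V B y c) x (b \<oplus>[B] b') =
     inner (pure_tensor K V B y c) x b \<oplus>[W.T] inner (pure_tensor K V B y c) x b'"
    using x b y c amap_add[OF W.pure_amap[OF h_closed[OF x y]]]
    by (simp add: inner_pure U.B.l_distr)
  qed (use x b in auto)
 qed (use amap_closed[OF inner_amap[OF x] Y] in simp)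
next
 fix b assume b: "b : carrier B"
 show "amap U W.T (%x. inner Y x b)"
 proof (rule amapI[OF U.V.abelian_group_axioms W.T_group])
  fix x x' assume x: "x : carrier U" "x' : carrier U"
  show "inner Y (x \<oplus>[U] x') b = inner Y x b \<oplus>[W.T] inner Y x' b"
  proof (rule V.tensor_ext[OF Y inner_amap amap_sum[OF inner_amap inner_amap]])
   fix y c assume y: "y : carrier V" and c: "c : carrier B"
   show "inner (pure_tensor K V B y c) (x \<oplus>[U] x') b =
     inner (pure_tensor K V B y c) x b \<oplus>[W.T] inner (pure_tensor K V B y c) x' b"
    using x b y c amap_add[OF W.pure_amap_left[of "b \<otimes>[B] c"]]
     amap_add[OF lin_amap[OF h_left[OF y]] x] h_closed
    by (simp add: inner_pure)
  qed (use x b in auto)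
 qed (use amap_closed[OF inner_amap[OF _ b] Y] in simp)
next
 fix k x b assume kxb: "k : carrier K" "x : carrier U" "b : carrier B"
 show "inner Y (k \<odot>[U] x) b = inner Y x (k \<odot>[B] b)"
 proof (rule V.tensor_ext[OF Y inner_amap inner_amap])
  fix y c assume y: "y : carrier V" and c: "c : carrier B"
  show "inner (pure_tensor K V B y c) (k \<odot>[U] x) b = inner (pure_tensor K V B y c) x (k \<odot>[B] b)"
   using kxb y c balanced_smult[OF W.pure_balanced kxb(1) h_closed[OF kxb(2) y], of "b \<otimes>[B] c"]
    lin_smult[OF h_left[OF y] kxb(1,2)]
   by (simp add: inner_pure U.B.smult_assoc2)
 qed (use kxb in auto)
qed

private lemma tensor_bilin_eq:
 assumes X: "X : carrier U.T" and Y: "Y : carrier V.T"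
 shows "tensor_bilin K W B h X Y = tlift B W.T (inner Y) X"
 unfolding tensor_bilin_def
proof (intro UN_eq_const[OF U.T_nonempty[OF X]] UN_eq_const[OF V.T_nonempty[OF Y]])
 fix s t assume s: "s : X" and t: "t : Y"
 note sF = U.F_supp[OF U.T_mem(1)[OF X s]] and tF = V.F_supp[OF V.T_mem(1)[OF Y t]]
 have "finsum W.T (%(x, y). pure_tensor K W B (h x y) (s x \<otimes>[B] t y))
    ({x. s x ~= \<zero>[B]} \<times> {y. t y ~= \<zero>[B]}) =
   finsum W.T (%x. finsum W.T (%y. pure_tensor K W B (h x y) (s x \<otimes>[B] t y)) {y. t y ~= \<zero>[B]})
    {x. s x ~= \<zero>[B]}"
  using sF tF h_closed
  by (subst W.T.finsum_cartesian) (auto intro!: W.pure_closed h_closed simp: subset_iff)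
 also have "\<dots> = finsum W.T (%x. inner Y x (s x)) {x. s x ~= \<zero>[B]}"
 proof (rule W.T.finsum_cong')
  fix x assume "x : {x. s x ~= \<zero>[B]}"
  then have x: "x : carrier U" using sF by blast
  show "finsum W.T (%y. pure_tensor K W B (h x y) (s x \<otimes>[B] t y)) {y. t y ~= \<zero>[B]} = inner Y x (s x)"
   using V.tlift_eq[OF bal_right[OF x sF(3)] W.T_group Y t] by (simp add: lft_def inner_def)
 next
  show "(%x. inner Y x (s x)) : {x. s x ~= \<zero>[B]} \<rightarrow> carrier W.T"
   using sF amap_closed[OF inner_amap[OF _ sF(3)] Y] by blast
 qed simp
 also have "\<dots> = tlift B W.T (inner Y) X"
  using U.tlift_eq[OF bal_left[OF Y] W.T_group X s] by (simp add: lft_def)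
 finally show "finsum W.T (%(x, y). pure_tensor K W B (h x y) (s x \<otimes>[B] t y))
    ({x. s x ~= \<zero>[B]} \<times> {y. t y ~= \<zero>[B]}) = tlift B W.T (inner Y) X" .
qed

lemma tensor_bilin_amap_left:
 assumes Y: "Y : tens K V B"
 shows "amap (tensor K U B) (tensor K W B) (%X. tensor_bilin K W B h X Y)"
proof (rule amapI[OF U.T_group W.T_group])
 note am = U.tlift_amap[OF bal_left[OF Y] W.T_group]
 fix X assume X: "X : carrier U.T"
 show "tensor_bilin K W B h X Y : carrier W.T"
  using tensor_bilin_eq[OF X Y] amap_closed[OF am X] by simp
 fix X' assume X': "X' : carrier U.T"
 show "tensor_bilin K W B h (X \<oplus>[U.T] X') Y =
   tensor_bilin K W B h X Y \<oplus>[W.T] tensor_bilin K W B h X' Y"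
  using tensor_bilin_eq[OF X Y] tensor_bilin_eq[OF X' Y] tensor_bilin_eq[OF U.T.a_closed[OF X X'] Y]
   amap_add[OF am X X'] by simp
qed

lemma tensor_bilin_pure:
 assumes "x : carrier U" "b : carrier B" "y : carrier V" "c : carrier B"
 shows "tensor_bilin K W B h (pure_tensor K U B x b) (pure_tensor K V B y c) =
  pure_tensor K W B (h x y) (b \<otimes>[B] c)"
 using assms tensor_bilin_eq[OF U.pure_closed V.pure_closed, of x b y c] inner_pure
  U.tlift_pure[OF bal_left[OF V.pure_closed] W.T_group, of y c x b] by simp

lemma tensor_bilin_amap_right:
 assumes X: "X : tens K U B"
 shows "amap (tensor K V B) (tensor K W B) (tensor_bilin K W B h X)"
proof (rule amapI[OF V.T_group W.T_group])
 fix Y assume Y: "Y : carrier V.T"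
 show "tensor_bilin K W B h X Y : carrier W.T"
  using amap_closed[OF tensor_bilin_amap_left[OF Y] X] .
 fix Y' assume Y': "Y' : carrier V.T"
 note am = tensor_bilin_amap_left
 show "tensor_bilin K W B h X (Y \<oplus>[V.T] Y') =
   tensor_bilin K W B h X Y \<oplus>[W.T] tensor_bilin K W B h X Y'"
 proof (rule U.tensor_ext[OF X am[OF V.T.a_closed[OF Y Y']] amap_sum[OF am[OF Y] am[OF Y']]])
  fix x b assume xb: "x : carrier U" "b : carrier B"
  have *: "tensor_bilin K W B h (pure_tensor K U B x b) Z = inner Z x b" if "Z : carrier V.T" for Z
   using tensor_bilin_eq[OF U.pure_closed[OF xb] that] U.tlift_pure[OF bal_left[OF that] W.T_group xb]
   by simp
  show "tensor_bilin K W B h (pure_tensor K U B x b) (Y \<oplus>[V.T] Y') =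
    tensor_bilin K W B h (pure_tensor K U B x b) Y \<oplus>[W.T]
    tensor_bilin K W B h (pure_tensor K U B x b) Y'"
   using Y Y' amap_add[OF inner_amap[OF xb] Y Y'] by (simp add: *)
 qed
qed

end

lemma tensor_base_bilin:
 assumes U: "module K U" and V: "module K V" and W: "module K W"
  and B: "algebra K B" and C: "algebra K C"
  and \<phi>: "\<phi> : alg_hom K B C" and h: "bilin K U V W h"
  and X: "X : tens K U B" and Y: "Y : tens K V B"
 shows "tensor_base K W B C \<phi> (tensor_bilin K W B h X Y) =
  tensor_bilin K W C h (tensor_base K U B C \<phi> X) (tensor_base K V B C \<phi> Y)"
proof -
 interpret U: tensor_pair K U B by (rule tensor_pair.intro[OF U B])
 interpret V: tensor_pair K V B by (rule tensor_pair.intro[OF V B])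
 note b = tensor_base_amap[OF _ B C \<phi>]
 show ?thesis
 proof (rule U.tensor_ext[OF X amap_comp[OF tensor_bilin_amap_left[OF U V W B h Y] b[OF W]]
    amap_comp[OF b[OF U] tensor_bilin_amap_left[OF U V W C h amap_closed[OF b[OF V] Y]]]])
  fix x a assume xa: "x : carrier U" "a : carrier B"
  note p = U.pure_closed[OF xa]
  show "tensor_base K W B C \<phi> (tensor_bilin K W B h (pure_tensor K U B x a) Y) =
   tensor_bilin K W C h (tensor_base K U B C \<phi> (pure_tensor K U B x a)) (tensor_base K V B C \<phi> Y)"
  proof (rule V.tensor_ext[OF Y amap_comp[OF tensor_bilin_amap_right[OF U V W B h p] b[OF W]]
    amap_comp[OF b[OF V] tensor_bilin_amap_right[OF U V W C h amap_closed[OF b[OF U] p]]]])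
   fix y c assume yc: "y : carrier V" "c : carrier B"
   have "h x y : carrier W" using h xa yc amap_closed[OF lin_amap, of K V W "h x" y] by (simp add: bilin_def)
   then show "tensor_base K W B C \<phi> (tensor_bilin K W B h (pure_tensor K U B x a) (pure_tensor K V B y c)) =
    tensor_bilin K W C h (tensor_base K U B C \<phi> (pure_tensor K U B x a))
     (tensor_base K V B C \<phi> (pure_tensor K V B y c))"
    using xa yc amap_closed[OF alg_hom_amap[OF B C \<phi>]] alg_hom_mult[OF \<phi>] U.B.m_closed
    by (simp add: tensor_bilin_pure[OF U V W B h] tensor_bilin_pure[OF U V W C h]
     tensor_base_pure[OF U B C \<phi>] tensor_base_pure[OF V B C \<phi>] tensor_base_pure[OF W B C \<phi>])
  qed
 qed
qed

subsection \<open>Finite-dimensional spaces\<close>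

text \<open>A basis recorded through its coordinate functionals: these extend to scalars in any
  algebra, which a statement of independence would not do directly.\<close>

definition dual_basis :: "'k ring => ('k, 'v) module => 'v set => ('v => 'v => 'k) => bool" where
 "dual_basis K V S \<kappa> \<longleftrightarrow> finite S & S \<subseteq> carrier V &
  (\<forall>s\<in>S. amap V K (\<kappa> s) & (\<forall>c\<in>carrier K. \<forall>v\<in>carrier V. \<kappa> s (c \<odot>[V] v) = c \<otimes>[K] \<kappa> s v)) &
  (\<forall>v\<in>carrier V. v = finsum V (%s. \<kappa> s v \<odot>[V] s) S)"

text \<open>A spanning set of least size is independent, since a relation with an invertible
  coefficient lets one element be dropped. Independence makes coefficients unique, and uniqueness
  makes the chosen coefficients linear in the vector.\<close>

lemma dual_basis_exists:
 assumes K: "field K" and V: "module K V" and fd: "fin_dim K V"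
 shows "\<exists>S \<kappa>. dual_basis K V S \<kappa>"
proof -
 interpret K: field K by (rule K)
 interpret V: module K V by (rule V)
 let ?sum = "%c S. finsum V (%s. c s \<odot>[V] s) S"
 let ?sp = "%S. finite S & S \<subseteq> carrier V & (\<forall>v\<in>carrier V. \<exists>c\<in>S \<rightarrow> carrier K. v = ?sum c S)"
 obtain S0 where S0: "?sp S0" using fd unfolding fin_dim_def by blast
 obtain S where S: "?sp S" and min: "!!S'. ?sp S' ==> card S <= card S'"
  using ex_has_least_nat[of ?sp S0 card] S0 by auto
 have fS: "finite S" and SV: "!!s. s : S ==> s : carrier V" using S by auto
 have lin: "?sum (%s. c s \<oplus>[K] d s) S = ?sum c S \<oplus>[V] ?sum d S"
  if "c : S \<rightarrow> carrier K" "d : S \<rightarrow> carrier K" for c d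
 proof -
  have "?sum (%s. c s \<oplus>[K] d s) S = finsum V (%s. c s \<odot>[V] s \<oplus>[V] d s \<odot>[V] s) S"
   using that SV by (intro V.finsum_cong') (auto simp: V.smult_l_distr Pi_def)
  then show ?thesis using that SV by (simp add: V.finsum_addf Pi_def)
 qed
 have smul: "?sum (%s. a \<otimes>[K] c s) S = a \<odot>[V] ?sum c S"
  if "a : carrier K" "c : S \<rightarrow> carrier K" for a c
 proof -
  have "?sum (%s. a \<otimes>[K] c s) S = finsum V (%s. a \<odot>[V] (c s \<odot>[V] s)) S"
   using that SV by (intro V.finsum_cong') (auto simp: V.smult_assoc1 Pi_def)
  then show ?thesis using that SV fS by (simp add: V.finsum_smult_ldistr Pi_def)
 qed
 have indep: "c s = \<zero>[K]" if c: "c : S \<rightarrow> carrier K" "?sum c S = \<zero>[V]" and s: "s : S" for c s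
 proof (rule ccontr)
  assume ne: "c s ~= \<zero>[K]"
  have cs: "c s : Units K" using ne c s by (auto simp: K.field_Units)
  have "?sp (S - {s})"
  proof (intro conjI ballI)
   fix v assume "v : carrier V"
   then obtain a where a: "a : S \<rightarrow> carrier K" "v = ?sum a S" using S by blast
   \<comment> \<open>Adding \<open>d\<close> times the relation \<open>c\<close> does not change the
     vector and is tuned to cancel the coefficient at \<open>s\<close>.\<close>
   define d where "d = \<ominus>[K] (a s \<otimes>[K] inv\<^bsub>K\<^esub> c s)"
   have d: "d : carrier K" using a s cs by (auto simp: d_def)
   let ?b = "%t. a t \<oplus>[K] d \<otimes>[K] c t"
   have b: "?b : S \<rightarrow> carrier K" using a c d by auto
   have "d \<otimes>[K] c s = \<ominus>[K] a s"
   proof -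
    have "a s : carrier K" "c s : carrier K" using a c s by auto
    then show ?thesis using cs unfolding d_def by (simp add: K.l_minus K.m_assoc)
   qed
   then have b0: "?b s = \<zero>[K]" using K.r_neg[OF funcset_mem[OF a(1) s]] by simp
   have "v = ?sum ?b S"
    using a d c lin[of a "%t. d \<otimes>[K] c t"] smul[OF d c(1)] SV
    by (auto simp: Pi_def intro!: V.finsum_closed)
   also have "\<dots> = ?sum ?b (insert s (S - {s}))" using s by (simp add: insert_absorb)
   also have "\<dots> = ?sum ?b (S - {s})"
    using b b0 SV fS s by (subst V.finsum_insert) (auto simp: Pi_def intro!: V.finsum_closed)
   finally have "v = ?sum ?b (S - {s})" .
   then show "\<exists>c\<in>S - {s} \<rightarrow> carrier K. v = ?sum c (S - {s})"
    using b by (intro bexI[of _ ?b]) auto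
  qed (use S in auto)
  from min[OF this] show False
   using s fS card_Suc_Diff1 by (metis Suc_n_not_le_n)
 qed
 have uniq: "c s = d s"
  if c: "c : S \<rightarrow> carrier K" and d: "d : S \<rightarrow> carrier K" and eq: "?sum c S = ?sum d S" and s: "s : S"
  for c d s
 proof -
  let ?e = "%t. c t \<oplus>[K] (\<ominus>[K] \<one>[K]) \<otimes>[K] d t"
  have cl: "?sum d S : carrier V" using d SV by (auto intro!: V.finsum_closed)
  have "?sum ?e S = ?sum d S \<oplus>[V] (\<ominus>[K] \<one>[K]) \<odot>[V] ?sum d S"
   using lin[OF c, of "%t. (\<ominus>[K] \<one>[K]) \<otimes>[K] d t"] smul[OF _ d, of "\<ominus>[K] \<one>[K]"] eq d by auto
  also have "\<dots> = \<zero>[V]" using cl by (simp add: V.smult_l_minus V.r_neg)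
  finally have "?e s = \<zero>[K]" using c d by (intro indep[OF _ _ s]) auto
  then have "c s \<oplus>[K] \<ominus>[K] d s = \<zero>[K]"
   using funcset_mem[OF d s] by (simp add: K.l_minus)
  moreover have "c s : carrier K" "d s : carrier K" using c d s by auto
  ultimately show ?thesis by (simp add: K.minus_eq[symmetric] K.minus_zero_iff)
 qed
 define co where "co v = (SOME c. c : S \<rightarrow> carrier K & v = ?sum c S)" for v
 have co: "co v : S \<rightarrow> carrier K" "v = ?sum (co v) S" if "v : carrier V" for v
  using someI_ex[of "%c. c : S \<rightarrow> carrier K & v = ?sum c S"] S that unfolding co_def by blast+
 have "dual_basis K V S (%s v. co v s)"
  unfolding dual_basis_def
 proof (intro conjI ballI)
  fix s assume s: "s : S"
  show "amap V K (%v. co v s)"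
  proof (rule amapI)
   fix v w assume vw: "v : carrier V" "w : carrier V"
   show "co (v \<oplus>[V] w) s = co v s \<oplus>[K] co w s"
   proof (rule uniq[OF _ _ _ s])
    show "?sum (co (v \<oplus>[V] w)) S = ?sum (%s. co v s \<oplus>[K] co w s) S"
     using lin[OF co(1) co(1), OF vw] co(2)[OF vw(1)] co(2)[OF vw(2)] co(2)[of "v \<oplus>[V] w"] vw by simp
    show "co (v \<oplus>[V] w) : S \<rightarrow> carrier K" using vw by (intro co) simp
    show "(%s. co v s \<oplus>[K] co w s) : S \<rightarrow> carrier K" using co(1)[OF vw(1)] co(1)[OF vw(2)] by auto
   qed
  qed (use co s in \<open>auto intro: V.abelian_group_axioms K.abelian_group_axioms\<close>)
  fix c v assume cv: "c : carrier K" "v : carrier V"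
  show "co (c \<odot>[V] v) s = c \<otimes>[K] co v s"
  proof (rule uniq[OF _ _ _ s])
   show "?sum (co (c \<odot>[V] v)) S = ?sum (%s. c \<otimes>[K] co v s) S"
    using smul[OF cv(1) co(1)[OF cv(2)]] co(2)[OF cv(2)] co(2)[of "c \<odot>[V] v"] cv by simp
   show "co (c \<odot>[V] v) : S \<rightarrow> carrier K" using cv by (intro co) simp
   show "(%s. c \<otimes>[K] co v s) : S \<rightarrow> carrier K" using co(1)[OF cv(2)] cv by auto
  qed
 qed (use S co in auto)
 then show ?thesis by blast
qed

context
 fixes K :: "'k ring" and V :: "('k, 'v) module" and S \<kappa>
 assumes K: "field K" and V: "module K V" and S: "dual_basis K V S \<kappa>"
begin

text \<open>The functional \<open>\<kappa> s\<close> after extension of scalars. By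
  \<open>coord_expand\<close> the tensor product is spanned by \<open>S\<close> over
  \<open>B\<close> with these coordinates, so an equation between tensors becomes finitely many
  equations in \<open>B\<close>.\<close>

definition coord :: "('k, 'b) module => 'v => ('v => 'b) set => 'b" where
 "coord B s = tlift B B (%v b. \<kappa> s v \<odot>[B] b)"

lemma dual_basis_finite: "finite S"
 and dual_basis_mem: "s : S ==> s : carrier V"
 and dual_basis_amap: "s : S ==> amap V K (\<kappa> s)"
 and dual_basis_smult: "s : S ==> c : carrier K ==> v : carrier V ==> \<kappa> s (c \<odot>[V] v) = c \<otimes>[K] \<kappa> s v"
 and dual_basis_expand: "v : carrier V ==> finsum V (%s. \<kappa> s v \<odot>[V] s) S = v"
 using S by (auto simp: dual_basis_def)

lemma coord_balanced:
 assumes B: "algebra K B" and s: "s : S"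
 shows "balanced K V B B (%v b. \<kappa> s v \<odot>[B] b)"
proof -
 interpret B: algebra K B by (rule B)
 interpret V: module K V by (rule V)
 note c = amap_closed[OF dual_basis_amap[OF s]]
 show ?thesis
  unfolding balanced_def
 proof (intro conjI ballI)
  show "amap B B ((\<odot>\<^bsub>B\<^esub>) (\<kappa> s v))" if "v : carrier V" for v
   using c[OF that] by (intro amapI B.M.abelian_group_axioms) (auto simp: B.smult_r_distr)
  show "amap V B (%v. \<kappa> s v \<odot>[B] b)" if "b : carrier B" for b
   using that c by (intro amapI B.M.abelian_group_axioms V.abelian_group_axioms)
    (auto simp: B.smult_l_distr amap_add[OF dual_basis_amap[OF s]])
  show "\<kappa> s (k \<odot>[V] v) \<odot>[B] b = \<kappa> s v \<odot>[B] (k \<odot>[B] b)"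
   if "k : carrier K" "v : carrier V" "b : carrier B" for k v b
   using that c by (simp add: dual_basis_smult[OF s] B.smult_assoc1[symmetric] B.R.m_comm)
 qed
qed

lemma coord_amap: "algebra K B ==> s : S ==> amap (tensor K V B) B (coord B s)"
 unfolding coord_def
 by (intro tensor_pair.tlift_amap tensor_pair.intro V coord_balanced algebra.axioms(1)
   module.axioms(2)[OF algebra.axioms(1)])

lemma coord_pure:
 assumes "algebra K B" "s : S" "v : carrier V" "b : carrier B"
 shows "coord B s (pure_tensor K V B v b) = \<kappa> s v \<odot>[B] b"
 unfolding coord_def using assms
 by (intro tensor_pair.tlift_pure tensor_pair.intro V coord_balanced
   module.axioms(2)[OF algebra.axioms(1)]) auto

lemma coord_expand:
 assumes B: "algebra K B" and X: "X : tens K V B"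
 shows "X = finsum (tensor K V B) (%s. pure_tensor K V B s (coord B s X)) S"
proof -
 interpret B: tensor_pair K V B by (rule tensor_pair.intro[OF V B])
 have pc: "pure_tensor K V B s (coord B s X) : carrier B.T" if "s : S" "X : carrier B.T" for s X
  using that B.pure_closed dual_basis_mem amap_closed[OF coord_amap[OF B]] by blast
 show ?thesis
 proof (rule B.tensor_ext[OF X amap_id[OF B.T_group]])
  show "amap B.T B.T (%X. finsum B.T (%s. pure_tensor K V B s (coord B s X)) S)"
  proof (rule amapI[OF B.T_group B.T_group])
   fix X Y assume XY: "X : carrier B.T" "Y : carrier B.T"
   have "finsum B.T (%s. pure_tensor K V B s (coord B s (X \<oplus>[B.T] Y))) S =
    finsum B.T (%s. pure_tensor K V B s (coord B s X) \<oplus>[B.T] pure_tensor K V B s (coord B s Y)) S"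
    using XY pc by (intro B.T.finsum_cong') (auto simp: amap_add[OF coord_amap[OF B]]
      amap_add[OF B.pure_amap[OF dual_basis_mem]] amap_closed[OF coord_amap[OF B]])
   also have "\<dots> = finsum B.T (%s. pure_tensor K V B s (coord B s X)) S \<oplus>[B.T]
     finsum B.T (%s. pure_tensor K V B s (coord B s Y)) S"
    using XY pc by (intro B.T.finsum_addf) auto
   finally show "finsum B.T (%s. pure_tensor K V B s (coord B s (X \<oplus>[B.T] Y))) S = \<dots>" .
  qed (use pc in \<open>auto intro!: B.T.finsum_closed\<close>)
  fix v b assume v: "v : carrier V" and b: "b : carrier B"
  have "pure_tensor K V B v b = pure_tensor K V B (finsum V (%s. \<kappa> s v \<odot>[V] s) S) b"
   using dual_basis_expand[OF v] by simp
  also have "\<dots> = finsum B.T (%s. pure_tensor K V B (\<kappa> s v \<odot>[V] s) b) S"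
   using v dual_basis_mem amap_closed[OF dual_basis_amap]
   by (intro amap_finsum[OF B.pure_amap_left[OF b]]) auto
  also have "\<dots> = finsum B.T (%s. pure_tensor K V B s (coord B s (pure_tensor K V B v b))) S"
   using v b pc B.pure_closed dual_basis_mem amap_closed[OF dual_basis_amap] balanced_smult[OF B.pure_balanced]
   by (intro B.T.finsum_cong') (auto simp: coord_pure[OF B])
  finally show "pure_tensor K V B v b =
   finsum B.T (%s. pure_tensor K V B s (coord B s (pure_tensor K V B v b))) S" .
 qed
qed

lemma coord_base:
 assumes B: "algebra K B" and C: "algebra K C" and \<phi>: "\<phi> : alg_hom K B C"
  and s: "s : S" and X: "X : tens K V B"
 shows "coord C s (tensor_base K V B C \<phi> X) = \<phi> (coord B s X)"
proof -
 interpret B: tensor_pair K V B by (rule tensor_pair.intro[OF V B])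
 note a = alg_hom_amap[OF B C \<phi>]
 show ?thesis
  by (rule B.tensor_ext[OF X amap_comp[OF tensor_base_amap[OF V B C \<phi>] coord_amap[OF C s]]
     amap_comp[OF coord_amap[OF B s] a]])
   (simp add: tensor_base_pure[OF V B C \<phi>] coord_pure[OF C s] coord_pure[OF B s]
    amap_closed[OF a] alg_hom_smult[OF \<phi>] amap_closed[OF dual_basis_amap[OF s]])
qed

lemma coord_eqI:
 assumes B: "algebra K B" and X: "X : tens K V B" and Y: "Y : tens K V B"
  and eq: "!!s. s : S ==> coord B s X = coord B s Y"
 shows "X = Y"
proof -
 interpret B: tensor_pair K V B by (rule tensor_pair.intro[OF V B])
 have "X = finsum B.T (%s. pure_tensor K V B s (coord B s X)) S"
  by (rule coord_expand[OF B X])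
 also have "\<dots> = finsum B.T (%s. pure_tensor K V B s (coord B s Y)) S"
  using eq dual_basis_mem amap_closed[OF coord_amap[OF B] Y]
  by (intro B.T.finsum_cong') (auto intro!: B.pure_closed)
 also have "\<dots> = Y" by (rule coord_expand[OF B Y, symmetric])
 finally show ?thesis .
qed

end

text \<open>Coordinates commute with base change, so a tensor in the kernel has all its coordinates
  in the kernel of \<open>\<phi>\<close>. Expanding both factors, every product of coordinates
  vanishes.\<close>

lemma tensor_kernel_mult:
 assumes K: "field K" and U: "module K U" and V: "module K V" and W: "module K W"
  and fU: "fin_dim K U" and fV: "fin_dim K V"
  and B: "algebra K B" and C: "algebra K C" and \<phi>: "\<phi> : alg_hom K B C" and h: "bilin K U V W h"
  and sq: "!!a b. a : carrier B ==> b : carrier B ==> \<phi> a = \<zero>[C] ==> \<phi> b = \<zero>[C] ==> a \<otimes>[B] b = \<zero>[B]"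
  and X: "X : tens K U B" "tensor_base K U B C \<phi> X = \<zero>[tensor K U C]"
  and Y: "Y : tens K V B" "tensor_base K V B C \<phi> Y = \<zero>[tensor K V C]"
 shows "tensor_bilin K W B h X Y = \<zero>[tensor K W B]"
proof -
 interpret U: tensor_pair K U B by (rule tensor_pair.intro[OF U B])
 interpret V: tensor_pair K V B by (rule tensor_pair.intro[OF V B])
 interpret W: tensor_pair K W B by (rule tensor_pair.intro[OF W B])
 obtain S \<kappa> where S: "dual_basis K U S \<kappa>" using dual_basis_exists[OF K U fU] by blast
 obtain R \<rho> where R: "dual_basis K V R \<rho>" using dual_basis_exists[OF K V fV] by blast
 note cU = coord_amap[OF K U S] and cV = coord_amap[OF K V R]
 note mU = dual_basis_mem[OF K U S] and mV = dual_basis_mem[OF K V R]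
 have b: "coord \<kappa> B s X : carrier B & \<phi> (coord \<kappa> B s X) = \<zero>[C]" if "s : S" for s
  using coord_base[OF K U S B C \<phi> that X(1)] X amap_zero[OF cU[OF C that]]
   amap_closed[OF cU[OF B that]] by simp
 have c: "coord \<rho> B t Y : carrier B & \<phi> (coord \<rho> B t Y) = \<zero>[C]" if "t : R" for t
  using coord_base[OF K V R B C \<phi> that Y(1)] Y amap_zero[OF cV[OF C that]]
   amap_closed[OF cV[OF B that]] by simp
 have hc: "h x y : carrier W" if "x : carrier U" "y : carrier V" for x y
  using h that amap_closed[OF lin_amap, of K V W "h x" y] by (simp add: bilin_def)
 have p: "tensor_bilin K W B h (pure_tensor K U B s (coord \<kappa> B s X)) Y = \<zero>[W.T]" if s: "s : S" for s
 proof -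
  note pc = U.pure_closed[OF mU[OF s] b[THEN conjunct1, OF s]]
  have "tensor_bilin K W B h (pure_tensor K U B s (coord \<kappa> B s X)) Y =
   tensor_bilin K W B h (pure_tensor K U B s (coord \<kappa> B s X))
    (finsum V.T (%t. pure_tensor K V B t (coord \<rho> B t Y)) R)"
   using coord_expand[OF K V R B Y(1)] by simp
  also have "\<dots> = finsum W.T (%t. tensor_bilin K W B h (pure_tensor K U B s (coord \<kappa> B s X))
    (pure_tensor K V B t (coord \<rho> B t Y))) R"
   using c mV V.pure_closed by (intro amap_finsum[OF tensor_bilin_amap_right[OF U V W B h pc]]) auto
  also have "\<dots> = \<zero>[W.T]"
   using b[OF s] c mU[OF s] mV sq hc
   by (intro W.T.add.finprod_one_eqI)
    (simp add: tensor_bilin_pure[OF U V W B h] W.pure_zero)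
  finally show ?thesis .
 qed
 have "tensor_bilin K W B h X Y = tensor_bilin K W B h
   (finsum U.T (%s. pure_tensor K U B s (coord \<kappa> B s X)) S) Y"
  using coord_expand[OF K U S B X(1)] by simp
 also have "\<dots> = finsum W.T (%s. tensor_bilin K W B h (pure_tensor K U B s (coord \<kappa> B s X)) Y) S"
  using b mU U.pure_closed by (intro amap_finsum[OF tensor_bilin_amap_left[OF U V W B h Y(1)]]) auto
 also have "\<dots> = \<zero>[W.T]"
  using p by (intro W.T.add.finprod_one_eqI) simp
 finally show ?thesis .
qed

section \<open>Tensor products and directed colimits of algebras\<close>

locale colimit =
 fixes K :: "'k ring" and I :: "'i set" and po and D :: "'i => ('k, 'b) module" and f
  and B :: "('k, 'b) module" and g
 assumes K: "field K" and ds: "directed_system K I po D f" and dc: "directed_colimit K I po D f B g"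
begin

lemma D: "i : I ==> algebra K (D i)"
 and B: "algebra K B"
 and f: "i : I ==> j : I ==> po i j ==> f i j : alg_hom K (D i) (D j)"
 and g: "i : I ==> g i : alg_hom K (D i) B"
 using ds dc unfolding directed_system_def directed_colimit_def by blast+

lemma po_refl: "i : I ==> po i i"
 and po_trans: "i : I ==> j : I ==> l : I ==> po i j ==> po j l ==> po i l"
 using ds unfolding directed_system_def by blast+

lemma po_bound: "i : I ==> j : I ==> \<exists>l\<in>I. po i l & po j l"
 using ds unfolding directed_system_def by blast

lemma ff: "i : I ==> j : I ==> l : I ==> po i j ==> po j l ==> b : carrier (D i) ==> f j l (f i j b) = f i l b"
 using ds unfolding directed_system_def by blast

lemma gf: "i : I ==> j : I ==> po i j ==> b : carrier (D i) ==> g j (f i j b) = g i b"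
 using dc unfolding directed_colimit_def by blast

lemma g_surj: "b : carrier B ==> \<exists>i\<in>I. \<exists>a\<in>carrier (D i). g i a = b"
 using dc unfolding directed_colimit_def by blast

lemma g_eq: "i : I ==> a : carrier (D i) ==> a' : carrier (D i) ==> g i a = g i a' ==>
  \<exists>j\<in>I. po i j & f i j a = f i j a'"
 using dc unfolding directed_colimit_def by blast

lemma base_f_f:
 assumes "module K V" "i : I" "j : I" "l : I" "po i j" "po j l" "X : tens K V (D i)"
 shows "tensor_base K V (D j) (D l) (f j l) (tensor_base K V (D i) (D j) (f i j) X) =
  tensor_base K V (D i) (D l) (f i l) X"
 by (rule tensor_base_comp[OF assms(1) D D D f f f ff assms(7)])
  (use assms po_trans[of i j l] in auto)

lemma base_g_f:
 assumes "module K V" "i : I" "j : I" "po i j" "X : tens K V (D i)"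
 shows "tensor_base K V (D j) B (g j) (tensor_base K V (D i) (D j) (f i j) X) =
  tensor_base K V (D i) B (g i) X"
 by (rule tensor_base_comp[OF assms(1) D D B f g g gf assms(5)]) (use assms in auto)

text \<open>Both tensors have finitely many coordinates, and each pair of coordinates becomes equal
  at some later stage. The induction over the basis keeps one stage that is good for all coordinates
  treated so far.\<close>

lemma stage_eq:
 assumes V: "module K V" and fV: "fin_dim K V" and i: "i : I"
  and X: "X : tens K V (D i)" and Y: "Y : tens K V (D i)"
  and eq: "tensor_base K V (D i) B (g i) X = tensor_base K V (D i) B (g i) Y"
 shows "\<exists>j\<in>I. po i j & tensor_base K V (D i) (D j) (f i j) X = tensor_base K V (D i) (D j) (f i j) Y"
proof -
 obtain S \<kappa> where S: "dual_basis K V S \<kappa>" using dual_basis_exists[OF K V fV] by blast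
 let ?c = "%s X. coord \<kappa> (D i) s X"
 have c: "?c s X : carrier (D i)" "?c s Y : carrier (D i)" if "s : S" for s
  using amap_closed[OF coord_amap[OF K V S D[OF i] that]] X Y by auto
 have "\<exists>j\<in>I. po i j & (\<forall>s\<in>R. f i j (?c s X) = f i j (?c s Y))" if "R \<subseteq> S" for R
  using finite_subset[OF that dual_basis_finite[OF K V S]] that
 proof (induction R)
  case empty
  then show ?case using i po_refl by blast
 next
  case (insert s R)
  then obtain j where j: "j : I" "po i j" "!!s. s : R ==> f i j (?c s X) = f i j (?c s Y)" by blast
  have s: "s : S" using insert by blast
  have "g i (?c s X) = g i (?c s Y)"
   using coord_base[OF K V S D[OF i] B g[OF i] s X] coord_base[OF K V S D[OF i] B g[OF i] s Y] eq by simp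
  then obtain l where l: "l : I" "po i l" "f i l (?c s X) = f i l (?c s Y)"
   using g_eq[OF i c[OF s]] by blast
  obtain m where m: "m : I" "po j m" "po l m" using po_bound[OF j(1) l(1)] by blast
  have "f i m (?c t X) = f i m (?c t Y)" if "t : insert s R" for t
  proof (cases "t = s")
   case True
   then show ?thesis using ff[OF i l(1) m(1) l(2) m(3)] c[OF s] l(3) by metis
  next
   case False
   then have "t : R" "t : S" using that insert by auto
   then show ?thesis using ff[OF i j(1) m(1) j(2) m(2)] c j(3) by metis
  qed
  then show ?case using m po_trans[OF i j(1) m(1) j(2) m(2)] by blast
 qed
 from this[OF subset_refl] obtain j where j: "j : I" "po i j"
  "!!s. s : S ==> f i j (?c s X) = f i j (?c s Y)" by blast
 note a = tensor_base_amap[OF V D[OF i] D[OF j(1)] f[OF i j(1,2)]]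
 have "tensor_base K V (D i) (D j) (f i j) X = tensor_base K V (D i) (D j) (f i j) Y"
  using coord_base[OF K V S D[OF i] D[OF j(1)] f[OF i j(1,2)]] X Y j(3)
  by (intro coord_eqI[OF K V S D[OF j(1)] amap_closed[OF a X] amap_closed[OF a Y]]) simp
 then show ?thesis using j by blast
qed

text \<open>A tensor is a finite sum of pure ones, and each coefficient comes from some stage; lifts
  of two summands are moved to a common stage and added there.\<close>

lemma stage_lift:
 assumes V: "module K V" and X: "X : tens K V B"
 shows "\<exists>i\<in>I. \<exists>Y\<in>tens K V (D i). tensor_base K V (D i) B (g i) Y = X"
proof -
 interpret V: tensor_pair K V B by (rule tensor_pair.intro[OF V B])
 show ?thesis using X
 proof (induction rule: V.tensor_induct)
  case (pure v b)
  then obtain i a where i: "i : I" "a : carrier (D i)" "g i a = b" using g_surj by blast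
  moreover have "pure_tensor K V (D i) v a : tens K V (D i)"
   by (rule tensor_pair.pure_closed[OF tensor_pair.intro[OF V D[OF i(1)]] pure(1) i(2)])
  ultimately show ?case using tensor_base_pure[OF V D[OF i(1)] B g[OF i(1)] pure(1) i(2)] by blast
 next
  case (add X Y)
  obtain i X' where i: "i : I" "X' : tens K V (D i)" "tensor_base K V (D i) B (g i) X' = X"
   using add by blast
  obtain j Y' where j: "j : I" "Y' : tens K V (D j)" "tensor_base K V (D j) B (g j) Y' = Y"
   using add by blast
  obtain l where l: "l : I" "po i l" "po j l" using po_bound[OF i(1) j(1)] by blast
  define X'' where "X'' = tensor_base K V (D i) (D l) (f i l) X'"
  define Y'' where "Y'' = tensor_base K V (D j) (D l) (f j l) Y'"
  have c: "X'' : tens K V (D l)" "Y'' : tens K V (D l)"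
   unfolding X''_def Y''_def
   using amap_closed[OF tensor_base_amap[OF V D[OF i(1)] D[OF l(1)] f[OF i(1) l(1,2)]] i(2)]
    amap_closed[OF tensor_base_amap[OF V D[OF j(1)] D[OF l(1)] f[OF j(1) l(1,3)]] j(2)] by auto
  have "tensor_base K V (D l) B (g l) X'' = X" "tensor_base K V (D l) B (g l) Y'' = Y"
   unfolding X''_def Y''_def using base_g_f[OF V i(1) l(1,2) i(2)] base_g_f[OF V j(1) l(1,3) j(2)] i j by auto
  then have "tensor_base K V (D l) B (g l) (X'' \<oplus>[tensor K V (D l)] Y'') = X \<oplus>[V.T] Y"
   using amap_add[OF tensor_base_amap[OF V D[OF l(1)] B g[OF l(1)]] c] by simp
  moreover have "X'' \<oplus>[tensor K V (D l)] Y'' : tens K V (D l)"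
   using c tensor_pair.T_group[OF tensor_pair.intro[OF V D[OF l(1)]]]
   by (meson abelian_groupE(1))
  ultimately show ?case using l(1) by blast
 qed
qed

end

section \<open>Additive dg-categories\<close>

text \<open>The curved version does not require the differential to square to zero: it is needed for
 the twisted differentials attached to elements that do not satisfy the Maurer-Cartan equation.\<close>

locale cdg =
 fixes A :: "('k, 'o, 'm) dgcat"
 assumes hom_group: "[|E : Ob A; F : Ob A|] ==> abelian_group (Hom A E F i)"
  and dif_amap: "[|E : Ob A; F : Ob A; j = i + 1|] ==> amap (Hom A E F i) (Hom A E F j) (dif A E F i)"
  and cmp_amap_left: "[|E : Ob A; F : Ob A; G : Ob A; f : mor A E F j; k = i + j|]
   ==> amap (Hom A F G i) (Hom A E G k) (%g. cmp A E F G i j g f)"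
  and cmp_amap_right: "[|E : Ob A; F : Ob A; G : Ob A; g : mor A F G i; k = i + j|]
   ==> amap (Hom A E F j) (Hom A E G k) (cmp A E F G i j g)"
  and cmp_assoc: "[|E : Ob A; F : Ob A; G : Ob A; H : Ob A;
    h : mor A G H l; g : mor A F G i; f : mor A E F j;
    p = l + i; q = i + j|]
   ==> cmp A E F H p j (cmp A F G H l i h g) f = cmp A E G H l q h (cmp A E F G i j g f)"
  and idn_closed: "E : Ob A ==> idn A E : mor A E E 0"
  and idn_left: "[|E : Ob A; F : Ob A; f : mor A E F i|] ==> cmp A E F F 0 i (idn A F) f = f"
  and idn_right: "[|E : Ob A; F : Ob A; f : mor A E F i|] ==> cmp A E E F i 0 f (idn A E) = f"
  and leibniz: "[|E : Ob A; F : Ob A; G : Ob A;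
    g : mor A F G i; f : mor A E F j;
    k = i + j; k' = k + 1; i' = i + 1; j' = j + 1|]
   ==> dif A E G k (cmp A E F G i j g f) =
     cmp A E F G i' j (dif A F G i g) f \<oplus>[Hom A E G k']
     sgn_act (Hom A E G k') i (cmp A E F G i j' g (dif A E F j f))"

locale adg = cdg +
 assumes dif_dif: "[|E : Ob A; F : Ob A; f : mor A E F i; j = i + 1; k = i + 2|]
   ==> dif A E F j (dif A E F i f) = \<zero>[Hom A E F k]"

context cdg
begin

lemma dif_closed: "[|E : Ob A; F : Ob A; f : mor A E F i; j = i + 1|]
  ==> dif A E F i f : mor A E F j"
 using amap_closed[OF dif_amap] by blast

lemma cmp_closed: "[|E : Ob A; F : Ob A; G : Ob A; g : mor A F G i;
  f : mor A E F j; k = i + j|] ==> cmp A E F G i j g f : mor A E G k"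
 using amap_closed[OF cmp_amap_right] by blast

text \<open>The Leibniz rule for 1 = 1 1 gives \<open>d 1 = d 1 + d 1\<close>.\<close>

lemma dif_idn:
 assumes E: "E : Ob A" shows "dif A E E 0 (idn A E) = \<zero>[Hom A E E 1]"
proof -
 interpret M: abelian_group "Hom A E E 1" using hom_group E by blast
 have d: "dif A E E 0 (idn A E) : mor A E E 1" using dif_closed[OF E E idn_closed[OF E], of 1] by simp
 have "dif A E E 0 (idn A E) = dif A E E 0 (idn A E) \<oplus>[Hom A E E 1] dif A E E 0 (idn A E)"
  using leibniz[OF E E E idn_closed[OF E] idn_closed[OF E], of 0 1 1 1] E d
  by (simp add: idn_left[OF E E idn_closed[OF E]] idn_left[OF E E d] idn_right[OF E E d] sgn_act_def)
 then show ?thesis using d by (metis M.add.r_cancel_one')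
qed

end

subsection \<open>Extension of scalars of a dg-category\<close>

context dg_category
begin

text \<open>The target degree is a variable tied by an equation, the form in which
  \<open>cdg\<close> states its axioms. Identities such as -1 + 1 = 0 are then side conditions and
  need not be rewritten under \<open>Hom\<close>.\<close>

lemma dif_lin:
 assumes "E : Ob A" "F : Ob A" "j = i + 1"
 shows "lin R (Hom A E F i) (Hom A E F j) (dif A E F i)"
 unfolding lin_def assms(3) using assms hom_module[of E F]
 by (intro conjI ballI amapI) (auto simp: dif_closed dif_add dif_smult module_def)

lemma cmp_bilin:
 assumes "E : Ob A" "F : Ob A" "G : Ob A" "k = i + j"
 shows "bilin R (Hom A F G i) (Hom A E F j) (Hom A E G k) (cmp A E F G i j)"
 unfolding bilin_def lin_def assms(4)
 using assms hom_module[of E F] hom_module[of F G] hom_module[of E G]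
 by (intro conjI ballI amapI)
  (auto simp: cmp_closed cmp_add_left cmp_add_right cmp_smult_left cmp_smult_right module_def)

end

context
 fixes K :: "'k ring" and P :: "('k, 'o, 'm) dgcat" and B :: "('k, 'b) module"
 assumes P: "dg_category K P" and B: "algebra K B"
begin

interpretation P: dg_category K P by (rule P)

abbreviation (input) "PB \<equiv> dg_tensor K P B"

lemma dg_tensor_simps:
 "Ob PB = Ob P" "Hom PB E F i = tensor K (Hom P E F i) B"
 "k = i + j ==> cmp PB E F G i j = tensor_bilin K (Hom P E G k) B (cmp P E F G i j)"
 "j = i + 1 ==> dif PB E F i = tensor_lin K (Hom P E F j) B (dif P E F i)"
 "idn PB E = pure_tensor K (Hom P E E 0) B (idn P E) \<one>[B]"
 by (simp_all add: dg_tensor_def)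

private lemma tp: "E : Ob P ==> F : Ob P ==> tensor_pair K (Hom P E F i) B"
 by (intro tensor_pair.intro P.hom_module B)

private lemma amap_cmp_left: "[|E : Ob P; F : Ob P; G : Ob P; f : mor PB E F j; k = i + j|]
   ==> amap (Hom PB F G i) (Hom PB E G k) (%g. cmp PB E F G i j g f)"
 unfolding dg_tensor_simps(2)
 by (subst dg_tensor_simps(3), assumption, rule tensor_bilin_amap_left)
  (auto simp: P.hom_module B P.cmp_bilin)

private lemma amap_cmp_right: "[|E : Ob P; F : Ob P; G : Ob P; g : mor PB F G i; k = i + j|]
   ==> amap (Hom PB E F j) (Hom PB E G k) (cmp PB E F G i j g)"
 unfolding dg_tensor_simps(2)
 by (subst dg_tensor_simps(3), assumption, rule tensor_bilin_amap_right)
  (auto simp: P.hom_module B P.cmp_bilin)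

private lemma amap_dif: "[|E : Ob P; F : Ob P; j = i + 1|]
  ==> amap (Hom PB E F i) (Hom PB E F j) (dif PB E F i)"
 unfolding dg_tensor_simps(2)
 by (subst dg_tensor_simps(4), assumption, rule tensor_lin_amap)
  (auto simp: P.hom_module B P.dif_lin)

private lemma cmp_pure: "[|E : Ob P; F : Ob P; G : Ob P; g : mor P F G i; b : carrier B;
  f : mor P E F j; c : carrier B; k = i + j|] ==>
  cmp PB E F G i j (pure_tensor K (Hom P F G i) B g b) (pure_tensor K (Hom P E F j) B f c) =
  pure_tensor K (Hom P E G k) B (cmp P E F G i j g f) (b \<otimes>[B] c)"
 by (subst dg_tensor_simps(3), assumption, rule tensor_bilin_pure)
  (auto simp: P.hom_module B P.cmp_bilin)

private lemma dif_pure: "[|E : Ob P; F : Ob P; f : mor P E F i; b : carrier B; j = i + 1|] ==>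
  dif PB E F i (pure_tensor K (Hom P E F i) B f b) = pure_tensor K (Hom P E F j) B (dif P E F i f) b"
 by (subst dg_tensor_simps(4), assumption, rule tensor_lin_pure)
  (auto simp: P.hom_module B P.dif_lin)

private lemma pure_cl: "[|E : Ob P; F : Ob P; f : mor P E F i; b : carrier B|] ==>
  pure_tensor K (Hom P E F i) B f b : mor PB E F i"
 unfolding dg_tensor_simps(2) by (rule tensor_pair.pure_closed[OF tp])

private lemma ext: "[|E : Ob P; F : Ob P; X : mor PB E F i;
  amap (Hom PB E F i) G f; amap (Hom PB E F i) G g;
  !!v b. v : mor P E F i ==> b : carrier B ==>
   f (pure_tensor K (Hom P E F i) B v b) = g (pure_tensor K (Hom P E F i) B v b)|] ==> f X = g X"
 unfolding dg_tensor_simps(2) by (rule tensor_pair.tensor_ext[OF tp])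

private lemma P_cmp_closed: "[|E : Ob P; F : Ob P; G : Ob P; g : mor P F G i;
  f : mor P E F j; k = i + j|] ==> cmp P E F G i j g f : mor P E G k"
 using P.cmp_closed by blast

private lemma P_dif_closed: "[|E : Ob P; F : Ob P; f : mor P E F i; j = i + 1|] ==>
  dif P E F i f : mor P E F j"
 using P.dif_closed by blast

interpretation B: algebra K B by (rule B)

text \<open>Each axiom is additive in every morphism that occurs in it, so the morphisms are
  replaced by pure tensors one after the other. On pure tensors the axiom is that of
  \<open>P\<close>, together with an identity in \<open>B\<close> for the coefficients.\<close>

lemma dg_tensor_adg: "adg PB"
proof (intro adg.intro cdg.intro adg_axioms.intro)
 fix E F :: 'o and i j :: int assume EF: "E : Ob PB" "F : Ob PB"
 then have EF': "E : Ob P" "F : Ob P" by (simp_all add: dg_tensor_simps)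
 show "abelian_group (Hom PB E F i)"
  unfolding dg_tensor_simps(2) by (rule tensor_pair.T_group[OF tp[OF EF']])
 show "j = i + 1 ==> amap (Hom PB E F i) (Hom PB E F j) (dif PB E F i)"
  using amap_dif EF' by blast
 fix f assume f: "f : mor PB E F i"
 note id = P.idn_closed[OF EF'(1)] P.idn_closed[OF EF'(2)]
 note gr = tensor_pair.T_group[OF tp[OF EF'], folded dg_tensor_simps(2)]
 show "cmp PB E F F 0 i (idn PB F) f = f"
 proof (rule ext[OF EF' f amap_cmp_right[OF EF'(1,2,2)] amap_id[OF gr]])
  show "idn PB F : mor PB F F 0" unfolding dg_tensor_simps(5) using id EF' by (auto intro: pure_cl)
  fix v b assume vb: "v : mor P E F i" "b : carrier B"
  show "cmp PB E F F 0 i (idn PB F) (pure_tensor K (Hom P E F i) B v b) = pure_tensor K (Hom P E F i) B v b"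
   unfolding dg_tensor_simps(5)
   using cmp_pure[OF EF'(1,2,2) id(2) B.one_closed vb, of i] vb EF' P.idn_left by simp
 qed simp
 show "cmp PB E E F i 0 f (idn PB E) = f"
 proof (rule ext[OF EF' f amap_cmp_left[OF EF'(1,1,2)] amap_id[OF gr]])
  show "idn PB E : mor PB E E 0" unfolding dg_tensor_simps(5) using id EF' by (auto intro: pure_cl)
  fix v b assume vb: "v : mor P E F i" "b : carrier B"
  show "cmp PB E E F i 0 (pure_tensor K (Hom P E F i) B v b) (idn PB E) = pure_tensor K (Hom P E F i) B v b"
   unfolding dg_tensor_simps(5)
   using cmp_pure[OF EF'(1,1,2) vb id(1) B.one_closed, of i] vb EF' P.idn_right by simp
 qed simp
 fix k :: int assume jk: "j = i + 1" "k = i + 2"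
 have k: "k = j + 1" using jk by simp
 have gr': "abelian_group (Hom P E F k)" using P.hom_module[OF EF'] by (simp add: module_def)
 have zero: "amap (Hom PB E F i) (Hom PB E F k) (%f. \<zero>[Hom PB E F k])"
  using tensor_pair.T_group[OF tp[OF EF'], folded dg_tensor_simps(2)]
  by (intro amapI) (auto simp: abelian_groupE abelian_monoid.zero_closed abelian_group_def abelian_monoid.l_zero)
 show "dif PB E F j (dif PB E F i f) = \<zero>[Hom PB E F k]"
 proof (rule ext[OF EF' f amap_comp[OF amap_dif[OF EF' jk(1)] amap_dif[OF EF' k]] zero])
  fix v b assume vb: "v : mor P E F i" "b : carrier B"
  have "dif P E F j (dif P E F i v) = \<zero>[Hom P E F k]" using P.dif_dif[OF EF' vb(1)] jk by simp
  then show "dif PB E F j (dif PB E F i (pure_tensor K (Hom P E F i) B v b)) = \<zero>[Hom PB E F k]"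
   using dif_pure[OF EF' vb jk(1)] dif_pure[OF EF' P_dif_closed[OF EF' vb(1) jk(1)] vb(2) k]
    tensor_pair.pure_zero_left[OF tp[OF EF'] vb(2), of k]
   by (simp add: dg_tensor_simps(2))
 qed
next
 fix E F G :: 'o and f and i j k :: int
 assume *: "E : Ob PB" "F : Ob PB" "G : Ob PB" "f : mor PB E F j" "k = i + j"
 show "amap (Hom PB F G i) (Hom PB E G k) (%g. cmp PB E F G i j g f)"
  by (rule amap_cmp_left) (use * in \<open>simp_all add: dg_tensor_simps(1)\<close>)
next
 fix E F G :: 'o and g and i j k :: int
 assume *: "E : Ob PB" "F : Ob PB" "G : Ob PB" "g : mor PB F G i" "k = i + j"
 show "amap (Hom PB E F j) (Hom PB E G k) (cmp PB E F G i j g)"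
  by (rule amap_cmp_right) (use * in \<open>simp_all add: dg_tensor_simps(1)\<close>)
next
 fix E :: 'o assume "E : Ob PB"
 then show "idn PB E : mor PB E E 0"
  unfolding dg_tensor_simps(1,5) using P.idn_closed by (auto intro: pure_cl)
next
 fix E F G H :: 'o and h g f and l i j p q :: int
 assume "E : Ob PB" "F : Ob PB" "G : Ob PB" "H : Ob PB" and h: "h : mor PB G H l"
  and g: "g : mor PB F G i" and f: "f : mor PB E F j"
  and p: "p = l + i" and q: "q = i + j"
 then have o: "E : Ob P" "F : Ob P" "G : Ob P" "H : Ob P" by (simp_all add: dg_tensor_simps(1))
 define r where "r = l + i + j"
 have r: "r = p + j" "r = l + q" using p q by (simp_all add: r_def)
 note gf = amap_closed[OF amap_cmp_left[OF o(1,2,3) f q] g]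
 show "cmp PB E F H p j (cmp PB F G H l i h g) f = cmp PB E G H l q h (cmp PB E F G i j g f)"
 proof (rule ext[OF o(3,4) h amap_comp[OF amap_cmp_left[OF o(2,3,4) g p] amap_cmp_left[OF o(1,2,4) f r(1)]]
    amap_cmp_left[OF o(1,3,4) gf r(2)]])
  fix h b assume h: "h : mor P G H l" "b : carrier B"
  note h' = pure_cl[OF o(3,4) h]
  let ?h = "pure_tensor K (Hom P G H l) B h b"
  show "cmp PB E F H p j (cmp PB F G H l i ?h g) f = cmp PB E G H l q ?h (cmp PB E F G i j g f)"
  proof (rule ext[OF o(2,3) g amap_comp[OF amap_cmp_right[OF o(2,3,4) h' p] amap_cmp_left[OF o(1,2,4) f r(1)]]
    amap_comp[OF amap_cmp_left[OF o(1,2,3) f q] amap_cmp_right[OF o(1,3,4) h' r(2)]]])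
   fix g c assume g: "g : mor P F G i" "c : carrier B"
   note g' = pure_cl[OF o(2,3) g]
   let ?g = "pure_tensor K (Hom P F G i) B g c"
   note hg' = amap_closed[OF amap_cmp_right[OF o(2,3,4) h' p] g']
   show "cmp PB E F H p j (cmp PB F G H l i ?h ?g) f = cmp PB E G H l q ?h (cmp PB E F G i j ?g f)"
   proof (rule ext[OF o(1,2) f amap_cmp_right[OF o(1,2,4) hg' r(1)]
     amap_comp[OF amap_cmp_right[OF o(1,2,3) g' q] amap_cmp_right[OF o(1,3,4) h' r(2)]]])
    fix f d assume f: "f : mor P E F j" "d : carrier B"
    have "cmp P E F H p j (cmp P F G H l i h g) f = cmp P E G H l q h (cmp P E F G i j g f)"
     unfolding p q using P.cmp_assoc[OF o h(1) g(1) f(1)] .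
    then show "cmp PB E F H p j (cmp PB F G H l i ?h ?g) (pure_tensor K (Hom P E F j) B f d) =
      cmp PB E G H l q ?h (cmp PB E F G i j ?g (pure_tensor K (Hom P E F j) B f d))"
     using h g f cmp_pure[OF o(2,3,4) h g p] cmp_pure[OF o(1,2,3) g f q]
      cmp_pure[OF o(1,2,4) P_cmp_closed[OF o(2,3,4) h(1) g(1) p] B.m_closed[OF h(2) g(2)] f r(1)]
      cmp_pure[OF o(1,3,4) h P_cmp_closed[OF o(1,2,3) g(1) f(1) q] B.m_closed[OF g(2) f(2)] r(2)]
     by (simp add: B.m_assoc)
   qed
  qed
 qed
next
 fix E F G :: 'o and g f and i j k k' i' j' :: int
 assume "E : Ob PB" "F : Ob PB" "G : Ob PB"
  and g: "g : mor PB F G i" and f: "f : mor PB E F j"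
  and k: "k = i + j" and k': "k' = k + 1" and i': "i' = i + 1" and j': "j' = j + 1"
 then have o: "E : Ob P" "F : Ob P" "G : Ob P" by (simp_all add: dg_tensor_simps(1))
 have k1: "k' = i' + j" "k' = i + j'" using k k' i' j' by simp_all
 note gr = tensor_pair.T_group[OF tp[OF o(1,3)], folded dg_tensor_simps(2)]
 note sg = sgn_act_amap[OF gr, of k' i]
 note df = amap_closed[OF amap_dif[OF o(1,2) j'] f]
 show "dif PB E G k (cmp PB E F G i j g f) = cmp PB E F G i' j (dif PB F G i g) f \<oplus>[Hom PB E G k']
     sgn_act (Hom PB E G k') i (cmp PB E F G i j' g (dif PB E F j f))"
 proof (rule ext[OF o(2,3) g amap_comp[OF amap_cmp_left[OF o f k] amap_dif[OF o(1,3) k']]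
    amap_sum[OF amap_comp[OF amap_dif[OF o(2,3) i'] amap_cmp_left[OF o f k1(1)]]
     amap_comp[OF amap_cmp_left[OF o df k1(2)] sg]]])
  fix g b assume g: "g : mor P F G i" "b : carrier B"
  note g' = pure_cl[OF o(2,3) g]
  let ?g = "pure_tensor K (Hom P F G i) B g b"
  note dg' = amap_closed[OF amap_dif[OF o(2,3) i'] g']
  show "dif PB E G k (cmp PB E F G i j ?g f) = cmp PB E F G i' j (dif PB F G i ?g) f \<oplus>[Hom PB E G k']
     sgn_act (Hom PB E G k') i (cmp PB E F G i j' ?g (dif PB E F j f))"
  proof (rule ext[OF o(1,2) f amap_comp[OF amap_cmp_right[OF o g' k] amap_dif[OF o(1,3) k']]
    amap_sum[OF amap_cmp_right[OF o dg' k1(1)]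
     amap_comp[OF amap_comp[OF amap_dif[OF o(1,2) j'] amap_cmp_right[OF o g' k1(2)]] sg]]])
   fix f c assume f: "f : mor P E F j" "c : carrier B"
   let ?f = "pure_tensor K (Hom P E F j) B f c"
   let ?p = "%x. pure_tensor K (Hom P E G k') B x (b \<otimes>[B] c)"
   have bc: "b \<otimes>[B] c : carrier B" using g f by simp
   have pa: "amap (Hom P E G k') (Hom PB E G k') ?p"
    unfolding dg_tensor_simps(2) by (rule tensor_pair.pure_amap_left[OF tp[OF o(1,3)] bc])
   note dg = P_dif_closed[OF o(2,3) g(1) i'] and df = P_dif_closed[OF o(1,2) f(1) j']
   note c1 = P_cmp_closed[OF o dg f(1) k1(1)] and c2 = P_cmp_closed[OF o g(1) df k1(2)]
   have gk: "abelian_group (Hom P E G k')" using P.hom_module[OF o(1,3)] by (simp add: module_def)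
   have "dif P E G k (cmp P E F G i j g f) = cmp P E F G i' j (dif P F G i g) f \<oplus>[Hom P E G k']
     sgn_act (Hom P E G k') i (cmp P E F G i j' g (dif P E F j f))"
    unfolding k k' i' j' by (rule P.leibniz[OF o g(1) f(1)])
   then have "?p (dif P E G k (cmp P E F G i j g f)) = ?p (cmp P E F G i' j (dif P F G i g) f) \<oplus>[Hom PB E G k']
     sgn_act (Hom PB E G k') i (?p (cmp P E F G i j' g (dif P E F j f)))"
    using amap_add[OF pa c1 sgn_act_closed[OF gk c2]] amap_sgn_act[OF pa c2] by simp
   then show "dif PB E G k (cmp PB E F G i j ?g ?f) = cmp PB E F G i' j (dif PB F G i ?g) ?f \<oplus>[Hom PB E G k']
     sgn_act (Hom PB E G k') i (cmp PB E F G i j' ?g (dif PB E F j ?f))"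
    using cmp_pure[OF o g f k] dif_pure[OF o(1,3) P_cmp_closed[OF o g(1) f(1) k] bc k']
     dif_pure[OF o(2,3) g i'] dif_pure[OF o(1,2) f j']
     cmp_pure[OF o dg g(2) f k1(1)] cmp_pure[OF o g df f(2) k1(2)]
    by simp
  qed
 qed
qed

end

subsection \<open>Twisted differentials\<close>

text \<open>The sign bookkeeping of the twisted Leibniz rule, with letters for the composites: in
  \<open>pMC_cdg\<close> they are a = (dg)f, b = \<xi>gf, c = g\<zeta>f, e = g(df) and h = gf\<eta>.
  The two terms through the middle object, both equal to c, cancel.\<close>

lemma twist_leibniz:
 fixes G :: "('k, 'a) module" (structure)
 assumes "abelian_group G"
  and "a : carrier G" "b : carrier G" "c : carrier G" "e : carrier G" "h : carrier G"
 shows "(a \<oplus> sgn_act G i e) \<oplus> b \<ominus> sgn_act G (i + j) h =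
  (a \<oplus> b \<ominus> sgn_act G i c) \<oplus> sgn_act G i (e \<oplus> c \<ominus> sgn_act G j h)"
proof -
 interpret abelian_group G by fact
 show ?thesis
  using assms(2-) by (cases "even i"; cases "even j"; simp add: sgn_act_def; algebra)
qed

text \<open>The same for the square of the twisted differential, with p = \<zeta>(df), q =
  (d\<zeta>)f, r = (df)\<eta>, t = f(d\<eta>), u = \<zeta>\<zeta>f, v = \<zeta>f\<eta> and w =
  f\<eta>\<eta>. The mixed terms p, r and v cancel, and the two curvatures remain.\<close>

lemma twist_curvature:
 fixes G :: "('k, 'a) module" (structure)
 assumes "abelian_group G"
  and "p : carrier G" "q : carrier G" "r : carrier G" "t : carrier G" "u : carrier G"
  "v : carrier G" "w : carrier G"
 shows "((q \<oplus> \<ominus> p) \<ominus> sgn_act G i (r \<oplus> sgn_act G i t)) \<oplus> (p \<oplus> u \<ominus> sgn_act G i v)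
   \<ominus> sgn_act G (i + 1) (r \<oplus> v \<ominus> sgn_act G i w) = (q \<oplus> u) \<ominus> (t \<oplus> w)"
proof -
 interpret abelian_group G by fact
 show ?thesis
  using assms(2-) by (cases "even i"; simp add: sgn_act_def; algebra)
qed

text \<open>The Maurer-Cartan equation is dropped, and \<open>curv\<close> measures its failure: a
  lift of a Maurer-Cartan element along a surjection is in general only an object of this category.
  Written as an update of \<open>MC\<close>, it shares homs, differential and composition with
  it.\<close>

definition pMC :: "('k, 'o, 'm) dgcat => ('k, 'o \<times> 'm, 'm) dgcat" where
 "pMC Q = (MC Q)\<lparr>Ob := {(E, \<eta>). E : Ob Q & \<eta> : mor Q E E 1}\<rparr>"

definition curv :: "('k, 'o, 'm) dgcat => 'o \<times> 'm => 'm" where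
 "curv Q = (%(E, \<eta>). dif Q E E 1 \<eta> \<oplus>[Hom Q E E 2] cmp Q E E E 1 1 \<eta> \<eta>)"

lemma pMC_Ob: "X : Ob (pMC Q) \<longleftrightarrow> fst X : Ob Q & snd X : mor Q (fst X) (fst X) 1"
 by (auto simp: pMC_def)

lemma MC_Ob: "X : Ob (MC Q) \<longleftrightarrow> X : Ob (pMC Q) & curv Q X = \<zero>[Hom Q (fst X) (fst X) 2]"
 by (auto simp: pMC_def MC_def curv_def)

lemma pMC_MC: "Hom (pMC Q) = Hom (MC Q)" "dif (pMC Q) = dif (MC Q)" "cmp (pMC Q) = cmp (MC Q)"
  "idn (pMC Q) = idn (MC Q)"
 by (simp_all add: pMC_def)

lemma MC_simps:
 "Hom (MC Q) X Y i = Hom Q (fst X) (fst Y) i"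
 "cmp (MC Q) X Y Z = cmp Q (fst X) (fst Y) (fst Z)"
 "idn (MC Q) X = idn Q (fst X)"
 "j = i + 1 ==> dif (MC Q) X Y i f =
  (dif Q (fst X) (fst Y) i f \<oplus>[Hom Q (fst X) (fst Y) j] cmp Q (fst X) (fst Y) (fst Y) 1 i (snd Y) f)
  \<ominus>[Hom Q (fst X) (fst Y) j] sgn_act (Hom Q (fst X) (fst Y) j) i (cmp Q (fst X) (fst X) (fst Y) i 1 f (snd X))"
 by (cases X; cases Y; cases Z; simp add: MC_def)+

lemmas pMC_simps = MC_simps[folded pMC_MC]

lemma (in cdg) curv_closed: "X : Ob (pMC A) ==> curv A X : mor A (fst X) (fst X) 2"
 unfolding curv_def pMC_Ob
 using hom_group[of "fst X" "fst X" 2]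
 by (auto simp: split_beta intro!: abelian_groupE(1) dif_closed cmp_closed)

lemma (in cdg) pMC_cdg: "cdg (pMC A)"
proof (intro cdg.intro)
 fix X Y and i j :: int assume XY: "X : Ob (pMC A)" "Y : Ob (pMC A)"
 then have o: "fst X : Ob A" "fst Y : Ob A" and e: "snd X : mor A (fst X) (fst X) 1"
  "snd Y : mor A (fst Y) (fst Y) 1" by (simp_all add: pMC_Ob)
 show "abelian_group (Hom (pMC A) X Y i)" unfolding pMC_simps using hom_group o .
 show "amap (Hom (pMC A) X Y i) (Hom (pMC A) X Y j) (dif (pMC A) X Y i)" if j: "j = i + 1"
 proof -
  have j1: "j = 1 + i" using j by simp
  note h = hom_group[OF o, of j]
  note a1 = amap_sum[OF dif_amap[OF o j] cmp_amap_right[OF o(1,2,2) e(2) j1]]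
  note a2 = amap_comp[OF cmp_amap_left[OF o(1,1,2) e(1) j] amap_minusI[OF h sgn_act_amap[OF h, of i]]]
  let ?M = "Hom A (fst X) (fst Y) j"
  have "(%f. (dif A (fst X) (fst Y) i f \<oplus>[?M] cmp A (fst X) (fst Y) (fst Y) 1 i (snd Y) f) \<oplus>[?M]
    \<ominus>[?M] sgn_act ?M i (cmp A (fst X) (fst X) (fst Y) i 1 f (snd X))) = dif (pMC A) X Y i"
   by (rule ext) (simp add: pMC_simps(4)[OF j] a_minus_def)
  then show ?thesis using amap_sum[OF a1 a2] unfolding pMC_simps by simp
 qed
 fix f assume f: "f : mor (pMC A) X Y i"
 show "cmp (pMC A) X Y Y 0 i (idn (pMC A) Y) f = f"
  using idn_left[OF o] f by (simp add: pMC_simps)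
 show "cmp (pMC A) X X Y i 0 f (idn (pMC A) X) = f"
  using idn_right[OF o] f by (simp add: pMC_simps)
next
 fix X Y Z f g and i j k k' i' j' :: int
 assume "X : Ob (pMC A)" "Y : Ob (pMC A)" "Z : Ob (pMC A)"
  and "g : mor (pMC A) Y Z i" "f : mor (pMC A) X Y j"
  and k: "k = i + j" "k' = k + 1" "i' = i + 1" "j' = j + 1"
 then have o: "fst X : Ob A" "fst Y : Ob A" "fst Z : Ob A"
  and e: "snd X : mor A (fst X) (fst X) 1" "snd Y : mor A (fst Y) (fst Y) 1"
  "snd Z : mor A (fst Z) (fst Z) 1"
  and g: "g : mor A (fst Y) (fst Z) i" and f: "f : mor A (fst X) (fst Y) j"
  by (simp_all add: pMC_Ob pMC_simps)
 obtain E \<eta> F \<zeta> G \<xi> where X: "X = (E, \<eta>)" "Y = (F, \<zeta>)" "Z = (G, \<xi>)" by (cases X, cases Y, cases Z)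
 note o = o[unfolded X fst_conv snd_conv] and e = e[unfolded X fst_conv snd_conv]
  and f = f[unfolded X fst_conv snd_conv] and g = g[unfolded X fst_conv snd_conv]
 note M = hom_group[OF o(1,3), of k']
 have k1: "k' = i' + j" "k' = i + j'" "k' = 1 + k" using k by simp_all
 have k2: "k' = (i + 1) + j" "i + 1 = i + 1" "j + 1 = 1 + j" "k' = i + (1 + j)" "k' = 1 + (i + j)"
  "k' = (i + j) + 1" "i + 1 = 1 + i" "j' = 1 + j" "i' = 1 + i" using k by simp_all
 let ?M = "Hom A E G k'"
 have dg: "dif A F G i g : mor A F G i'" and df: "dif A E F j f : mor A E F j'"
  using dif_closed o f g k by auto
 have gf: "cmp A E F G i j g f : mor A E G k" using cmp_closed o f g k by blast
 have xg: "cmp A F G G 1 i \<xi> g : mor A F G i'" using cmp_closed[OF o(2,3,3) e(3) g k2(9)] .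
 have gz: "cmp A F F G i 1 g \<zeta> : mor A F G i'" using cmp_closed[OF o(2,2,3) g e(2) k(3)] .
 have zf: "cmp A E F F 1 j \<zeta> f : mor A E F j'" using cmp_closed[OF o(1,2,2) e(2) f k2(8)] .
 have fe: "cmp A E E F j 1 f \<eta> : mor A E F j'" using cmp_closed[OF o(1,1,2) f e(1) k(4)] .
 let ?a = "cmp A E F G i' j (dif A F G i g) f" and ?b = "cmp A E G G 1 k \<xi> (cmp A E F G i j g f)"
  and ?c = "cmp A E F G i j' g (cmp A E F F 1 j \<zeta> f)" and ?e = "cmp A E F G i j' g (dif A E F j f)"
  and ?h = "cmp A E F G i j' g (cmp A E E F j 1 f \<eta>)"
 have cl: "?a : carrier ?M" "?b : carrier ?M" "?c : carrier ?M" "?e : carrier ?M" "?h : carrier ?M"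
  using cmp_closed[OF o dg f k1(1)] cmp_closed[OF o(1,3,3) e(3) gf k1(3)]
   cmp_closed[OF o g zf k1(2)] cmp_closed[OF o g df k1(2)] cmp_closed[OF o g fe k1(2)] by auto
 have L: "dif (pMC A) X Z k (cmp (pMC A) X Y Z i j g f) =
  (?a \<oplus>[?M] sgn_act ?M i ?e) \<oplus>[?M] ?b \<ominus>[?M] sgn_act ?M (i + j) ?h"
  using leibniz[OF o g f k] cmp_assoc[OF o(1,1,2,3) g f e(1) k(1) k(4)]
  by (simp add: pMC_simps(1-3) pMC_simps(4)[OF k(2)] X k(1)[symmetric])
 note al = cmp_amap_left[OF o f k1(1)] and ar = cmp_amap_right[OF o g k1(2)]
 have gr: "abelian_group (Hom A F G i')" "abelian_group (Hom A E F j')" using hom_group o by auto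
 have 1: "cmp A E F G i' j (dif (pMC A) Y Z i g) f = ?a \<oplus>[?M] ?b \<ominus>[?M] sgn_act ?M i ?c"
  using amap_minus[OF al] amap_add[OF al dg xg] amap_sgn_act[OF al gz] abelian_groupE(1)[OF gr(1) dg xg]
   sgn_act_closed[OF gr(1) gz] cmp_assoc[OF o(1,2,3,3) e(3) g f k2(9) k(1)]
   cmp_assoc[OF o(1,2,2,3) g e(2) f k(3) k2(8)]
  by (simp add: pMC_simps(4)[OF k(3)] X)
 have 2: "cmp A E F G i j' g (dif (pMC A) X Y j f) = ?e \<oplus>[?M] ?c \<ominus>[?M] sgn_act ?M j ?h"
  using amap_minus[OF ar] amap_add[OF ar df zf] amap_sgn_act[OF ar fe] abelian_groupE(1)[OF gr(2) df zf]
   sgn_act_closed[OF gr(2) fe]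
  by (simp add: pMC_simps(4)[OF k(4)] X)
 show "dif (pMC A) X Z k (cmp (pMC A) X Y Z i j g f) =
  cmp (pMC A) X Y Z i' j (dif (pMC A) Y Z i g) f \<oplus>[Hom (pMC A) X Z k']
  sgn_act (Hom (pMC A) X Z k') i (cmp (pMC A) X Y Z i j' g (dif (pMC A) X Y j f))"
  unfolding L twist_leibniz[OF M cl]
  using 1 2 by (simp add: pMC_simps X)
next
 fix X Y Z W h g f and l i j p q :: int
 assume "X : Ob (pMC A)" "Y : Ob (pMC A)" "Z : Ob (pMC A)" "W : Ob (pMC A)"
  "h : mor (pMC A) Z W l" "g : mor (pMC A) Y Z i" "f : mor (pMC A) X Y j"
  "p = l + i" "q = i + j"
 then show "cmp (pMC A) X Y W p j (cmp (pMC A) Y Z W l i h g) f = cmp (pMC A) X Z W l q h (cmp (pMC A) X Y Z i j g f)"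
  unfolding pMC_simps pMC_Ob by (intro cmp_assoc) auto
qed (auto simp: pMC_simps pMC_Ob idn_closed cmp_amap_left cmp_amap_right)

text \<open>In \<open>lift_target\<close> this relates the differential of the failure of closedness
  to the curvature, which is the cocycle condition needed there.\<close>

lemma (in adg) pMC_dif_dif:
 assumes X: "X : Ob (pMC A)" and Y: "Y : Ob (pMC A)" and f: "f : mor (pMC A) X Y i"
  and j: "j = i + 1" and k: "k = i + 2"
 shows "dif (pMC A) X Y j (dif (pMC A) X Y i f) =
  cmp (pMC A) X Y Y 2 i (curv A Y) f \<ominus>[Hom (pMC A) X Y k] cmp (pMC A) X X Y i 2 f (curv A X)"
proof -
 obtain E \<eta> F \<zeta> where XY: "X = (E, \<eta>)" "Y = (F, \<zeta>)" by (cases X, cases Y)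
 have o: "E : Ob A" "F : Ob A" and e: "\<eta> : mor A E E 1" "\<zeta> : mor A F F 1"
  and f: "f : mor A E F i" using X Y f by (simp_all add: pMC_Ob pMC_simps XY)
 let ?M = "Hom A E F k" and ?N = "Hom A E F j"
 note M = hom_group[OF o, of k] and N = hom_group[OF o, of j]
 have k1: "k = j + 1" "k = 1 + j" "j = 1 + i" "k = 2 + i" "2 = (1::int) + 1" using j k by simp_all
 have df: "dif A E F i f : carrier ?N" and zf: "cmp A E F F 1 i \<zeta> f : carrier ?N"
  and fe: "cmp A E E F i 1 f \<eta> : carrier ?N"
  using dif_closed[OF o f j] cmp_closed[OF o(1,2,2) e(2) f k1(3)] cmp_closed[OF o(1,1,2) f e(1) j] by auto
 have dz: "dif A F F 1 \<zeta> : mor A F F 2" and de: "dif A E E 1 \<eta> : mor A E E 2"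
  and zz: "cmp A F F F 1 1 \<zeta> \<zeta> : mor A F F 2"
  and ee: "cmp A E E E 1 1 \<eta> \<eta> : mor A E E 2"
  using dif_closed[OF o(2,2) e(2), of 2] dif_closed[OF o(1,1) e(1), of 2]
   cmp_closed[OF o(2,2,2) e(2,2), of 2] cmp_closed[OF o(1,1,1) e(1,1), of 2] by simp_all
 let ?p = "cmp A E F F 1 j \<zeta> (dif A E F i f)" and ?q = "cmp A E F F 2 i (dif A F F 1 \<zeta>) f"
  and ?r = "cmp A E E F j 1 (dif A E F i f) \<eta>" and ?t = "cmp A E E F i 2 f (dif A E E 1 \<eta>)"
  and ?u = "cmp A E F F 1 j \<zeta> (cmp A E F F 1 i \<zeta> f)" and ?v = "cmp A E F F 1 j \<zeta> (cmp A E E F i 1 f \<eta>)"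
  and ?w = "cmp A E E F i 2 f (cmp A E E E 1 1 \<eta> \<eta>)"
 have cl: "?p : carrier ?M" "?q : carrier ?M" "?r : carrier ?M" "?t : carrier ?M" "?u : carrier ?M"
   "?v : carrier ?M" "?w : carrier ?M"
  using cmp_closed[OF o(1,2,2) e(2) df k1(2)] cmp_closed[OF o(1,2,2) dz f k1(4)]
   cmp_closed[OF o(1,1,2) df e(1) k1(1)] cmp_closed[OF o(1,1,2) f de k] cmp_closed[OF o(1,2,2) e(2) zf k1(2)]
   cmp_closed[OF o(1,2,2) e(2) fe k1(2)] cmp_closed[OF o(1,1,2) f ee k] by auto
 note zfa = cmp_assoc[OF o(1,2,2,2) e(2) e(2) f k1(5) k1(3)]
  and vfa = cmp_assoc[OF o(1,1,2,2) e(2) f e(1) k1(3) j]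
  and wfa = cmp_assoc[OF o(1,1,1,2) f e(1) e(1) j k1(5)]
 let ?D = "dif (pMC A) X Y i f"
 have D: "?D = dif A E F i f \<oplus>[?N] cmp A E F F 1 i \<zeta> f \<ominus>[?N] sgn_act ?N i (cmp A E E F i 1 f \<eta>)"
  by (simp add: pMC_simps(4)[OF j] XY)
 note s = abelian_groupE(1)[OF N df zf] sgn_act_closed[OF N fe]
 have am: "T ?D = T (dif A E F i f) \<oplus>[?M] T (cmp A E F F 1 i \<zeta> f) \<ominus>[?M] sgn_act ?M i (T (cmp A E E F i 1 f \<eta>))"
  if "amap ?N ?M T" for T
  unfolding D using amap_minus[OF that s] amap_add[OF that df zf] amap_sgn_act[OF that fe] by simp
 interpret M: abelian_group ?M by (rule M)
 have 1: "dif A E F j ?D = (?q \<oplus>[?M] \<ominus>[?M] ?p) \<ominus>[?M] sgn_act ?M i (?r \<oplus>[?M] sgn_act ?M i ?t)"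
  using am[OF dif_amap[OF o k1(1)]] dif_dif[OF o f j k] leibniz[OF o(1,2,2) e(2) f k1(3) k1(1) _ j, of 2]
   leibniz[OF o(1,1,2) f e(1) j k1(1) j, of 2] cl
  by (simp add: sgn_act_odd)
 have 2: "cmp A E F F 1 j \<zeta> ?D = ?p \<oplus>[?M] ?u \<ominus>[?M] sgn_act ?M i ?v"
  using am[OF cmp_amap_right[OF o(1,2,2) e(2) k1(2)]] by simp
 have 3: "cmp A E E F j 1 ?D \<eta> = ?r \<oplus>[?M] ?v \<ominus>[?M] sgn_act ?M i ?w"
  using am[OF cmp_amap_left[OF o(1,1,2) e(1) k1(1)]] vfa wfa by simp
 have "dif (pMC A) X Y j ?D = (?q \<oplus>[?M] ?u) \<ominus>[?M] (?t \<oplus>[?M] ?w)"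
  unfolding pMC_simps(4)[OF k1(1)] XY fst_conv snd_conv 1[unfolded XY] 2[unfolded XY] 3[unfolded XY]
  unfolding j by (rule twist_curvature[OF M cl[unfolded j]])
 also have "?q \<oplus>[?M] ?u = cmp A E F F 2 i (curv A Y) f"
  using amap_add[OF cmp_amap_left[OF o(1,2,2) f k1(4)] dz zz] zfa by (simp add: curv_def XY)
 also have "?t \<oplus>[?M] ?w = cmp A E E F i 2 f (curv A X)"
  using amap_add[OF cmp_amap_right[OF o(1,1,2) f k] de ee] by (simp add: curv_def XY)
 finally show ?thesis by (simp add: pMC_simps XY)
qed

lemma (in cdg) cdg_restrict: "W \<subseteq> Ob A ==> cdg (A\<lparr>Ob := W\<rparr>)"
 by (intro cdg.intro; simp; (rule hom_group dif_amap cmp_amap_left cmp_amap_right cmp_assoc idn_closed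
    idn_left idn_right leibniz; auto))

text \<open>Maurer-Cartan objects form a full subcategory of \<open>pMC\<close> on which both
  curvature terms in the square of the differential vanish.\<close>

lemma (in adg) MC_adg: "adg (MC A)"
proof -
 have *: "MC A = (pMC A)\<lparr>Ob := Ob (MC A)\<rparr>" by (simp add: pMC_def)
 have "cdg ((pMC A)\<lparr>Ob := Ob (MC A)\<rparr>)"
  by (rule cdg.cdg_restrict[OF pMC_cdg]) (auto simp: MC_Ob)
 then have c: "cdg (MC A)" by (subst *)
 then interpret MC: cdg "MC A" .
 show ?thesis
 proof (intro adg.intro adg_axioms.intro c)
  fix X Y f and i j k :: int
  assume X: "X : Ob (MC A)" and Y: "Y : Ob (MC A)" and f: "f : mor (MC A) X Y i"
   and j: "j = i + 1" and k: "k = i + 2"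
  have XY: "X : Ob (pMC A)" "Y : Ob (pMC A)" "curv A X = \<zero>[Hom (MC A) X X 2]" "curv A Y = \<zero>[Hom (MC A) Y Y 2]"
   using X Y by (auto simp: MC_Ob MC_simps)
  have k': "k = 2 + i" using k by simp
  interpret M: abelian_group "Hom (MC A) X Y k" by (rule MC.hom_group[OF X Y])
  have "cmp (MC A) X Y Y 2 i (curv A Y) f = \<zero>[Hom (MC A) X Y k]"
   unfolding XY using amap_zero[OF MC.cmp_amap_left[OF X Y Y f k']] .
  moreover have "cmp (MC A) X X Y i 2 f (curv A X) = \<zero>[Hom (MC A) X Y k]"
   unfolding XY using amap_zero[OF MC.cmp_amap_right[OF X X Y f k]] .
  ultimately show "dif (MC A) X Y j (dif (MC A) X Y i f) = \<zero>[Hom (MC A) X Y k]"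
   using pMC_dif_dif[OF XY(1,2) _ j k, of f] f by (simp add: pMC_MC M.minus_self)
 qed
qed

subsection \<open>Functors\<close>

text \<open>Base change leads from a category over \<open>B\<close> to one over \<open>C\<close>, so
  compatibility is asked for sums, differential and composition but not for scalars.\<close>

locale dgfun = A: cdg A + B: cdg B
 for A :: "('k, 'o, 'm) dgcat" and B :: "('l, 'p, 'n) dgcat" +
 fixes Fo :: "'o => 'p" and Fm :: "'o => 'o => int => 'm => 'n"
 assumes Fo_Ob: "E : Ob A ==> Fo E : Ob B"
  and Fm_amap: "[|E : Ob A; F : Ob A|] ==> amap (Hom A E F i) (Hom B (Fo E) (Fo F) i) (Fm E F i)"
  and Fm_dif: "[|E : Ob A; F : Ob A; f : mor A E F i; j = i + 1|] ==>
   Fm E F j (dif A E F i f) = dif B (Fo E) (Fo F) i (Fm E F i f)"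
  and Fm_cmp: "[|E : Ob A; F : Ob A; G : Ob A; g : mor A F G i;
    f : mor A E F j; k = i + j|] ==>
   Fm E G k (cmp A E F G i j g f) = cmp B (Fo E) (Fo F) (Fo G) i j (Fm F G i g) (Fm E F j f)"
  and Fm_idn: "E : Ob A ==> Fm E E 0 (idn A E) = idn B (Fo E)"
begin

lemma Fm_closed: "[|E : Ob A; F : Ob A; f : mor A E F i|] ==> Fm E F i f : mor B (Fo E) (Fo F) i"
 using amap_closed[OF Fm_amap] .

lemma Fm_curv:
 assumes X: "X : Ob (pMC A)"
 shows "curv B (Fo (fst X), Fm (fst X) (fst X) 1 (snd X)) = Fm (fst X) (fst X) 2 (curv A X)"
proof -
 have o: "fst X : Ob A" and e: "snd X : mor A (fst X) (fst X) 1" using X by (simp_all add: pMC_Ob)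
 have 2: "2 = (1::int) + 1" by simp
 show ?thesis
  using amap_add[OF Fm_amap[OF o o] A.dif_closed[OF o o e 2] A.cmp_closed[OF o o o e e 2]]
   Fm_dif[OF o o e 2] Fm_cmp[OF o o o e e 2] by (simp add: curv_def split_beta)
qed

lemma pMC_dgfun: "dgfun (pMC A) (pMC B) (%X. (Fo (fst X), Fm (fst X) (fst X) 1 (snd X))) (%X Y. Fm (fst X) (fst Y))"
proof (intro dgfun.intro dgfun_axioms.intro A.pMC_cdg B.pMC_cdg)
 fix X Y f and i j :: int
 assume "X : Ob (pMC A)" "Y : Ob (pMC A)" "f : mor (pMC A) X Y i" and j: "j = i + 1"
 then have o: "fst X : Ob A" "fst Y : Ob A" and e: "snd X : mor A (fst X) (fst X) 1"
  "snd Y : mor A (fst Y) (fst Y) 1" and f: "f : mor A (fst X) (fst Y) i"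
  by (simp_all add: pMC_Ob pMC_simps)
 have j': "j = 1 + i" using j by simp
 note df = A.dif_closed[OF o f j] and yf = A.cmp_closed[OF o(1,2,2) e(2) f j']
  and fx = A.cmp_closed[OF o(1,1,2) f e(1) j] and am = Fm_amap[OF o] and gr = A.hom_group[OF o]
 show "Fm (fst X) (fst Y) j (dif (pMC A) X Y i f) =
  dif (pMC B) (Fo (fst X), Fm (fst X) (fst X) 1 (snd X)) (Fo (fst Y), Fm (fst Y) (fst Y) 1 (snd Y)) i
   (Fm (fst X) (fst Y) i f)"
  unfolding pMC_simps(4)[OF j] fst_conv snd_conv
  using amap_minus[OF am abelian_groupE(1)[OF gr df yf] sgn_act_closed[OF gr fx]] amap_add[OF am df yf]
   amap_sgn_act[OF am fx] Fm_dif[OF o f j] Fm_cmp[OF o(1,2,2) e(2) f j'] Fm_cmp[OF o(1,1,2) f e(1) j]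
  by simp
qed (auto simp: pMC_Ob pMC_simps Fo_Ob Fm_closed Fm_amap Fm_cmp Fm_idn)

end

lemma MC_dgfun:
 assumes A: "adg A" and B: "adg B" and F: "dgfun A B Fo Fm"
 shows "dgfun (MC A) (MC B) (%X. (Fo (fst X), Fm (fst X) (fst X) 1 (snd X))) (%X Y. Fm (fst X) (fst Y))"
proof -
 interpret F: dgfun A B Fo Fm by (rule F)
 interpret pF: dgfun "pMC A" "pMC B" "%X. (Fo (fst X), Fm (fst X) (fst X) 1 (snd X))" "%X Y. Fm (fst X) (fst Y)"
  by (rule F.pMC_dgfun)
 have ob: "X : Ob (pMC A)" if "X : Ob (MC A)" for X using that by (simp add: MC_Ob)
 show ?thesis
 proof (intro dgfun.intro dgfun_axioms.intro adg.axioms(1)[OF adg.MC_adg] A B)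
  fix X assume X: "X : Ob (MC A)"
  then show "(Fo (fst X), Fm (fst X) (fst X) 1 (snd X)) : Ob (MC B)"
   using pF.Fo_Ob[OF ob[OF X]] F.Fm_curv[OF ob[OF X]] amap_zero[OF F.Fm_amap[of "fst X" "fst X" 2]]
   by (simp add: MC_Ob pMC_Ob)
 qed (use pF.Fm_amap pF.Fm_dif pF.Fm_cmp pF.Fm_idn ob in \<open>auto simp: pMC_MC\<close>)
qed

lemma dg_tensor_dgfun:
 assumes P: "dg_category K P" and B: "algebra K B" and C: "algebra K C" and \<phi>: "\<phi> : alg_hom K B C"
 shows "dgfun (dg_tensor K P B) (dg_tensor K P C) (%E. E) (%E F i. hbase K P E F i B C \<phi>)"
proof (intro dgfun.intro dgfun_axioms.intro adg.axioms(1)[OF dg_tensor_adg] P B C)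
 interpret P: dg_category K P by (rule P)
 note s = dg_tensor_simps[OF P B] dg_tensor_simps[OF P C]
 fix E assume "E : Ob (dg_tensor K P B)"
 then have E: "E : Ob P" by (simp add: s)
 then show "E : Ob (dg_tensor K P C)" by (simp add: s)
 show "hbase K P E E 0 B C \<phi> (idn (dg_tensor K P B) E) = idn (dg_tensor K P C) E"
  unfolding s using tensor_base_pure[OF P.hom_module[OF E E] B C \<phi> P.idn_closed[OF E], of "\<one>[B]"]
   alg_hom_one[OF \<phi>] B monoid.one_closed[of B]
  by (simp add: algebra_def cring_def ring_def)
 fix F assume "F : Ob (dg_tensor K P B)"
 then have F: "F : Ob P" by (simp add: s)
 note m = P.hom_module[OF E F]
 show "amap (Hom (dg_tensor K P B) E F i) (Hom (dg_tensor K P C) E F i) (hbase K P E F i B C \<phi>)" for i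
  unfolding s by (rule tensor_base_amap[OF m B C \<phi>])
 show "hbase K P E F j B C \<phi> (dif (dg_tensor K P B) E F i f) =
   dif (dg_tensor K P C) E F i (hbase K P E F i B C \<phi> f)"
  if "f : mor (dg_tensor K P B) E F i" "j = i + 1" for f i j
  using tensor_base_lin[OF m m B C \<phi> P.dif_lin[OF E F that(2)]] that
  by (simp add: s(2) s(4)[OF that(2)] s(9)[OF that(2)])
 fix G assume "G : Ob (dg_tensor K P B)"
 then have G: "G : Ob P" by (simp add: s)
 show "hbase K P E G k B C \<phi> (cmp (dg_tensor K P B) E F G i j g f) =
   cmp (dg_tensor K P C) E F G i j (hbase K P F G i B C \<phi> g) (hbase K P E F j B C \<phi> f)"
  if "g : mor (dg_tensor K P B) F G i" "f : mor (dg_tensor K P B) E F j" "k = i + j"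
  for g f i j k
  using tensor_base_bilin[OF P.hom_module[OF F G] m P.hom_module[OF E G] B C \<phi> P.cmp_bilin[OF E F G that(3)]] that
  by (simp add: s(2) s(3)[OF that(3)] s(8)[OF that(3)])
qed

subsection \<open>Homotopy classes of cocycles\<close>

context cdg
begin

lemma cocycle0_closed: "f : cocycle0 A X Y ==> f : mor A X Y 0"
 and cocycle0_dif: "f : cocycle0 A X Y ==> dif A X Y 0 f = \<zero>[Hom A X Y 1]"
 by (simp_all add: cocycle0_def)

lemma cocycle0_idn: "X : Ob A ==> idn A X : cocycle0 A X X"
 by (simp add: cocycle0_def idn_closed dif_idn)

lemma homologous0_iff:
 assumes "X : Ob A" "Y : Ob A" "f : mor A X Y 0" "f' : mor A X Y 0"
 shows "homologous0 A X Y f f' \<longleftrightarrow>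
  (\<exists>h\<in>mor A X Y (-1). f = f' \<oplus>[Hom A X Y 0] dif A X Y (-1) h)"
proof -
 interpret M: abelian_group "Hom A X Y 0" using hom_group assms by blast
 have "(f \<ominus>[Hom A X Y 0] f' = d) = (f = f' \<oplus>[Hom A X Y 0] d)" if "d : mor A X Y 0" for d
 proof
  assume "f \<ominus>[Hom A X Y 0] f' = d"
  then have "f' \<oplus>[Hom A X Y 0] d = f' \<oplus>[Hom A X Y 0] (f \<ominus>[Hom A X Y 0] f')" by simp
  also have "\<dots> = f" using assms by algebra
  finally show "f = f' \<oplus>[Hom A X Y 0] d" by simp
 next
  assume f: "f = f' \<oplus>[Hom A X Y 0] d"
  show "f \<ominus>[Hom A X Y 0] f' = d" unfolding f using assms that by algebra
 qed
 then show ?thesis unfolding homologous0_def using dif_closed[OF assms(1,2), of _ "-1" 0] by auto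
qed

lemma homologous0_refl:
 assumes "X : Ob A" "Y : Ob A" "f : mor A X Y 0" shows "homologous0 A X Y f f"
proof -
 interpret M: abelian_group "Hom A X Y 0" using hom_group assms by blast
 interpret N: abelian_group "Hom A X Y (-1)" using hom_group assms by blast
 show ?thesis using assms amap_zero[OF dif_amap[OF assms(1,2), of 0 "-1"]]
  by (auto simp: homologous0_iff intro!: bexI[of _ "\<zero>[Hom A X Y (-1)]"])
qed

lemma homologous0_sym:
 assumes o: "X : Ob A" "Y : Ob A" and f: "f : mor A X Y 0" "f' : mor A X Y 0"
  and h: "homologous0 A X Y f f'"
 shows "homologous0 A X Y f' f"
proof -
 interpret M: abelian_group "Hom A X Y 0" using hom_group o by blast
 interpret N: abelian_group "Hom A X Y (-1)" using hom_group o by blast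
 obtain h where h: "h : mor A X Y (-1)" "f = f' \<oplus>[Hom A X Y 0] dif A X Y (-1) h"
  using h homologous0_iff[OF o f] by blast
 have d: "dif A X Y (-1) h : mor A X Y 0" using dif_closed[OF o h(1)] by simp
 have "f' = f \<oplus>[Hom A X Y 0] \<ominus>[Hom A X Y 0] dif A X Y (-1) h" unfolding h(2) using f d by algebra
 then have "f' = f \<oplus>[Hom A X Y 0] dif A X Y (-1) (\<ominus>[Hom A X Y (-1)] h)"
  using amap_neg[OF dif_amap[OF o, of 0 "-1"] h(1)] by simp
 then show ?thesis using h(1) homologous0_iff[OF o f(2,1)] by blast
qed

lemma homologous0_trans:
 assumes o: "X : Ob A" "Y : Ob A"
  and f: "f : mor A X Y 0" "f' : mor A X Y 0" "f'' : mor A X Y 0"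
  and h: "homologous0 A X Y f f'" "homologous0 A X Y f' f''"
 shows "homologous0 A X Y f f''"
proof -
 interpret M: abelian_group "Hom A X Y 0" using hom_group o by blast
 interpret N: abelian_group "Hom A X Y (-1)" using hom_group o by blast
 obtain h where h: "h : mor A X Y (-1)" "f = f' \<oplus>[Hom A X Y 0] dif A X Y (-1) h"
  using h homologous0_iff[OF o f(1,2)] by blast
 obtain k where k: "k : mor A X Y (-1)" "f' = f'' \<oplus>[Hom A X Y 0] dif A X Y (-1) k"
  using assms(7) homologous0_iff[OF o f(2,3)] by blast
 have d: "dif A X Y (-1) h : mor A X Y 0" "dif A X Y (-1) k : mor A X Y 0"
  using dif_closed[OF o h(1)] dif_closed[OF o k(1)] by simp_all
 have "f = f'' \<oplus>[Hom A X Y 0] dif A X Y (-1) (k \<oplus>[Hom A X Y (-1)] h)"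
  unfolding h(2) k(2) using amap_add[OF dif_amap[OF o, of 0 "-1"] k(1) h(1)] f d by (simp add: M.a_assoc)
 then show ?thesis using h(1) k(1) homologous0_iff[OF o f(1,3)] by blast
qed

lemma homologous0_post:
 assumes o: "X : Ob A" "Y : Ob A" "Z : Ob A"
  and f: "f : mor A X Y 0" "f' : mor A X Y 0" "homologous0 A X Y f f'"
  and g: "g : cocycle0 A Y Z"
 shows "homologous0 A X Z (cmp A X Y Z 0 0 g f) (cmp A X Y Z 0 0 g f')"
proof -
 obtain h where h: "h : mor A X Y (-1)" "f = f' \<oplus>[Hom A X Y 0] dif A X Y (-1) h"
  using f homologous0_iff[OF o(1,2) f(1,2)] by blast
 note g' = cocycle0_closed[OF g]
 note ar = cmp_amap_right[OF o g', of 0 0] and al = cmp_amap_left[OF o h(1), of 0 1]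
 have d: "dif A X Y (-1) h : mor A X Y 0" using dif_closed[OF o(1,2) h(1)] by simp
 have c: "cmp A X Y Z 0 0 g f : mor A X Z 0" "cmp A X Y Z 0 0 g f' : mor A X Z 0"
  "cmp A X Y Z 0 0 g (dif A X Y (-1) h) : mor A X Z 0"
  using amap_closed[OF ar] f d by auto
 interpret M: abelian_group "Hom A X Z 0" using hom_group o by blast
 have "dif A X Z (-1) (cmp A X Y Z 0 (-1) g h) = cmp A X Y Z 0 0 g (dif A X Y (-1) h)"
  using leibniz[OF o g' h(1), of "-1" 0 1 0] cocycle0_dif[OF g] amap_zero[OF cmp_amap_left[OF o h(1), of 0 1]] c
  by (simp add: sgn_act_def)
 then have "cmp A X Y Z 0 0 g f = cmp A X Y Z 0 0 g f' \<oplus>[Hom A X Z 0] dif A X Z (-1) (cmp A X Y Z 0 (-1) g h)"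
  unfolding h(2) using amap_add[OF ar f(2) d] by simp
 moreover have "cmp A X Y Z 0 (-1) g h : mor A X Z (-1)" using cmp_closed[OF o g' h(1)] by simp
 ultimately show ?thesis using homologous0_iff[OF o(1,3) c(1,2)] by blast
qed

lemma homologous0_pre:
 assumes o: "X : Ob A" "Y : Ob A" "Z : Ob A"
  and f: "f : mor A Y Z 0" "f' : mor A Y Z 0" "homologous0 A Y Z f f'"
  and g: "g : cocycle0 A X Y"
 shows "homologous0 A X Z (cmp A X Y Z 0 0 f g) (cmp A X Y Z 0 0 f' g)"
proof -
 obtain h where h: "h : mor A Y Z (-1)" "f = f' \<oplus>[Hom A Y Z 0] dif A Y Z (-1) h"
  using f homologous0_iff[OF o(2,3) f(1,2)] by blast
 note g' = cocycle0_closed[OF g]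
 note al = cmp_amap_left[OF o g', of 0 0] and ar = cmp_amap_right[OF o h(1), of 0 1]
 have d: "dif A Y Z (-1) h : mor A Y Z 0" using dif_closed[OF o(2,3) h(1)] by simp
 have c: "cmp A X Y Z 0 0 f g : mor A X Z 0" "cmp A X Y Z 0 0 f' g : mor A X Z 0"
  "cmp A X Y Z 0 0 (dif A Y Z (-1) h) g : mor A X Z 0"
  using amap_closed[OF al] f d by auto
 interpret M: abelian_group "Hom A X Z 0" using hom_group o by blast
 have "dif A X Z (-1) (cmp A X Y Z (-1) 0 h g) = cmp A X Y Z 0 0 (dif A Y Z (-1) h) g"
  using leibniz[OF o h(1) g', of "-1" 0 0 1] cocycle0_dif[OF g] amap_zero[OF ar] c
  by (simp add: sgn_act_def)
 then have "cmp A X Y Z 0 0 f g = cmp A X Y Z 0 0 f' g \<oplus>[Hom A X Z 0] dif A X Z (-1) (cmp A X Y Z (-1) 0 h g)"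
  unfolding h(2) using amap_add[OF al f(2) d] by simp
 moreover have "cmp A X Y Z (-1) 0 h g : mor A X Z (-1)" using cmp_closed[OF o h(1) g'] by simp
 ultimately show ?thesis using homologous0_iff[OF o(1,3) c(1,2)] by blast
qed

lemma cocycle0_cmp:
 assumes o: "X : Ob A" "Y : Ob A" "Z : Ob A" and f: "f : cocycle0 A X Y" and g: "g : cocycle0 A Y Z"
 shows "cmp A X Y Z 0 0 g f : cocycle0 A X Z"
proof -
 interpret M: abelian_group "Hom A X Z 1" using hom_group o by blast
 note f' = cocycle0_closed[OF f] and g' = cocycle0_closed[OF g]
 show ?thesis
  unfolding cocycle0_def using cmp_closed[OF o g' f', of 0] leibniz[OF o g' f', of 0 1 1 1]
   amap_zero[OF cmp_amap_left[OF o f', of 1 1]] amap_zero[OF cmp_amap_right[OF o g', of 1 1]]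
  by (simp add: cocycle0_dif[OF f] cocycle0_dif[OF g] sgn_act_def)
qed

lemma equivalence_idn: assumes X: "X : Ob A" shows "equivalence A X X (idn A X)"
 unfolding equivalence_def using cocycle0_idn[OF X] homologous0_refl[OF X X idn_closed[OF X]]
 by (auto simp: idn_left[OF X X idn_closed[OF X]] intro!: bexI[of _ "idn A X"])

lemma equivalence_cocycle: "equivalence A X Y f ==> f : cocycle0 A X Y"
 by (simp add: equivalence_def)

text \<open>A left and a right homotopy inverse agree: g ~ (g'f)g = g'(fg) ~ g'. This form suits
  \<open>equiv_mod_lift\<close>, which constructs the two inverses separately.\<close>

lemma equivalenceI:
 assumes o: "X : Ob A" "Y : Ob A" and f: "f : cocycle0 A X Y"
  and g: "g : cocycle0 A Y X" "homologous0 A Y Y (cmp A Y X Y 0 0 f g) (idn A Y)"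
  and g': "g' : cocycle0 A Y X" "homologous0 A X X (cmp A X Y X 0 0 g' f) (idn A X)"
 shows "equivalence A X Y f"
proof -
 note c = cocycle0_closed and id = idn_closed[OF o(1)] idn_closed[OF o(2)]
 note fg = cocycle0_cmp[OF o(2,1,2) g(1) f] and gf = cocycle0_cmp[OF o(1,2,1) f g'(1)]
 note gfg = cocycle0_cmp[OF o(2,2,1) fg g'(1)]
 have "homologous0 A Y X (cmp A Y Y X 0 0 g' (cmp A Y X Y 0 0 f g)) (cmp A Y Y X 0 0 g' (idn A Y))"
  by (rule homologous0_post[OF o(2,2,1) c[OF fg] id(2) g(2) g'(1)])
 moreover have "homologous0 A Y X (cmp A Y X X 0 0 (cmp A X Y X 0 0 g' f) g) (cmp A Y X X 0 0 (idn A X) g)"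
  by (rule homologous0_pre[OF o(2,1,1) c[OF gf] id(1) g'(2) g(1)])
 moreover have "cmp A Y X X 0 0 (cmp A X Y X 0 0 g' f) g = cmp A Y Y X 0 0 g' (cmp A Y X Y 0 0 f g)"
  by (rule cmp_assoc[OF o(2,1,2,1) c[OF g'(1)] c[OF f] c[OF g(1)]]) auto
 ultimately have h: "homologous0 A Y X (cmp A Y Y X 0 0 g' (cmp A Y X Y 0 0 f g)) g'"
  "homologous0 A Y X (cmp A Y Y X 0 0 g' (cmp A Y X Y 0 0 f g)) g"
  using idn_right[OF o(2,1) c[OF g'(1)]] idn_left[OF o(2,1) c[OF g(1)]] by auto
 have "homologous0 A Y X g g'"
  using homologous0_trans[OF o(2,1) c[OF g(1)] c[OF gfg] c[OF g'(1)]
    homologous0_sym[OF o(2,1) c[OF gfg] c[OF g(1)] h(2)] h(1)] .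
 then have "homologous0 A X X (cmp A X Y X 0 0 g f) (cmp A X Y X 0 0 g' f)"
  by (rule homologous0_pre[OF o(1,2,1) c[OF g(1)] c[OF g'(1)] _ f])
 then have "homologous0 A X X (cmp A X Y X 0 0 g f) (idn A X)"
  using homologous0_trans[OF o(1,1) c[OF cocycle0_cmp[OF o(1,2,1) f g(1)]] c[OF gf] id(1)] g'(2) by blast
 then show ?thesis unfolding equivalence_def using f g by blast
qed

lemma equivalence_homologous:
 assumes o: "X : Ob A" "Y : Ob A" and f: "equivalence A X Y f" and f': "f' : cocycle0 A X Y"
  and h: "homologous0 A X Y f' f"
 shows "equivalence A X Y f'"
proof -
 note c = cocycle0_closed and id = idn_closed[OF o(1)] idn_closed[OF o(2)]
 obtain g where g: "g : cocycle0 A Y X" "homologous0 A X X (cmp A X Y X 0 0 g f) (idn A X)"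
  "homologous0 A Y Y (cmp A Y X Y 0 0 f g) (idn A Y)" using f by (auto simp: equivalence_def)
 note fc = equivalence_cocycle[OF f]
 have "homologous0 A X X (cmp A X Y X 0 0 g f') (idn A X)"
  by (rule homologous0_trans[OF o(1,1) c[OF cocycle0_cmp[OF o(1,2,1) f' g(1)]]
     c[OF cocycle0_cmp[OF o(1,2,1) fc g(1)]] id(1) homologous0_post[OF o(1,2,1) c[OF f'] c[OF fc] h g(1)] g(2)])
 moreover have "homologous0 A Y Y (cmp A Y X Y 0 0 f' g) (idn A Y)"
  by (rule homologous0_trans[OF o(2,2) c[OF cocycle0_cmp[OF o(2,1,2) g(1) f']]
     c[OF cocycle0_cmp[OF o(2,1,2) g(1) fc]] id(2) homologous0_pre[OF o(2,1,2) c[OF f'] c[OF fc] h g(1)] g(3)])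
 ultimately show ?thesis unfolding equivalence_def using f' g(1) by blast
qed

text \<open>The composite f'g'gf shrinks to f'f and then to the identity. Both halves of
  \<open>equivalence_cmp\<close> are instances, the second with maps and inverses exchanged.\<close>

lemma homologous0_cancel:
 assumes o: "X : Ob A" "Y : Ob A" "Z : Ob A"
  and f: "f : cocycle0 A X Y" and g: "g : cocycle0 A Y Z" and g': "g' : cocycle0 A Z Y"
  and f': "f' : cocycle0 A Y X"
  and hg: "homologous0 A Y Y (cmp A Y Z Y 0 0 g' g) (idn A Y)"
  and hf: "homologous0 A X X (cmp A X Y X 0 0 f' f) (idn A X)"
 shows "homologous0 A X X (cmp A X Z X 0 0 (cmp A Z Y X 0 0 f' g') (cmp A X Y Z 0 0 g f)) (idn A X)"
proof -
 note c = cocycle0_closed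
 note gg = cocycle0_cmp[OF o(2,3,2) g g'] and gf = cocycle0_cmp[OF o f g]
 have "cmp A X Z X 0 0 (cmp A Z Y X 0 0 f' g') (cmp A X Y Z 0 0 g f) =
   cmp A X Y X 0 0 f' (cmp A X Z Y 0 0 g' (cmp A X Y Z 0 0 g f))"
  by (rule cmp_assoc[OF o(1,3,2,1) c[OF f'] c[OF g'] c[OF gf]]) auto
 also have "cmp A X Z Y 0 0 g' (cmp A X Y Z 0 0 g f) = cmp A X Y Y 0 0 (cmp A Y Z Y 0 0 g' g) f"
  by (rule cmp_assoc[OF o(1,2,3,2) c[OF g'] c[OF g] c[OF f], symmetric]) auto
 finally have eq: "cmp A X Z X 0 0 (cmp A Z Y X 0 0 f' g') (cmp A X Y Z 0 0 g f) =
   cmp A X Y X 0 0 f' (cmp A X Y Y 0 0 (cmp A Y Z Y 0 0 g' g) f)" .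
 have "homologous0 A X Y (cmp A X Y Y 0 0 (cmp A Y Z Y 0 0 g' g) f) f"
  using homologous0_pre[OF o(1,2,2) c[OF gg] idn_closed[OF o(2)] hg f] idn_left[OF o(1,2) c[OF f]] by simp
 then have "homologous0 A X X (cmp A X Y X 0 0 f' (cmp A X Y Y 0 0 (cmp A Y Z Y 0 0 g' g) f)) (cmp A X Y X 0 0 f' f)"
  by (rule homologous0_post[OF o(1,2,1) c[OF cocycle0_cmp[OF o(1,2,2) f gg]] c[OF f] _ f'])
 then show ?thesis unfolding eq
  using homologous0_trans[OF o(1,1) c[OF cocycle0_cmp[OF o(1,2,1) cocycle0_cmp[OF o(1,2,2) f gg] f']]
    c[OF cocycle0_cmp[OF o(1,2,1) f f']] idn_closed[OF o(1)]] hf by blast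
qed

lemma equivalence_cmp:
 assumes o: "X : Ob A" "Y : Ob A" "Z : Ob A" and f: "equivalence A X Y f" and g: "equivalence A Y Z g"
 shows "equivalence A X Z (cmp A X Y Z 0 0 g f)"
proof -
 obtain f' where f': "f' : cocycle0 A Y X" "homologous0 A X X (cmp A X Y X 0 0 f' f) (idn A X)"
  "homologous0 A Y Y (cmp A Y X Y 0 0 f f') (idn A Y)" using f by (auto simp: equivalence_def)
 obtain g' where g': "g' : cocycle0 A Z Y" "homologous0 A Y Y (cmp A Y Z Y 0 0 g' g) (idn A Y)"
  "homologous0 A Z Z (cmp A Z Y Z 0 0 g g') (idn A Z)" using g by (auto simp: equivalence_def)
 note fc = equivalence_cocycle[OF f] and gc = equivalence_cocycle[OF g]
 show ?thesis unfolding equivalence_def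
  using homologous0_cancel[OF o fc gc g'(1) f'(1) g'(2) f'(2)]
   homologous0_cancel[OF o(3,2,1) g'(1) f'(1) fc gc f'(3) g'(3)]
   cocycle0_cmp[OF o fc gc] cocycle0_cmp[OF o(3,2,1) g'(1) f'(1)] by blast
qed

lemma equivalence_inverse:
 assumes f: "equivalence A X Y f"
 obtains g where "equivalence A Y X g" "homologous0 A X X (cmp A X Y X 0 0 g f) (idn A X)"
  "homologous0 A Y Y (cmp A Y X Y 0 0 f g) (idn A Y)"
 using f unfolding equivalence_def by blast

text \<open>Two out of three: with \<open>g\<close> inverse to \<open>f\<close> one has u ~ (gf)u =
  g(fu) ~ ge, a composite of equivalences. It recovers the new edge of an outer horn of dimension
  2.\<close>

lemma equivalence_cancel_left:
 assumes o: "X : Ob A" "Y : Ob A" "Z : Ob A"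
  and f: "equivalence A Y Z f" and e: "equivalence A X Z e" and u: "u : cocycle0 A X Y"
  and h: "homologous0 A X Z (cmp A X Y Z 0 0 f u) e"
 shows "equivalence A X Y u"
proof -
 obtain g where g: "equivalence A Z Y g" "homologous0 A Y Y (cmp A Y Z Y 0 0 g f) (idn A Y)"
  using f by (rule equivalence_inverse)
 note c = cocycle0_closed and fc = equivalence_cocycle[OF f] and gc = equivalence_cocycle[OF g(1)]
  and ec = equivalence_cocycle[OF e]
 note fu = cocycle0_cmp[OF o u fc] and gf = cocycle0_cmp[OF o(2,3,2) fc gc]
 have eq: "cmp A X Y Y 0 0 (cmp A Y Z Y 0 0 g f) u = cmp A X Z Y 0 0 g (cmp A X Y Z 0 0 f u)"
  by (rule cmp_assoc[OF o(1,2,3,2) c[OF gc] c[OF fc] c[OF u]]) auto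
 have "homologous0 A X Y (cmp A X Z Y 0 0 g (cmp A X Y Z 0 0 f u)) u"
  using homologous0_pre[OF o(1,2,2) c[OF gf] idn_closed[OF o(2)] g(2) u] idn_left[OF o(1,2) c[OF u]] eq by simp
 then have "homologous0 A X Y u (cmp A X Z Y 0 0 g (cmp A X Y Z 0 0 f u))"
  using homologous0_sym[OF o(1,2) c[OF cocycle0_cmp[OF o(1,3,2) fu gc]] c[OF u]] by blast
 moreover have "homologous0 A X Y (cmp A X Z Y 0 0 g (cmp A X Y Z 0 0 f u)) (cmp A X Z Y 0 0 g e)"
  by (rule homologous0_post[OF o(1,3,2) c[OF fu] c[OF ec] h gc])
 ultimately have "homologous0 A X Y u (cmp A X Z Y 0 0 g e)"
  using homologous0_trans[OF o(1,2) c[OF u] c[OF cocycle0_cmp[OF o(1,3,2) fu gc]]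
    c[OF cocycle0_cmp[OF o(1,3,2) ec gc]]] by blast
 then show ?thesis by (rule equivalence_homologous[OF o(1,2) equivalence_cmp[OF o(1,3,2) e g(1)] u])
qed

lemma equivalence_cancel_right:
 assumes o: "X : Ob A" "Y : Ob A" "Z : Ob A"
  and f: "equivalence A X Y f" and e: "equivalence A X Z e" and u: "u : cocycle0 A Y Z"
  and h: "homologous0 A X Z (cmp A X Y Z 0 0 u f) e"
 shows "equivalence A Y Z u"
proof -
 obtain g where g: "equivalence A Y X g" "homologous0 A Y Y (cmp A Y X Y 0 0 f g) (idn A Y)"
  using f by (rule equivalence_inverse)
 note c = cocycle0_closed and fc = equivalence_cocycle[OF f] and gc = equivalence_cocycle[OF g(1)]
  and ec = equivalence_cocycle[OF e]
 note fu = cocycle0_cmp[OF o fc u] and gf = cocycle0_cmp[OF o(2,1,2) gc fc]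
 have eq: "cmp A Y X Z 0 0 (cmp A X Y Z 0 0 u f) g = cmp A Y Y Z 0 0 u (cmp A Y X Y 0 0 f g)"
  by (rule cmp_assoc[OF o(2,1,2,3) c[OF u] c[OF fc] c[OF gc]]) auto
 have "homologous0 A Y Z (cmp A Y X Z 0 0 (cmp A X Y Z 0 0 u f) g) u"
  using homologous0_post[OF o(2,2,3) c[OF gf] idn_closed[OF o(2)] g(2) u] idn_right[OF o(2,3) c[OF u]] eq by simp
 then have "homologous0 A Y Z u (cmp A Y X Z 0 0 (cmp A X Y Z 0 0 u f) g)"
  using homologous0_sym[OF o(2,3) c[OF cocycle0_cmp[OF o(2,1,3) gc fu]] c[OF u]] by blast
 moreover have "homologous0 A Y Z (cmp A Y X Z 0 0 (cmp A X Y Z 0 0 u f) g) (cmp A Y X Z 0 0 e g)"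
  by (rule homologous0_pre[OF o(2,1,3) c[OF fu] c[OF ec] h gc])
 ultimately have "homologous0 A Y Z u (cmp A Y X Z 0 0 e g)"
  using homologous0_trans[OF o(2,3) c[OF u] c[OF cocycle0_cmp[OF o(2,1,3) gc fu]]
    c[OF cocycle0_cmp[OF o(2,1,3) gc ec]]] by blast
 then show ?thesis by (rule equivalence_homologous[OF o(2,3) equivalence_cmp[OF o(2,1,3) g(1) e] u])
qed

end

context dgfun
begin

lemma Fm_cocycle0:
 assumes o: "X : Ob A" "Y : Ob A" and f: "f : cocycle0 A X Y"
 shows "Fm X Y 0 f : cocycle0 B (Fo X) (Fo Y)"
 unfolding cocycle0_def using Fm_closed[OF o A.cocycle0_closed[OF f]] Fm_dif[OF o A.cocycle0_closed[OF f], of 1]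
  A.cocycle0_dif[OF f] amap_zero[OF Fm_amap[OF o, of 1]] by simp

lemma Fm_homologous0:
 assumes o: "X : Ob A" "Y : Ob A" and f: "f : mor A X Y 0" "f' : mor A X Y 0"
  and h: "homologous0 A X Y f f'"
 shows "homologous0 B (Fo X) (Fo Y) (Fm X Y 0 f) (Fm X Y 0 f')"
proof -
 obtain h where h: "h : mor A X Y (-1)" "f \<ominus>[Hom A X Y 0] f' = dif A X Y (-1) h"
  using h by (auto simp: homologous0_def)
 show ?thesis unfolding homologous0_def
  using amap_minus[OF Fm_amap[OF o] f] h(2) Fm_dif[OF o h(1), of 0] Fm_closed[OF o h(1)]
  by (intro bexI[of _ "Fm X Y (-1) h"]) simp_all
qed

lemma Fm_equivalence:
 assumes o: "X : Ob A" "Y : Ob A" and f: "equivalence A X Y f"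
 shows "equivalence B (Fo X) (Fo Y) (Fm X Y 0 f)"
proof -
 obtain g where g: "g : cocycle0 A Y X" "homologous0 A X X (cmp A X Y X 0 0 g f) (idn A X)"
  "homologous0 A Y Y (cmp A Y X Y 0 0 f g) (idn A Y)" and fc: "f : cocycle0 A X Y"
  using f by (auto simp: equivalence_def)
 note c = A.cocycle0_closed
 show ?thesis unfolding equivalence_def
  using Fm_cocycle0[OF o fc] Fm_cocycle0[OF o(2,1) g(1)]
   Fm_homologous0[OF o(1,1) c[OF A.cocycle0_cmp[OF o(1,2,1) fc g(1)]] A.idn_closed[OF o(1)] g(2)]
   Fm_homologous0[OF o(2,2) c[OF A.cocycle0_cmp[OF o(2,1,2) g(1) fc]] A.idn_closed[OF o(2)] g(3)]
   Fm_cmp[OF o(1,2,1) c[OF g(1)] c[OF fc], of 0] Fm_cmp[OF o(2,1,2) c[OF fc] c[OF g(1)], of 0]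
   Fm_idn[OF o(1)] Fm_idn[OF o(2)] by auto
qed

end

subsection \<open>Cones over equivalences\<close>

text \<open>Two ideals annihilating each other. For \<open>J = 0\<close> the ideal \<open>N\<close> may be everything; for the
 kernel of a square-zero extension one takes \<open>N = J\<close>, and then an equation that holds modulo the
 kernel is as good as an equation when it acts on \<open>N\<close>.\<close>

locale ann_pair = cdg A for A :: "('k, 'o, 'm) dgcat" +
 fixes N J :: "'o => 'o => int => 'm set"
 assumes N_sub: "[|E : Ob A; F : Ob A; x : N E F i|] ==> x : mor A E F i"
  and N_zero: "[|E : Ob A; F : Ob A|] ==> \<zero>[Hom A E F i] : N E F i"
  and N_add: "[|E : Ob A; F : Ob A; x : N E F i; y : N E F i|] ==> x \<oplus>[Hom A E F i] y : N E F i"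
  and N_neg: "[|E : Ob A; F : Ob A; x : N E F i|] ==> \<ominus>[Hom A E F i] x : N E F i"
  and N_dif: "[|E : Ob A; F : Ob A; x : N E F i; j = i + 1|] ==> dif A E F i x : N E F j"
  and N_left: "[|E : Ob A; F : Ob A; G : Ob A; g : mor A F G i; x : N E F j; k = i + j|]
   ==> cmp A E F G i j g x : N E G k"
  and N_right: "[|E : Ob A; F : Ob A; G : Ob A; x : N F G i; f : mor A E F j; k = i + j|]
   ==> cmp A E F G i j x f : N E G k"
  and J_sub: "[|E : Ob A; F : Ob A; x : J E F i|] ==> x : mor A E F i"
  and JN: "[|E : Ob A; F : Ob A; G : Ob A; g : J F G i; x : N E F j; k = i + j|]
   ==> cmp A E F G i j g x = \<zero>[Hom A E G k]"
  and NJ: "[|E : Ob A; F : Ob A; G : Ob A; x : N F G i; f : J E F j; k = i + j|]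
   ==> cmp A E F G i j x f = \<zero>[Hom A E G k]"

text \<open>Every equation in the definition of an equivalence is allowed an error in
  \<open>J\<close>; in particular \<open>f\<close> and \<open>g\<close> need not be closed. For
  \<open>J\<close> = 0 an equivalence is of this kind, and for the kernel of a functor any lift of
  an equivalence is.\<close>

definition equiv_mod :: "('k, 'o, 'm) dgcat => ('o => 'o => int => 'm set) => 'o => 'o => 'm => bool" where
 "equiv_mod A J X Y f \<longleftrightarrow> f : mor A X Y 0 & dif A X Y 0 f : J X Y 1 &
  (\<exists>g\<in>mor A Y X 0. dif A Y X 0 g : J Y X 1 &
   (\<exists>h\<in>mor A X X (-1). (cmp A X Y X 0 0 g f \<ominus>[Hom A X X 0] idn A X) \<ominus>[Hom A X X 0] dif A X X (-1) h : J X X 0) &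
   (\<exists>h\<in>mor A Y Y (-1). (cmp A Y X Y 0 0 f g \<ominus>[Hom A Y Y 0] idn A Y) \<ominus>[Hom A Y Y 0] dif A Y Y (-1) h : J Y Y 0))"

text \<open>Acyclicity of the cone of \<open>T\<close>, from the complex \<open>N X1 X2\<close> to
  the complex \<open>N Y1 Y2\<close>: the pair (a, b) is a cocycle of the cone and (u, v) bounds it,
  up to the sign convention for \<open>v\<close>.\<close>

definition cone_solvable :: "('k, 'o, 'm) dgcat => ('o => 'o => int => 'm set) => (int => 'm => 'm) =>
  'o => 'o => 'o => 'o => bool" where
 "cone_solvable A N T X1 X2 Y1 Y2 \<longleftrightarrow>
  (\<forall>i i1 i2 im a b. i1 = i + 1 --> i2 = i + 2 --> im = i - 1 -->
    a : N X1 X2 i1 --> dif A X1 X2 i1 a = \<zero>[Hom A X1 X2 i2] -->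
    b : N Y1 Y2 i --> dif A Y1 Y2 i b = T i1 a -->
    (\<exists>u\<in>N X1 X2 i. \<exists>v\<in>N Y1 Y2 im. dif A X1 X2 i u = a &
     T i u = b \<oplus>[Hom A Y1 Y2 i] dif A Y1 Y2 im v))"

lemma cone_solvableD:
 assumes "cone_solvable A N T X1 X2 Y1 Y2" "a : N X1 X2 i1" "dif A X1 X2 i1 a = \<zero>[Hom A X1 X2 i2]"
  "b : N Y1 Y2 i" "dif A Y1 Y2 i b = T i1 a" "i1 = i + 1" "i2 = i + 2" "im = i - 1"
 obtains u v where "u : N X1 X2 i" "v : N Y1 Y2 im" "dif A X1 X2 i u = a"
  "T i u = b \<oplus>[Hom A Y1 Y2 i] dif A Y1 Y2 im v"
 using assms unfolding cone_solvable_def by blast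

context ann_pair
begin

lemma N_minus: "[|E : Ob A; F : Ob A; x : N E F i; y : N E F i|] ==> x \<ominus>[Hom A E F i] y : N E F i"
 by (simp add: a_minus_def N_add N_neg)

lemma N_sgn: "[|E : Ob A; F : Ob A; x : N E F i|] ==> sgn_act (Hom A E F i) k x : N E F i"
 by (simp add: sgn_act_def N_neg)

text \<open>Acyclicity from two facts about cohomology: \<open>inj\<close> says that a class killed
  by \<open>T\<close> is zero, \<open>surj\<close> that every class is hit. Once
  \<open>d u = a\<close>, the remaining error \<open>c\<close> = b - Tu is closed, and a closed
  \<open>p\<close> with Tp = c + dv repairs it without changing \<open>d u\<close>.\<close>

lemma cone_solvableI:
 assumes o: "X1 : Ob A" "X2 : Ob A" "Y1 : Ob A" "Y2 : Ob A"
  and T: "!!i. amap (Hom A X1 X2 i) (Hom A Y1 Y2 i) (T i)"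
  and TN: "!!i x. x : N X1 X2 i ==> T i x : N Y1 Y2 i"
  and comm: "!!i i1 x. x : N X1 X2 i ==> i1 = i + 1 ==> dif A Y1 Y2 i (T i x) = T i1 (dif A X1 X2 i x)"
  and inj: "!!i i1 i2 a b. [|a : N X1 X2 i1; dif A X1 X2 i1 a = \<zero>[Hom A X1 X2 i2]; b : N Y1 Y2 i;
    dif A Y1 Y2 i b = T i1 a; i1 = i + 1; i2 = i + 2|] ==> \<exists>u\<in>N X1 X2 i. dif A X1 X2 i u = a"
  and surj: "!!i i1 im c. [|c : N Y1 Y2 i; dif A Y1 Y2 i c = \<zero>[Hom A Y1 Y2 i1]; i1 = i + 1; im = i - 1|] ==>
    \<exists>p\<in>N X1 X2 i. dif A X1 X2 i p = \<zero>[Hom A X1 X2 i1] &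
     (\<exists>v\<in>N Y1 Y2 im. T i p = c \<oplus>[Hom A Y1 Y2 i] dif A Y1 Y2 im v)"
 shows "cone_solvable A N T X1 X2 Y1 Y2"
 unfolding cone_solvable_def
proof (intro allI impI)
 fix i i1 i2 im :: int and a b
 assume i: "i1 = i + 1" "i2 = i + 2" "im = i - 1"
  and a: "a : N X1 X2 i1" "dif A X1 X2 i1 a = \<zero>[Hom A X1 X2 i2]"
  and b: "b : N Y1 Y2 i" "dif A Y1 Y2 i b = T i1 a"
 have ii: "i = im + 1" using i by simp
 interpret M: abelian_group "Hom A X1 X2 i1" using hom_group o by blast
 interpret P: abelian_group "Hom A Y1 Y2 i" using hom_group o by blast
 interpret Q: abelian_group "Hom A Y1 Y2 i1" using hom_group o by blast
 obtain u where u: "u : N X1 X2 i" "dif A X1 X2 i u = a" using inj[OF a b i(1,2)] by blast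
 define c where "c = b \<ominus>[Hom A Y1 Y2 i] T i u"
 have c: "c : N Y1 Y2 i" unfolding c_def by (intro N_minus o b TN u)
 note bc = N_sub[OF o(3,4) b(1)] and Tu = N_sub[OF o(3,4) TN[OF u(1)]]
 have "dif A Y1 Y2 i c = \<zero>[Hom A Y1 Y2 i1]"
  unfolding c_def using amap_minus[OF dif_amap[OF o(3,4) i(1)] bc Tu] comm[OF u(1) i(1)] u(2) b(2)
   N_sub[OF o(3,4) TN[OF a(1)]] Q.minus_self by simp
 then obtain p v where p: "p : N X1 X2 i" "dif A X1 X2 i p = \<zero>[Hom A X1 X2 i1]"
  and v: "v : N Y1 Y2 im" "T i p = c \<oplus>[Hom A Y1 Y2 i] dif A Y1 Y2 im v"
  using surj[OF c _ i(1,3)] by blast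
 note us = N_sub[OF o(1,2) u(1)] and ps = N_sub[OF o(1,2) p(1)] and dv = N_sub[OF o(3,4) N_dif[OF o(3,4) v(1) ii]]
 have "dif A X1 X2 i (u \<oplus>[Hom A X1 X2 i] p) = a"
  using amap_add[OF dif_amap[OF o(1,2) i(1)] us ps] u(2) p(2) N_sub[OF o(1,2) a(1)] by simp
 moreover have "T i (u \<oplus>[Hom A X1 X2 i] p) = b \<oplus>[Hom A Y1 Y2 i] dif A Y1 Y2 im v"
  unfolding amap_add[OF T us ps] v(2) c_def using bc Tu dv by algebra
 ultimately show "\<exists>u\<in>N X1 X2 i. \<exists>v\<in>N Y1 Y2 im. dif A X1 X2 i u = a &
     T i u = b \<oplus>[Hom A Y1 Y2 i] dif A Y1 Y2 im v"
  using N_add[OF o(1,2) u(1) p(1)] v(1) by blast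
qed

text \<open>The case of an inner horn, where \<open>T\<close> is the identity up to sign: b itself
  is the solution.\<close>

lemma cone_identity:
 assumes o: "X : Ob A" "Y : Ob A" shows "cone_solvable A N (%i x. x) X Y X Y"
 unfolding cone_solvable_def
proof (intro allI impI)
 fix i i1 i2 im :: int and a b
 assume i: "i1 = i + 1" "i2 = i + 2" "im = i - 1" and b: "b : N X Y i" "dif A X Y i b = a"
 interpret M: abelian_group "Hom A X Y i" using hom_group o by blast
 have "i = im + 1" using i by simp
 from amap_zero[OF dif_amap[OF o this]] show "\<exists>u\<in>N X Y i. \<exists>v\<in>N X Y im. dif A X Y i u = a &
     u = b \<oplus>[Hom A X Y i] dif A X Y im v"
  using b N_zero[OF o] N_sub[OF o b(1)] by (intro bexI[of _ b] bexI[of _ "\<zero>[Hom A X Y im]"]) auto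
qed

lemma cone_sgn:
 assumes o: "X1 : Ob A" "X2 : Ob A" "Y1 : Ob A" "Y2 : Ob A"
  and T: "!!i x. x : N X1 X2 i ==> T i x : mor A Y1 Y2 i"
  and c: "cone_solvable A N T X1 X2 Y1 Y2"
 shows "cone_solvable A N (%i x. sgn_act (Hom A Y1 Y2 i) e (T i x)) X1 X2 Y1 Y2"
 unfolding cone_solvable_def
proof (intro allI impI)
 fix i i1 i2 im :: int and a b
 assume i: "i1 = i + 1" "i2 = i + 2" "im = i - 1"
  and a: "a : N X1 X2 i1" "dif A X1 X2 i1 a = \<zero>[Hom A X1 X2 i2]"
  and b: "b : N Y1 Y2 i" "dif A Y1 Y2 i b = sgn_act (Hom A Y1 Y2 i1) e (T i1 a)"
 have ii: "i = im + 1" using i by simp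
 note g = hom_group[OF o(3,4)]
 have ss: "sgn_act (Hom A Y1 Y2 j) e (sgn_act (Hom A Y1 Y2 j) e x) = x" if "x : mor A Y1 Y2 j" for x j
  using sgn_act_sgn_act[OF g that] by (simp add: sgn_act_even)
 have "dif A Y1 Y2 i (sgn_act (Hom A Y1 Y2 i) e b) = T i1 a"
  using amap_sgn_act[OF dif_amap[OF o(3,4) i(1)] N_sub[OF o(3,4) b(1)]] b(2) ss[OF T[OF a(1)]] by simp
 from cone_solvableD[OF c a N_sgn[OF o(3,4) b(1)] this i] obtain u v where
  u: "u : N X1 X2 i" "v : N Y1 Y2 im" "dif A X1 X2 i u = a"
  "T i u = sgn_act (Hom A Y1 Y2 i) e b \<oplus>[Hom A Y1 Y2 i] dif A Y1 Y2 im v" by blast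
 note vs = N_sub[OF o(3,4) u(2)]
 have "sgn_act (Hom A Y1 Y2 i) e (T i u) = b \<oplus>[Hom A Y1 Y2 i] dif A Y1 Y2 im (sgn_act (Hom A Y1 Y2 im) e v)"
  unfolding u(4) using amap_add[OF sgn_act_amap[OF g] sgn_act_closed[OF g N_sub[OF o(3,4) b(1)]]
    amap_closed[OF dif_amap[OF o(3,4) ii] vs]] ss[OF N_sub[OF o(3,4) b(1)]]
   amap_sgn_act[OF dif_amap[OF o(3,4) ii] vs] by simp
 then show "\<exists>u\<in>N X1 X2 i. \<exists>v\<in>N Y1 Y2 im. dif A X1 X2 i u = a &
  sgn_act (Hom A Y1 Y2 i) e (T i u) = b \<oplus>[Hom A Y1 Y2 i] dif A Y1 Y2 im v"
  using u(1,3) N_sgn[OF o(3,4) u(2)] by blast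
qed

text \<open>The error e - 1 - dh lies in \<open>J\<close> and kills \<open>x\<close>, so ex = x +
  (dh)x; since \<open>x\<close> is closed, the last term is d(hx).\<close>

lemma mod_idn_left:
 assumes o: "X : Ob A" "Z : Ob A"
  and e: "e : mor A X X 0" and h: "h : mor A X X (-1)"
  and J: "(e \<ominus>[Hom A X X 0] idn A X) \<ominus>[Hom A X X 0] dif A X X (-1) h : J X X 0"
  and x: "x : N Z X i" "dif A Z X i x = \<zero>[Hom A Z X i1]" and i: "i1 = i + 1" "im = i - 1"
 shows "cmp A Z X X 0 i e x = x \<oplus>[Hom A Z X i] dif A Z X im (cmp A Z X X (-1) i h x)"
proof -
 interpret E: abelian_group "Hom A X X 0" using hom_group o by blast
 interpret M: abelian_group "Hom A Z X i" using hom_group o by blast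
 have xs: "x : mor A Z X i" by (rule N_sub[OF o(2,1) x(1)])
 note al = cmp_amap_left[OF o(2,1,1) xs, of i 0, simplified]
 note id = idn_closed[OF o(1)]
 have d: "dif A X X (-1) h : mor A X X 0" using dif_closed[OF o(1,1) h] by simp
 have k: "im = -1 + i" "i = im + 1" "0 = -1 + (1::int)" using i by simp_all
 have "cmp A Z X X 0 i ((e \<ominus>[Hom A X X 0] idn A X) \<ominus>[Hom A X X 0] dif A X X (-1) h) x = \<zero>[Hom A Z X i]"
  using JN[OF o(2,1,1) J x(1)] by simp
 then have *: "cmp A Z X X 0 i e x \<ominus>[Hom A Z X i] x \<ominus>[Hom A Z X i] cmp A Z X X 0 i (dif A X X (-1) h) x = \<zero>[Hom A Z X i]"
  using e id d by (simp add: amap_minus[OF al] idn_left[OF o(2,1) xs])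
 have c: "cmp A Z X X 0 i e x : mor A Z X i" "cmp A Z X X 0 i (dif A X X (-1) h) x : mor A Z X i"
  using amap_closed[OF al] e d by auto
 have l: "dif A Z X im (cmp A Z X X (-1) i h x) = cmp A Z X X 0 i (dif A X X (-1) h) x"
  using leibniz[OF o(2,1,1) h xs k(1,2) _ i(1), of 0] x(2) c(2)
   amap_zero[OF cmp_amap_right[OF o(2,1,1) h, of i i1]] i sgn_act_zero[OF hom_group[OF o(2,1)]]
  by simp
 have "cmp A Z X X 0 i e x = x \<oplus>[Hom A Z X i] cmp A Z X X 0 i (dif A X X (-1) h) x \<oplus>[Hom A Z X i]
  (cmp A Z X X 0 i e x \<ominus>[Hom A Z X i] x \<ominus>[Hom A Z X i] cmp A Z X X 0 i (dif A X X (-1) h) x)"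
  using c xs by algebra
 then show ?thesis unfolding l * using c xs by simp
qed

text \<open>As on the left, except that d(xh) is x(dh) with the sign of the degree of
  \<open>x\<close>; the sign in the homotopy compensates.\<close>

lemma mod_idn_right:
 assumes o: "X : Ob A" "Z : Ob A"
  and e: "e : mor A X X 0" and h: "h : mor A X X (-1)"
  and J: "(e \<ominus>[Hom A X X 0] idn A X) \<ominus>[Hom A X X 0] dif A X X (-1) h : J X X 0"
  and x: "x : N X Z i" "dif A X Z i x = \<zero>[Hom A X Z i1]" and i: "i1 = i + 1" "im = i - 1"
 shows "cmp A X X Z i 0 x e = x \<oplus>[Hom A X Z i] dif A X Z im (sgn_act (Hom A X Z im) i (cmp A X X Z i (-1) x h))"
proof -
 interpret E: abelian_group "Hom A X X 0" using hom_group o by blast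
 interpret M: abelian_group "Hom A X Z i" using hom_group o by blast
 have xs: "x : mor A X Z i" by (rule N_sub[OF o x(1)])
 note ar = cmp_amap_right[OF o(1,1,2) xs, of i 0, simplified]
 note id = idn_closed[OF o(1)]
 have d: "dif A X X (-1) h : mor A X X 0" using dif_closed[OF o(1,1) h] by simp
 have k: "im = i + -1" "i = im + 1" "0 = -1 + (1::int)" using i by simp_all
 have "cmp A X X Z i 0 x ((e \<ominus>[Hom A X X 0] idn A X) \<ominus>[Hom A X X 0] dif A X X (-1) h) = \<zero>[Hom A X Z i]"
  using NJ[OF o(1,1,2) x(1) J] by simp
 then have *: "cmp A X X Z i 0 x e \<ominus>[Hom A X Z i] x \<ominus>[Hom A X Z i] cmp A X X Z i 0 x (dif A X X (-1) h) = \<zero>[Hom A X Z i]"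
  using e id d by (simp add: amap_minus[OF ar] idn_right[OF o xs])
 have c: "cmp A X X Z i 0 x e : mor A X Z i" "cmp A X X Z i 0 x (dif A X X (-1) h) : mor A X Z i"
  using amap_closed[OF ar] e d by auto
 have xh: "cmp A X X Z i (-1) x h : mor A X Z im" by (rule cmp_closed[OF o(1,1,2) xs h k(1)])
 have "dif A X Z im (cmp A X X Z i (-1) x h) = sgn_act (Hom A X Z i) i (cmp A X X Z i 0 x (dif A X X (-1) h))"
  using leibniz[OF o(1,1,2) xs h k(1,2) i(1), of 0] x(2) sgn_act_closed[OF M.abelian_group_axioms c(2)]
   amap_zero[OF cmp_amap_left[OF o(1,1,2) h, of i i1]] i
  by simp
 then have l: "dif A X Z im (sgn_act (Hom A X Z im) i (cmp A X X Z i (-1) x h)) = cmp A X X Z i 0 x (dif A X X (-1) h)"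
  using amap_sgn_act[OF dif_amap[OF o k(2)] xh] sgn_act_sgn_act[OF M.abelian_group_axioms c(2)]
  by (simp add: sgn_act_even)
 have "cmp A X X Z i 0 x e = x \<oplus>[Hom A X Z i] cmp A X X Z i 0 x (dif A X X (-1) h) \<oplus>[Hom A X Z i]
  (cmp A X X Z i 0 x e \<ominus>[Hom A X Z i] x \<ominus>[Hom A X Z i] cmp A X X Z i 0 x (dif A X X (-1) h))"
  using c xs by algebra
 then show ?thesis unfolding l * using c xs by simp
qed

text \<open>The map \<open>f\<close> is closed only modulo \<open>J\<close>, but its differential
  kills \<open>x\<close>, so the Leibniz rule has no extra term.\<close>

lemma dif_left_mod:
 assumes o: "X : Ob A" "Y : Ob A" "Z : Ob A" and f: "f : mor A Y Z 0" "dif A Y Z 0 f : J Y Z 1"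
  and x: "x : N X Y i" and i: "i1 = i + 1"
 shows "dif A X Z i (cmp A X Y Z 0 i f x) = cmp A X Y Z 0 i1 f (dif A X Y i x)"
proof -
 interpret M: abelian_group "Hom A X Z i1" using hom_group o by blast
 have xs: "x : mor A X Y i" by (rule N_sub[OF o(1,2) x])
 have k: "i = 0 + i" "i1 = 1 + i" "i1 = 0 + i1" using i by simp_all
 show ?thesis
  using leibniz[OF o f(1) xs k(1) i _ i, of 1] JN[OF o f(2) x k(2)]
   cmp_closed[OF o f(1) dif_closed[OF o(1,2) xs i] k(3)] by (simp add: sgn_act_def)
qed

lemma dif_right_mod:
 assumes o: "X : Ob A" "Y : Ob A" "Z : Ob A" and f: "f : mor A X Y 0" "dif A X Y 0 f : J X Y 1"
  and x: "x : N Y Z i" and i: "i1 = i + 1"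
 shows "dif A X Z i (cmp A X Y Z i 0 x f) = cmp A X Y Z i1 0 (dif A Y Z i x) f"
proof -
 interpret M: abelian_group "Hom A X Z i1" using hom_group o by blast
 have xs: "x : mor A Y Z i" by (rule N_sub[OF o(2,3) x])
 have k: "i = i + 0" "i1 = i1 + 0" using i by simp_all
 show ?thesis
  using leibniz[OF o xs f(1) k(1) i i, of 1] NJ[OF o x f(2) i]
   cmp_closed[OF o dif_closed[OF o(2,3) xs i] f(1) k(2)] sgn_act_zero[OF hom_group[OF o(1,3)]] by simp
qed

text \<open>With \<open>g\<close> inverse to \<open>f\<close> modulo \<open>J\<close>: if fa = db,
  then d(gb) = gfa = a + d(ha), so \<open>a\<close> is the differential of gb - ha. And a closed
  \<open>c\<close> is hit by gc up to the boundary of kc.\<close>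

lemma cone_post:
 assumes o: "X : Ob A" "Y : Ob A" "Z : Ob A" and f: "equiv_mod A J X Y f"
 shows "cone_solvable A N (%i. cmp A Z X Y 0 i f) Z X Z Y"
proof -
 have fc: "f : mor A X Y 0" and df: "dif A X Y 0 f : J X Y 1" using f by (simp_all add: equiv_mod_def)
 obtain g h k where g: "g : mor A Y X 0" "dif A Y X 0 g : J Y X 1"
  and h: "h : mor A X X (-1)"
   "(cmp A X Y X 0 0 g f \<ominus>[Hom A X X 0] idn A X) \<ominus>[Hom A X X 0] dif A X X (-1) h : J X X 0"
  and k: "k : mor A Y Y (-1)"
   "(cmp A Y X Y 0 0 f g \<ominus>[Hom A Y Y 0] idn A Y) \<ominus>[Hom A Y Y 0] dif A Y Y (-1) k : J Y Y 0"
  using f unfolding equiv_mod_def by blast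
 have gf: "cmp A X Y X 0 0 g f : mor A X X 0" and fg: "cmp A Y X Y 0 0 f g : mor A Y Y 0"
  using cmp_closed[OF o(1,2,1) g(1) fc, of 0] cmp_closed[OF o(2,1,2) fc g(1), of 0] by simp_all
 show ?thesis
 proof (rule cone_solvableI[OF o(3,1) o(3,2)])
  show "amap (Hom A Z X i) (Hom A Z Y i) (cmp A Z X Y 0 i f)" for i
   by (rule cmp_amap_right[OF o(3,1,2) fc]) simp
  show "x : N Z X i ==> cmp A Z X Y 0 i f x : N Z Y i" for i x
   using N_left[OF o(3,1,2) fc] by simp
  show "dif A Z Y i (cmp A Z X Y 0 i f x) = cmp A Z X Y 0 i1 f (dif A Z X i x)"
   if "x : N Z X i" "i1 = i + 1" for i i1 x by (rule dif_left_mod[OF o(3,1,2) fc df that])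
  fix i i1 i2 :: int and a b
  assume a: "a : N Z X i1" "dif A Z X i1 a = \<zero>[Hom A Z X i2]" and b: "b : N Z Y i"
   "dif A Z Y i b = cmp A Z X Y 0 i1 f a" and i: "i1 = i + 1" "i2 = i + 2"
  interpret M: abelian_group "Hom A Z X i1" using hom_group o by blast
  have i': "i2 = i1 + 1" "i = i1 - 1" "i = 0 + i" "i = -1 + i1" using i by simp_all
  note as = N_sub[OF o(3,1) a(1)]
  have gb: "cmp A Z Y X 0 i g b : N Z X i" and ha: "cmp A Z X X (-1) i1 h a : N Z X i"
   using N_left[OF o(3,2,1) g(1) b(1) i'(3)] N_left[OF o(3,1,1) h(1) a(1) i'(4)] .
  note gbs = N_sub[OF o(3,1) gb] and has = N_sub[OF o(3,1) ha]
  have "dif A Z X i (cmp A Z Y X 0 i g b) = cmp A Z X X 0 i1 (cmp A X Y X 0 0 g f) a"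
   using dif_left_mod[OF o(3,2,1) g b(1) i(1)] b(2) cmp_assoc[OF o(3,1,2,1) g(1) fc as, of 0 i1] by simp
  also have "\<dots> = a \<oplus>[Hom A Z X i1] dif A Z X i (cmp A Z X X (-1) i1 h a)"
   by (rule mod_idn_left[OF o(1,3) gf h a i'(1,2)])
  finally have "dif A Z X i (cmp A Z Y X 0 i g b \<ominus>[Hom A Z X i] cmp A Z X X (-1) i1 h a) =
   (a \<oplus>[Hom A Z X i1] dif A Z X i (cmp A Z X X (-1) i1 h a)) \<ominus>[Hom A Z X i1] dif A Z X i (cmp A Z X X (-1) i1 h a)"
   using amap_minus[OF dif_amap[OF o(3,1) i(1)] gbs has] by simp
  also have "\<dots> = a" using as dif_closed[OF o(3,1) has i(1)] by algebra
  finally show "\<exists>u\<in>N Z X i. dif A Z X i u = a" using N_minus[OF o(3,1) gb ha] by blast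
 next
  fix i i1 im :: int and c
  assume c: "c : N Z Y i" "dif A Z Y i c = \<zero>[Hom A Z Y i1]" and i: "i1 = i + 1" "im = i - 1"
  have i': "i = 0 + i" "im = -1 + i" "i1 = 0 + i1" using i by simp_all
  note gc = N_left[OF o(3,2,1) g(1) c(1) i'(1)] and kc = N_left[OF o(3,2,2) k(1) c(1) i'(2)]
  have "dif A Z X i (cmp A Z Y X 0 i g c) = \<zero>[Hom A Z X i1]"
   using dif_left_mod[OF o(3,2,1) g c(1) i(1)] c(2) amap_zero[OF cmp_amap_right[OF o(3,2,1) g(1) i'(3)]] by simp
  moreover have "cmp A Z X Y 0 i f (cmp A Z Y X 0 i g c) = c \<oplus>[Hom A Z Y i] dif A Z Y im (cmp A Z Y Y (-1) i k c)"
   using cmp_assoc[OF o(3,2,1,2) fc g(1) N_sub[OF o(3,2) c(1)], of 0 i] mod_idn_left[OF o(2,3) fg k c i] by simp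
  ultimately show "\<exists>p\<in>N Z X i. dif A Z X i p = \<zero>[Hom A Z X i1] &
     (\<exists>v\<in>N Z Y im. cmp A Z X Y 0 i f p = c \<oplus>[Hom A Z Y i] dif A Z Y im v)"
   using gc kc by blast
 qed
qed

lemma cone_pre:
 assumes o: "X : Ob A" "Y : Ob A" "Z : Ob A" and f: "equiv_mod A J X Y f"
 shows "cone_solvable A N (%i x. cmp A X Y Z i 0 x f) Y Z X Z"
proof -
 have fc: "f : mor A X Y 0" and df: "dif A X Y 0 f : J X Y 1" using f by (simp_all add: equiv_mod_def)
 obtain g h k where g: "g : mor A Y X 0" "dif A Y X 0 g : J Y X 1"
  and h: "h : mor A X X (-1)"
   "(cmp A X Y X 0 0 g f \<ominus>[Hom A X X 0] idn A X) \<ominus>[Hom A X X 0] dif A X X (-1) h : J X X 0"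
  and k: "k : mor A Y Y (-1)"
   "(cmp A Y X Y 0 0 f g \<ominus>[Hom A Y Y 0] idn A Y) \<ominus>[Hom A Y Y 0] dif A Y Y (-1) k : J Y Y 0"
  using f unfolding equiv_mod_def by blast
 have gf: "cmp A X Y X 0 0 g f : mor A X X 0" and fg: "cmp A Y X Y 0 0 f g : mor A Y Y 0"
  using cmp_closed[OF o(1,2,1) g(1) fc, of 0] cmp_closed[OF o(2,1,2) fc g(1), of 0] by simp_all
 show ?thesis
 proof (rule cone_solvableI[OF o(2,3) o(1,3)])
  show "amap (Hom A Y Z i) (Hom A X Z i) (%x. cmp A X Y Z i 0 x f)" for i
   by (rule cmp_amap_left[OF o fc]) simp
  show "x : N Y Z i ==> cmp A X Y Z i 0 x f : N X Z i" for i x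
   using N_right[OF o _ fc] by simp
  show "dif A X Z i (cmp A X Y Z i 0 x f) = cmp A X Y Z i1 0 (dif A Y Z i x) f"
   if "x : N Y Z i" "i1 = i + 1" for i i1 x by (rule dif_right_mod[OF o fc df that])
  fix i i1 i2 :: int and a b
  assume a: "a : N Y Z i1" "dif A Y Z i1 a = \<zero>[Hom A Y Z i2]" and b: "b : N X Z i"
   "dif A X Z i b = cmp A X Y Z i1 0 a f" and i: "i1 = i + 1" "i2 = i + 2"
  interpret M: abelian_group "Hom A Y Z i1" using hom_group o by blast
  have i': "i2 = i1 + 1" "i = i1 - 1" "i = i + 0" "i = i1 + -1" using i by simp_all
  note as = N_sub[OF o(2,3) a(1)]
  \<comment> \<open>The sign is that of the homotopy in \<open>mod_idn_right\<close>, taken in the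
    degree of \<open>a\<close>.\<close>
  let ?ak = "sgn_act (Hom A Y Z i) i1 (cmp A Y Y Z i1 (-1) a k)"
  have bg: "cmp A Y X Z i 0 b g : N Y Z i" and ak: "?ak : N Y Z i"
   using N_right[OF o(2,1,3) b(1) g(1) i'(3)] N_sgn[OF o(2,3) N_right[OF o(2,2,3) a(1) k(1) i'(4)]] .
  note bgs = N_sub[OF o(2,3) bg] and aks = N_sub[OF o(2,3) ak]
  have "dif A Y Z i (cmp A Y X Z i 0 b g) = cmp A Y Y Z i1 0 a (cmp A Y X Y 0 0 f g)"
   using dif_right_mod[OF o(2,1,3) g b(1) i(1)] b(2) cmp_assoc[OF o(2,1,2,3) as fc g(1), of i1 0] by simp
  also have "\<dots> = a \<oplus>[Hom A Y Z i1] dif A Y Z i ?ak"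
   by (rule mod_idn_right[OF o(2,3) fg k a i'(1,2)])
  finally have "dif A Y Z i (cmp A Y X Z i 0 b g \<ominus>[Hom A Y Z i] ?ak) =
   (a \<oplus>[Hom A Y Z i1] dif A Y Z i ?ak) \<ominus>[Hom A Y Z i1] dif A Y Z i ?ak"
   using amap_minus[OF dif_amap[OF o(2,3) i(1)] bgs aks] by simp
  also have "\<dots> = a" using as dif_closed[OF o(2,3) aks i(1)] by algebra
  finally show "\<exists>u\<in>N Y Z i. dif A Y Z i u = a" using N_minus[OF o(2,3) bg ak] by blast
 next
  fix i i1 im :: int and c
  assume c: "c : N X Z i" "dif A X Z i c = \<zero>[Hom A X Z i1]" and i: "i1 = i + 1" "im = i - 1"
  have i': "i = i + 0" "im = i + -1" "i1 = i1 + 0" using i by simp_all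
  note cg = N_right[OF o(2,1,3) c(1) g(1) i'(1)]
   and ch = N_sgn[OF o(1,3) N_right[OF o(1,1,3) c(1) h(1) i'(2)], of i]
  have "dif A Y Z i (cmp A Y X Z i 0 c g) = \<zero>[Hom A Y Z i1]"
   using dif_right_mod[OF o(2,1,3) g c(1) i(1)] c(2) amap_zero[OF cmp_amap_left[OF o(2,1,3) g(1) i'(3)]] by simp
  moreover have "cmp A X Y Z i 0 (cmp A Y X Z i 0 c g) f =
    c \<oplus>[Hom A X Z i] dif A X Z im (sgn_act (Hom A X Z im) i (cmp A X X Z i (-1) c h))"
   using cmp_assoc[OF o(1,2,1,3) N_sub[OF o(1,3) c(1)] g(1) fc, of i 0] mod_idn_right[OF o(1,3) gf h c i] by simp
  ultimately show "\<exists>p\<in>N Y Z i. dif A Y Z i p = \<zero>[Hom A Y Z i1] &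
     (\<exists>v\<in>N X Z im. cmp A X Y Z i 0 p f = c \<oplus>[Hom A X Z i] dif A X Z im v)"
   using cg ch by blast
 qed
qed

end

lemma (in abelian_group) minus_r_zero: "x : carrier G ==> x \<ominus> \<zero> = x"
 by (simp add: a_minus_def)

context cdg
begin

lemma ann_pair_all: "ann_pair A (%E F i. mor A E F i) (%E F i. {\<zero>[Hom A E F i]})"
proof (intro ann_pair.intro ann_pair_axioms.intro cdg_axioms)
 fix E F x y and i j :: int assume o: "E : Ob A" "F : Ob A"
 interpret M: abelian_group "Hom A E F i" using hom_group o by blast
 show "\<zero>[Hom A E F i] : mor A E F i" by simp
 show "x : {\<zero>[Hom A E F i]} ==> x : mor A E F i" by simp
 assume x: "x : mor A E F i"
 show "\<ominus>[Hom A E F i] x : mor A E F i" using x by simp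
 show "y : mor A E F i ==> x \<oplus>[Hom A E F i] y : mor A E F i" using x by simp
 show "j = i + 1 ==> dif A E F i x : mor A E F j" using dif_closed[OF o x] by simp
next
 fix E F G g x and i j k :: int
 assume o: "E : Ob A" "F : Ob A" "G : Ob A" and k: "k = i + j"
 show "g : {\<zero>[Hom A F G i]} ==> x : mor A E F j ==> cmp A E F G i j g x = \<zero>[Hom A E G k]"
  using amap_zero[OF cmp_amap_left[OF o _ k]] by simp
 show "x : mor A F G i ==> g : {\<zero>[Hom A E F j]} ==> cmp A E F G i j x g = \<zero>[Hom A E G k]"
  using amap_zero[OF cmp_amap_right[OF o _ k]] by simp
qed (auto intro: cmp_closed)

lemma equivalence_equiv_mod:
 assumes o: "X : Ob A" "Y : Ob A" and f: "equivalence A X Y f"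
 shows "equiv_mod A (%E F i. {\<zero>[Hom A E F i]}) X Y f"
proof -
 interpret M: abelian_group "Hom A X X 0" using hom_group o by blast
 interpret N: abelian_group "Hom A Y Y 0" using hom_group o by blast
 obtain g where g: "g : cocycle0 A Y X" "homologous0 A X X (cmp A X Y X 0 0 g f) (idn A X)"
  "homologous0 A Y Y (cmp A Y X Y 0 0 f g) (idn A Y)" and fc: "f : cocycle0 A X Y"
  using f by (auto simp: equivalence_def)
 obtain h k where h: "h : mor A X X (-1)" "cmp A X Y X 0 0 g f \<ominus>[Hom A X X 0] idn A X = dif A X X (-1) h"
  and k: "k : mor A Y Y (-1)" "cmp A Y X Y 0 0 f g \<ominus>[Hom A Y Y 0] idn A Y = dif A Y Y (-1) k"
  using g(2,3) unfolding homologous0_def by blast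
 have "dif A X X (-1) h : mor A X X 0" "dif A Y Y (-1) k : mor A Y Y 0"
  using dif_closed[OF o(1,1) h(1)] dif_closed[OF o(2,2) k(1)] by simp_all
 then have "cmp A X Y X 0 0 g f \<ominus>[Hom A X X 0] idn A X \<ominus>[Hom A X X 0] dif A X X (-1) h = \<zero>[Hom A X X 0]"
  "cmp A Y X Y 0 0 f g \<ominus>[Hom A Y Y 0] idn A Y \<ominus>[Hom A Y Y 0] dif A Y Y (-1) k = \<zero>[Hom A Y Y 0]"
  unfolding h(2) k(2) by (simp_all add: M.minus_self N.minus_self)
 then show ?thesis unfolding equiv_mod_def
  using cocycle0_closed[OF fc] cocycle0_dif[OF fc] cocycle0_closed[OF g(1)] cocycle0_dif[OF g(1)] h(1) k(1)
  by blast
qed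

end

section \<open>The kernel of a functor as an ideal\<close>

context dgfun
begin

definition kern :: "'o => 'o => int => 'm set" where
 "kern E F i = {f : mor A E F i. Fm E F i f = \<zero>[Hom B (Fo E) (Fo F) i]}"

lemma kernI: "f : mor A E F i ==> Fm E F i f = \<zero>[Hom B (Fo E) (Fo F) i] ==> f : kern E F i"
 by (simp add: kern_def)

lemma kernD: "f : kern E F i ==> f : mor A E F i"
 "f : kern E F i ==> Fm E F i f = \<zero>[Hom B (Fo E) (Fo F) i]"
 by (simp_all add: kern_def)

text \<open>The kernel is always an ideal stable under the differential; only the annihilation by
  \<open>J\<close> has to be supplied.\<close>

lemma ann_pair_kern:
 assumes J_sub: "!!E F x i. [|E : Ob A; F : Ob A; x : J E F i|] ==> x : mor A E F i"
  and JN: "!!E F G g x i j k. [|E : Ob A; F : Ob A; G : Ob A; g : J F G i; x : kern E F j; k = i + j|]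
   ==> cmp A E F G i j g x = \<zero>[Hom A E G k]"
  and NJ: "!!E F G x f i j k. [|E : Ob A; F : Ob A; G : Ob A; x : kern F G i; f : J E F j; k = i + j|]
   ==> cmp A E F G i j x f = \<zero>[Hom A E G k]"
 shows "ann_pair A kern J"
proof (intro ann_pair.intro ann_pair_axioms.intro A.cdg_axioms)
 fix E F x y and i j :: int assume o: "E : Ob A" "F : Ob A"
 note am = Fm_amap[OF o]
 interpret M: abelian_group "Hom A E F i" using A.hom_group o by blast
 interpret N: abelian_group "Hom B (Fo E) (Fo F) i" using B.hom_group Fo_Ob o by blast
 show "\<zero>[Hom A E F i] : kern E F i" using amap_zero[OF am] by (simp add: kern_def)
 assume x: "x : kern E F i"
 show "x : mor A E F i" using kernD[OF x] by simp
 show "\<ominus>[Hom A E F i] x : kern E F i" using kernD[OF x] amap_neg[OF am] by (simp add: kern_def)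
 show "y : kern E F i ==> x \<oplus>[Hom A E F i] y : kern E F i" using kernD[OF x] kernD[of y]
  by (auto intro!: kernI simp: amap_add[OF am])
 show "j = i + 1 ==> dif A E F i x : kern E F j" using kernD[OF x] A.dif_closed[OF o] Fm_dif[OF o]
   amap_zero[OF B.dif_amap[OF Fo_Ob[OF o(1)] Fo_Ob[OF o(2)]]] by (auto intro!: kernI)
next
 fix E F G g x and i j k :: int
 assume o: "E : Ob A" "F : Ob A" "G : Ob A" and k: "k = i + j"
 note o' = Fo_Ob[OF o(1)] Fo_Ob[OF o(2)] Fo_Ob[OF o(3)]
 show "g : mor A F G i ==> x : kern E F j ==> cmp A E F G i j g x : kern E G k"
  using A.cmp_closed[OF o _ _ k] Fm_cmp[OF o _ _ k] amap_zero[OF B.cmp_amap_right[OF o' _ k]] Fm_closed[OF o(2,3)] kernD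
  by (auto intro!: kernI)
 show "x : kern F G i ==> g : mor A E F j ==> cmp A E F G i j x g : kern E G k"
  using A.cmp_closed[OF o _ _ k] Fm_cmp[OF o _ _ k] amap_zero[OF B.cmp_amap_left[OF o' _ k]] Fm_closed[OF o(1,2)] kernD
  by (auto intro!: kernI)
qed (use J_sub JN NJ in blast)+

lemma ann_pair_kern_zero: "ann_pair A kern (%E F i. {\<zero>[Hom A E F i]})"
proof -
 interpret all: ann_pair A "%E F i. mor A E F i" "%E F i. {\<zero>[Hom A E F i]}"
  by (rule A.ann_pair_all)
 show ?thesis using all.J_sub all.JN all.NJ kernD(1) by (intro ann_pair_kern) auto
qed

text \<open>The inverse and both homotopies are lifted as mere elements. Each equation that they
  satisfy below then holds up to the kernel, and this is what the notion allows.\<close>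

lemma kern_equiv_mod:
 assumes surj: "!!E F i y. [|E : Ob A; F : Ob A; y : mor B (Fo E) (Fo F) i|] ==>
   \<exists>x\<in>mor A E F i. Fm E F i x = y"
  and o: "X : Ob A" "Y : Ob A" and f: "f : mor A X Y 0"
  and e: "equivalence B (Fo X) (Fo Y) (Fm X Y 0 f)"
 shows "equiv_mod A kern X Y f"
proof -
 note o' = Fo_Ob[OF o(1)] Fo_Ob[OF o(2)]
 obtain g where g: "g : cocycle0 B (Fo Y) (Fo X)"
  "homologous0 B (Fo X) (Fo X) (cmp B (Fo X) (Fo Y) (Fo X) 0 0 g (Fm X Y 0 f)) (idn B (Fo X))"
  "homologous0 B (Fo Y) (Fo Y) (cmp B (Fo Y) (Fo X) (Fo Y) 0 0 (Fm X Y 0 f) g) (idn B (Fo Y))"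
  and fc: "Fm X Y 0 f : cocycle0 B (Fo X) (Fo Y)"
  using e unfolding equivalence_def by blast
 obtain g' where g': "g' : mor A Y X 0" "Fm Y X 0 g' = g"
  using surj[OF o(2,1) B.cocycle0_closed[OF g(1)]] by blast
 have *: "\<exists>h\<in>mor A Z Z (-1). (x \<ominus>[Hom A Z Z 0] idn A Z) \<ominus>[Hom A Z Z 0] dif A Z Z (-1) h : kern Z Z 0"
  if Z: "Z : Ob A" and x: "x : mor A Z Z 0" "homologous0 B (Fo Z) (Fo Z) (Fm Z Z 0 x) (idn B (Fo Z))" for x Z
 proof -
  interpret M: abelian_group "Hom A Z Z 0" using A.hom_group Z by blast
  interpret N: abelian_group "Hom B (Fo Z) (Fo Z) 0" using B.hom_group Fo_Ob Z by blast
  obtain k where k: "k : mor B (Fo Z) (Fo Z) (-1)"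
   "Fm Z Z 0 x \<ominus>[Hom B (Fo Z) (Fo Z) 0] idn B (Fo Z) = dif B (Fo Z) (Fo Z) (-1) k"
   using x(2) unfolding homologous0_def by blast
  obtain h where h: "h : mor A Z Z (-1)" "Fm Z Z (-1) h = k" using surj[OF Z Z k(1)] by blast
  have d: "dif A Z Z (-1) h : mor A Z Z 0" using A.dif_closed[OF Z Z h(1)] by simp
  note am = Fm_amap[OF Z Z, of 0] and id = A.idn_closed[OF Z]
  have "Fm Z Z 0 ((x \<ominus>[Hom A Z Z 0] idn A Z) \<ominus>[Hom A Z Z 0] dif A Z Z (-1) h) = \<zero>[Hom B (Fo Z) (Fo Z) 0]"
   using x id d k(2) Fm_dif[OF Z Z h(1), of 0] h(2) N.minus_self[OF amap_closed[OF am d]]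
   by (simp add: amap_minus[OF am] Fm_idn[OF Z])
  then show ?thesis using h(1) x id d by (intro bexI[of _ h] kernI) auto
 qed
 have "dif A X Y 0 f : kern X Y 1" "dif A Y X 0 g' : kern Y X 1"
  using A.dif_closed[OF o f] Fm_dif[OF o f] B.cocycle0_dif[OF fc] A.dif_closed[OF o(2,1) g'(1)]
   Fm_dif[OF o(2,1) g'(1)] B.cocycle0_dif[OF g(1)] g'(2) by (auto intro!: kernI)
 moreover have "\<exists>h\<in>mor A X X (-1). (cmp A X Y X 0 0 g' f \<ominus>[Hom A X X 0] idn A X) \<ominus>[Hom A X X 0] dif A X X (-1) h : kern X X 0"
  by (rule *[OF o(1)])
   (use A.cmp_closed[OF o(1,2,1) g'(1) f, of 0] Fm_cmp[OF o(1,2,1) g'(1) f, of 0] g(2) g'(2) in simp_all)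
 moreover have "\<exists>h\<in>mor A Y Y (-1). (cmp A Y X Y 0 0 f g' \<ominus>[Hom A Y Y 0] idn A Y) \<ominus>[Hom A Y Y 0] dif A Y Y (-1) h : kern Y Y 0"
  by (rule *[OF o(2)])
   (use A.cmp_closed[OF o(2,1,2) f g'(1), of 0] Fm_cmp[OF o(2,1,2) f g'(1), of 0] g(3) g'(2) in simp_all)
 ultimately show ?thesis unfolding equiv_mod_def using f g'(1) by blast
qed

end

text \<open>An inverse modulo \<open>J\<close> has two defects, in being closed and in being
  inverse. They form a cocycle in the cone of composition with \<open>f\<close>, on either side.
  Correcting for each side separately yields a right and a left inverse, which
  \<open>equivalenceI\<close> combines.\<close>

lemma (in ann_pair) equiv_mod_lift:
 assumes A: "adg A" and NJ: "N = J"
  and o: "X : Ob A" "Y : Ob A" and f: "f : cocycle0 A X Y" and e: "equiv_mod A J X Y f"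
 shows "equivalence A X Y f"
proof -
 interpret A: adg A by (rule A)
 note fc = cocycle0_closed[OF f]
 obtain g h k where g: "g : mor A Y X 0" "dif A Y X 0 g : J Y X 1"
  and h: "h : mor A X X (-1)"
   "(cmp A X Y X 0 0 g f \<ominus>[Hom A X X 0] idn A X) \<ominus>[Hom A X X 0] dif A X X (-1) h : J X X 0"
  and k: "k : mor A Y Y (-1)"
   "(cmp A Y X Y 0 0 f g \<ominus>[Hom A Y Y 0] idn A Y) \<ominus>[Hom A Y Y 0] dif A Y Y (-1) k : J Y Y 0"
  using e unfolding equiv_mod_def by blast
 interpret YX0: abelian_group "Hom A Y X 0" using hom_group o by blast
 interpret YX1: abelian_group "Hom A Y X 1" using hom_group o by blast
 interpret YX2: abelian_group "Hom A Y X 2" using hom_group o by blast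
 note dg = N_sub[OF o(2,1) g(2)[folded NJ]]
 let ?a = "\<ominus>[Hom A Y X 1] dif A Y X 0 g"
 have a: "?a : N Y X 1" using g(2) NJ N_neg o by blast
 have da: "dif A Y X 1 ?a = \<zero>[Hom A Y X 2]"
  using amap_neg[OF dif_amap[OF o(2,1), of 2 1] dg] A.dif_dif[OF o(2,1) g(1), of 1 2] by simp
 \<comment> \<open>\<open>T\<close> stands for composition with \<open>f\<close> on one side. The
   cocycle is (-dg, -(Tg - 1 - dk)); its solution u, v makes g + u closed with T(g + u) = 1 + d(k +
   v).\<close>
 have adj: "\<exists>u\<in>mor A Y X 0. dif A Y X 0 u = \<zero>[Hom A Y X 1] & homologous0 A Z Z (T 0 u) (idn A Z)"
  if Z: "Z : Ob A" and T: "!!i. amap (Hom A Y X i) (Hom A Z Z i) (T i)"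
   and Td: "!!x. x : mor A Y X 0 ==> dif A Z Z 0 (T 0 x) = T 1 (dif A Y X 0 x)"
   and c: "cone_solvable A N T Y X Z Z"
   and k: "k : mor A Z Z (-1)" "(T 0 g \<ominus>[Hom A Z Z 0] idn A Z) \<ominus>[Hom A Z Z 0] dif A Z Z (-1) k : J Z Z 0"
  for T Z k
 proof -
  interpret Z0: abelian_group "Hom A Z Z 0" using hom_group Z by blast
  interpret Z1: abelian_group "Hom A Z Z 1" using hom_group Z by blast
  note id = idn_closed[OF Z] and Tg = amap_closed[OF T g(1)]
  have dk: "dif A Z Z (-1) k : mor A Z Z 0" using dif_closed[OF Z Z k(1)] by simp
  let ?b = "\<ominus>[Hom A Z Z 0] ((T 0 g \<ominus>[Hom A Z Z 0] idn A Z) \<ominus>[Hom A Z Z 0] dif A Z Z (-1) k)"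
  have b: "?b : N Z Z 0" using k(2) NJ N_neg Z by blast
  note d = dif_amap[OF Z Z, of 1 0, simplified]
  have "dif A Z Z 0 ?b = T 1 ?a"
   using Tg id dk A.dif_dif[OF Z Z k(1), of 0 1] dif_idn[OF Z] Td[OF g(1)] amap_closed[OF T dg]
   by (simp add: amap_neg[OF d] amap_minus[OF d] amap_neg[OF T dg] Z1.minus_r_zero)
  from cone_solvableD[OF c a da b this, of "-1"] obtain u v where u: "u : N Y X 0" "v : N Z Z (-1)"
   "dif A Y X 0 u = ?a" "T 0 u = ?b \<oplus>[Hom A Z Z 0] dif A Z Z (-1) v" by auto
  note us = N_sub[OF o(2,1) u(1)] and vs = N_sub[OF Z Z u(2)]
  have dv: "dif A Z Z (-1) v : mor A Z Z 0" using dif_closed[OF Z Z vs] by simp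
  interpret Zm: abelian_group "Hom A Z Z (-1)" using hom_group Z by blast
  have "T 0 (g \<oplus>[Hom A Y X 0] u) = idn A Z \<oplus>[Hom A Z Z 0] (dif A Z Z (-1) k \<oplus>[Hom A Z Z 0] dif A Z Z (-1) v)"
   unfolding amap_add[OF T g(1) us] u(4) using Tg id dk dv by algebra
  then have "T 0 (g \<oplus>[Hom A Y X 0] u) = idn A Z \<oplus>[Hom A Z Z 0] dif A Z Z (-1) (k \<oplus>[Hom A Z Z (-1)] v)"
   using amap_add[OF dif_amap[OF Z Z, of 0 "-1"] k(1) vs] by simp
  then have "homologous0 A Z Z (T 0 (g \<oplus>[Hom A Y X 0] u)) (idn A Z)"
   unfolding homologous0_iff[OF Z Z amap_closed[OF T YX0.a_closed[OF g(1) us]] id]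
   using k(1) vs by blast
  moreover have "dif A Y X 0 (g \<oplus>[Hom A Y X 0] u) = \<zero>[Hom A Y X 1]"
   using amap_add[OF dif_amap[OF o(2,1), of 1 0] g(1) us] u(3) dg by (simp add: YX1.r_neg)
  ultimately show ?thesis using g(1) us by blast
 qed
 interpret X1: abelian_group "Hom A X X 1" using hom_group o by blast
 interpret Y1: abelian_group "Hom A Y Y 1" using hom_group o by blast
 have "\<exists>u\<in>mor A Y X 0. dif A Y X 0 u = \<zero>[Hom A Y X 1] & homologous0 A Y Y (cmp A Y X Y 0 0 f u) (idn A Y)"
 proof (rule adj[OF o(2) _ _ cone_post[OF o o(2) e] k])
  show "dif A Y Y 0 (cmp A Y X Y 0 0 f x) = cmp A Y X Y 0 1 f (dif A Y X 0 x)" if x: "x : mor A Y X 0" for x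
   using leibniz[OF o(2,1,2) fc x, of 0 1 1 1] amap_zero[OF cmp_amap_left[OF o(2,1,2) x, of 1 1]]
    cmp_closed[OF o(2,1,2) fc dif_closed[OF o(2,1) x, of 1], of 1]
   by (simp add: cocycle0_dif[OF f] sgn_act_def)
 qed (use cmp_amap_right[OF o(2,1,2) fc] in simp)
 moreover have "\<exists>u\<in>mor A Y X 0. dif A Y X 0 u = \<zero>[Hom A Y X 1] & homologous0 A X X (cmp A X Y X 0 0 u f) (idn A X)"
 proof (rule adj[OF o(1) _ _ cone_pre[OF o o(1) e] h])
  show "dif A X X 0 (cmp A X Y X 0 0 x f) = cmp A X Y X 1 0 (dif A Y X 0 x) f" if x: "x : mor A Y X 0" for x
   using leibniz[OF o(1,2,1) x fc, of 0 1 1 1] amap_zero[OF cmp_amap_right[OF o(1,2,1) x, of 1 1]]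
    cmp_closed[OF o(1,2,1) dif_closed[OF o(2,1) x, of 1] fc, of 1]
   by (simp add: cocycle0_dif[OF f] sgn_act_def)
 qed (use cmp_amap_left[OF o(1,2,1) fc] in simp)
 ultimately show ?thesis
  using equivalenceI[OF o f] unfolding cocycle0_def by blast
qed

subsection \<open>Deformations of Maurer-Cartan objects\<close>

text \<open>The Bianchi identity for the curvature R of \<open>\<zeta>\<close>: dR =
  (d\<zeta>)\<zeta> - \<zeta>(d\<zeta>), while \<zeta>R - R\<zeta> is the negative of this because
  the triple products cancel.\<close>

lemma (in adg) dif_curv:
 assumes Y: "Y : Ob (pMC A)"
 shows "dif (pMC A) Y Y 2 (curv A Y) = \<zero>[Hom (pMC A) Y Y 3]"
proof -
 obtain F \<zeta> where Y': "Y = (F, \<zeta>)" by (cases Y)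
 have o: "F : Ob A" and z: "\<zeta> : mor A F F 1" using Y by (simp_all add: pMC_Ob Y')
 have d: "dif A F F 1 \<zeta> : mor A F F 2" "cmp A F F F 1 1 \<zeta> \<zeta> : mor A F F 2"
  using dif_closed[OF o o z, of 2] cmp_closed[OF o o o z z, of 2] by simp_all
 interpret M: abelian_group "Hom A F F 3" using hom_group o by blast
 interpret M2: abelian_group "Hom A F F 2" using hom_group o by blast
 let ?p = "cmp A F F F 2 1 (dif A F F 1 \<zeta>) \<zeta>" and ?q = "cmp A F F F 1 2 \<zeta> (dif A F F 1 \<zeta>)"
  and ?r = "cmp A F F F 1 2 \<zeta> (cmp A F F F 1 1 \<zeta> \<zeta>)"
 have c: "?p : mor A F F 3" "?q : mor A F F 3" "?r : mor A F F 3"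
  using cmp_closed[OF o o o d(1) z, of 3] cmp_closed[OF o o o z d(1), of 3] cmp_closed[OF o o o z d(2), of 3] by simp_all
 have 1: "dif A F F 2 (curv A Y) = \<zero>[Hom A F F 3] \<oplus>[Hom A F F 3] (?p \<oplus>[Hom A F F 3] \<ominus>[Hom A F F 3] ?q)"
 proof -
  have "dif A F F 2 (dif A F F 1 \<zeta>) = \<zero>[Hom A F F 3]" by (rule dif_dif[OF o o z]) auto
  moreover have "dif A F F 2 (cmp A F F F 1 1 \<zeta> \<zeta>) = ?p \<oplus>[Hom A F F 3] sgn_act (Hom A F F 3) 1 ?q"
   by (rule leibniz[OF o o o z z]) auto
  moreover have "dif A F F 2 (curv A Y) = dif A F F 2 (dif A F F 1 \<zeta>) \<oplus>[Hom A F F 3] dif A F F 2 (cmp A F F F 1 1 \<zeta> \<zeta>)"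
   unfolding curv_def Y' split by (rule amap_add[OF dif_amap[OF o o] d]) auto
  ultimately show ?thesis by (simp only: sgn_act_odd[OF odd_one])
 qed
 have 2: "cmp A F F F 1 2 \<zeta> (curv A Y) = ?q \<oplus>[Hom A F F 3] ?r"
  using amap_add[OF cmp_amap_right[OF o o o z, of 3 2] d] by (simp add: curv_def Y')
 have 3: "cmp A F F F 2 1 (curv A Y) \<zeta> = ?p \<oplus>[Hom A F F 3] ?r"
 proof -
  have "cmp A F F F 2 1 (cmp A F F F 1 1 \<zeta> \<zeta>) \<zeta> = ?r" by (rule cmp_assoc[OF o o o o z z z]) auto
  moreover have "cmp A F F F 2 1 (curv A Y) \<zeta> = ?p \<oplus>[Hom A F F 3] cmp A F F F 2 1 (cmp A F F F 1 1 \<zeta> \<zeta>) \<zeta>"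
   unfolding curv_def Y' split by (rule amap_add[OF cmp_amap_left[OF o o o z] d]) auto
  ultimately show ?thesis by (simp only:)
 qed
 show ?thesis
  unfolding pMC_simps(4)[of 3 2, simplified] unfolding pMC_simps(1)
  unfolding Y' fst_conv snd_conv 1[unfolded Y'] 2[unfolded Y'] 3[unfolded Y'] sgn_act_even[of 2, simplified]
  using c by algebra
qed

text \<open>The notion of equivalence does not refer to the set of objects, the only difference
  between the two categories. An equivalence over the quotient can thus be lifted while its target
  is still curved.\<close>

lemma equivalence_pMC: "equivalence (pMC A) = equivalence (MC A)"
 unfolding equivalence_def[abs_def] cocycle0_def homologous0_def pMC_MC ..

locale square_zero = dgfun A B Fo Fm + A: adg A + B: adg B for A B Fo Fm +
 assumes surj: "[|E : Ob A; F : Ob A; y : mor B (Fo E) (Fo F) i|] ==>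
   \<exists>x\<in>mor A E F i. Fm E F i x = y"
  and kern_mult: "[|E : Ob A; F : Ob A; G : Ob A; g : kern F G i; f : kern E F j; k = i + j|]
   ==> cmp A E F G i j g f = \<zero>[Hom A E G k]"
begin

abbreviation "Fo' \<equiv> %X. (Fo (fst X), Fm (fst X) (fst X) 1 (snd X))"
abbreviation "Fm' \<equiv> %X Y. Fm (fst X) (fst Y)"

sublocale p: dgfun "pMC A" "pMC B" Fo' Fm' by (rule pMC_dgfun)
sublocale m: dgfun "MC A" "MC B" Fo' Fm' by (rule MC_dgfun[OF A.adg_axioms B.adg_axioms dgfun_axioms])

lemma kern_eq: "p.kern X Y i = kern (fst X) (fst Y) i" "m.kern X Y i = kern (fst X) (fst Y) i"
 by (simp_all add: p.kern_def m.kern_def kern_def pMC_simps MC_simps)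

sublocale pk: ann_pair "pMC A" p.kern p.kern
 using kern_mult by (intro p.ann_pair_kern) (auto simp: kern_eq pMC_Ob pMC_simps kernD)

sublocale mk: ann_pair "MC A" m.kern m.kern
 using kern_mult by (intro m.ann_pair_kern) (auto simp: kern_eq MC_Ob pMC_Ob MC_simps kernD)

lemma p_surj: "[|E : Ob (pMC A); F : Ob (pMC A); y : mor (pMC B) (Fo' E) (Fo' F) i|] ==>
   \<exists>x\<in>mor (pMC A) E F i. Fm' E F i x = y"
 using surj by (auto simp: pMC_Ob pMC_simps)

lemma m_surj: "[|E : Ob (MC A); F : Ob (MC A); y : mor (MC B) (Fo' E) (Fo' F) i|] ==>
   \<exists>x\<in>mor (MC A) E F i. Fm' E F i x = y"
 using surj by (auto simp: MC_Ob pMC_Ob MC_simps)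

lemma p_kern_equiv_mod:
 assumes "X : Ob (pMC A)" "Y : Ob (pMC A)" "f : mor (pMC A) X Y 0"
  "equivalence (pMC B) (Fo' X) (Fo' Y) (Fm' X Y 0 f)"
 shows "equiv_mod (pMC A) p.kern X Y f"
 by (rule p.kern_equiv_mod) (fact p_surj assms)+

lemma m_kern_equiv_mod:
 assumes "X : Ob (MC A)" "Y : Ob (MC A)" "f : mor (MC A) X Y 0"
  "equivalence (MC B) (Fo' X) (Fo' Y) (Fm' X Y 0 f)"
 shows "equiv_mod (MC A) m.kern X Y f"
 by (rule m.kern_equiv_mod) (fact m_surj assms)+

lemma curv_kern:
 assumes Y: "Y : Ob (pMC A)" "Fo' Y : Ob (MC B)" shows "curv A Y : p.kern Y Y 2"
 using A.curv_closed[OF Y(1)] Fm_curv[OF Y(1)] Y(2) by (simp add: p.kern_def pMC_simps MC_Ob)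

text \<open>The quadratic term \<open>u u\<close> vanishes in a square-zero kernel, so the curvature
  is affine in \<open>u\<close> and its linear part is the twisted differential.\<close>

lemma curv_deform:
 assumes Y: "(F, \<zeta>) : Ob (pMC A)" and u: "u : kern F F 1"
 shows "curv A (F, \<zeta> \<oplus>[Hom A F F 1] u) = curv A (F, \<zeta>) \<oplus>[Hom A F F 2] dif (pMC A) (F, \<zeta>) (F, \<zeta>) 1 u"
proof -
 have o: "F : Ob A" and z: "\<zeta> : mor A F F 1" using Y by (simp_all add: pMC_Ob)
 note us = kernD(1)[OF u]
 interpret M: abelian_group "Hom A F F 1" using A.hom_group o by blast
 interpret M2: abelian_group "Hom A F F 2" using A.hom_group o by blast
 note al = A.cmp_amap_left[OF o o o, of _ 1 2 1, simplified] and ar = A.cmp_amap_right[OF o o o, of _ 1 2 1, simplified]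
  and d = A.dif_amap[OF o o, of 2 1, simplified]
 have c: "dif A F F 1 \<zeta> : mor A F F 2" "dif A F F 1 u : mor A F F 2"
  "cmp A F F F 1 1 \<zeta> \<zeta> : mor A F F 2" "cmp A F F F 1 1 \<zeta> u : mor A F F 2"
  "cmp A F F F 1 1 u \<zeta> : mor A F F 2"
  using amap_closed[OF d] amap_closed[OF ar] z us by auto
 have "cmp A F F F 1 1 u u = \<zero>[Hom A F F 2]" using kern_mult[OF o o o u u] by simp
 then have "cmp A F F F 1 1 (\<zeta> \<oplus>[Hom A F F 1] u) (\<zeta> \<oplus>[Hom A F F 1] u) =
  (cmp A F F F 1 1 \<zeta> \<zeta> \<oplus>[Hom A F F 2] cmp A F F F 1 1 u \<zeta>) \<oplus>[Hom A F F 2] cmp A F F F 1 1 \<zeta> u"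
  using amap_add[OF ar[OF M.a_closed[OF z us]] z us] amap_add[OF al[OF z] z us] amap_add[OF al[OF us] z us] c by simp
 then show ?thesis
  unfolding pMC_simps(4)[of 2 1, simplified] curv_def split amap_add[OF d z us] fst_conv snd_conv
   sgn_act_odd[of 1, simplified]
  using c by simp algebra
qed

text \<open>For arbitrary lifts \<open>\<zeta>\<close> and \<open>f\<close>, let R be the curvature
  of \<open>\<zeta>\<close> and S the twisted differential of \<open>f\<close>; both lie in the
  kernel. If (u, v) solves the cone problem for (-R, -S), then \<open>\<zeta>\<close> + u and f - v
  satisfy the equations exactly.\<close>

lemma lift_target:
 assumes X: "X : Ob (MC A)" and F: "F : Ob A" and Y': "(Fo F, \<zeta>') : Ob (MC B)"
  and e: "equivalence (MC B) (Fo' X) (Fo F, \<zeta>') f'"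
 shows "\<exists>\<zeta> f. (F, \<zeta>) : Ob (MC A) & Fm F F 1 \<zeta> = \<zeta>' & f : mor A (fst X) F 0 &
  Fm (fst X) F 0 f = f' & equivalence (MC A) X (F, \<zeta>) f"
proof -
 have z': "\<zeta>' : mor B (Fo F) (Fo F) 1" using Y' by (simp add: MC_Ob pMC_Ob)
 obtain \<zeta> where z: "\<zeta> : mor A F F 1" "Fm F F 1 \<zeta> = \<zeta>'" using surj[OF F F z'] by blast
 define Y where "Y = (F, \<zeta>)"
 have Yp: "Y : Ob (pMC A)" and FoY: "Fo' Y = (Fo F, \<zeta>')" using F z by (simp_all add: pMC_Ob Y_def)
 have Xp: "X : Ob (pMC A)" and Xa: "fst X : Ob A" and Xc: "curv A X = \<zero>[Hom A (fst X) (fst X) 2]"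
  using X by (auto simp: MC_Ob pMC_Ob)
 have f'c: "f' : mor B (Fo (fst X)) (Fo F) 0"
  using m.B.cocycle0_closed[OF m.B.equivalence_cocycle[OF e]] by (simp add: MC_simps)
 obtain f where f: "f : mor A (fst X) F 0" "Fm (fst X) F 0 f = f'" using surj[OF Xa F f'c] by blast
 have fp: "f : mor (pMC A) X Y 0" using f by (simp add: pMC_simps Y_def)
 have "equivalence (pMC B) (Fo' X) (Fo' Y) (Fm' X Y 0 f)"
  using e f(2) unfolding FoY equivalence_pMC by (simp add: Y_def)
 then have em: "equiv_mod (pMC A) p.kern X Y f" by (rule p_kern_equiv_mod[OF Xp Yp fp])
 let ?XY = "Hom (pMC A) X Y" and ?YY = "Hom (pMC A) Y Y"
 interpret YY2: abelian_group "?YY 2" using p.A.hom_group Yp by blast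
 interpret YY3: abelian_group "?YY 3" using p.A.hom_group Yp by blast
 interpret XY1: abelian_group "?XY 1" using p.A.hom_group Xp Yp by blast
 interpret XY2: abelian_group "?XY 2" using p.A.hom_group Xp Yp by blast
 interpret XY0: abelian_group "?XY 0" using p.A.hom_group Xp Yp by blast
 define R where "R = curv A Y"
 define S where "S = dif (pMC A) X Y 0 f"
 have Rk: "R : p.kern Y Y 2" unfolding R_def using Y' by (intro curv_kern Yp) (simp add: FoY)
 note Rs = p.kernD(1)[OF Rk]
 have Sk: "S : p.kern X Y 1" using em by (simp add: equiv_mod_def S_def)
 note Ss = p.kernD(1)[OF Sk]
 have dR: "dif (pMC A) Y Y 2 R = \<zero>[?YY 3]" unfolding R_def by (rule A.dif_curv[OF Yp])
 have Rf: "cmp (pMC A) X Y Y 2 0 R f : carrier (?XY 2)" using p.A.cmp_closed[OF Xp Yp Yp Rs fp] by simp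
 \<comment> \<open>\<open>X\<close> is a true Maurer-Cartan object, so only the curvature of
   \<open>Y\<close> contributes to the square of the differential. This is the cocycle condition for
   the pair (R, S).\<close>
 have dS: "dif (pMC A) X Y 1 S = cmp (pMC A) X Y Y 2 0 R f"
  unfolding S_def using A.pMC_dif_dif[OF Xp Yp fp, of 1 2] amap_zero[OF p.A.cmp_amap_right[OF Xp Xp Yp fp, of 2 2]] Rf
  by (simp add: R_def Xc pMC_simps(1)[symmetric, of A X X] a_minus_def)
 let ?a = "\<ominus>[?YY 2] R" and ?b = "\<ominus>[?XY 1] S"
 have a: "?a : p.kern Y Y 2" "dif (pMC A) Y Y 2 ?a = \<zero>[?YY 3]"
  using pk.N_neg[OF Yp Yp Rk] amap_neg[OF p.A.dif_amap[OF Yp Yp, of 3 2] Rs] dR by simp_all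
 have b: "?b : p.kern X Y 1" "dif (pMC A) X Y 1 ?b = cmp (pMC A) X Y Y 2 0 ?a f"
  using pk.N_neg[OF Xp Yp Sk] amap_neg[OF p.A.dif_amap[OF Xp Yp, of 2 1] Ss] dS
   amap_neg[OF p.A.cmp_amap_left[OF Xp Yp Yp fp, of 2 2] Rs] by simp_all
 obtain u v where u: "u : p.kern Y Y 1" and v: "v : p.kern X Y 0" and du: "dif (pMC A) Y Y 1 u = ?a"
  and uf: "cmp (pMC A) X Y Y 1 0 u f = ?b \<oplus>[?XY 1] dif (pMC A) X Y 0 v"
  using cone_solvableD[OF pk.cone_pre[OF Xp Yp Yp em] a b, of 0] by auto
 note us = p.kernD(1)[OF u] and vs = p.kernD(1)[OF v]
 define \<xi> where "\<xi> = \<zeta> \<oplus>[Hom A F F 1] u"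
 define h where "h = f \<ominus>[?XY 0] v"
 have uF: "u : kern F F 1" using u by (simp add: kern_eq Y_def)
 interpret FF1: abelian_group "Hom A F F 1" using A.hom_group F by blast
 have xi: "\<xi> : mor A F F 1" "Fm F F 1 \<xi> = \<zeta>'"
  using z kernD[OF uF] amap_add[OF Fm_amap[OF F F] z(1)] z'
   abelian_monoid.r_zero[OF abelian_group.axioms(1)[OF B.hom_group[OF Fo_Ob[OF F] Fo_Ob[OF F]]]] by (simp_all add: \<xi>_def)
 have "curv A (F, \<xi>) = \<zero>[Hom A F F 2]"
  unfolding \<xi>_def using curv_deform[OF Yp[unfolded Y_def] uF] du Rs YY2.r_neg
  by (simp add: R_def[symmetric] Y_def[symmetric]) (simp add: R_def Y_def pMC_simps)
 then have W: "(F, \<xi>) : Ob (MC A)" using F xi by (simp add: MC_Ob pMC_Ob)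
 have hs: "h : carrier (?XY 0)" unfolding h_def using fp vs by simp
 have hF: "h : mor A (fst X) F 0" using hs by (simp add: pMC_simps Y_def)
 have dvs: "dif (pMC A) X Y 0 v : carrier (?XY 1)" using p.A.dif_closed[OF Xp Yp vs] by simp
 have dh: "dif (pMC A) X Y 0 h = S \<ominus>[?XY 1] dif (pMC A) X Y 0 v"
  unfolding h_def S_def using amap_minus[OF p.A.dif_amap[OF Xp Yp, of 1 0] fp vs] by simp
 have uv: "cmp (pMC A) X Y Y 1 0 u v = \<zero>[?XY 1]" using pk.JN[OF Xp Yp Yp u v] by simp
 have uh: "cmp (pMC A) X Y Y 1 0 u h = ?b \<oplus>[?XY 1] dif (pMC A) X Y 0 v"
  unfolding h_def using amap_minus[OF p.A.cmp_amap_right[OF Xp Yp Yp us, of 1 0] fp vs] uv uf Ss dvs by (simp add: a_minus_def)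
 \<comment> \<open>Replacing \<open>\<zeta>\<close> by \<open>\<xi>\<close> at the target adds uh to
   the differential. As uv = 0, uh = uf = -S + dv, which cancels dh = S - dv.\<close>
 have "dif (MC A) X (F, \<xi>) 0 h = dif (pMC A) X Y 0 h \<oplus>[?XY 1] cmp (pMC A) X Y Y 1 0 u h"
 proof -
  have g: "dif A (fst X) F 0 h : mor A (fst X) F 1" "cmp A (fst X) F F 1 0 \<zeta> h : mor A (fst X) F 1"
   "cmp A (fst X) F F 1 0 u h : mor A (fst X) F 1"
   "cmp A (fst X) (fst X) F 0 1 h (snd X) : mor A (fst X) F 1"
   using A.dif_closed[OF Xa F hF, of 1] A.cmp_closed[OF Xa F F z(1) hF, of 1]
    A.cmp_closed[OF Xa F F kernD(1)[OF uF] hF, of 1] A.cmp_closed[OF Xa Xa F hF, of "snd X" 1 1] Xp by (simp_all add: pMC_Ob)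
  interpret M: abelian_group "Hom A (fst X) F 1" using A.hom_group Xa F by blast
  have "cmp A (fst X) F F 1 0 \<xi> h = cmp A (fst X) F F 1 0 \<zeta> h \<oplus>[Hom A (fst X) F 1] cmp A (fst X) F F 1 0 u h"
   unfolding \<xi>_def using amap_add[OF A.cmp_amap_left[OF Xa F F hF, of 1 1] z(1) kernD(1)[OF uF]] by simp
  then show ?thesis
   unfolding pMC_MC(2) MC_simps(4)[of 1 0, simplified] unfolding pMC_simps MC_simps(2) Y_def fst_conv snd_conv
    sgn_act_even[of 0, simplified] using g by simp algebra
 qed
 also have "\<dots> = \<zero>[?XY 1]" unfolding dh uh using Ss dvs by algebra
 finally have hc: "h : cocycle0 (MC A) X (F, \<xi>)" using hF by (simp add: cocycle0_def MC_simps pMC_simps Y_def)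
 interpret N0: abelian_group "Hom B (Fo (fst X)) (Fo F) 0" by (rule B.hom_group[OF Fo_Ob[OF Xa] Fo_Ob[OF F]])
 have Fh: "Fm (fst X) F 0 h = f'"
  unfolding h_def using amap_minus[OF p.Fm_amap[OF Xp Yp] fp vs] p.kernD(2)[OF v] f f'c
  by (simp add: Y_def pMC_simps N0.minus_r_zero)
 \<comment> \<open>Now \<open>h\<close> is closed between Maurer-Cartan objects, but so far
   invertible only modulo the kernel; \<open>equiv_mod_lift\<close> removes the restriction.\<close>
 have "equiv_mod (MC A) m.kern X (F, \<xi>) h"
  by (rule m_kern_equiv_mod[OF X W]) (use hF e xi Fh in \<open>simp_all add: MC_simps\<close>)
 then have "equivalence (MC A) X (F, \<xi>) h"
  using mk.equiv_mod_lift[OF A.MC_adg refl X W hc] by simp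
 then show ?thesis using W xi(2) hF Fh by blast
qed

text \<open>A homotopy inverse of \<open>f'\<close> is lifted first; a homotopy inverse of its lift differs from the
 desired lift by a homotopy, which lifts as well.\<close>

lemma lift_source:
 assumes Y: "Y : Ob (MC A)" and F: "F : Ob A" and X': "(Fo F, \<zeta>') : Ob (MC B)"
  and e: "equivalence (MC B) (Fo F, \<zeta>') (Fo' Y) f'"
 shows "\<exists>\<zeta> f. (F, \<zeta>) : Ob (MC A) & Fm F F 1 \<zeta> = \<zeta>' & f : mor A F (fst Y) 0 &
  Fm F (fst Y) 0 f = f' & equivalence (MC A) (F, \<zeta>) Y f"
proof -
 interpret MA: adg "MC A" by (rule A.MC_adg)
 let ?W = "(Fo F, \<zeta>')" and ?Y = "Fo' Y"
 note Y' = m.Fo_Ob[OF Y]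
 obtain g' where g': "equivalence (MC B) ?Y ?W g'"
  and gf: "homologous0 (MC B) ?W ?W (cmp (MC B) ?W ?Y ?W 0 0 g' f') (idn (MC B) ?W)"
  by (rule m.B.equivalence_inverse[OF e])
 obtain \<zeta> g where W: "(F, \<zeta>) : Ob (MC A)" and z: "Fm F F 1 \<zeta> = \<zeta>'" and g: "Fm (fst Y) F 0 g = g'"
  and eg: "equivalence (MC A) Y (F, \<zeta>) g" using lift_target[OF Y F X' g'] by blast
 obtain h where h: "equivalence (MC A) (F, \<zeta>) Y h"
  and hg: "homologous0 (MC A) Y Y (cmp (MC A) Y (F, \<zeta>) Y 0 0 h g) (idn (MC A) Y)"
  by (rule m.A.equivalence_inverse[OF eg])
 note gc = m.A.cocycle0_closed[OF m.A.equivalence_cocycle[OF eg]] and hcc = m.A.equivalence_cocycle[OF h]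
 note hc = m.A.cocycle0_closed[OF hcc]
 define h' where "h' = Fm' (F, \<zeta>) Y 0 h"
 have FW: "Fo' (F, \<zeta>) = ?W" using z by simp
 have h'c: "h' : cocycle0 (MC B) ?W ?Y" unfolding h'_def using m.Fm_cocycle0[OF W Y hcc] unfolding FW .
 have i0: "(0::int) = 0 + 0" "(0::int) = -1 + 1" "(1::int) = 0 + 1" "(1::int) = -1 + 2" by simp_all
 have "homologous0 (MC B) ?Y ?Y (Fm' Y Y 0 (cmp (MC A) Y (F, \<zeta>) Y 0 0 h g)) (Fm' Y Y 0 (idn (MC A) Y))"
  by (rule m.Fm_homologous0[OF Y Y m.A.cmp_closed[OF Y W Y hc gc i0(1)] m.A.idn_closed[OF Y] hg])
 then have h'g: "homologous0 (MC B) ?Y ?Y (cmp (MC B) ?Y ?W ?Y 0 0 h' g') (idn (MC B) ?Y)"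
  unfolding m.Fm_cmp[OF Y W Y hc gc i0(1)] m.Fm_idn[OF Y] FW h'_def[symmetric] by (simp add: g)
 note f'c = m.B.equivalence_cocycle[OF e] and g'c = m.B.equivalence_cocycle[OF g']
 note cl = m.B.cocycle0_closed[OF f'c] m.B.cocycle0_closed[OF g'c] m.B.cocycle0_closed[OF h'c]
 \<comment> \<open>Both f' and h' are inverse to g': f' ~ (h'g')f' = h'(g'f') ~ h'.\<close>
 have 1: "homologous0 (MC B) ?W ?Y (cmp (MC B) ?W ?Y ?Y 0 0 (cmp (MC B) ?Y ?W ?Y 0 0 h' g') f') f'"
  using m.B.homologous0_pre[OF X' Y' Y' m.B.cmp_closed[OF Y' X' Y' cl(3,2) i0(1)] m.B.idn_closed[OF Y'] h'g f'c]
  unfolding m.B.idn_left[OF X' Y' cl(1)] .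
 have 2: "homologous0 (MC B) ?W ?Y (cmp (MC B) ?W ?W ?Y 0 0 h' (cmp (MC B) ?W ?Y ?W 0 0 g' f')) h'"
  using m.B.homologous0_post[OF X' X' Y' m.B.cmp_closed[OF X' Y' X' cl(2,1) i0(1)] m.B.idn_closed[OF X'] gf h'c]
  unfolding m.B.idn_right[OF X' Y' cl(3)] .
 note as = m.B.cmp_assoc[OF X' Y' X' Y' cl(3,2,1) i0(1,1)]
 have c: "cmp (MC B) ?W ?W ?Y 0 0 h' (cmp (MC B) ?W ?Y ?W 0 0 g' f') : mor (MC B) ?W ?Y 0"
  by (rule m.B.cmp_closed[OF X' X' Y' cl(3) m.B.cmp_closed[OF X' Y' X' cl(2,1) i0(1)] i0(1)])
 have "homologous0 (MC B) ?W ?Y f' h'"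
  by (rule m.B.homologous0_trans[OF X' Y' cl(1) c cl(3) m.B.homologous0_sym[OF X' Y' c cl(1) 1[unfolded as]] 2])
 then obtain t' where t': "t' : mor (MC B) ?W ?Y (-1)" "f' \<ominus>[Hom (MC B) ?W ?Y 0] h' = dif (MC B) ?W ?Y (-1) t'"
  unfolding homologous0_def by blast
 obtain t where t: "t : mor (MC A) (F, \<zeta>) Y (-1)" "Fm' (F, \<zeta>) Y (-1) t = t'"
  using m_surj[OF W Y] t'(1) unfolding FW by blast
 let ?d = "dif (MC A) (F, \<zeta>) Y (-1) t"
 note dc = m.A.dif_closed[OF W Y t(1) i0(2)]
 interpret M0: abelian_group "Hom (MC A) (F, \<zeta>) Y 0" by (rule m.A.hom_group[OF W Y])
 interpret M1: abelian_group "Hom (MC A) (F, \<zeta>) Y 1" by (rule m.A.hom_group[OF W Y])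
 interpret B0: abelian_group "Hom (MC B) ?W ?Y 0" by (rule m.B.hom_group[OF X' Y'])
 define f where "f = h \<oplus>[Hom (MC A) (F, \<zeta>) Y 0] ?d"
 have fc: "f : mor (MC A) (F, \<zeta>) Y 0" unfolding f_def using hc dc by simp
 have "f : cocycle0 (MC A) (F, \<zeta>) Y"
  using fc hcc amap_add[OF m.A.dif_amap[OF W Y i0(3)] hc dc] MA.dif_dif[OF W Y t(1) i0(2,4)]
  unfolding f_def by (simp add: cocycle0_def)
 moreover have "f \<ominus>[Hom (MC A) (F, \<zeta>) Y 0] h = ?d" unfolding f_def using hc dc by algebra
 then have "homologous0 (MC A) (F, \<zeta>) Y f h" unfolding homologous0_def using t(1) by blast
 ultimately have "equivalence (MC A) (F, \<zeta>) Y f" by (rule m.A.equivalence_homologous[OF W Y h])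
 moreover have "Fm' (F, \<zeta>) Y 0 f = h' \<oplus>[Hom (MC B) ?W ?Y 0] (f' \<ominus>[Hom (MC B) ?W ?Y 0] h')"
  unfolding f_def amap_add[OF m.Fm_amap[OF W Y] hc dc] m.Fm_dif[OF W Y t(1) i0(2)] t(2) FW h'_def[symmetric]
  by (simp only: t'(2))
 then have "Fm F (fst Y) 0 f = f'" using cl by simp algebra
 ultimately show ?thesis using W z fc by (auto simp: MC_simps)
qed

end

section \<open>Simplices of the coherent nerve\<close>

subsection \<open>The boundary expression\<close>

text \<open>The right-hand side of the nerve equation is cut into its summands, because boundaries
  of two families are compared, and differentiated, position by position.\<close>

definition bterm :: "('k, 'o, 'm) dgcat => (nat => 'o) => (nat list => 'm) => nat list => nat => 'm" where
 "bterm A X aa s j =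
  (let M = sHom A X s (seq_deg s + 1) in
   sgn_act M (int (length s - 1) - int j - 1)
    (cmp A (X (hd s)) (X (s ! j)) (X (last s)) (seq_deg (drop j s)) (seq_deg (take (j + 1) s))
     (aa (drop j s)) (aa (take (j + 1) s))
    \<ominus>[M] aa (take j s @ drop (j + 1) s)))"

definition bnd :: "('k, 'o, 'm) dgcat => (nat => 'o) => (nat list => 'm) => nat list => 'm" where
 "bnd A X aa s =
  finsum (sHom A X s (seq_deg s + 1)) (bterm A X aa s) {1..<length s - 1}"

text \<open>What the Leibniz rule makes of \<open>bterm\<close> when \<open>D\<close> takes the place of the differential of \<open>aa\<close>.\<close>

definition eterm :: "('k, 'o, 'm) dgcat => (nat => 'o) => (nat list => 'm) => (nat list => 'm) =>
  nat list => nat => 'm" where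
 "eterm A X aa D s j =
  (let M = sHom A X s (seq_deg s + 2); e = int (length s - 1) - int j - 1 in
   sgn_act M e
    ((cmp A (X (hd s)) (X (s ! j)) (X (last s)) (seq_deg (drop j s) + 1) (seq_deg (take (j + 1) s))
     (D (drop j s)) (aa (take (j + 1) s))
    \<oplus>[M] sgn_act M e (cmp A (X (hd s)) (X (s ! j)) (X (last s)) (seq_deg (drop j s))
     (seq_deg (take (j + 1) s) + 1) (aa (drop j s)) (D (take (j + 1) s))))
    \<ominus>[M] D (take j s @ drop (j + 1) s)))"

lemma coherent_nerve_iff:
 "(X, aa) : coherent_nerve A n \<longleftrightarrow> X : {..n} \<rightarrow>\<^sub>E Ob A &
  aa : (\<Pi>\<^sub>E s\<in>nerve_seqs n. smor A X s (seq_deg s)) &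
  (\<forall>i\<le>n. aa [i, i] = idn A (X i)) &
  (\<forall>s\<in>nerve_seqs n. 3 <= length s & (\<exists>j. Suc j < length s & s ! j = s ! Suc j) -->
    aa s = \<zero>[sHom A X s (seq_deg s)]) &
  (\<forall>s\<in>nerve_seqs n. dif A (X (hd s)) (X (last s)) (seq_deg s) (aa s) = bnd A X aa s)"
 unfolding coherent_nerve_def bnd_def bterm_def[abs_def] Let_def by simp

lemma nerve_seqsD:
 assumes "s : nerve_seqs n"
 shows "2 <= length s" "sorted s" "set s \<subseteq> {..n}" "j < length s ==> s ! j <= n" "hd s <= n" "last s <= n" "s ~= []"
proof -
 show *: "2 <= length s" "sorted s" "set s \<subseteq> {..n}" using assms by (auto simp: nerve_seqs_def)
 then show ne: "s ~= []" by auto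
 show "j < length s ==> s ! j <= n" using * nth_mem by blast
 show "hd s <= n" "last s <= n" using * hd_in_set[OF ne] last_in_set[OF ne] by blast+
qed

lemma sub_seq_simps:
 assumes "0 < j" "j < length s - 1"
 shows "hd (drop j s) = s ! j" "last (drop j s) = last s"
  "hd (take (Suc j) s) = hd s" "last (take (Suc j) s) = s ! j"
  "hd (take j s @ drop (Suc j) s) = hd s" "last (take j s @ drop (Suc j) s) = last s"
  "length (drop j s) = length s - j" "length (take (Suc j) s) = Suc j"
  "length (take j s @ drop (Suc j) s) = length s - 1"
 using assms by (auto simp: hd_drop_conv_nth take_Suc_conv_app_nth hd_append last_drop hd_take)

lemma sub_seq_mem:
 assumes s: "s : nerve_seqs n" and j: "0 < j" "j < length s - 1"
 shows "drop j s : nerve_seqs n" "take (Suc j) s : nerve_seqs n" "take j s @ drop (Suc j) s : nerve_seqs n"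
proof -
 have "sorted (take j s @ s ! j # drop (Suc j) s)"
  using nerve_seqsD(2)[OF s] id_take_nth_drop[of j s] j by simp
 then have "sorted (take j s @ drop (Suc j) s)" by (auto simp: sorted_append)
 then show "take j s @ drop (Suc j) s : nerve_seqs n"
  using s j set_take_subset[of j s] set_drop_subset[of "Suc j" s] unfolding nerve_seqs_def by auto
qed (use s j set_take_subset[of "Suc j" s] set_drop_subset[of j s] in \<open>auto simp: nerve_seqs_def\<close>)

lemma seq_deg_sub:
 assumes "0 < j" "j < length s - 1"
 shows "seq_deg (drop j s) = seq_deg s + int j" "seq_deg (take (Suc j) s) = 1 - int j"
  "seq_deg (take j s @ drop (Suc j) s) = seq_deg s + 1"
 using sub_seq_simps[OF assms] assms by (simp_all add: seq_deg_def)

lemma (in abelian_group) finsum_minus: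
 assumes "!!i. i : I ==> f i : carrier G" "!!i. i : I ==> g i : carrier G"
 shows "finsum G (%i. f i \<ominus> g i) I = finsum G f I \<ominus> finsum G g I"
proof -
 have m: "amap G G (%x. \<ominus> x)" by (rule amapI) (auto simp: abelian_group_axioms minus_add a_comm)
 have "finsum G (%i. f i \<ominus> g i) I = finsum G f I \<oplus> finsum G (%i. \<ominus> g i) I"
  unfolding a_minus_def using assms by (intro finsum_addf) auto
 then show ?thesis using amap_finsum[OF m, of I g] assms by (simp add: a_minus_def)
qed

lemma (in abelian_group) finsum_triangle:
 assumes G: "!!i j. i : {1..<l} ==> j : {1..<l} ==> i < j ==> f i j : carrier G"
 shows "finsum G (%i. finsum G (f i) {i+1..<l}) {1..<l::nat} = finsum G (%j. finsum G (%i. f i j) {1..<j}) {1..<l}"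
proof -
 let ?g = "%i j. if i < j then f i j else \<zero>"
 have g: "?g i j : carrier G" if "i : {1..<l}" "j : {1..<l}" for i j using G that by auto
 have "finsum G (%i. finsum G (f i) {i+1..<l}) {1..<l} = finsum G (%i. finsum G (?g i) {1..<l}) {1..<l}"
 proof (rule finsum_cong')
  fix i assume i: "i : {1..<l}"
  show "finsum G (f i) {i+1..<l} = finsum G (?g i) {1..<l}"
   using i g[OF i] by (intro add.finprod_mono_neutral_cong_left) auto
 qed (use g in \<open>auto intro!: finsum_closed\<close>)
 also have "\<dots> = finsum G (%j. finsum G (%i. ?g i j) {1..<l}) {1..<l}"
  using g by (intro finsum_swap) auto
 also have "\<dots> = finsum G (%j. finsum G (%i. f i j) {1..<j}) {1..<l}"
 proof (rule finsum_cong')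
  fix j assume j: "j : {1..<l}"
  show "finsum G (%i. ?g i j) {1..<l} = finsum G (%i. f i j) {1..<j}"
   using j g[OF _ j] by (intro add.finprod_mono_neutral_cong_right) auto
 qed (use G in \<open>auto intro!: finsum_closed\<close>)
 finally show ?thesis .
qed

text \<open>Only degrees are prescribed and no equation is imposed. The Bianchi identity is formal,
  and it is applied to families in which one face has been set to zero.\<close>

locale nerve_family = adg A for A :: "('k, 'o, 'm) dgcat" +
 fixes n :: nat and X :: "nat => 'o" and aa :: "nat list => 'm"
 assumes X: "i <= n ==> X i : Ob A"
  and aa: "s : nerve_seqs n ==> aa s : smor A X s (seq_deg s)"
begin

lemma seq_Ob: "s : nerve_seqs n ==> X (hd s) : Ob A" "s : nerve_seqs n ==> X (last s) : Ob A"
 "s : nerve_seqs n ==> j < length s ==> X (s ! j) : Ob A"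
 using nerve_seqsD X by blast+

lemma seq_cmp_closed:
 assumes s: "s : nerve_seqs n" and j: "0 < j" "j < length s - 1"
  and g: "g : mor A (X (s ! j)) (X (last s)) a" and f: "f : mor A (X (hd s)) (X (s ! j)) b"
  and c: "c = a + b"
 shows "cmp A (X (hd s)) (X (s ! j)) (X (last s)) a b g f : smor A X s c"
 using cmp_closed[OF seq_Ob(1)[OF s] seq_Ob(3)[OF s] seq_Ob(2)[OF s] g f c] j by simp

lemma sub_closed:
 assumes s: "s : nerve_seqs n" and j: "0 < j" "j < length s - 1"
  and D: "!!s. s : nerve_seqs n ==> D s : smor A X s (seq_deg s + d)"
 shows "D (drop j s) : mor A (X (s ! j)) (X (last s)) (seq_deg s + int j + d)"
  "D (take (Suc j) s) : mor A (X (hd s)) (X (s ! j)) (1 - int j + d)"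
  "D (take j s @ drop (Suc j) s) : smor A X s (seq_deg s + 1 + d)"
 using D[OF sub_seq_mem(1)[OF s j]] D[OF sub_seq_mem(2)[OF s j]] D[OF sub_seq_mem(3)[OF s j]]
 by (simp_all only: sub_seq_simps[OF j] seq_deg_sub[OF j])

lemma aa_sub:
 assumes s: "s : nerve_seqs n" and j: "0 < j" "j < length s - 1"
 shows "aa (drop j s) : mor A (X (s ! j)) (X (last s)) (seq_deg (drop j s))"
  "aa (take (Suc j) s) : mor A (X (hd s)) (X (s ! j)) (seq_deg (take (Suc j) s))"
  "aa (take j s @ drop (Suc j) s) : smor A X s (seq_deg s + 1)"
 using sub_closed[OF s j, of aa 0] aa by (simp_all add: seq_deg_sub[OF j])

lemma deg_sum:
 assumes "0 < j" "j < length s - 1"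
 shows "seq_deg s + 1 = seq_deg (drop j s) + seq_deg (take (Suc j) s)"
  "seq_deg s + 2 = (seq_deg (drop j s) + 1) + seq_deg (take (Suc j) s)"
  "seq_deg s + 2 = seq_deg (drop j s) + (seq_deg (take (Suc j) s) + 1)"
 using seq_deg_sub[OF assms] by simp_all

lemma bterm_closed:
 assumes s: "s : nerve_seqs n" and j: "0 < j" "j < length s - 1"
 shows "bterm A X aa s j : smor A X s (seq_deg s + 1)"
proof -
 note gr = hom_group[OF seq_Ob(1)[OF s] seq_Ob(2)[OF s]]
 show ?thesis
  unfolding bterm_def Let_def Suc_eq_plus1[symmetric]
  using seq_cmp_closed[OF s j aa_sub(1,2)[OF s j] deg_sum(1)[OF j]] aa_sub(3)[OF s j]
  by (intro sgn_act_closed[OF gr] abelian_group.minus_closed[OF gr])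
qed

lemma bnd_closed:
 assumes s: "s : nerve_seqs n"
 shows "bnd A X aa s : smor A X s (seq_deg s + 1)"
proof -
 interpret M: abelian_group "sHom A X s (seq_deg s + 1)" by (rule hom_group[OF seq_Ob(1)[OF s] seq_Ob(2)[OF s]])
 show ?thesis unfolding bnd_def using bterm_closed[OF s] by (intro M.finsum_closed) auto
qed

lemma eterm_parts_closed:
 assumes s: "s : nerve_seqs n" and j: "0 < j" "j < length s - 1"
  and D: "!!s. s : nerve_seqs n ==> D s : smor A X s (seq_deg s + 1)"
 shows "cmp A (X (hd s)) (X (s ! j)) (X (last s)) (seq_deg (drop j s) + 1) (seq_deg (take (Suc j) s))
     (D (drop j s)) (aa (take (Suc j) s)) : smor A X s (seq_deg s + 2)"
  "cmp A (X (hd s)) (X (s ! j)) (X (last s)) (seq_deg (drop j s)) (seq_deg (take (Suc j) s) + 1)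
     (aa (drop j s)) (D (take (Suc j) s)) : smor A X s (seq_deg s + 2)"
  "D (take j s @ drop (Suc j) s) : smor A X s (seq_deg s + 2)"
proof -
 note Dc = sub_closed[OF s j D]
 show "D (take j s @ drop (Suc j) s) : smor A X s (seq_deg s + 2)" using Dc(3) by (simp add: algebra_simps)
 have D1: "D (drop j s) : mor A (X (s ! j)) (X (last s)) (seq_deg (drop j s) + 1)"
  and D2: "D (take (Suc j) s) : mor A (X (hd s)) (X (s ! j)) (seq_deg (take (Suc j) s) + 1)"
  using Dc by (simp_all add: seq_deg_sub[OF j])
 show "cmp A (X (hd s)) (X (s ! j)) (X (last s)) (seq_deg (drop j s) + 1) (seq_deg (take (Suc j) s))
     (D (drop j s)) (aa (take (Suc j) s)) : smor A X s (seq_deg s + 2)"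
  by (rule seq_cmp_closed[OF s j D1 aa_sub(2)[OF s j] deg_sum(2)[OF j]])
 show "cmp A (X (hd s)) (X (s ! j)) (X (last s)) (seq_deg (drop j s)) (seq_deg (take (Suc j) s) + 1)
     (aa (drop j s)) (D (take (Suc j) s)) : smor A X s (seq_deg s + 2)"
  by (rule seq_cmp_closed[OF s j aa_sub(1)[OF s j] D2 deg_sum(3)[OF j]])
qed

lemma eterm_closed:
 assumes s: "s : nerve_seqs n" and j: "0 < j" "j < length s - 1"
  and D: "!!s. s : nerve_seqs n ==> D s : smor A X s (seq_deg s + 1)"
 shows "eterm A X aa D s j : smor A X s (seq_deg s + 2)"
proof -
 note gr = hom_group[OF seq_Ob(1)[OF s] seq_Ob(2)[OF s]]
 show ?thesis
  unfolding eterm_def Let_def Suc_eq_plus1[symmetric]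
  using eterm_parts_closed[OF s j D]
  by (intro sgn_act_closed[OF gr] abelian_group.minus_closed[OF gr] abelian_groupE(1)[OF gr])
qed

lemma dif_aa_closed: "s : nerve_seqs n ==>
  dif A (X (hd s)) (X (last s)) (seq_deg s) (aa s) : smor A X s (seq_deg s + 1)"
 using dif_closed[OF seq_Ob(1,2) aa] by blast

lemma dif_bnd:
 assumes s: "s : nerve_seqs n"
 shows "dif A (X (hd s)) (X (last s)) (seq_deg s + 1) (bnd A X aa s) =
  finsum (sHom A X s (seq_deg s + 2))
   (eterm A X aa (%t. dif A (X (hd t)) (X (last t)) (seq_deg t) (aa t)) s) {1..<length s - 1}"
proof -
 note o = seq_Ob(1)[OF s] seq_Ob(2)[OF s]
 note gr = hom_group[OF o]
 interpret M1: abelian_group "sHom A X s (seq_deg s + 1)" by (rule gr)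
 interpret M2: abelian_group "sHom A X s (seq_deg s + 2)" by (rule gr)
 have k: "seq_deg s + 2 = seq_deg s + 1 + 1" by simp
 note am = dif_amap[OF o k]
 have "dif A (X (hd s)) (X (last s)) (seq_deg s + 1) (bnd A X aa s) =
  finsum (sHom A X s (seq_deg s + 2))
   (%j. dif A (X (hd s)) (X (last s)) (seq_deg s + 1) (bterm A X aa s j)) {1..<length s - 1}"
  unfolding bnd_def using bterm_closed[OF s] by (intro amap_finsum[OF am]) auto
 also have "\<dots> = finsum (sHom A X s (seq_deg s + 2))
   (eterm A X aa (%t. dif A (X (hd t)) (X (last t)) (seq_deg t) (aa t)) s) {1..<length s - 1}"
 proof (rule M2.finsum_cong')
  fix j assume "j : {1..<length s - 1}"
  then have j: "0 < j" "j < length s - 1" by auto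
  then have jl: "j < length s" by simp
  note a = aa_sub[OF s j]
  have c: "cmp A (X (hd s)) (X (s ! j)) (X (last s)) (seq_deg (drop j s)) (seq_deg (take (Suc j) s))
    (aa (drop j s)) (aa (take (Suc j) s)) : smor A X s (seq_deg s + 1)"
   by (rule seq_cmp_closed[OF s j a(1,2) deg_sum(1)[OF j]])
  \<comment> \<open>The degree of the left factor is j + 1 - l, so the sign of the Leibniz rule
    equals the sign of the summand. This is why the same exponent occurs twice in
    \<open>eterm\<close>.\<close>
  have e: "even (seq_deg (drop j s)) = even (int (length s - 1) - int j - 1)"
   using seq_deg_sub(1)[OF j] j by (simp add: seq_deg_def)
  have l: "dif A (X (hd s)) (X (last s)) (seq_deg s + 1) (cmp A (X (hd s)) (X (s ! j)) (X (last s))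
    (seq_deg (drop j s)) (seq_deg (take (Suc j) s)) (aa (drop j s)) (aa (take (Suc j) s))) =
   cmp A (X (hd s)) (X (s ! j)) (X (last s)) (seq_deg (drop j s) + 1) (seq_deg (take (Suc j) s))
    (dif A (X (s ! j)) (X (last s)) (seq_deg (drop j s)) (aa (drop j s))) (aa (take (Suc j) s))
   \<oplus>[sHom A X s (seq_deg s + 2)]
   sgn_act (sHom A X s (seq_deg s + 2)) (seq_deg (drop j s))
   (cmp A (X (hd s)) (X (s ! j)) (X (last s)) (seq_deg (drop j s)) (seq_deg (take (Suc j) s) + 1)
    (aa (drop j s)) (dif A (X (hd s)) (X (s ! j)) (seq_deg (take (Suc j) s)) (aa (take (Suc j) s))))"
   by (rule leibniz[OF o(1) seq_Ob(3)[OF s jl] o(2) a(1,2) deg_sum(1)[OF j] k refl refl])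
  show "dif A (X (hd s)) (X (last s)) (seq_deg s + 1) (bterm A X aa s j) =
    eterm A X aa (%t. dif A (X (hd t)) (X (last t)) (seq_deg t) (aa t)) s j"
   unfolding bterm_def eterm_def Let_def Suc_eq_plus1[symmetric] sub_seq_simps[OF j] seq_deg_sub(3)[OF j]
    amap_sgn_act[OF am M1.minus_closed[OF c a(3)]] amap_minus[OF am c a(3)] l sgn_act_cong[OF e] ..
 qed (use eterm_closed[OF s _ _ dif_aa_closed] in auto)
 finally show ?thesis .
qed

text \<open>Bianchi identity: over each pair \<open>p < q\<close> of inner positions the triple products and the
 terms in which one or both positions are deleted cancel.\<close>

lemma sum_eterm_bnd:
 assumes s: "s : nerve_seqs n"
 shows "finsum (sHom A X s (seq_deg s + 2)) (eterm A X aa (bnd A X aa) s) {1..<length s - 1}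
  = \<zero>[sHom A X s (seq_deg s + 2)]"
proof -
 let ?H = "X (hd s)" and ?Z = "X (last s)" and ?l = "length s - 1"
 define M where "M = Hom A ?H ?Z (seq_deg s + 2)"
 note oH = seq_Ob(1)[OF s] and oZ = seq_Ob(2)[OF s]
 note gr = hom_group[OF oH oZ]
 interpret M: abelian_group M unfolding M_def by (rule gr)
 \<comment> \<open>For p < q: \<open>t1\<close> cuts at both positions, \<open>t2\<close> cuts at p
   with q deleted, \<open>t3\<close> cuts at q with p deleted, and \<open>t4\<close> deletes
   both.\<close>
 define t1 where "t1 p q = cmp A ?H (X (s ! q)) ?Z (seq_deg (drop q s)) (seq_deg (take (Suc q) s) + 1) (aa (drop q s))
  (cmp A ?H (X (s ! p)) (X (s ! q)) (seq_deg (drop p (take (Suc q) s))) (seq_deg (take (Suc p) s))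
   (aa (drop p (take (Suc q) s))) (aa (take (Suc p) s)))" for p q
 define t2 where "t2 p q = cmp A ?H (X (s ! p)) ?Z (seq_deg (drop p s) + 1) (seq_deg (take (Suc p) s))
  (aa (take (q - p) (drop p s) @ drop (Suc q) s)) (aa (take (Suc p) s))" for p q
 define t3 where "t3 p q = cmp A ?H (X (s ! q)) ?Z (seq_deg (drop q s)) (seq_deg (take (Suc q) s) + 1)
  (aa (drop q s)) (aa (take p s @ drop (Suc p) (take (Suc q) s)))" for p q
 define t4 where "t4 p q = aa (take p (take q s @ drop (Suc q) s) @ drop (Suc p) (take q s @ drop (Suc q) s))" for p q
 define G where "G p q = sgn_act M (int p + int q) (t1 p q \<ominus>[M] t2 p q \<ominus>[M] t3 p q \<oplus>[M] t4 p q)" for p q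
 have seg: "drop p (take (Suc q) s) = take (Suc q - p) (drop p s)" for p q by (simp add: drop_take)
 have inner: "cmp A ?H (X (s ! p)) (X (s ! q)) (seq_deg (drop p (take (Suc q) s))) (seq_deg (take (Suc p) s))
   (aa (drop p (take (Suc q) s))) (aa (take (Suc p) s)) : mor A ?H (X (s ! q)) (seq_deg (take (Suc q) s) + 1)"
  "aa (take p s @ drop (Suc p) (take (Suc q) s)) : mor A ?H (X (s ! q)) (seq_deg (take (Suc q) s) + 1)"
  "aa (drop p (take (Suc q) s)) : mor A (X (s ! p)) (X (s ! q)) (seq_deg (drop p (take (Suc q) s)))"
  "aa (take (q - p) (drop p s) @ drop (Suc q) s) : mor A (X (s ! p)) ?Z (seq_deg (drop p s) + 1)"
  "t4 p q : carrier M"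
  if pq: "0 < p" "p < q" "q < ?l" for p q
 proof -
  have q: "0 < q" "q < ?l" and p: "0 < p" "p < ?l" using pq by auto
  let ?t = "take (Suc q) s"
  note t = sub_seq_mem(2)[OF s q] and st = sub_seq_simps[OF q]
  have pt: "0 < p" "p < length ?t - 1" using pq st by auto
  have tp: "?t ! p = s ! p" "take (Suc p) ?t = take (Suc p) s" "take p ?t = take p s" using pq by (auto simp: min_def)
  note at = aa_sub[OF t pt]
  show "aa (take p s @ drop (Suc p) ?t) : mor A ?H (X (s ! q)) (seq_deg ?t + 1)"
   "aa (drop p ?t) : mor A (X (s ! p)) (X (s ! q)) (seq_deg (drop p ?t))"
   using at(1,3) unfolding st tp by auto
  show "cmp A ?H (X (s ! p)) (X (s ! q)) (seq_deg (drop p ?t)) (seq_deg (take (Suc p) s))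
   (aa (drop p ?t)) (aa (take (Suc p) s)) : mor A ?H (X (s ! q)) (seq_deg ?t + 1)"
   using seq_cmp_closed[OF t pt at(1,2) deg_sum(1)[OF pt]] unfolding st tp .
  let ?d = "drop p s"
  note d = sub_seq_mem(1)[OF s p] and sd = sub_seq_simps[OF p]
  have qd: "0 < q - p" "q - p < length ?d - 1" using pq sd by auto
  have dd: "drop (Suc (q - p)) (drop p s) = drop (Suc q) s" using pq by simp
  show "aa (take (q - p) ?d @ drop (Suc q) s) : mor A (X (s ! p)) ?Z (seq_deg ?d + 1)"
   using aa_sub(3)[OF d qd] unfolding sd dd .
  let ?e = "take q s @ drop (Suc q) s"
  note e = sub_seq_mem(3)[OF s q]
  have pe: "0 < p" "p < length ?e - 1" using pq st by auto
  show "t4 p q : carrier M"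
   using aa_sub(3)[OF e pe] unfolding t4_def M_def st seq_deg_sub(3)[OF q] by (simp add: algebra_simps)
 qed
 have tc: "t1 p q : carrier M" "t2 p q : carrier M" "t3 p q : carrier M" "t4 p q : carrier M"
  if pq: "0 < p" "p < q" "q < ?l" for p q
 proof -
  have q: "0 < q" "q < ?l" and p: "0 < p" "p < ?l" using pq by auto
  show "t1 p q : carrier M" "t3 p q : carrier M" unfolding t1_def t3_def M_def
   using seq_cmp_closed[OF s q aa_sub(1)[OF s q] inner(1)[OF pq] deg_sum(3)[OF q]]
    seq_cmp_closed[OF s q aa_sub(1)[OF s q] inner(2)[OF pq] deg_sum(3)[OF q]] .
  show "t2 p q : carrier M" unfolding t2_def M_def
   using seq_cmp_closed[OF s p inner(4)[OF pq] aa_sub(2)[OF s p] deg_sum(2)[OF p]] .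
  show "t4 p q : carrier M" by (rule inner(5)[OF pq])
 qed
 note sc = sgn_act_closed[OF M.abelian_group_axioms]
 have Gc: "G p q : carrier M" if "0 < p" "p < q" "q < ?l" for p q
  unfolding G_def using tc[OF that] by (intro sc) simp
 \<comment> \<open>Position \<open>j\<close> meets every other position once: as the smaller member
   of a pair it contributes \<open>G j q\<close>, as the larger one the negative of
   \<open>G p j\<close>. In the sum over \<open>j\<close> each pair therefore occurs with both
   signs.\<close>
 have main: "eterm A X aa (bnd A X aa) s j =
   finsum M (G j) {j+1..<?l} \<ominus>[M] finsum M (%p. G p j) {1..<j}" if "j : {1..<?l}" for j
 proof -
  have j: "0 < j" "j < ?l" and jl: "j < length s" using that by auto
  note oj = seq_Ob(3)[OF s jl]
  let ?e = "int ?l - int j - 1"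
  let ?a = "%q. sgn_act M (int ?l - int q - 1) (t1 j q \<ominus>[M] t2 j q)"
  let ?b = "%p. sgn_act M (int j - int p - 1) (t1 p j \<ominus>[M] t3 p j)"
  let ?c = "%p. sgn_act M (int ?l - int p) (t2 p j \<ominus>[M] t4 p j)"
  let ?d = "%q. sgn_act M (int ?l - int q - 1) (t3 j q \<ominus>[M] t4 j q)"
  let ?S1 = "{j+1..<?l}" and ?S2 = "{1..<j}"
  have cl1: "?a q : carrier M" "?d q : carrier M" if "q : ?S1" for q
   using tc[of j q] that j by (auto intro!: sc)
  have cl2: "?b p : carrier M" "?c p : carrier M" if "p : ?S2" for p
   using tc[of p j] that j by (auto intro!: sc)
  note cl3 = sc[OF cl2(1), of _ ?e]
  have im: "?S1 = (%p. p + j) ` {1..<?l - j}"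
   using image_add_atLeastLessThan'[of j 1 "?l - j"] j by (simp add: add.commute)
  have P1: "cmp A ?H (X (s ! j)) ?Z (seq_deg (drop j s) + 1) (seq_deg (take (Suc j) s))
    (bnd A X aa (drop j s)) (aa (take (Suc j) s)) = finsum M ?a ?S1"
  proof -
   let ?t = "drop j s"
   note t = sub_seq_mem(1)[OF s j] and st = sub_seq_simps[OF j]
   note am = cmp_amap_left[OF oH oj oZ aa_sub(2)[OF s j] deg_sum(2)[OF j], folded M_def]
   have "cmp A ?H (X (s ! j)) ?Z (seq_deg ?t + 1) (seq_deg (take (Suc j) s))
    (bnd A X aa ?t) (aa (take (Suc j) s)) = finsum M (%p. cmp A ?H (X (s ! j)) ?Z (seq_deg ?t + 1)
     (seq_deg (take (Suc j) s)) (bterm A X aa ?t p) (aa (take (Suc j) s))) {1..<length ?t - 1}"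
    unfolding bnd_def st(1,2)
    using bterm_closed[OF t, unfolded st(1,2)] by (intro amap_finsum[OF am]) auto
   also have "\<dots> = finsum M (%p. ?a (p + j)) {1..<?l - j}"
   proof (rule M.finsum_cong')
    show "{1..<length ?t - 1} = {1..<?l - j}" using j by simp
    show "(%p. ?a (p + j)) : {1..<?l - j} \<rightarrow> carrier M" by (rule Pi_I, rule cl1(1)) (use j in auto)
    fix p assume p': "p : {1..<?l - j}"
    then have p: "0 < p" "p < length ?t - 1" and q: "0 < p + j" "j < p + j" "p + j < ?l" using j by auto
    have pl: "p + j < length s" using q by simp
    note oq = seq_Ob(3)[OF s pl]
    have ls: "drop p ?t = drop (p + j) s" "?t ! p = s ! (p + j)" "take (Suc p) ?t = drop j (take (Suc (p + j)) s)"
     "drop (Suc p) ?t = drop (Suc (p + j)) s"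
     using j q by (simp_all add: take_drop add.commute)
    note at = aa_sub[OF t p, unfolded st(1,2) ls]
    note gt = hom_group[OF oj oZ, of "seq_deg ?t + 1"]
    note dt = deg_sum(1)[OF p, unfolded ls]
    have c1: "cmp A (X (s ! j)) (X (s ! (p + j))) ?Z (seq_deg (drop (p + j) s)) (seq_deg (drop j (take (Suc (p + j)) s)))
     (aa (drop (p + j) s)) (aa (drop j (take (Suc (p + j)) s))) : mor A (X (s ! j)) ?Z (seq_deg ?t + 1)"
     by (rule cmp_closed[OF oj oq oZ at(1,2) dt])
    have jq: "0 < j" "j < p + j" "p + j < ?l" using j q by auto
    have dq: "seq_deg (take (Suc (p + j)) s) + 1 = seq_deg (drop j (take (Suc (p + j)) s)) + seq_deg (take (Suc j) s)"
     using deg_sum(1)[of j "take (Suc (p + j)) s"] jq by (simp add: min_def)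
    have as: "cmp A ?H (X (s ! j)) ?Z (seq_deg ?t + 1) (seq_deg (take (Suc j) s))
     (cmp A (X (s ! j)) (X (s ! (p + j))) ?Z (seq_deg (drop (p + j) s)) (seq_deg (drop j (take (Suc (p + j)) s)))
     (aa (drop (p + j) s)) (aa (drop j (take (Suc (p + j)) s)))) (aa (take (Suc j) s)) = t1 j (p + j)"
     unfolding t1_def by (rule cmp_assoc[OF oH oj oq oZ at(1,2) aa_sub(2)[OF s j] dt dq])
    have pj: "p + j - j = p" by simp
    have sg: "int (length ?t - 1) - int p - 1 = int ?l - int (p + j) - 1" using p by simp
    show "cmp A ?H (X (s ! j)) ?Z (seq_deg ?t + 1) (seq_deg (take (Suc j) s)) (bterm A X aa ?t p) (aa (take (Suc j) s)) = ?a (p + j)"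
     unfolding bterm_def Let_def Suc_eq_plus1[symmetric] st(1,2) ls
      amap_sgn_act[OF am abelian_group.minus_closed[OF gt c1 at(3)]] amap_minus[OF am c1 at(3)] as
     unfolding t2_def pj sg ..
   qed
   also have "\<dots> = finsum M ?a ?S1"
    unfolding im using cl1[unfolded im] by (subst M.finsum_reindex) auto
   finally show ?thesis .
  qed
  have P2: "cmp A ?H (X (s ! j)) ?Z (seq_deg (drop j s)) (seq_deg (take (Suc j) s) + 1)
    (aa (drop j s)) (bnd A X aa (take (Suc j) s)) = finsum M ?b ?S2"
  proof -
   let ?t = "take (Suc j) s"
   note t = sub_seq_mem(2)[OF s j] and st = sub_seq_simps[OF j]
   note am = cmp_amap_right[OF oH oj oZ aa_sub(1)[OF s j] deg_sum(3)[OF j], folded M_def]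
   have "cmp A ?H (X (s ! j)) ?Z (seq_deg (drop j s)) (seq_deg ?t + 1) (aa (drop j s)) (bnd A X aa ?t) =
    finsum M (%p. cmp A ?H (X (s ! j)) ?Z (seq_deg (drop j s)) (seq_deg ?t + 1) (aa (drop j s)) (bterm A X aa ?t p)) {1..<length ?t - 1}"
    unfolding bnd_def st(3,4)
    using bterm_closed[OF t, unfolded st(3,4)] by (intro amap_finsum[OF am]) auto
   also have "\<dots> = finsum M ?b ?S2"
   proof (rule M.finsum_cong')
    show "{1..<length ?t - 1} = ?S2" using st by simp
    show "?b : ?S2 \<rightarrow> carrier M" using cl2 by blast
    fix p assume "p : ?S2"
    then have p: "0 < p" "p < length ?t - 1" and pj: "0 < p" "p < j" "j < ?l" using j st by auto
    have ls: "?t ! p = s ! p" "take (Suc p) ?t = take (Suc p) s" "take p ?t = take p s" using pj by (auto simp: min_def)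
    have sg: "int (length ?t - 1) - int p - 1 = int j - int p - 1" using st by simp
    note gt = hom_group[OF oH oj, of "seq_deg ?t + 1"]
    show "cmp A ?H (X (s ! j)) ?Z (seq_deg (drop j s)) (seq_deg ?t + 1) (aa (drop j s)) (bterm A X aa ?t p) = ?b p"
     unfolding bterm_def Let_def Suc_eq_plus1[symmetric] st(3,4) ls
      amap_sgn_act[OF am abelian_group.minus_closed[OF gt inner(1,2)[OF pj]]] amap_minus[OF am inner(1,2)[OF pj]] sg
     unfolding t1_def t3_def ..
   qed
   finally show ?thesis .
  qed
  have P3: "bnd A X aa (take j s @ drop (Suc j) s) = finsum M ?c ?S2 \<oplus>[M] finsum M ?d ?S1"
  proof -
   let ?t = "take j s @ drop (Suc j) s"
   note t = sub_seq_mem(3)[OF s j] and st = sub_seq_simps[OF j]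
   have sd: "seq_deg ?t + 1 = seq_deg s + 2" using seq_deg_sub(3)[OF j] by simp
   have btc: "bterm A X aa ?t p : carrier M" if "0 < p" "p < length ?t - 1" for p
    using bterm_closed[OF t that] unfolding st(5,6) sd M_def .
   have un: "{1..<length ?t - 1} = ?S2 \<union> {j..<?l - 1}" using j st by auto
   have lt: "length ?t - 1 = ?l - 1" using st by simp
   have "bnd A X aa ?t = finsum M (bterm A X aa ?t) (?S2 \<union> {j..<?l - 1})"
    unfolding bnd_def st(5,6) sd un M_def ..
   also have "\<dots> = finsum M (bterm A X aa ?t) ?S2 \<oplus>[M] finsum M (bterm A X aa ?t) {j..<?l - 1}"
    using btc j lt by (intro M.finsum_Un_disjoint) auto
   also have "finsum M (bterm A X aa ?t) ?S2 = finsum M ?c ?S2"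
   proof (rule M.finsum_cong')
    show "?c : ?S2 \<rightarrow> carrier M" using cl2 by blast
    fix p assume "p : ?S2"
    then have p: "0 < p" "p < j" "p < ?l" using j by auto
    have ls: "drop p ?t = take (j - p) (drop p s) @ drop (Suc j) s" "take (Suc p) ?t = take (Suc p) s" "?t ! p = s ! p"
     using p j by (auto simp: nth_append drop_take min_def)
    have sg: "even (int (length ?t - 1) - int p - 1) = even (int ?l - int p)" using st j p by auto
    have dg: "seq_deg (take (j - p) (drop p s) @ drop (Suc j) s) = seq_deg (drop p s) + 1"
     using p j by (simp add: seq_deg_def)
    show "bterm A X aa ?t p = ?c p"
     unfolding bterm_def Let_def Suc_eq_plus1[symmetric] st(5,6) sd ls dg M_def[symmetric] sgn_act_cong[OF sg]
     unfolding t2_def t4_def ..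
   qed simp
   \<comment> \<open>Behind the deleted position \<open>j\<close>, index p of the shortened sequence
     is position p + 1 of \<open>s\<close>.\<close>
   also have "finsum M (bterm A X aa ?t) {j..<?l - 1} = finsum M (%p. ?d (Suc p)) {j..<?l - 1}"
   proof (rule M.finsum_cong')
    show "(%p. ?d (Suc p)) : {j..<?l - 1} \<rightarrow> carrier M" by (rule Pi_I, rule cl1(2)) auto
    fix p assume p': "p : {j..<?l - 1}"
    then have p: "j <= p" "Suc p < ?l" by auto
    obtain d where d: "p = j + d" using p(1) le_Suc_ex by blast
    have lj: "length (take j s) = j" "length (take (Suc (j + d)) s) = Suc (j + d)" "Suc (Suc (j + d)) - Suc j = Suc d"
     "Suc (j + d) - Suc j = d" "j - Suc (j + d) = 0" "d + Suc j = Suc (j + d)" "Suc d + Suc j = Suc (Suc (j + d))"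
     "j + d - j = d" "Suc (j + d) - j = Suc d" "j - (j + d) = 0" "Suc j - Suc (j + d) = 0"
     "min (j + d) j = j" "min (Suc (j + d)) j = j" "min j (Suc (j + d)) = j"
     using p j d by auto
    note lsimps = d drop_append take_append lj drop_take drop_drop take_take take_0 append_Nil append_Nil2
     append_assoc drop_0 add_0
    have ls: "drop p ?t = drop (Suc p) s" "take (Suc p) ?t = take j s @ drop (Suc j) (take (Suc (Suc p)) s)"
     "take p ?t @ drop (Suc p) ?t = take j (take (Suc p) s @ drop (Suc (Suc p)) s) @ drop (Suc j) (take (Suc p) s @ drop (Suc (Suc p)) s)"
     by (simp_all only: lsimps)
    have nt: "?t ! p = s ! Suc p" using p j by (auto simp: nth_append min_def)
    have sg: "int (length ?t - 1) - int p - 1 = int ?l - int (Suc p) - 1" using st p by simp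
    have dg: "seq_deg (take j s @ drop (Suc j) (take (Suc (Suc p)) s)) = seq_deg (take (Suc (Suc p)) s) + 1"
     using p j by (simp add: seq_deg_def)
    show "bterm A X aa ?t p = ?d (Suc p)"
     unfolding bterm_def Let_def Suc_eq_plus1[symmetric] ls(3)
     unfolding st(5,6) sd ls(1,2) nt dg M_def[symmetric] sg
     unfolding t3_def t4_def ..
   qed simp
   also have "\<dots> = finsum M ?d ?S1"
   proof -
    have "Suc (?l - 1) = ?l" using j by simp
    then have "?S1 = Suc ` {j..<?l - 1}" by (simp only: image_Suc_atLeastLessThan Suc_eq_plus1[symmetric])
    then show ?thesis using cl1 by (simp only:) (subst M.finsum_reindex; auto)
   qed
   finally show ?thesis .
  qed
  have fin: "finsum M ?a ?S1 : carrier M" "finsum M ?b ?S2 : carrier M" "finsum M ?c ?S2 : carrier M" "finsum M ?d ?S1 : carrier M"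
   using cl1 cl2 by (auto intro!: M.finsum_closed)
  \<comment> \<open>Exponents enter only through their parities. \<open>sgn4\<close> separates the
    pairs in which \<open>j\<close> is the smaller member from those in which it is the larger;
    \<open>sgn5\<close> and \<open>sgn6\<close> collect the four terms of a pair in these two
    cases.\<close>
  have sgn4: "sgn_act M e ((a \<oplus>[M] sgn_act M e b) \<ominus>[M] (c \<oplus>[M] d)) = sgn_act M e (a \<ominus>[M] d) \<oplus>[M] sgn_act M e (sgn_act M e b \<ominus>[M] c)"
   if "a : carrier M" "b : carrier M" "c : carrier M" "d : carrier M" for a b c d e
   using that by (cases "even e"; simp add: sgn_act_def; algebra)
  have sgn5: "sgn_act M e (sgn_act M f (x1 \<ominus>[M] x2) \<ominus>[M] sgn_act M f (x3 \<ominus>[M] x4)) =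
    sgn_act M g (x1 \<ominus>[M] x2 \<ominus>[M] x3 \<oplus>[M] x4)"
   if "x1 : carrier M" "x2 : carrier M" "x3 : carrier M" "x4 : carrier M" "even g = (even e = even f)"
   for x1 x2 x3 x4 e f g
   using that by (cases "even e"; cases "even f"; simp add: sgn_act_def; algebra)
  have sgn6: "sgn_act M e (sgn_act M e (sgn_act M f (x1 \<ominus>[M] x3)) \<ominus>[M] sgn_act M h (x2 \<ominus>[M] x4)) =
    \<ominus>[M] sgn_act M g (x1 \<ominus>[M] x2 \<ominus>[M] x3 \<oplus>[M] x4)"
   if "x1 : carrier M" "x2 : carrier M" "x3 : carrier M" "x4 : carrier M"
    "even g = odd f" "even h = (even e = even f)"
   for x1 x2 x3 x4 e f g h
   using that by (cases "even e"; cases "even f"; simp add: sgn_act_def; algebra)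
  note sam = sgn_act_amap[OF M.abelian_group_axioms]
  have "eterm A X aa (bnd A X aa) s j = sgn_act M ?e (finsum M ?a ?S1 \<ominus>[M] finsum M ?d ?S1) \<oplus>[M]
    sgn_act M ?e (sgn_act M ?e (finsum M ?b ?S2) \<ominus>[M] finsum M ?c ?S2)"
   unfolding eterm_def Let_def Suc_eq_plus1[symmetric] P1 P2 P3 M_def[symmetric]
   by (rule sgn4[OF fin[unfolded Suc_eq_plus1[symmetric]]])
  also have "finsum M ?a ?S1 \<ominus>[M] finsum M ?d ?S1 = finsum M (%q. ?a q \<ominus>[M] ?d q) ?S1"
   using cl1 by (intro M.finsum_minus[symmetric]) auto
  also have "sgn_act M ?e \<dots> = finsum M (%q. sgn_act M ?e (?a q \<ominus>[M] ?d q)) ?S1"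
   using cl1 by (intro amap_finsum[OF sam]) auto
  also have "\<dots> = finsum M (G j) ?S1"
  proof (rule M.finsum_cong')
   fix q assume q: "q : ?S1"
   then have c: "t1 j q : carrier M" "t2 j q : carrier M" "t3 j q : carrier M" "t4 j q : carrier M" using tc[of j q] j by auto
   have ev: "even (int j + int q) = (even ?e = even (int ?l - int q - 1))" by auto
   show "sgn_act M ?e (?a q \<ominus>[M] ?d q) = G j q"
    unfolding G_def by (rule sgn5[OF c ev])
  qed (use Gc j in auto)
  also have "sgn_act M ?e (finsum M ?b ?S2) = finsum M (%p. sgn_act M ?e (?b p)) ?S2"
   using cl2 by (intro amap_finsum[OF sam]) auto
  also have "\<dots> \<ominus>[M] finsum M ?c ?S2 = finsum M (%p. sgn_act M ?e (?b p) \<ominus>[M] ?c p) ?S2"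
   by (intro M.finsum_minus[symmetric] cl3 cl2)
  also have "sgn_act M ?e \<dots> = finsum M (%p. sgn_act M ?e (sgn_act M ?e (?b p) \<ominus>[M] ?c p)) ?S2"
   by (intro amap_finsum[OF sam] M.minus_closed cl3 cl2)
  also have "\<dots> = finsum M (%p. \<ominus>[M] G p j) ?S2"
  proof (rule M.finsum_cong')
   fix p assume p: "p : ?S2"
   then have c: "t1 p j : carrier M" "t2 p j : carrier M" "t3 p j : carrier M" "t4 p j : carrier M" using tc[of p j] j by auto
   have ev: "even (int p + int j) = odd (int j - int p - 1)"
    "even (int ?l - int p) = (even ?e = even (int j - int p - 1))" by auto
   show "sgn_act M ?e (sgn_act M ?e (?b p) \<ominus>[M] ?c p) = \<ominus>[M] G p j"
    unfolding G_def by (rule sgn6[OF c ev])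
  qed (use Gc j in auto)
  also have "\<dots> = \<ominus>[M] finsum M (%p. G p j) ?S2"
   using Gc j amap_finsum[OF sgn_act_amap[OF M.abelian_group_axioms, of 1], of ?S2 "%p. G p j"] by (simp add: sgn_act_def)
  finally show ?thesis by (simp add: a_minus_def)
 qed
 have fc: "finsum M (G j) {j+1..<?l} : carrier M" "finsum M (%p. G p j) {1..<j} : carrier M" if "j : {1..<?l}" for j
  using Gc that by (auto intro!: M.finsum_closed)
 have "finsum M (eterm A X aa (bnd A X aa) s) {1..<?l} =
   finsum M (%j. finsum M (G j) {j+1..<?l} \<ominus>[M] finsum M (%p. G p j) {1..<j}) {1..<?l}"
  using main fc by (intro M.finsum_cong') auto
 also have "\<dots> = finsum M (%j. finsum M (G j) {j+1..<?l}) {1..<?l} \<ominus>[M] finsum M (%j. finsum M (%p. G p j) {1..<j}) {1..<?l}"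
  using fc by (intro M.finsum_minus) auto
 also have "finsum M (%j. finsum M (G j) {j+1..<?l}) {1..<?l} = finsum M (%j. finsum M (%p. G p j) {1..<j}) {1..<?l}"
  using Gc by (intro M.finsum_triangle) auto
 also have "\<dots> \<ominus>[M] \<dots> = \<zero>[M]"
  using fc by (intro M.minus_self M.finsum_closed) auto
 finally show ?thesis unfolding M_def .
qed

end

lemma (in abelian_group) finsum_update:
 assumes I: "finite I" "j : I" and d: "d : carrier G" and g: "!!i. i : I ==> g i : carrier G"
  and f: "!!i. i : I ==> i ~= j ==> f i = g i" "f j = g j \<oplus> d"
 shows "finsum G f I = finsum G g I \<oplus> d"
proof -
 have "finsum G f I = finsum G (%i. g i \<oplus> (if i = j then d else \<zero>)) I"
  using d g f by (intro finsum_cong') auto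
 also have "\<dots> = finsum G g I \<oplus> finsum G (%i. if i = j then d else \<zero>) I"
  using d g by (intro finsum_addf) auto
 also have "finsum G (%i. if i = j then d else \<zero>) I = d"
  using I d finsum_single[of I j "%i. if i = j then d else \<zero>"] by simp
 finally show ?thesis .
qed

lemma bterm_cong:
 assumes "aa (drop j s) = \<beta> (drop j s)" "aa (take (Suc j) s) = \<beta> (take (Suc j) s)"
  "aa (take j s @ drop (Suc j) s) = \<beta> (take j s @ drop (Suc j) s)"
  "X (hd s) = Y (hd s)" "X (last s) = Y (last s)" "X (s ! j) = Y (s ! j)"
 shows "bterm A X aa s j = bterm A Y \<beta> s j"
 unfolding bterm_def Let_def Suc_eq_plus1[symmetric] assms ..

lemma eterm_cong:
 assumes "D (drop j s) = E (drop j s)" "D (take (Suc j) s) = E (take (Suc j) s)"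
  "D (take j s @ drop (Suc j) s) = E (take j s @ drop (Suc j) s)"
 shows "eterm A X aa D s j = eterm A X aa E s j"
 unfolding eterm_def Let_def Suc_eq_plus1[symmetric] assms ..

lemma (in nerve_family) bnd_cong:
 assumes s: "s : nerve_seqs n" and Y: "!!i. i <= n ==> X i = Y i"
  and eq: "!!j. 0 < j ==> j < length s - 1 ==> aa (drop j s) = \<beta> (drop j s) &
   aa (take (Suc j) s) = \<beta> (take (Suc j) s) & aa (take j s @ drop (Suc j) s) = \<beta> (take j s @ drop (Suc j) s)"
 shows "bnd A X aa s = bnd A Y \<beta> s"
proof -
 note m = nerve_seqsD[OF s]
 have XY: "X (hd s) = Y (hd s)" "X (last s) = Y (last s)" using Y m(5,6) by auto
 interpret M: abelian_group "sHom A X s (seq_deg s + 1)" by (rule hom_group[OF seq_Ob(1)[OF s] seq_Ob(2)[OF s]])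
 have bt: "bterm A Y \<beta> s j = bterm A X aa s j" if j: "0 < j" "j < length s - 1" for j
 proof (rule bterm_cong[symmetric])
  show "X (s ! j) = Y (s ! j)" using Y m(4)[of j] j by simp
 qed (use eq[OF j] XY in auto)
 show ?thesis unfolding bnd_def XY[symmetric]
  using bt bterm_closed[OF s] by (intro M.finsum_cong') auto
qed

section \<open>Degenerate sequences\<close>

lemma sorted_not_distinct:
 assumes "sorted (s :: nat list)" "\<not> distinct s" shows "\<exists>q. Suc q < length s & s ! q = s ! Suc q"
proof -
 obtain i j where ij: "i < j" "j < length s" "s ! i = s ! j"
  using assms(2) unfolding distinct_conv_nth by (metis nat_neq_iff)
 then have "s ! i <= s ! Suc i" "s ! Suc i <= s ! j"
  using sorted_nth_mono[OF assms(1), of i "Suc i"] sorted_nth_mono[OF assms(1), of "Suc i" j] by simp_all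
 then show ?thesis using ij by (intro exI[of _ i]) auto
qed

lemma del_adjacent:
 assumes "Suc q < length s" "s ! q = s ! Suc q"
 shows "take q s @ drop (Suc q) s = take (Suc q) s @ drop (Suc (Suc q)) s"
proof -
 have "drop (Suc q) s = s ! q # drop (Suc (Suc q)) s" using assms Cons_nth_drop_Suc by metis
 then show ?thesis using take_Suc_conv_app_nth[of q s] assms by simp
qed

text \<open>For \<open>j\<close> other than q and q + 1, the product and the deleted sequence still
  contain the repetition and vanish. At q and q + 1 the two deletions give the same sequence with
  opposite signs, and the products vanish. At an end of the sequence only one of the two positions
  is inner; its term is a composite with an identity minus the same element.\<close>

lemma (in nerve_family) bnd_degenerate:
 assumes ids: "!!i. i <= n ==> aa [i, i] = idn A (X i)"
  and deg: "!!s j. s : nerve_seqs n ==> 3 <= length s ==> Suc j < length s ==> s ! j = s ! Suc j ==>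
   aa s = \<zero>[sHom A X s (seq_deg s)]"
  and s: "s : nerve_seqs n" and q: "Suc q < length s" "s ! q = s ! Suc q"
 shows "bnd A X aa s = \<zero>[sHom A X s (seq_deg s + 1)]"
proof -
 define M where "M = sHom A X s (seq_deg s + 1)"
 note oH = seq_Ob(1)[OF s] and oZ = seq_Ob(2)[OF s]
 interpret M: abelian_group M unfolding M_def by (rule hom_group[OF oH oZ])
 let ?l = "length s - 1"
 have lq: "Suc q <= ?l" using q by simp
 let ?c = "%j. cmp A (X (hd s)) (X (s ! j)) (X (last s)) (seq_deg (drop j s)) (seq_deg (take (Suc j) s))
     (aa (drop j s)) (aa (take (Suc j) s))"
 let ?d = "%j. take j s @ drop (Suc j) s"
 have bt: "bterm A X aa s j = sgn_act M (int ?l - int j - 1) (?c j \<ominus>[M] aa (?d j))" for j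
  unfolding bterm_def Let_def Suc_eq_plus1[symmetric] M_def ..
 have dc: "aa (?d j) : carrier M" if "0 < j" "j < ?l" for j using aa_sub(3)[OF s that] unfolding M_def .
 have z: "sgn_act M i \<zero>[M] = \<zero>[M]" for i by (rule sgn_act_zero) (rule M.abelian_group_axioms)
 have cz: "?c j = \<zero>[M]" if j: "0 < j" "j < ?l" and
  "aa (drop j s) = \<zero>[Hom A (X (s ! j)) (X (last s)) (seq_deg (drop j s))] \<or>
  aa (take (Suc j) s) = \<zero>[Hom A (X (hd s)) (X (s ! j)) (seq_deg (take (Suc j) s))]" for j
 proof -
  have oj: "X (s ! j) : Ob A" using seq_Ob(3)[OF s, of j] j by simp
  note sub = aa_sub[OF s j]
  show ?thesis using that(3) amap_zero[OF cmp_amap_left[OF oH oj oZ sub(2) deg_sum(1)[OF j]]]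
   amap_zero[OF cmp_amap_right[OF oH oj oZ sub(1) deg_sum(1)[OF j]]] unfolding M_def by auto
 qed
 have drop_z: "aa (drop j s) = \<zero>[Hom A (X (s ! j)) (X (last s)) (seq_deg (drop j s))]"
  if j: "0 < j" "j < ?l" "j <= q" "j + 3 <= length s" for j
  using deg[OF sub_seq_mem(1)[OF s j(1,2)], of "q - j"] that q sub_seq_simps[OF j(1,2)] by simp
 have take_z: "aa (take (Suc j) s) = \<zero>[Hom A (X (hd s)) (X (s ! j)) (seq_deg (take (Suc j) s))]"
  if j: "0 < j" "j < ?l" "Suc q <= j" "2 <= j" for j
  using deg[OF sub_seq_mem(2)[OF s j(1,2)], of q] that q sub_seq_simps[OF j(1,2)] by simp
 have del_z: "aa (?d j) = \<zero>[M]" if j: "0 < j" "j < ?l" "j < q \<or> Suc q < j" for j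
 proof -
  \<comment> \<open>The place of the repetition after deletion: it moves down by one if an earlier
    entry is deleted.\<close>
  define r where "r = (if j < q then q - 1 else q)"
  have "Suc r < length (?d j)" "?d j ! r = ?d j ! Suc r" "3 <= length (?d j)"
   using j q sub_seq_simps(9)[OF j(1,2)] unfolding r_def by (auto simp: nth_append min_def)
  from deg[OF sub_seq_mem(3)[OF s j(1,2)] this(3,1,2)] show ?thesis
   unfolding sub_seq_simps[OF j(1,2)] seq_deg_sub(3)[OF j(1,2)] M_def .
 qed
 have b0: "bterm A X aa s j = \<zero>[M]" if j: "0 < j" "j < ?l" "j < q \<or> Suc q < j" for j
 proof -
  have "?c j = \<zero>[M]" using drop_z[OF j(1,2)] take_z[OF j(1,2)] j q by (intro cz[OF j(1,2)]) linarith
  then show ?thesis unfolding bt using del_z[OF j] by (simp add: M.minus_self z)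
 qed
 have len2: "t = [t ! 0, t ! Suc 0]" if "length t = 2" for t :: "nat list"
  using that by (auto simp: numeral_2_eq_2 length_Suc_conv)
 have low: "bterm A X aa s (Suc q) = \<zero>[M]" if q0: "q = 0" "Suc q < ?l"
 proof -
  have j: "0 < Suc 0" "Suc 0 < ?l" using q0 by auto
  note sub = aa_sub[OF s j, unfolded sub_seq_simps[OF j]]
  have tk: "take (Suc (Suc 0)) s = [s ! 0, s ! 0]" using len2[of "take (Suc (Suc 0)) s"] q q0 by simp
  have hs: "hd s = s ! 0" using nerve_seqsD(7)[OF s] by (simp add: hd_conv_nth)
  have xs: "X (s ! Suc 0) = X (hd s)" using q q0 hs by simp
  have "aa (take (Suc (Suc 0)) s) = idn A (X (hd s))" unfolding tk using ids nerve_seqsD(5)[OF s] hs by simp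
  moreover have "seq_deg (take (Suc (Suc 0)) s) = 0" unfolding tk by (simp add: seq_deg_def)
  ultimately have c: "?c (Suc 0) = aa (drop (Suc 0) s)" using idn_right[OF oH oZ] sub(1) unfolding xs by simp
  have d: "?d (Suc 0) = drop (Suc 0) s" using del_adjacent[of 0 s] q q0 by simp
  show ?thesis unfolding q0(1) bt c d using dc[OF j] unfolding d by (simp add: M.minus_self z)
 qed
 have high: "bterm A X aa s q = \<zero>[M]" if q0: "0 < q" "Suc q = ?l"
 proof -
  have j: "0 < q" "q < ?l" using q0 by auto
  note sub = aa_sub[OF s j, unfolded sub_seq_simps[OF j]]
  have dr: "drop q s = [s ! q, s ! q]" using len2[of "drop q s"] q q0 by simp
  have ls: "last s = s ! q" using sub_seq_simps(2)[OF j] dr by simp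
  have "aa (drop q s) = idn A (X (last s))" unfolding dr using ids nerve_seqsD(6)[OF s] ls by simp
  moreover have "seq_deg (drop q s) = 0" unfolding dr by (simp add: seq_deg_def)
  ultimately have c: "?c q = aa (take (Suc q) s)" using idn_left[OF oH oZ] sub(2) unfolding ls by simp
  have d: "?d q = take (Suc q) s" using del_adjacent[OF q] q0 by simp
  show ?thesis unfolding bt c d using dc[OF j] unfolding d by (simp add: M.minus_self z)
 qed
 have "finsum M (bterm A X aa s) {1..<?l} = \<zero>[M]"
 proof (cases "0 < q & Suc q < ?l")
  case False
  have "bterm A X aa s j = \<zero>[M]" if "j : {1..<?l}" for j
  proof -
   consider "j < q \<or> Suc q < j" | "j = q" | "j = Suc q" by linarith
   then show ?thesis using that b0[of j] low high lq False by cases auto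
  qed
  then show ?thesis by (intro M.add.finprod_one_eqI)
 next
  case True
  then have j1: "0 < q" "q < ?l" and j2: "0 < Suc q" "Suc q < ?l" by auto
  have c1: "?c q = \<zero>[M]"
   by (rule cz[OF j1], rule disjI1, rule drop_z[OF j1]) (use True in auto)
  have c2: "?c (Suc q) = \<zero>[M]"
   by (rule cz[OF j2], rule disjI2, rule take_z[OF j2]) (use True in auto)
  note btc = bterm_closed[OF s, folded M_def]
  have "finsum M (bterm A X aa s) {1..<?l} = finsum M (bterm A X aa s) {q, Suc q}"
  proof (rule M.add.finprod_mono_neutral_cong_right)
   show "bterm A X aa s i = \<zero>[M]" if "i : {1..<?l} - {q, Suc q}" for i
    using b0[of i] that by (cases "i < q") auto
  qed (use True btc in auto)
  also have "\<dots> = bterm A X aa s q \<oplus>[M] bterm A X aa s (Suc q)"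
   using btc[OF j1] btc[OF j2] by simp
  also have "bterm A X aa s q = \<ominus>[M] bterm A X aa s (Suc q)"
   unfolding bt c1 c2 del_adjacent[OF q] using dc[OF j2] by (simp add: sgn_act_def)
  also have "\<dots> \<oplus>[M] bterm A X aa s (Suc q) = \<zero>[M]"
   using btc[OF j2] by (simp add: M.l_neg)
  finally show ?thesis .
 qed
 then show ?thesis unfolding bnd_def M_def .
qed

text \<open>On a sequence with a repetition both sides of the nerve equation are zero: the right one
  by \<open>bnd_degenerate\<close>, the left one as the differential of zero or of an identity. Only
  strictly increasing sequences remain to be checked.\<close>

lemma (in adg) nerveI:
 assumes X: "X : {..n} \<rightarrow>\<^sub>E Ob A"
  and aa: "aa : (\<Pi>\<^sub>E s\<in>nerve_seqs n. smor A X s (seq_deg s))"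
  and ids: "!!i. i <= n ==> aa [i, i] = idn A (X i)"
  and deg: "!!s j. s : nerve_seqs n ==> 3 <= length s ==> Suc j < length s ==> s ! j = s ! Suc j ==>
   aa s = \<zero>[sHom A X s (seq_deg s)]"
  and eq: "!!s. s : nerve_seqs n ==> distinct s ==> dif A (X (hd s)) (X (last s)) (seq_deg s) (aa s) = bnd A X aa s"
 shows "(X, aa) : coherent_nerve A n"
proof -
 interpret nf: nerve_family A n X aa
  using X aa by unfold_locales auto
 have "dif A (X (hd s)) (X (last s)) (seq_deg s) (aa s) = bnd A X aa s" if s: "s : nerve_seqs n" for s
 proof (cases "distinct s")
  case False
  then obtain q where q: "Suc q < length s" "s ! q = s ! Suc q"
   using sorted_not_distinct nerve_seqsD(2)[OF s] by blast
  have b: "bnd A X aa s = \<zero>[sHom A X s (seq_deg s + 1)]"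
   by (rule nf.bnd_degenerate[OF ids deg s q])
  show ?thesis
  proof (cases "3 <= length s")
   case True
   show ?thesis unfolding deg[OF s True q] b
    using amap_zero[OF dif_amap[OF nf.seq_Ob(1)[OF s] nf.seq_Ob(2)[OF s] refl]] .
  next
   case False
   then have l: "length s = 2" using nerve_seqsD(1)[OF s] by simp
   then have "q = 0" using q by simp
   then obtain i where i: "s = [i, i]" using l q by (auto simp: numeral_2_eq_2 length_Suc_conv)
   then have "i <= n" using nerve_seqsD(5)[OF s] by simp
   then show ?thesis unfolding b unfolding i by (simp add: ids seq_deg_def dif_idn nf.X)
  qed
 qed (use eq s in blast)
 then show ?thesis unfolding coherent_nerve_iff using X aa ids deg by blast
qed

subsection \<open>Filling horns\<close>

definition top_seq :: "nat => nat list" where "top_seq n = [0..<Suc n]"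

definition omit :: "nat => nat => nat list" where
 "omit n k = take k (top_seq n) @ drop (Suc k) (top_seq n)"

text \<open>The sequences lying in some face other than the \<open>k\<close>-th, hence those on
  which a horn prescribes the data. By \<open>horn_cases\<close> the only strictly increasing ones
  left out are the missing face and the top sequence.\<close>

definition horn :: "nat => nat => nat list set" where
 "horn n k = {s : nerve_seqs n. \<exists>i\<le>n. i ~= k & i \<notin> set s}"

lemma top_seq_simps: "length (top_seq n) = Suc n" "j <= n ==> top_seq n ! j = j" "hd (top_seq n) = 0"
  "last (top_seq n) = n" "set (top_seq n) = {..n}" "distinct (top_seq n)" "seq_deg (top_seq n) = 1 - int n"
 unfolding top_seq_def by (auto simp: nth_upt hd_upt seq_deg_def simp del: upt_Suc)

lemma omit_simps:
 assumes "k <= n" "2 <= n"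
 shows "length (omit n k) = n" "set (omit n k) = {..n} - {k}" "distinct (omit n k)"
  "hd (omit n k) = (if k = 0 then 1 else 0)" "last (omit n k) = (if k = n then n - 1 else n)"
  "seq_deg (omit n k) = 2 - int n"
proof -
 have o: "omit n k = [0..<k] @ [Suc k..<Suc n]"
  unfolding omit_def top_seq_def using assms by (simp add: take_upt drop_upt del: upt_Suc)
 show "length (omit n k) = n" "seq_deg (omit n k) = 2 - int n" unfolding seq_deg_def o using assms by (auto simp del: upt_Suc)
 show "set (omit n k) = {..n} - {k}" "distinct (omit n k)" unfolding o using assms by (auto simp del: upt_Suc)
 show "hd (omit n k) = (if k = 0 then 1 else 0)" unfolding o using assms by (auto simp: hd_append simp del: upt_Suc)
 show "last (omit n k) = (if k = n then n - 1 else n)" unfolding o using assms by (auto simp: last_append last_upt simp del: upt_Suc)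
qed

lemma top_seq_mem: "1 <= n ==> top_seq n : nerve_seqs n"
 unfolding nerve_seqs_def top_seq_def by (auto simp del: upt_Suc)

lemma omit_mem:
 assumes "k <= n" "2 <= n" shows "omit n k : nerve_seqs n"
proof -
 have "sorted (omit n k)" unfolding omit_def top_seq_def using assms
  by (auto simp: take_upt drop_upt sorted_append simp del: upt_Suc)
 then show ?thesis using omit_simps[OF assms] assms unfolding nerve_seqs_def by auto
qed

lemma horn_cases:
 assumes s: "s : nerve_seqs n" "distinct s" and kn: "k <= n" "2 <= n"
 shows "s : horn n k \<or> s = omit n k \<or> s = top_seq n"
proof (cases "s : horn n k")
 case False
 then have "{..n} - {k} \<subseteq> set s" using s by (auto simp: horn_def)
 then consider "set s = {..n}" | "set s = {..n} - {k}" using nerve_seqsD(3)[OF s(1)] by blast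
 then show ?thesis
 proof cases
  case 1
  then have "s = top_seq n"
   using sorted_distinct_set_unique[OF nerve_seqsD(2)[OF s(1)] s(2) nerve_seqsD(2)[OF top_seq_mem]] kn
   by (simp add: top_seq_simps)
  then show ?thesis by simp
 next
  case 2
  then have "s = omit n k"
   using sorted_distinct_set_unique[OF nerve_seqsD(2)[OF s(1)] s(2) nerve_seqsD(2)[OF omit_mem[OF kn]]]
   by (simp add: omit_simps[OF kn])
  then show ?thesis by simp
 qed
qed simp

lemma horn_sub:
 assumes s: "s : horn n k" and j: "0 < j" "j < length s - 1"
 shows "drop j s : horn n k" "take (Suc j) s : horn n k" "take j s @ drop (Suc j) s : horn n k"
 using s sub_seq_mem[of s n j, OF _ j] set_drop_subset[of j s] set_take_subset[of "Suc j" s]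
  set_drop_subset[of "Suc j" s] set_take_subset[of j s] unfolding horn_def by auto

text \<open>Each piece loses a vertex of the missing face: a final segment the first one, an initial
  segment the last one, a deletion the \<open>j\<close>-th.\<close>

lemma omit_sub:
 assumes kn: "k <= n" "2 <= n" and j: "0 < j" "j < length (omit n k) - 1"
 shows "drop j (omit n k) : horn n k" "take (Suc j) (omit n k) : horn n k"
  "take j (omit n k) @ drop (Suc j) (omit n k) : horn n k"
proof -
 let ?s = "omit n k"
 note m = sub_seq_mem[OF omit_mem[OF kn] j] and d = omit_simps(3)[OF kn]
 have s: "?s ! i <= n & ?s ! i ~= k" if "i < length ?s" for i
  using nth_mem[OF that] omit_simps(2)[OF kn] by auto
 have "distinct (take j ?s @ drop j ?s)" "distinct (take (Suc j) ?s @ drop (Suc j) ?s)" using d by simp_all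
 then have dj: "set (take j ?s) \<inter> set (drop j ?s) = {}" "set (take (Suc j) ?s) \<inter> set (drop (Suc j) ?s) = {}"
  by (simp_all only: distinct_append)
 have "distinct (take j ?s @ ?s ! j # drop (Suc j) ?s)" using d id_take_nth_drop[of j ?s] j by simp
 then have "?s ! j \<notin> set (take j ?s @ drop (Suc j) ?s)" by simp
 moreover have "?s ! 0 : set (take j ?s)"
  unfolding in_set_conv_nth using j by (intro exI[of _ 0]) simp
 moreover have "?s ! (length ?s - 1) : set (drop (Suc j) ?s)"
 proof -
  have i: "length ?s - 1 - Suc j < length (drop (Suc j) ?s)" by (subst length_drop) (use j in linarith)
  have e: "Suc j + (length ?s - 1 - Suc j) = length ?s - 1" and l: "Suc j <= length ?s" using j by linarith+
  show ?thesis using nth_mem[OF i] by (simp only: nth_drop[OF l] e)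
 qed
 ultimately have "?s ! 0 \<notin> set (drop j ?s)" "?s ! (length ?s - 1) \<notin> set (take (Suc j) ?s)"
  "?s ! j \<notin> set (take j ?s @ drop (Suc j) ?s)"
  using dj by blast+
 moreover have "0 < length ?s" "length ?s - 1 < length ?s" "j < length ?s" using j by auto
 ultimately show "drop j ?s : horn n k" "take (Suc j) ?s : horn n k"
  "take j ?s @ drop (Suc j) ?s : horn n k"
  unfolding horn_def using m s by blast+
qed

text \<open>Among all pieces of the top sequence exactly one is the missing face: a final segment if
  \<open>k\<close> = 0, an initial segment if \<open>k\<close> = \<open>n\<close>, and a deletion
  otherwise. This trichotomy is behind the definition of \<open>Tm\<close>.\<close>

lemma top_sub:
 assumes kn: "k <= n" "2 <= n" and j: "0 < j" "j < n"
 shows "if k = 0 & j = 1 then drop j (top_seq n) = omit n k else drop j (top_seq n) : horn n k"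
  "if k = n & j = n - 1 then take (Suc j) (top_seq n) = omit n k else take (Suc j) (top_seq n) : horn n k"
  "if k = j then take j (top_seq n) @ drop (Suc j) (top_seq n) = omit n k
   else take j (top_seq n) @ drop (Suc j) (top_seq n) : horn n k"
proof -
 have j': "0 < j" "j < length (top_seq n) - 1" using j by (simp_all add: top_seq_simps)
 have "1 <= n" using kn by simp
 note m = sub_seq_mem[OF top_seq_mem[OF this] j']
 have st: "set (drop j (top_seq n)) = {j..n}" "set (take (Suc j) (top_seq n)) = {..j}"
  "set (take j (top_seq n) @ drop (Suc j) (top_seq n)) = {..n} - {j}"
  unfolding top_seq_def using j by (auto simp: take_upt drop_upt simp del: upt_Suc)
 show "if k = 0 & j = 1 then drop j (top_seq n) = omit n k else drop j (top_seq n) : horn n k"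
 proof (cases "k = 0 & j = 1")
  case False
  \<comment> \<open>A vertex different from \<open>k\<close> that the final segment misses. For
    \<open>k\<close> = 0 the excluded case leaves \<open>j\<close> > 1, so that 1 is missed.\<close>
  define w :: nat where "w = (if k = 0 then 1 else 0)"
  have "w <= n" "w ~= k" "w \<notin> {j..n}" using False j kn by (auto simp: w_def)
  then show ?thesis using m(1) st(1) False unfolding horn_def by auto
 qed (simp add: omit_def)
 show "if k = n & j = n - 1 then take (Suc j) (top_seq n) = omit n k else take (Suc j) (top_seq n) : horn n k"
 proof (cases "k = n & j = n - 1")
  case False
  define w :: nat where "w = (if k = n then n - 1 else n)"
  have "w <= n" "w ~= k" "w \<notin> {..j}" using False j kn by (auto simp: w_def)
  then show ?thesis using m(2) st(2) False unfolding horn_def by auto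
 next
  case True
  have "drop (Suc n) (top_seq n) = []" by (simp add: top_seq_simps)
  then have "take (Suc j) (top_seq n) = omit n k" using True j unfolding omit_def by simp
  then show ?thesis using True by simp
 qed
 show "if k = j then take j (top_seq n) @ drop (Suc j) (top_seq n) = omit n k
   else take j (top_seq n) @ drop (Suc j) (top_seq n) : horn n k"
 proof (cases "k = j")
  case False
  have "j \<notin> set (take j (top_seq n) @ drop (Suc j) (top_seq n))" unfolding st(3) by simp
  moreover have "j <= n" "j ~= k" using j False by auto
  ultimately have "take j (top_seq n) @ drop (Suc j) (top_seq n) : horn n k"
   unfolding horn_def mem_Collect_eq using m(3) by blast
  then show ?thesis using False by (simp only: if_False)
 next
  case True
  then show ?thesis unfolding omit_def True by (simp only: if_True)
 qed
qed

lemma not_horn: "k <= n ==> 2 <= n ==> omit n k \<notin> horn n k" "top_seq n \<notin> horn n k"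
 by (auto simp: horn_def omit_simps top_seq_simps)

lemma omit_neq_top: "k <= n ==> 2 <= n ==> omit n k ~= top_seq n"
 using omit_simps(1)[of k n] top_seq_simps(1)[of n] by auto

text \<open>The family is total and satisfies the conditions on identities and repetitions
  everywhere, but the nerve equation only on the horn. Its values at the missing face and at the top
  are placeholders to be overwritten.\<close>

locale horn_family = nerve_family A n X aa
 for A :: "('k, 'o, 'm) dgcat" and n :: nat and X :: "nat => 'o" and aa :: "nat list => 'm" +
 fixes k :: nat
 assumes n2: "2 <= n" and kn: "k <= n"
  and ids: "i <= n ==> aa [i, i] = idn A (X i)"
  and deg: "s : nerve_seqs n ==> 3 <= length s ==> Suc j < length s ==> s ! j = s ! Suc j ==>
   aa s = \<zero>[sHom A X s (seq_deg s)]"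
  and eq: "s : horn n k ==> dif A (X (hd s)) (X (last s)) (seq_deg s) (aa s) = bnd A X aa s"
begin

abbreviation "om \<equiv> omit n k"
abbreviation "tp \<equiv> top_seq n"
abbreviation "HO i \<equiv> sHom A X om i"
abbreviation "HT i \<equiv> Hom A (X 0) (X n) i"

text \<open>The prescribed differential of the missing face. The boundary of the top cell is affine
  in that face: \<open>top_bnd\<close> is its constant term, computed with the face set to zero, and
  \<open>Tm\<close> its linear part.\<close>

definition face_bnd :: 'm where "face_bnd = bnd A X aa om"
definition zero_face :: "nat list => 'm" where "zero_face = aa(om := \<zero>[HO (2 - int n)])"
definition top_bnd :: 'm where "top_bnd = bnd A X zero_face tp"

text \<open>For \<open>k\<close> = 0 the missing face is the left factor at \<open>j\<close> = 1,
  for \<open>k\<close> = \<open>n\<close> the right factor at \<open>j\<close> = \<open>n\<close> -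
  1, otherwise the deleted sequence at \<open>j\<close> = \<open>k\<close>. The exponent n - j - 1
  of the nerve equation becomes n - 2, then 0, and finally, with the minus sign of the deletion, n -
  k.\<close>

definition Tm :: "int => 'm => 'm" where
 "Tm = (if k = 0 then (%i x. sgn_act (HT i) (int n - 2) (cmp A (X 0) (X 1) (X n) i 0 x (aa [0, 1])))
  else if k = n then (%i. cmp A (X 0) (X (n - 1)) (X n) 0 i (aa [n - 1, n]))
  else (%i x. sgn_act (HT i) (int n - int k) x))"

lemma om_mem: "om : nerve_seqs n" and tp_mem: "tp : nerve_seqs n"
 using omit_mem[OF kn n2] top_seq_mem n2 by auto

lemma om_Ob: "X (hd om) : Ob A" "X (last om) : Ob A"
 using seq_Ob(1)[OF om_mem] seq_Ob(2)[OF om_mem] .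

lemma tp_Ob: "X 0 : Ob A" "X n : Ob A"
 using X by auto

lemma om_deg: "seq_deg om = 2 - int n" and tp_deg: "seq_deg tp = 1 - int n"
 using omit_simps(6)[OF kn n2] top_seq_simps(7) .

lemma edge_facts:
 "k = 0 ==> [0, 1] : horn n k" "k = n ==> [n - 1, n] : horn n k"
 using n2 unfolding horn_def nerve_seqs_def by (auto intro: exI[of _ n] exI[of _ 0])

lemma horn_mem: "s : horn n k ==> s : nerve_seqs n"
 by (simp add: horn_def)

lemma edge_closed:
 assumes "[p, q] : horn n k"
 shows "aa [p, q] : mor A (X p) (X q) 0" "dif A (X p) (X q) 0 (aa [p, q]) = \<zero>[Hom A (X p) (X q) 1]"
proof -
 show "aa [p, q] : mor A (X p) (X q) 0" using aa[OF horn_mem[OF assms]] by (simp add: seq_deg_def)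
 interpret M: abelian_group "Hom A (X p) (X q) 1"
  using hom_group seq_Ob(1)[OF horn_mem[OF assms]] seq_Ob(2)[OF horn_mem[OF assms]] by simp
 show "dif A (X p) (X q) 0 (aa [p, q]) = \<zero>[Hom A (X p) (X q) 1]"
  using eq[OF assms] by (simp add: seq_deg_def bnd_def)
qed

lemma om_ends: "k = 0 ==> hd om = 1" "k = 0 ==> last om = n" "k = n ==> hd om = 0" "k = n ==> last om = n - 1"
 "0 < k ==> hd om = 0" "k < n ==> last om = n"
 using omit_simps(4,5)[OF kn n2] n2 by auto

lemma X_Ob: "i <= n ==> X i : Ob A" by (rule X)

lemma Tm_amap: "amap (HO i) (HT i) (Tm i)"
proof -
 consider (0) "k = 0" | (n) "k ~= 0" "k = n" | (m) "k ~= 0" "k ~= n" by blast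
 then show ?thesis
 proof cases
  case 0
  have "amap (Hom A (X 1) (X n) i) (HT i) (%x. cmp A (X 0) (X 1) (X n) i 0 x (aa [0, 1]))"
   using n2 edge_closed(1)[OF edge_facts(1)[OF 0]] by (intro cmp_amap_left X_Ob) auto
  from amap_comp[OF this sgn_act_amap[OF hom_group[OF tp_Ob], of i "int n - 2"]]
  show ?thesis using om_ends(1)[OF 0] om_ends(2)[OF 0] unfolding Tm_def by (simp add: 0)
 next
  case n
  have "amap (Hom A (X 0) (X (n - 1)) i) (HT i) (cmp A (X 0) (X (n - 1)) (X n) 0 i (aa [n - 1, n]))"
   using edge_closed(1)[OF edge_facts(2)[OF n(2)]] by (intro cmp_amap_right X_Ob) auto
  then show ?thesis using om_ends(3)[OF n(2)] om_ends(4)[OF n(2)] n n2 unfolding Tm_def by simp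
 next
  case m
  then have "0 < k" "k < n" using kn by auto
  then show ?thesis using om_ends(5,6) m sgn_act_amap[OF hom_group[OF tp_Ob], of i "int n - int k"]
   unfolding Tm_def by simp
 qed
qed

text \<open>The edge is closed of degree 0, so composing with it on either side commutes with the
  differential without a sign.\<close>

lemma Tm_dif:
 assumes x: "x : carrier (HO i)" and i: "i1 = i + 1"
 shows "dif A (X 0) (X n) i (Tm i x) = Tm i1 (dif A (X (hd om)) (X (last om)) i x)"
proof -
 note d = dif_amap[OF tp_Ob i]
 consider (0) "k = 0" | (n) "k ~= 0" "k = n" | (m) "k ~= 0" "k ~= n" by blast
 then show ?thesis
 proof cases
  case 0
  have ii: "i = i + 0" "i1 = i1 + 0" "i1 = i + 1" using i by auto
  note e = edge_closed[OF edge_facts(1)[OF 0]]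
  have o: "X 0 : Ob A" "X 1 : Ob A" "X n : Ob A" using n2 by (auto intro: X_Ob)
  interpret M: abelian_group "HT i1" by (rule hom_group[OF tp_Ob])
  have x': "x : mor A (X 1) (X n) i" using x om_ends(1)[OF 0] om_ends(2)[OF 0] by simp
  have dx: "cmp A (X 0) (X 1) (X n) i1 0 (dif A (X 1) (X n) i x) (aa [0, 1]) : carrier (HT i1)"
   by (rule cmp_closed[OF o dif_closed[OF o(2,3) x' i] e(1) ii(2)])
  have "dif A (X 0) (X n) i (cmp A (X 0) (X 1) (X n) i 0 x (aa [0, 1])) =
    cmp A (X 0) (X 1) (X n) i1 0 (dif A (X 1) (X n) i x) (aa [0, 1])"
   using leibniz[OF o x' e(1) ii(1) i i refl] e(2) amap_zero[OF cmp_amap_right[OF o x' ii(3)]] dx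
    sgn_act_zero[OF M.abelian_group_axioms] by simp
  then show ?thesis
   using amap_sgn_act[OF d cmp_closed[OF o x' e(1) ii(1)]] om_ends(1)[OF 0] om_ends(2)[OF 0] unfolding Tm_def by (simp add: 0)
 next
  case n
  have ii: "i = 0 + i" "i1 = 0 + i1" "i1 = 1 + i" using i by auto
  note e = edge_closed[OF edge_facts(2)[OF n(2)]]
  have o: "X 0 : Ob A" "X (n - 1) : Ob A" "X n : Ob A" using n2 by (auto intro: X_Ob)
  interpret M: abelian_group "HT i1" by (rule hom_group[OF tp_Ob])
  have x': "x : mor A (X 0) (X (n - 1)) i" using x om_ends(3)[OF n(2)] om_ends(4)[OF n(2)] by simp
  have dx: "cmp A (X 0) (X (n - 1)) (X n) 0 i1 (aa [n - 1, n]) (dif A (X 0) (X (n - 1)) i x) : carrier (HT i1)"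
   by (rule cmp_closed[OF o e(1) dif_closed[OF o(1,2) x' i] ii(2)])
  have "dif A (X 0) (X n) i (cmp A (X 0) (X (n - 1)) (X n) 0 i (aa [n - 1, n]) x) =
    cmp A (X 0) (X (n - 1)) (X n) 0 i1 (aa [n - 1, n]) (dif A (X 0) (X (n - 1)) i x)"
   using leibniz[OF o e(1) x' ii(1) i refl i] e(2) amap_zero[OF cmp_amap_left[OF o x' ii(3)]] dx
   by (simp add: sgn_act_def)
  then show ?thesis using om_ends(3)[OF n(2)] om_ends(4)[OF n(2)] n n2 unfolding Tm_def by simp
 next
  case m
  then have "0 < k" "k < n" using kn by auto
  then show ?thesis using om_ends(5,6) m amap_sgn_act[OF d] x unfolding Tm_def by simp
 qed
qed

text \<open>The only position at which the missing face occurs in the equation of the top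
  cell.\<close>

definition jk :: nat where "jk = (if k = 0 then 1 else if k = n then n - 1 else k)"

lemma jk: "0 < jk" "jk < n" "jk : {1..<length tp - 1}"
 unfolding jk_def using n2 kn by (auto simp: top_seq_simps)

lemma tp_sub_other:
 assumes j: "0 < j" "j < n" "j ~= jk"
 shows "drop j tp : horn n k" "take (Suc j) tp : horn n k" "take j tp @ drop (Suc j) tp : horn n k"
 using top_sub[OF kn n2 j(1,2)] j unfolding jk_def by (auto split: if_splits)

lemma horn_neq_om: "s : horn n k ==> s ~= om" "s : horn n k ==> s ~= tp"
 using not_horn kn n2 by auto

lemma tp_edge: "take (Suc (Suc 0)) tp = [0, 1]" "drop (n - 1) tp = [n - 1, n]"
proof -
 show "take (Suc (Suc 0)) tp = [0, 1]" unfolding top_seq_def using n2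
  by (simp add: take_upt upt_rec del: upt_Suc)
 have "[n - 1..<Suc n] = [n - 1, n]" using n2 by (simp add: upt_conv_Cons del: upt_Suc)
 then show "drop (n - 1) tp = [n - 1, n]" unfolding top_seq_def by (simp add: drop_upt del: upt_Suc)
qed

text \<open>A change of \<open>D\<close> at the missing face affects one summand only, and it does
  so through \<open>Tm\<close> again: the inner sign of \<open>eterm\<close> concerns the right
  factor, which is the missing face for \<open>k\<close> = \<open>n\<close>, and there the sign is
  trivial.\<close>

lemma eterm_om:
 assumes D: "!!s. s : nerve_seqs n ==> D s : smor A X s (seq_deg s + 1)"
  and aa': "nerve_family A n X aa'" and ag: "!!s. s : horn n k ==> aa' s = aa s"
 shows "finsum (HT (3 - int n)) (eterm A X aa' D tp) {1..<length tp - 1} =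
  finsum (HT (3 - int n)) (eterm A X aa' (D(om := \<zero>[HO (3 - int n)])) tp) {1..<length tp - 1}
   \<oplus>[HT (3 - int n)] Tm (3 - int n) (D om)"
proof -
 interpret aa': nerve_family A n X aa' by (rule aa')
 let ?i = "3 - int n" and ?z = "\<zero>[HO (3 - int n)]"
 let ?D = "D(om := ?z)"
 interpret M: abelian_group "HT ?i" by (rule hom_group[OF tp_Ob])
 interpret Z: abelian_group "HO ?i" by (rule hom_group[OF om_Ob])
 have di: "seq_deg tp + 2 = ?i" "seq_deg om + 1 = ?i" "seq_deg tp + 1 = 2 - int n" by (simp_all add: om_deg tp_deg)
 have D': "?D s : smor A X s (seq_deg s + 1)" if "s : nerve_seqs n" for s
  using D[OF that] di by simp
 have Do: "D om : carrier (HO ?i)" using D[OF om_mem] di by simp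
 note ec = aa'.eterm_closed[where D = ?D, OF tp_mem _ _ D', unfolded di top_seq_simps(3,4)]
 have jl: "0 < jk" "jk < length tp - 1" using jk by auto
 note pc = aa'.eterm_parts_closed[OF tp_mem jl D, unfolded di top_seq_simps(3,4)]
 have at: "eterm A X aa' D tp jk = eterm A X aa' ?D tp jk \<oplus>[HT ?i] Tm ?i (D om)"
 proof -
  note sub = top_sub[OF kn n2 jk(1,2)]
  have tj: "tp ! jk = jk" using jk by (intro top_seq_simps(2)) simp
  have ln: "int (length tp - 1) = int n" by (simp add: top_seq_simps)
  \<comment> \<open>The three lines isolate the left product, the right product and the deletion,
    for \<open>k\<close> = 0, \<open>k\<close> = \<open>n\<close> and inner \<open>k\<close>; the
    deletion carries the opposite sign, whence e + 1.\<close>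
  have sg: "sgn_act (HT ?i) e (x \<oplus>[HT ?i] y \<ominus>[HT ?i] w) = sgn_act (HT ?i) e (\<zero>[HT ?i] \<oplus>[HT ?i] y \<ominus>[HT ?i] w) \<oplus>[HT ?i] sgn_act (HT ?i) e x"
   "sgn_act (HT ?i) e (x \<oplus>[HT ?i] y \<ominus>[HT ?i] w) = sgn_act (HT ?i) e (x \<oplus>[HT ?i] \<zero>[HT ?i] \<ominus>[HT ?i] w) \<oplus>[HT ?i] sgn_act (HT ?i) e y"
   "sgn_act (HT ?i) e (x \<oplus>[HT ?i] y \<ominus>[HT ?i] w) = sgn_act (HT ?i) e (x \<oplus>[HT ?i] y \<ominus>[HT ?i] \<zero>[HT ?i]) \<oplus>[HT ?i] sgn_act (HT ?i) (e + 1) w"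
   if "x : carrier (HT ?i)" "y : carrier (HT ?i)" "w : carrier (HT ?i)" for x y w e
   using that by (cases "even e"; simp add: sgn_act_def; algebra)+
  note sc = sgn_act_closed[OF M.abelian_group_axioms]
  consider (0) "k = 0" | (n) "k ~= 0" "k = n" | (m) "k ~= 0" "k ~= n" by blast
  then show ?thesis
  proof cases
   case 0
   have j: "jk = 1" unfolding jk_def using 0 by simp
   have sl: "drop 1 tp = om" "take (Suc 1) tp : horn n k" "take 1 tp @ drop (Suc 1) tp : horn n k"
    using sub n2 unfolding j by (simp_all add: 0)
   have t2: "take (Suc 1) tp = [0, 1]" using tp_edge(1) by simp
   have d0: "seq_deg (take (Suc 1) tp) = 0" "seq_deg om + 1 = ?i" unfolding t2 di by (simp_all add: seq_deg_def)
   have o: "X 0 : Ob A" "X 1 : Ob A" "X n : Ob A" using n2 by (auto intro: X_Ob)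
   have a01: "aa' (take (Suc 1) tp) = aa [0, 1]" using ag[OF sl(2)] t2 by simp
   have z: "cmp A (X 0) (X 1) (X n) ?i 0 ?z (aa [0, 1]) = \<zero>[HT ?i]"
    using amap_zero[OF cmp_amap_left[OF o edge_closed(1)[OF edge_facts(1)[OF 0]], of ?i ?i]] om_ends(1)[OF 0] om_ends(2)[OF 0] by simp
   have ne: "?D (take (Suc 1) tp) = D (take (Suc 1) tp)" "?D (take 1 tp @ drop (Suc 1) tp) = D (take 1 tp @ drop (Suc 1) tp)"
    using horn_neq_om(1)[OF sl(2)] horn_neq_om(1)[OF sl(3)] by simp_all
   have e: "int n - int 1 - 1 = int n - 2" by simp
   show ?thesis
    using sg(1)[OF pc(1) sc[OF pc(2)] pc(3), of "int n - 2"] z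
    unfolding eterm_def Let_def Suc_eq_plus1[symmetric] j tj[unfolded j] ln top_seq_simps(3,4) di e ne a01 sl(1) d0
    unfolding Tm_def by (simp add: 0 fun_upd_same)
  next
   case n
   have j: "jk = n - 1" unfolding jk_def using n by simp
   have sn: "Suc (n - 1) = n" using n2 by simp
   have sl: "drop (n - 1) tp : horn n k" "take n tp = om" "take (n - 1) tp @ drop n tp : horn n k"
    using sub n2 n unfolding j sn by (auto split: if_splits)
   have d0: "seq_deg (drop (n - 1) tp) = 0" "seq_deg om + 1 = ?i" unfolding tp_edge di by (simp_all add: seq_deg_def)
   have o: "X 0 : Ob A" "X (n - 1) : Ob A" "X n : Ob A" using n2 by (auto intro: X_Ob)
   have a01: "aa' (drop (n - 1) tp) = aa [n - 1, n]" using ag[OF sl(1)] tp_edge(2) by simp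
   have z: "cmp A (X 0) (X (n - 1)) (X n) 0 ?i (aa [n - 1, n]) ?z = \<zero>[HT ?i]"
    using amap_zero[OF cmp_amap_right[OF o edge_closed(1)[OF edge_facts(2)[OF n(2)]], of ?i ?i]] om_ends(3)[OF n(2)] om_ends(4)[OF n(2)] by simp
   have ne: "?D (drop (n - 1) tp) = D (drop (n - 1) tp)" "?D (take (n - 1) tp @ drop n tp) = D (take (n - 1) tp @ drop n tp)"
    using horn_neq_om(1)[OF sl(1)] horn_neq_om(1)[OF sl(3)] by simp_all
   have e: "int n - int (n - 1) - 1 = 0" using n2 by simp
   show ?thesis
    using sg(2)[OF pc(1) sc[OF pc(2)] pc(3), of 0 0] z
    unfolding eterm_def Let_def Suc_eq_plus1[symmetric] j tj[unfolded j] ln top_seq_simps(3,4) di e sn ne a01 sl(2) d0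
    unfolding Tm_def using n n2 by (simp add: fun_upd_same sgn_act_even)
  next
   case m
   have j: "jk = k" unfolding jk_def using m by simp
   have k: "0 < k" "k < n" using m kn by auto
   have sl: "drop k tp : horn n k" "take (Suc k) tp : horn n k" "take k tp @ drop (Suc k) tp = om"
    using sub m k unfolding j by (auto split: if_splits)
   have ne: "?D (drop k tp) = D (drop k tp)" "?D (take (Suc k) tp) = D (take (Suc k) tp)"
    using horn_neq_om(1)[OF sl(1)] horn_neq_om(1)[OF sl(2)] by simp_all
   have e: "int n - int k - 1 + 1 = int n - int k" by simp
   show ?thesis
    using sg(3)[OF pc(1) sc[OF pc(2)] pc(3), of "int n - int k - 1" "int n - int k - 1"] om_ends(5)[OF k(1)] om_ends(6)[OF k(2)]
    unfolding eterm_def Let_def Suc_eq_plus1[symmetric] j tj[unfolded j] ln top_seq_simps(3,4) di ne sl(3) e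
    unfolding Tm_def using m by (simp add: fun_upd_same)
  qed
 qed
 show ?thesis
 proof (rule M.finsum_update)
  show "finite {1..<length tp - 1}" by simp
  show "jk : {1..<length tp - 1}" by (rule jk(3))
  show "Tm ?i (D om) : carrier (HT ?i)" by (rule amap_closed[OF Tm_amap Do])
  show "eterm A X aa' D tp jk = eterm A X aa' ?D tp jk \<oplus>[HT ?i] Tm ?i (D om)" by (rule at)
  show "eterm A X aa' ?D tp i : carrier (HT ?i)" if "i : {1..<length tp - 1}" for i using ec that by auto
  show "eterm A X aa' D tp i = eterm A X aa' ?D tp i" if "i : {1..<length tp - 1}" "i ~= jk" for i
  proof (rule eterm_cong)
   have i: "0 < i" "i < n" "i ~= jk" using that by (auto simp: top_seq_simps)
   note h = tp_sub_other[OF i]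
   show "D (drop i tp) = ?D (drop i tp)" "D (take (Suc i) tp) = ?D (take (Suc i) tp)"
    "D (take i tp @ drop (Suc i) tp) = ?D (take i tp @ drop (Suc i) tp)"
    using horn_neq_om(1)[OF h(1)] horn_neq_om(1)[OF h(2)] horn_neq_om(1)[OF h(3)] by simp_all
  qed
 qed
qed

lemma bnd_top:
 assumes u: "u : carrier (HO (2 - int n))"
 shows "bnd A X (aa(om := u)) tp = top_bnd \<oplus>[HT (2 - int n)] Tm (2 - int n) u"
proof -
 let ?i = "2 - int n" and ?z = "\<zero>[HO (2 - int n)]"
 interpret M: abelian_group "HT ?i" by (rule hom_group[OF tp_Ob])
 interpret Z: abelian_group "HO ?i" by (rule hom_group[OF om_Ob])
 have fam: "nerve_family A n X (aa(om := w))" if "w : carrier (HO ?i)" for w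
  using that aa om_deg by unfold_locales (auto intro: X)
 interpret U: nerve_family A n X "aa(om := u)" by (rule fam[OF u])
 interpret W: nerve_family A n X zero_face unfolding zero_face_def by (rule fam) simp
 have di: "seq_deg tp + 1 = ?i" by (simp add: tp_deg)
 have jl: "0 < jk" "jk < length tp - 1" using jk by auto
 have tj: "tp ! jk = jk" using jk by (intro top_seq_simps(2)) simp
 have ln: "int (length tp - 1) = int n" by (simp add: top_seq_simps)
 note sub = top_sub[OF kn n2 jk(1,2)]
 have at: "bterm A X (aa(om := u)) tp jk = bterm A X zero_face tp jk \<oplus>[HT ?i] Tm ?i u"
 proof -
  note pc = U.seq_cmp_closed[OF tp_mem jl U.aa_sub(1,2)[OF tp_mem jl] U.deg_sum(1)[OF jl], unfolded di top_seq_simps(3,4)]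
   U.aa_sub(3)[OF tp_mem jl, unfolded di top_seq_simps(3,4)]
  have sg: "sgn_act (HT ?i) e (x \<ominus>[HT ?i] w) = sgn_act (HT ?i) e (\<zero>[HT ?i] \<ominus>[HT ?i] w) \<oplus>[HT ?i] sgn_act (HT ?i) e x"
   "sgn_act (HT ?i) e (x \<ominus>[HT ?i] w) = sgn_act (HT ?i) e (x \<ominus>[HT ?i] \<zero>[HT ?i]) \<oplus>[HT ?i] sgn_act (HT ?i) (e + 1) w"
   if "x : carrier (HT ?i)" "w : carrier (HT ?i)" for x w e
   using that by (cases "even e"; simp add: sgn_act_def; algebra)+
  consider (0) "k = 0" | (n) "k ~= 0" "k = n" | (m) "k ~= 0" "k ~= n" by blast
  then show ?thesis
  proof cases
   case 0
   have j: "jk = 1" unfolding jk_def using 0 by simp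
   have sl: "drop 1 tp = om" "take (Suc 1) tp : horn n k" "take 1 tp @ drop (Suc 1) tp : horn n k"
    using sub n2 unfolding j by (simp_all add: 0)
   have t2: "take (Suc 1) tp = [0, 1]" using tp_edge(1) by simp
   have d0: "seq_deg (take (Suc 1) tp) = 0" unfolding t2 by (simp add: seq_deg_def)
   have o: "X 0 : Ob A" "X 1 : Ob A" "X n : Ob A" using n2 by (auto intro: X_Ob)
   have z: "cmp A (X 0) (X 1) (X n) ?i 0 ?z (aa [0, 1]) = \<zero>[HT ?i]"
    using amap_zero[OF cmp_amap_left[OF o edge_closed(1)[OF edge_facts(1)[OF 0]], of ?i ?i]] om_ends(1)[OF 0] om_ends(2)[OF 0] by simp
   have ne: "(aa(om := w)) (take (Suc 1) tp) = aa [0, 1]" "(aa(om := w)) (take 1 tp @ drop (Suc 1) tp) = aa (take 1 tp @ drop (Suc 1) tp)" for w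
    using horn_neq_om(1)[OF sl(2)] horn_neq_om(1)[OF sl(3)] t2 by simp_all
   have e: "int n - int 1 - 1 = int n - 2" by simp
   show ?thesis
    using sg(1)[OF pc, of "int n - 2"] z
    unfolding bterm_def zero_face_def Let_def Suc_eq_plus1[symmetric] j tj[unfolded j] ln top_seq_simps(3,4) di e ne sl(1) d0 om_deg
    unfolding Tm_def by (simp add: 0 fun_upd_same)
  next
   case n
   have j: "jk = n - 1" unfolding jk_def using n by simp
   have sn: "Suc (n - 1) = n" using n2 by simp
   have sl: "drop (n - 1) tp : horn n k" "take n tp = om" "take (n - 1) tp @ drop n tp : horn n k"
    using sub n2 n unfolding j sn by (auto split: if_splits)
   have d0: "seq_deg (drop (n - 1) tp) = 0" unfolding tp_edge by (simp add: seq_deg_def)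
   have o: "X 0 : Ob A" "X (n - 1) : Ob A" "X n : Ob A" using n2 by (auto intro: X_Ob)
   have z: "cmp A (X 0) (X (n - 1)) (X n) 0 ?i (aa [n - 1, n]) ?z = \<zero>[HT ?i]"
    using amap_zero[OF cmp_amap_right[OF o edge_closed(1)[OF edge_facts(2)[OF n(2)]], of ?i ?i]] om_ends(3)[OF n(2)] om_ends(4)[OF n(2)] by simp
   have ne: "(aa(om := w)) (drop (n - 1) tp) = aa [n - 1, n]" "(aa(om := w)) (take (n - 1) tp @ drop n tp) = aa (take (n - 1) tp @ drop n tp)" for w
    using horn_neq_om(1)[OF sl(1)] horn_neq_om(1)[OF sl(3)] tp_edge(2) by simp_all
   have e: "int n - int (n - 1) - 1 = 0" using n2 by simp
   show ?thesis
    using sg(1)[OF pc, of 0] z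
    unfolding bterm_def zero_face_def Let_def Suc_eq_plus1[symmetric] j tj[unfolded j] ln top_seq_simps(3,4) di e sn ne sl(2) d0 om_deg
    unfolding Tm_def using n n2 by (simp add: fun_upd_same sgn_act_even)
  next
   case m
   have j: "jk = k" unfolding jk_def using m by simp
   have k: "0 < k" "k < n" using m kn by auto
   have sl: "drop k tp : horn n k" "take (Suc k) tp : horn n k" "take k tp @ drop (Suc k) tp = om"
    using sub m k unfolding j by (auto split: if_splits)
   have ne: "(aa(om := w)) (drop k tp) = aa (drop k tp)" "(aa(om := w)) (take (Suc k) tp) = aa (take (Suc k) tp)" for w
    using horn_neq_om(1)[OF sl(1)] horn_neq_om(1)[OF sl(2)] by simp_all
   have e: "int n - int k - 1 + 1 = int n - int k" by simp
   show ?thesis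
    using sg(2)[OF pc, of "int n - int k - 1"] om_ends(5)[OF k(1)] om_ends(6)[OF k(2)]
    unfolding bterm_def zero_face_def Let_def Suc_eq_plus1[symmetric] j tj[unfolded j] ln top_seq_simps(3,4) di ne sl(3) e om_deg
    unfolding Tm_def using m by (simp add: fun_upd_same)
  qed
 qed
 show ?thesis
  unfolding top_bnd_def bnd_def top_seq_simps(3,4) di
 proof (rule M.finsum_update)
  show "finite {1..<length tp - 1}" by simp
  show "jk : {1..<length tp - 1}" by (rule jk(3))
  show "Tm ?i u : carrier (HT ?i)" by (rule amap_closed[OF Tm_amap u])
  show "bterm A X (aa(om := u)) tp jk = bterm A X zero_face tp jk \<oplus>[HT ?i] Tm ?i u" by (rule at)
  show "bterm A X zero_face tp i : carrier (HT ?i)" if "i : {1..<length tp - 1}" for i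
   using W.bterm_closed[OF tp_mem, of i] that unfolding top_seq_simps(3,4) di by simp
  show "bterm A X (aa(om := u)) tp i = bterm A X zero_face tp i" if "i : {1..<length tp - 1}" "i ~= jk" for i
  proof (rule bterm_cong)
   have i: "0 < i" "i < n" "i ~= jk" using that by (auto simp: top_seq_simps)
   note h = tp_sub_other[OF i]
   show "(aa(om := u)) (drop i tp) = zero_face (drop i tp)" "(aa(om := u)) (take (Suc i) tp) = zero_face (take (Suc i) tp)"
    "(aa(om := u)) (take i tp @ drop (Suc i) tp) = zero_face (take i tp @ drop (Suc i) tp)"
    using horn_neq_om(1)[OF h(1)] horn_neq_om(1)[OF h(2)] horn_neq_om(1)[OF h(3)] unfolding zero_face_def by simp_all
  qed auto
 qed
qed

end

section \<open>The two equations of a filler\<close>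

context horn_family
begin

lemma bnd_horn_cong:
 assumes t: "t : horn n k \<or> t = om" and ag: "!!s. s : horn n k ==> aa' s = aa s"
  and Y: "!!i. i <= n ==> X i = Y i"
 shows "bnd A X aa t = bnd A Y aa' t"
proof (rule bnd_cong[OF _ Y])
 show "t : nerve_seqs n" using t om_mem horn_mem by blast
 fix j assume "0 < j" "j < length t - 1"
 then show "aa (drop j t) = aa' (drop j t) & aa (take (Suc j) t) = aa' (take (Suc j) t) &
   aa (take j t @ drop (Suc j) t) = aa' (take j t @ drop (Suc j) t)"
  using t horn_sub[of t n k j] omit_sub[OF kn n2, of j] ag by metis
qed

lemma face_bnd_closed: "face_bnd : carrier (HO (3 - int n))"
 using bnd_closed[OF om_mem] unfolding face_bnd_def om_deg by simp

lemma zero_face_family: "nerve_family A n X zero_face"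
proof
 interpret Z: abelian_group "HO (2 - int n)" by (rule hom_group[OF om_Ob])
 show "zero_face s : smor A X s (seq_deg s)" if "s : nerve_seqs n" for s
  using aa[OF that] om_deg unfolding zero_face_def by auto
qed (rule X)

lemma top_bnd_closed: "top_bnd : carrier (HT (2 - int n))"
 using nerve_family.bnd_closed[OF zero_face_family tp_mem] unfolding top_bnd_def tp_deg top_seq_simps by simp

text \<open>All pieces of the missing face lie in the horn, where differentials are boundaries; so
  the differential of its boundary is a double boundary and vanishes.\<close>

lemma dif_face_bnd: "dif A (X (hd om)) (X (last om)) (3 - int n) face_bnd = \<zero>[HO (4 - int n)]"
proof -
 have di: "seq_deg om + 1 = 3 - int n" "seq_deg om + 2 = 4 - int n" by (simp_all add: om_deg)
 interpret M: abelian_group "HO (4 - int n)" by (rule hom_group[OF om_Ob])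
 have "dif A (X (hd om)) (X (last om)) (3 - int n) face_bnd =
  finsum (HO (4 - int n)) (eterm A X aa (%t. dif A (X (hd t)) (X (last t)) (seq_deg t) (aa t)) om) {1..<length om - 1}"
  using dif_bnd[OF om_mem] unfolding di face_bnd_def .
 also have "\<dots> = finsum (HO (4 - int n)) (eterm A X aa (bnd A X aa) om) {1..<length om - 1}"
 proof (rule M.finsum_cong')
  show "eterm A X aa (bnd A X aa) om : {1..<length om - 1} \<rightarrow> carrier (HO (4 - int n))"
   using eterm_closed[OF om_mem _ _ bnd_closed] unfolding di by auto
  fix j assume "j : {1..<length om - 1}"
  then have j: "0 < j" "j < length om - 1" by auto
  show "eterm A X aa (%t. dif A (X (hd t)) (X (last t)) (seq_deg t) (aa t)) om j = eterm A X aa (bnd A X aa) om j"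
   by (rule eterm_cong) (rule eq, rule omit_sub[OF kn n2 j])+
 qed simp
 also have "\<dots> = \<zero>[HO (4 - int n)]" using sum_eterm_bnd[OF om_mem] unfolding di .
 finally show ?thesis .
qed

text \<open>The double boundary of \<open>zero_face\<close> vanishes. On the pieces of the top
  sequence its differential equals its boundary except at the missing face, where the one is 0 and
  the other \<open>face_bnd\<close>; by \<open>eterm_om\<close> this discrepancy contributes
  \<open>Tm\<close> of \<open>face_bnd\<close>.\<close>

lemma dif_top_bnd: "dif A (X 0) (X n) (2 - int n) top_bnd = \<ominus>[HT (3 - int n)] Tm (3 - int n) face_bnd"
proof -
 interpret W: nerve_family A n X zero_face by (rule zero_face_family)
 have di: "seq_deg tp + 1 = 2 - int n" "seq_deg tp + 2 = 3 - int n" "seq_deg om + 1 = 3 - int n" by (simp_all add: om_deg tp_deg)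
 interpret M: abelian_group "HT (3 - int n)" by (rule hom_group[OF tp_Ob])
 interpret Z: abelian_group "HO (3 - int n)" by (rule hom_group[OF om_Ob])
 have ag: "zero_face s = aa s" if "s : horn n k" for s using horn_neq_om[OF that] unfolding zero_face_def by simp
 \<comment> \<open>The boundary, except at the missing face: there \<open>zero_face\<close> is zero
   and so is its differential.\<close>
 let ?D = "(bnd A X zero_face)(om := \<zero>[HO (3 - int n)])"
 have Dc: "?D s : smor A X s (seq_deg s + 1)" if "s : nerve_seqs n" for s
  using W.bnd_closed[OF that] di(3) by simp
 note ec = W.eterm_closed[where D = ?D, OF tp_mem _ _ Dc, unfolded di top_seq_simps(3,4)]
 have fb: "bnd A X zero_face om = face_bnd" unfolding face_bnd_def
  by (rule bnd_horn_cong[symmetric]) (use ag in auto)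
 have "dif A (X 0) (X n) (2 - int n) top_bnd =
  finsum (HT (3 - int n)) (eterm A X zero_face (%t. dif A (X (hd t)) (X (last t)) (seq_deg t) (zero_face t)) tp) {1..<length tp - 1}"
  using W.dif_bnd[OF tp_mem] unfolding di top_bnd_def top_seq_simps(3,4) .
 also have "\<dots> = finsum (HT (3 - int n)) (eterm A X zero_face ?D tp) {1..<length tp - 1}"
 proof (rule M.finsum_cong')
  show "eterm A X zero_face ?D tp : {1..<length tp - 1} \<rightarrow> carrier (HT (3 - int n))"
   using ec by auto
  fix j assume "j : {1..<length tp - 1}"
  then have j: "0 < j" "j < n" by (auto simp: top_seq_simps)
  have h: "dif A (X (hd t)) (X (last t)) (seq_deg t) (zero_face t) = ?D t" if t: "t : horn n k \<or> t = om" for t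
  proof (cases "t = om")
   case True
   have "3 - int n = seq_deg om + 1" by (simp add: om_deg)
   from amap_zero[OF dif_amap[OF om_Ob this]] show ?thesis unfolding True zero_face_def om_deg by simp
  next
   case False
   then have t: "t : horn n k" using t by simp
   have "bnd A X aa t = bnd A X zero_face t" by (rule bnd_horn_cong) (use t ag in auto)
   then show ?thesis using eq[OF t] ag[OF t] False by simp
  qed
  show "eterm A X zero_face (%t. dif A (X (hd t)) (X (last t)) (seq_deg t) (zero_face t)) tp j = eterm A X zero_face ?D tp j"
   using top_sub[OF kn n2 j] by (intro eterm_cong h) (auto split: if_splits)
 qed simp
 finally have 1: "dif A (X 0) (X n) (2 - int n) top_bnd =
  finsum (HT (3 - int n)) (eterm A X zero_face ?D tp) {1..<length tp - 1}" .
 have fc: "finsum (HT (3 - int n)) (eterm A X zero_face ?D tp) {1..<length tp - 1} : carrier (HT (3 - int n))"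
  using ec by (intro M.finsum_closed) auto
 note tc = amap_closed[OF Tm_amap face_bnd_closed]
 have "finsum (HT (3 - int n)) (eterm A X zero_face ?D tp) {1..<length tp - 1} \<oplus>[HT (3 - int n)] Tm (3 - int n) face_bnd
  = \<zero>[HT (3 - int n)]"
  using eterm_om[OF W.bnd_closed zero_face_family ag] W.sum_eterm_bnd[OF tp_mem] unfolding di fb top_seq_simps(3,4) by simp
 then show ?thesis unfolding 1 using M.minus_equality[OF _ tc fc] by simp
qed

lemma Tm_cone:
 assumes N: "ann_pair A N J"
  and e: "!!p q. [p, q] : horn n k ==> equiv_mod A J (X p) (X q) (aa [p, q])"
 shows "cone_solvable A N Tm (X (hd om)) (X (last om)) (X 0) (X n)"
proof -
 interpret N: ann_pair A N J by (rule N)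
 consider (0) "k = 0" | (n) "k ~= 0" "k = n" | (m) "k ~= 0" "k ~= n" by blast
 then show ?thesis
 proof cases
  case 0
  have o: "X 0 : Ob A" "X 1 : Ob A" "X n : Ob A" using n2 by (auto intro: X_Ob)
  note c = N.cone_pre[OF o e[OF edge_facts(1)[OF 0]]]
  have "cmp A (X 0) (X 1) (X n) i 0 x (aa [0, 1]) : carrier (HT i)" if "x : N (X 1) (X n) i" for i x
   using cmp_closed[OF o N.N_sub[OF o(2,3) that] edge_closed(1)[OF edge_facts(1)[OF 0]]] by simp
  from N.cone_sgn[OF o(2,3,1,3) this c, of "int n - 2"]
  show ?thesis using om_ends(1)[OF 0] om_ends(2)[OF 0] unfolding Tm_def by (simp add: 0)
 next
  case n
  have o: "X 0 : Ob A" "X (n - 1) : Ob A" "X n : Ob A" using n2 by (auto intro: X_Ob)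
  from N.cone_post[OF o(2,3,1) e[OF edge_facts(2)[OF n(2)]]]
  show ?thesis using om_ends(3)[OF n(2)] om_ends(4)[OF n(2)] n n2 unfolding Tm_def by simp
 next
  case m
  then have k: "0 < k" "k < n" using kn by auto
  have "cone_solvable A N (%i x. sgn_act (HT i) (int n - int k) x) (X 0) (X n) (X 0) (X n)"
   by (rule N.cone_sgn[OF tp_Ob tp_Ob _ N.cone_identity[OF tp_Ob]]) (rule N.N_sub[OF tp_Ob])
  then show ?thesis using om_ends(5)[OF k(1)] om_ends(6)[OF k(2)] m unfolding Tm_def by simp
 qed
qed

text \<open>An approximate filler can be corrected modulo \<open>N\<close>: the two error terms form a cocycle
 in the cone of \<open>Tm\<close>.\<close>

lemma correct_filler:
 assumes N: "ann_pair A N J" and c: "cone_solvable A N Tm (X (hd om)) (X (last om)) (X 0) (X n)"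
  and u: "u : carrier (HO (2 - int n))" and v: "v : carrier (HT (1 - int n))"
  and du: "face_bnd \<ominus>[HO (3 - int n)] dif A (X (hd om)) (X (last om)) (2 - int n) u : N (X (hd om)) (X (last om)) (3 - int n)"
  and dv: "dif A (X 0) (X n) (1 - int n) v \<ominus>[HT (2 - int n)] (top_bnd \<oplus>[HT (2 - int n)] Tm (2 - int n) u) : N (X 0) (X n) (2 - int n)"
 obtains u' v' where "u' : N (X (hd om)) (X (last om)) (2 - int n)" "v' : N (X 0) (X n) (1 - int n)"
  "dif A (X (hd om)) (X (last om)) (2 - int n) (u \<oplus>[HO (2 - int n)] u') = face_bnd"
  "dif A (X 0) (X n) (1 - int n) (v \<oplus>[HT (1 - int n)] v') =
   top_bnd \<oplus>[HT (2 - int n)] Tm (2 - int n) (u \<oplus>[HO (2 - int n)] u')"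
proof -
 interpret N: ann_pair A N J by (rule N)
 interpret O3: abelian_group "HO (3 - int n)" by (rule hom_group[OF om_Ob])
 interpret O4: abelian_group "HO (4 - int n)" by (rule hom_group[OF om_Ob])
 interpret T1: abelian_group "HT (1 - int n)" by (rule hom_group[OF tp_Ob])
 interpret T2: abelian_group "HT (2 - int n)" by (rule hom_group[OF tp_Ob])
 interpret T3: abelian_group "HT (3 - int n)" by (rule hom_group[OF tp_Ob])
 have i: "3 - int n = (2 - int n) + 1" "4 - int n = (3 - int n) + 1" "2 - int n = (1 - int n) + 1"
  "4 - int n = (2 - int n) + 2" "3 - int n = (1 - int n) + 2" "1 - int n = (2 - int n) - 1" by simp_all
 let ?dO = "dif A (X (hd om)) (X (last om))" and ?dT = "dif A (X 0) (X n)"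
 let ?a = "face_bnd \<ominus>[HO (3 - int n)] ?dO (2 - int n) u"
 let ?b = "?dT (1 - int n) v \<ominus>[HT (2 - int n)] (top_bnd \<oplus>[HT (2 - int n)] Tm (2 - int n) u)"
 note duc = dif_closed[OF om_Ob u i(1)] and dvc = dif_closed[OF tp_Ob v i(3)]
 note Tu = amap_closed[OF Tm_amap u] and Ta = amap_closed[OF Tm_amap face_bnd_closed] and Tdu = amap_closed[OF Tm_amap duc]
 have da: "?dO (3 - int n) ?a = \<zero>[HO (4 - int n)]"
  using amap_minus[OF dif_amap[OF om_Ob i(2)] face_bnd_closed duc] dif_face_bnd dif_dif[OF om_Ob u i(1,4)]
  by (simp add: O4.minus_self)
 have "?dT (2 - int n) ?b = ?dT (2 - int n) (?dT (1 - int n) v) \<ominus>[HT (3 - int n)]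
   (?dT (2 - int n) top_bnd \<oplus>[HT (3 - int n)] ?dT (2 - int n) (Tm (2 - int n) u))"
  using amap_minus[OF dif_amap[OF tp_Ob i(1)] dvc T2.a_closed[OF top_bnd_closed Tu]]
   amap_add[OF dif_amap[OF tp_Ob i(1)] top_bnd_closed Tu] by simp
 also have "\<dots> = \<zero>[HT (3 - int n)] \<ominus>[HT (3 - int n)] (\<ominus>[HT (3 - int n)] Tm (3 - int n) face_bnd \<oplus>[HT (3 - int n)] Tm (3 - int n) (?dO (2 - int n) u))"
  unfolding dif_dif[OF tp_Ob v i(3,5)] dif_top_bnd Tm_dif[OF u i(1)] ..
 also have "\<dots> = Tm (3 - int n) face_bnd \<ominus>[HT (3 - int n)] Tm (3 - int n) (?dO (2 - int n) u)"
  using Ta Tdu by algebra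
 also have "\<dots> = Tm (3 - int n) ?a" using amap_minus[OF Tm_amap face_bnd_closed duc] by simp
 finally have db: "?dT (2 - int n) ?b = Tm (3 - int n) ?a" .
 obtain u' v' where u': "u' : N (X (hd om)) (X (last om)) (2 - int n)" and v': "v' : N (X 0) (X n) (1 - int n)"
  and e: "?dO (2 - int n) u' = ?a" "Tm (2 - int n) u' = ?b \<oplus>[HT (2 - int n)] ?dT (1 - int n) v'"
  by (rule cone_solvableD[OF c du da dv db i(1,4,6)])
 note us = N.N_sub[OF om_Ob u'] and vs = N.N_sub[OF tp_Ob v']
 note dvc' = dif_closed[OF tp_Ob vs i(3)]
 have 1: "?dO (2 - int n) (u \<oplus>[HO (2 - int n)] u') = face_bnd"
  unfolding amap_add[OF dif_amap[OF om_Ob i(1)] u us] e using duc face_bnd_closed by algebra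
 have 2: "?dT (1 - int n) (v \<oplus>[HT (1 - int n)] v') =
   top_bnd \<oplus>[HT (2 - int n)] Tm (2 - int n) (u \<oplus>[HO (2 - int n)] u')"
  unfolding amap_add[OF dif_amap[OF tp_Ob i(3)] v vs] amap_add[OF Tm_amap u us] e(2)
  using dvc dvc' Tu top_bnd_closed by algebra
 from that[OF u' v' 1 2] show thesis .
qed

definition fill :: "'m => 'm => ('o, 'm) simplex" where
 "fill u v = (\<lambda>i\<in>{..n}. X i, \<lambda>s\<in>nerve_seqs n. (aa(om := u, tp := v)) s)"

lemma fill_simps:
 "i <= n ==> fst (fill u v) i = X i" "s : horn n k ==> snd (fill u v) s = aa s"
 "snd (fill u v) om = u" "snd (fill u v) tp = v"
 using om_mem tp_mem omit_neq_top[OF kn n2] horn_mem horn_neq_om by (auto simp: fill_def)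

lemma degenerate_neq:
 assumes "s ! j = s ! Suc j" "Suc j < length s" shows "s ~= om" "s ~= tp"
 using assms omit_simps(3)[OF kn n2] top_seq_simps(6)[of n] nth_eq_iff_index_eq[of s j "Suc j"] by auto

lemma fill_nerve:
 assumes u: "u : carrier (HO (2 - int n))" and v: "v : carrier (HT (1 - int n))"
  and du: "dif A (X (hd om)) (X (last om)) (2 - int n) u = face_bnd"
  and dv: "dif A (X 0) (X n) (1 - int n) v = top_bnd \<oplus>[HT (2 - int n)] Tm (2 - int n) u"
 shows "fill u v : coherent_nerve A n"
 unfolding fill_def
proof (rule nerveI)
 let ?X = "\<lambda>i\<in>{..n}. X i" and ?a = "\<lambda>s\<in>nerve_seqs n. (aa(om := u, tp := v)) s"
 have XX: "?X (hd s) = X (hd s)" "?X (last s) = X (last s)" if "s : nerve_seqs n" for s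
  using nerve_seqsD(5,6)[OF that] by auto
 show "?X : {..n} \<rightarrow>\<^sub>E Ob A" using X by auto
 have am: "(aa(om := u, tp := v)) s : smor A X s (seq_deg s)" if "s : nerve_seqs n" for s
  using aa[OF that] u v om_deg tp_deg top_seq_simps(3,4) by auto
 then show "?a : (\<Pi>\<^sub>E s\<in>nerve_seqs n. mor A (?X (hd s)) (?X (last s)) (seq_deg s))"
  using XX by auto
 have fam: "nerve_family A n X (aa(om := u, tp := v))" using am by unfold_locales (auto intro: X)
 interpret U: nerve_family A n X "aa(om := u, tp := v)" by (rule fam)
 show "?a [i, i] = idn A (?X i)" if i: "i <= n" for i
 proof -
  have m: "[i, i] : nerve_seqs n" using i by (simp add: nerve_seqs_def)
  show ?thesis using m i ids[OF i] degenerate_neq[of "[i, i]" 0] by simp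
 qed
 show "?a s = \<zero>[Hom A (?X (hd s)) (?X (last s)) (seq_deg s)]"
  if s: "s : nerve_seqs n" "3 <= length s" "Suc j < length s" "s ! j = s ! Suc j" for s j
  using s deg[OF s] degenerate_neq[OF s(4,3)] XX[OF s(1)] by simp
 fix s assume s: "s : nerve_seqs n" "distinct s"
 have bc: "bnd A X (aa(om := u, tp := v)) s = bnd A ?X ?a s"
  by (rule U.bnd_cong[OF s(1)]) (use sub_seq_mem[OF s(1)] in auto)
 have ag: "(aa(om := u, tp := v)) t = aa t" if "t : horn n k" for t using horn_neq_om[OF that] by simp
 consider "s : horn n k" | "s = om" | "s = tp" using horn_cases[OF s kn n2] by blast
 then have "dif A (X (hd s)) (X (last s)) (seq_deg s) ((aa(om := u, tp := v)) s) = bnd A X (aa(om := u, tp := v)) s"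
 proof cases
  case 1
  have "bnd A X aa s = bnd A X (aa(om := u, tp := v)) s" by (rule bnd_horn_cong) (use 1 ag in auto)
  then show ?thesis using eq[OF 1] ag[OF 1] by simp
 next
  case 2
  have "bnd A X aa s = bnd A X (aa(om := u, tp := v)) s" by (rule bnd_horn_cong) (use 2 ag in auto)
  moreover have "(aa(om := u, tp := v)) s = u" using 2 omit_neq_top[OF kn n2] by simp
  ultimately show ?thesis using du unfolding 2 om_deg face_bnd_def by simp
 next
  case 3
  have e: "(aa(om := u, tp := v)) t = (aa(om := u)) t" if "t : horn n k \<or> t = om" for t
   using that horn_neq_om(2)[of t] omit_neq_top[OF kn n2] by auto
  have fam': "nerve_family A n X (aa(om := u))"
   using aa u om_deg by unfold_locales (auto intro: X)
  have "bnd A X (aa(om := u)) tp = bnd A X (aa(om := u, tp := v)) tp"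
  proof (rule nerve_family.bnd_cong[OF fam' tp_mem])
   fix j assume "0 < j" "j < length tp - 1"
   then have j: "0 < j" "j < n" by (auto simp: top_seq_simps)
   note ts = top_sub[OF kn n2 j]
   have "drop j tp : horn n k \<or> drop j tp = om" "take (Suc j) tp : horn n k \<or> take (Suc j) tp = om"
    "take j tp @ drop (Suc j) tp : horn n k \<or> take j tp @ drop (Suc j) tp = om"
    using ts by (auto split: if_splits)
   from this[THEN e] show "(aa(om := u)) (drop j tp) = (aa(om := u, tp := v)) (drop j tp) &
    (aa(om := u)) (take (Suc j) tp) = (aa(om := u, tp := v)) (take (Suc j) tp) &
    (aa(om := u)) (take j tp @ drop (Suc j) tp) = (aa(om := u, tp := v)) (take j tp @ drop (Suc j) tp)" by simp
  qed simp
  moreover have "(aa(om := u, tp := v)) tp = v" by simp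
  ultimately show ?thesis using dv bnd_top[OF u] unfolding 3 tp_deg top_seq_simps(3,4) by simp
 qed
 then show "dif A (?X (hd s)) (?X (last s)) (seq_deg s) (?a s) = bnd A ?X ?a s"
  unfolding XX[OF s(1)] bc[symmetric] using s(1) by simp
qed

text \<open>Together with \<open>fill_nerve\<close> this identifies simplices over the horn with
  pairs solving two equations. Lifting, uniqueness and descent to a stage all pass through
  it.\<close>

lemma nerve_fill:
 assumes x: "x : coherent_nerve A n" and xX: "!!i. i <= n ==> fst x i = X i"
  and xa: "!!s. s : horn n k ==> snd x s = aa s"
 shows "snd x om : carrier (HO (2 - int n))" "snd x tp : carrier (HT (1 - int n))"
  "dif A (X (hd om)) (X (last om)) (2 - int n) (snd x om) = face_bnd"
  "dif A (X 0) (X n) (1 - int n) (snd x tp) = top_bnd \<oplus>[HT (2 - int n)] Tm (2 - int n) (snd x om)"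
  "fill (snd x om) (snd x tp) = x"
proof -
 obtain Y \<beta> where xe: "x = (Y, \<beta>)" by (cases x)
 note nv = x[unfolded xe coherent_nerve_iff]
 have Yx: "Y i = X i" if "i <= n" for i using xX[OF that] by (simp add: xe)
 have YY: "Y (hd s) = X (hd s)" "Y (last s) = X (last s)" if "s : nerve_seqs n" for s
  using nerve_seqsD(5,6)[OF that] Yx by auto
 have ba: "\<beta> s = aa s" if "s : horn n k" for s using xa[OF that] by (simp add: xe)
 have bc: "\<beta> s : smor A X s (seq_deg s)" if "s : nerve_seqs n" for s
  using nv YY[OF that] that by (auto simp: PiE_iff)
 have bd: "dif A (X (hd s)) (X (last s)) (seq_deg s) (\<beta> s) = bnd A Y \<beta> s" if "s : nerve_seqs n" for s
  using nv YY[OF that] that by auto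
 show u: "snd x om : carrier (HO (2 - int n))" using bc[OF om_mem] by (simp add: xe om_deg)
 show v: "snd x tp : carrier (HT (1 - int n))" using bc[OF tp_mem] by (simp add: xe tp_deg top_seq_simps)
 have "bnd A X aa om = bnd A Y \<beta> om" by (rule bnd_horn_cong) (use ba Yx in auto)
 then show "dif A (X (hd om)) (X (last om)) (2 - int n) (snd x om) = face_bnd"
  using bd[OF om_mem] by (simp add: xe om_deg face_bnd_def)
 have fam': "nerve_family A n X (aa(om := \<beta> om))"
  using aa u om_deg by unfold_locales (auto intro: X simp: xe)
 have "bnd A X (aa(om := \<beta> om)) tp = bnd A Y \<beta> tp"
 proof (rule nerve_family.bnd_cong[OF fam' tp_mem])
  show "i <= n ==> X i = Y i" for i using Yx by simp
  have e: "(aa(om := \<beta> om)) t = \<beta> t" if "t : horn n k \<or> t = om" for t using that ba by auto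
  fix j assume "0 < j" "j < length tp - 1"
  then have j: "0 < j" "j < n" by (auto simp: top_seq_simps)
  note ts = top_sub[OF kn n2 j]
  have "drop j tp : horn n k \<or> drop j tp = om" "take (Suc j) tp : horn n k \<or> take (Suc j) tp = om"
   "take j tp @ drop (Suc j) tp : horn n k \<or> take j tp @ drop (Suc j) tp = om"
   using ts by (auto split: if_splits)
  from this[THEN e] show "(aa(om := \<beta> om)) (drop j tp) = \<beta> (drop j tp) &
   (aa(om := \<beta> om)) (take (Suc j) tp) = \<beta> (take (Suc j) tp) &
   (aa(om := \<beta> om)) (take j tp @ drop (Suc j) tp) = \<beta> (take j tp @ drop (Suc j) tp)" by simp
 qed
 then show "dif A (X 0) (X n) (1 - int n) (snd x tp) = top_bnd \<oplus>[HT (2 - int n)] Tm (2 - int n) (snd x om)"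
  using bd[OF tp_mem] bnd_top[OF u] by (simp add: xe tp_deg top_seq_simps)
 have "(\<lambda>i\<in>{..n}. X i) = Y"
  using nv Yx by (auto simp: PiE_iff intro!: extensionalityI[of _ "{..n}"])
 moreover have "(\<lambda>s\<in>nerve_seqs n. (aa(om := \<beta> om, tp := \<beta> tp)) s) = \<beta>"
 proof (rule extensionalityI[of _ "nerve_seqs n"])
  show "\<beta> : extensional (nerve_seqs n)" using nv by (auto simp: PiE_iff)
  fix s assume s: "s : nerve_seqs n"
  have "aa s = \<beta> s" if "s ~= om" "s ~= tp"
  proof (cases "distinct s")
   case True
   then show ?thesis using horn_cases[OF s True kn n2] that ba by auto
  next
   case False
   then obtain q where q: "Suc q < length s" "s ! q = s ! Suc q"
    using sorted_not_distinct nerve_seqsD(2)[OF s] by blast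
   show ?thesis
   proof (cases "3 <= length s")
    case True
    have "\<beta> s = \<zero>[sHom A Y s (seq_deg s)]" using nv s q True by blast
    then show ?thesis using deg[OF s True q] YY[OF s] by simp
   next
    case False
    then have l: "length s = 2" using nerve_seqsD(1)[OF s] by simp
    then have "q = 0" using q by simp
    then obtain i where i: "s = [i, i]" using l q by (auto simp: numeral_2_eq_2 length_Suc_conv)
    then have "i <= n" using nerve_seqsD(5)[OF s] by simp
    then show ?thesis using nv ids Yx unfolding i by auto
   qed
  qed
  then show "(\<lambda>s\<in>nerve_seqs n. (aa(om := \<beta> om, tp := \<beta> tp)) s) s = \<beta> s" using s by auto
 qed simp
 ultimately show "fill (snd x om) (snd x tp) = x" unfolding fill_def xe snd_conv by (simp only:)
qed

end

subsection \<open>Simplicial operators\<close>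

definition dl :: "nat => nat => nat" where "dl i = (%j. if j < i then j else Suc j)"
abbreviation (input) "facet n i \<equiv> nerve_pullback (n - 1) (dl i)"
text \<open>Renumbers the vertices of the \<open>i\<close>-th face, inverting the coface map
  \<open>dl i\<close>.\<close>

definition col :: "nat => nat => nat" where "col i = (%j. if j < i then j else j - 1)"

lemma dl_col: "p ~= i ==> dl i (col i p) = p" and col_dl: "col i (dl i p) = p" and dl_neq: "dl i p ~= i"
 by (auto simp: dl_def col_def)

lemma map_mono_seqs:
 assumes "s : nerve_seqs n" "!!p q. p : set s ==> q : set s ==> p <= q ==> f p <= f q" "!!p. p : set s ==> f p <= m"
 shows "map f s : nerve_seqs m"
proof -
 have "sorted (map f s)" unfolding sorted_wrt_map
  by (rule sorted_wrt_mono_rel[OF _ nerve_seqsD(2)[OF assms(1)]]) (use assms(2) in auto)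
 then show ?thesis using assms(1,3) unfolding nerve_seqs_def by auto
qed

lemma col_mem: "s : nerve_seqs n ==> i <= n ==> i \<notin> set s ==> map (col i) s : nerve_seqs (n - 1)"
proof (rule map_mono_seqs)
 fix p assume "s : nerve_seqs n" "i <= n" "i \<notin> set s" "p : set s"
 then have "p <= n" "p ~= i" using nerve_seqsD(3)[of s n] by auto
 then show "col i p <= n - 1" using \<open>i <= n\<close> by (auto simp: col_def)
qed (auto simp: col_def)

lemma dl_mem: "s : nerve_seqs (n - 1) ==> 1 <= n ==> map (dl i) s : nerve_seqs n"
proof (rule map_mono_seqs)
 fix p assume "s : nerve_seqs (n - 1)" "1 <= n" "p : set s"
 then have "p <= n - 1" using nerve_seqsD(3)[of s "n - 1"] by auto
 then show "dl i p <= n" using \<open>1 <= n\<close> by (auto simp: dl_def)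
qed (auto simp: dl_def)

lemma ord_map_mem: "\<theta> : ord_map p n ==> s : nerve_seqs p ==> map \<theta> s : nerve_seqs n"
 by (rule map_mono_seqs) (auto simp: ord_map_def mono_on_def nerve_seqs_def Pi_iff subset_iff)

lemma dl_ord_map: "1 <= n ==> dl i : ord_map (n - 1) n"
 by (auto simp: ord_map_def mono_on_def dl_def)

text \<open>Restates a face equation in the vertices of \<open>x\<close> itself, the common
  numbering in which several faces can be compared and glued.\<close>

lemma pullback_face_iff:
 assumes n: "1 <= n" and i: "i <= n"
  and z: "fst z : extensional {..n - 1}" "snd z : extensional (nerve_seqs (n - 1))"
 shows "facet n i x = z \<longleftrightarrow>
  (\<forall>p\<le>n. p ~= i --> fst x p = fst z (col i p)) &
  (\<forall>s\<in>nerve_seqs n. i \<notin> set s --> snd x s = snd z (map (col i) s))"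
proof
 assume e: "facet n i x = z"
 show "(\<forall>p\<le>n. p ~= i --> fst x p = fst z (col i p)) &
  (\<forall>s\<in>nerve_seqs n. i \<notin> set s --> snd x s = snd z (map (col i) s))"
 proof (intro conjI allI impI ballI)
  fix p assume "p <= n" "p ~= i"
  moreover from this have "col i p <= n - 1" using i by (auto simp: col_def)
  ultimately show "fst x p = fst z (col i p)" unfolding e[symmetric] by (simp add: nerve_pullback_def dl_col)
 next
  fix s assume s: "s : nerve_seqs n" "i \<notin> set s"
  have "map (dl i) (map (col i) s) = s" using s(2) by (induction s) (auto simp: dl_col)
  then show "snd x s = snd z (map (col i) s)"
   unfolding e[symmetric] using col_mem[OF s(1) i s(2)] by (simp add: nerve_pullback_def)
 qed
next
 assume a: "(\<forall>p\<le>n. p ~= i --> fst x p = fst z (col i p)) &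
  (\<forall>s\<in>nerve_seqs n. i \<notin> set s --> snd x s = snd z (map (col i) s))"
 have "(\<lambda>q\<in>{..n - 1}. fst x (dl i q)) = fst z"
 proof (rule extensionalityI[of _ "{..n - 1}"])
  fix q assume "q : {..n - 1}"
  then have "dl i q <= n" using n by (auto simp: dl_def)
  then show "(\<lambda>q\<in>{..n - 1}. fst x (dl i q)) q = fst z q" using a \<open>q : _\<close> by (simp add: dl_neq col_dl)
 qed (use z in auto)
 moreover have "(\<lambda>s\<in>nerve_seqs (n - 1). snd x (map (dl i) s)) = snd z"
 proof (rule extensionalityI[of _ "nerve_seqs (n - 1)"])
  fix s assume s: "s : nerve_seqs (n - 1)"
  have "map (col i) (map (dl i) s) = s" by (induction s) (auto simp: col_dl)
  moreover have "i \<notin> set (map (dl i) s)" by (auto simp: dl_neq dest: sym)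
  ultimately show "(\<lambda>s\<in>nerve_seqs (n - 1). snd x (map (dl i) s)) s = snd z s" using a dl_mem[OF s n, of i] s by simp
 qed (use z in auto)
 ultimately show "facet n i x = z" by (simp add: nerve_pullback_def prod_eq_iff)
qed

lemma coherent_nerve_ext:
 assumes "x : coherent_nerve A n" shows "fst x : extensional {..n}" "snd x : extensional (nerve_seqs n)"
 using assms by (cases x; auto simp: coherent_nerve_iff PiE_iff)+

lemma seq_deg_map: "seq_deg (map f s) = seq_deg s"
 by (simp add: seq_deg_def)

lemma bterm_map:
 assumes "s ~= []" "j < length s"
 shows "bterm A Y \<beta> (map f s) j = bterm A (%i. Y (f i)) (%t. \<beta> (map f t)) s j"
 using assms unfolding bterm_def Let_def
 by (simp add: hd_map last_map seq_deg_map drop_map take_map)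

lemma (in adg) nerve_family_of:
 assumes "(Y, \<beta>) : coherent_nerve A n" shows "nerve_family A n Y \<beta>"
 using assms by unfold_locales (auto simp: coherent_nerve_iff PiE_iff)

lemma (in adg) bnd_map:
 assumes fam: "nerve_family A n Y \<beta>" and s: "s : nerve_seqs p" "map f s : nerve_seqs n"
 shows "bnd A Y \<beta> (map f s) = bnd A (%i. Y (f i)) (%t. \<beta> (map f t)) s"
proof -
 interpret fam: nerve_family A n Y \<beta> by (rule fam)
 have ne: "s ~= []" using nerve_seqsD(7)[OF s(1)] .
 note hl = hd_map[OF ne, of f] last_map[OF ne, of f] seq_deg_map[of f s] length_map[of f s]
 interpret M: abelian_group "sHom A Y (map f s) (seq_deg (map f s) + 1)"
  by (rule hom_group[OF fam.seq_Ob(1)[OF s(2)] fam.seq_Ob(2)[OF s(2)]])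
 have b: "bterm A (%i. Y (f i)) (%t. \<beta> (map f t)) s j = bterm A Y \<beta> (map f s) j" if "j < length s - 1" for j
  by (rule bterm_map[OF ne, symmetric]) (use that in simp)
 have "bnd A Y \<beta> (map f s) = finsum (sHom A Y (map f s) (seq_deg (map f s) + 1))
   (bterm A (%i. Y (f i)) (%t. \<beta> (map f t)) s) {1..<length s - 1}"
  unfolding bnd_def using b fam.bterm_closed[OF s(2)] by (intro M.finsum_cong') auto
 then show ?thesis unfolding bnd_def hl .
qed

lemma (in adg) nerve_pullback_mem:
 assumes \<theta>: "\<theta> : ord_map p n" and x: "x : coherent_nerve A n"
 shows "nerve_pullback p \<theta> x : coherent_nerve A p"
proof -
 obtain Y \<beta> where xe: "x = (Y, \<beta>)" by (cases x)
 note nv = x[unfolded xe coherent_nerve_iff]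
 note fam = nerve_family_of[OF x[unfolded xe]]
 have t: "\<theta> i <= n" if "i <= p" for i using \<theta> that by (auto simp: ord_map_def)
 have Ys: "(\<lambda>i\<in>{..p}. Y (\<theta> i)) (hd s) = Y (hd (map \<theta> s))" "(\<lambda>i\<in>{..p}. Y (\<theta> i)) (last s) = Y (last (map \<theta> s))"
  if "s : nerve_seqs p" for s
  using nerve_seqsD(5-7)[OF that] by (auto simp: hd_map last_map)
 let ?Y = "\<lambda>i\<in>{..p}. Y (\<theta> i)" and ?b = "\<lambda>s\<in>nerve_seqs p. \<beta> (map \<theta> s)"
 have fam': "nerve_family A p (%i. Y (\<theta> i)) (%s. \<beta> (map \<theta> s))"
 proof
  show "i <= p ==> Y (\<theta> i) : Ob A" for i using nerve_family.X[OF fam] t by blast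
  show "\<beta> (map \<theta> s) : mor A (Y (\<theta> (hd s))) (Y (\<theta> (last s))) (seq_deg s)" if s: "s : nerve_seqs p" for s
   using nerve_family.aa[OF fam ord_map_mem[OF \<theta> s]] nerve_seqsD(7)[OF s] by (simp add: hd_map last_map seq_deg_map)
 qed
 have "(?Y, ?b) : coherent_nerve A p"
  unfolding coherent_nerve_iff
 proof (intro conjI ballI allI impI)
  show "?Y : {..p} \<rightarrow>\<^sub>E Ob A" using nerve_family.X[OF fam'] by auto
  show "?b : (\<Pi>\<^sub>E s\<in>nerve_seqs p. mor A (?Y (hd s)) (?Y (last s)) (seq_deg s))"
   using nerve_family.aa[OF fam ord_map_mem[OF \<theta>]] Ys by (auto simp: seq_deg_map)
  show "?b [i, i] = idn A (?Y i)" if "i <= p" for i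
   using nv t[OF that] that by (auto simp: nerve_seqs_def)
  fix s assume s: "s : nerve_seqs p"
  note ms = ord_map_mem[OF \<theta> s]
  show "?b s = \<zero>[Hom A (?Y (hd s)) (?Y (last s)) (seq_deg s)]"
   if d: "3 <= length s & (\<exists>j. Suc j < length s & s ! j = s ! Suc j)"
  proof -
   have "3 <= length (map \<theta> s) & (\<exists>j. Suc j < length (map \<theta> s) & map \<theta> s ! j = map \<theta> s ! Suc j)"
    using d by auto
   then have "\<beta> (map \<theta> s) = \<zero>[sHom A Y (map \<theta> s) (seq_deg (map \<theta> s))]"
    using nv ms by blast
   then show ?thesis using s unfolding Ys[OF s] seq_deg_map by simp
  qed
  have "bnd A (%i. Y (\<theta> i)) (%s. \<beta> (map \<theta> s)) s = bnd A ?Y ?b s"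
   by (rule nerve_family.bnd_cong[OF fam' s]) (use sub_seq_mem[OF s] in auto)
  then have "bnd A Y \<beta> (map \<theta> s) = bnd A ?Y ?b s" using bnd_map[OF fam s ms] by simp
  moreover have "dif A (Y (hd (map \<theta> s))) (Y (last (map \<theta> s))) (seq_deg (map \<theta> s)) (\<beta> (map \<theta> s)) = bnd A Y \<beta> (map \<theta> s)"
   using nv ms by blast
  ultimately show "dif A (?Y (hd s)) (?Y (last s)) (seq_deg s) (?b s) = bnd A ?Y ?b s"
   unfolding Ys[OF s] using s by (simp add: seq_deg_map)
 qed
 then show ?thesis by (simp add: nerve_pullback_def xe)
qed

lemma coherent_nerve_eq_iff:
 "x : coherent_nerve_eq A n \<longleftrightarrow> x : coherent_nerve A n &
  (\<forall>i j. i <= j & j <= n --> equivalence A (fst x i) (fst x j) (snd x [i, j]))"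
 by (cases x) (simp add: coherent_nerve_eq_def)

lemma (in adg) nerve_pullback_eq_mem:
 assumes \<theta>: "\<theta> : ord_map p n" and x: "x : coherent_nerve_eq A n"
 shows "nerve_pullback p \<theta> x : coherent_nerve_eq A p"
 unfolding coherent_nerve_eq_iff
proof (intro conjI allI impI)
 show "nerve_pullback p \<theta> x : coherent_nerve A p"
  using x by (intro nerve_pullback_mem[OF \<theta>]) (simp add: coherent_nerve_eq_iff)
 fix i j assume ij: "i <= j & j <= p"
 then have "\<theta> i <= \<theta> j" "\<theta> j <= n" using \<theta> by (auto simp: ord_map_def mono_on_def)
 moreover have "[i, j] : nerve_seqs p" using ij by (simp add: nerve_seqs_def)
 ultimately show "equivalence A (fst (nerve_pullback p \<theta> x) i) (fst (nerve_pullback p \<theta> x) j) (snd (nerve_pullback p \<theta> x) [i, j])"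
  using x ij by (simp add: coherent_nerve_eq_iff nerve_pullback_def)
qed

subsection \<open>Horns as partial simplices\<close>

definition hX :: "nat => nat => (nat => ('o, 'm) simplex) => nat => 'o" where
 "hX n k y p = (let i = (SOME i. i <= n & i ~= k & i ~= p) in fst (y i) (col i p))"

text \<open>The value is read off any face containing the sequence; \<open>glue_mor\<close> shows
  that the choice does not matter. The default zero off the horn is what the condition on sequences
  with repetitions demands there.\<close>

definition hA :: "('k, 'o, 'm) dgcat => nat => nat => (nat => ('o, 'm) simplex) => nat list => 'm" where
 "hA A n k y s = (if s : horn n k then (let i = (SOME i. i <= n & i ~= k & i \<notin> set s) in snd (y i) (map (col i) s))
  else \<zero>[Hom A (hX n k y (hd s)) (hX n k y (last s)) (seq_deg s)])"

locale match_data = adg A for A :: "('k, 'o, 'm) dgcat" +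
 fixes n k :: nat and y :: "nat => ('o, 'm) simplex"
 assumes n2: "2 <= n" and kn: "k <= n"
  and y: "i <= n ==> i ~= k ==> y i : coherent_nerve A (n - 1)"
  and compat: "[|i <= n; j <= n; i ~= k; j ~= k; i < j|] ==>
   nerve_pullback (n - 1 - 1) (dl i) (y j) = nerve_pullback (n - 1 - 1) (dl (j - 1)) (y i)"
begin

text \<open>Data avoiding both i and j lie on the common codimension-two face;
  \<open>col i (col j p)\<close> is the number of vertex p in it, and both faces restrict to it by
  the matching condition.\<close>

lemma compat_lt:
 assumes i: "i <= n" "i ~= k" and j: "j <= n" "j ~= k" and ij: "i < j"
 shows "p <= n ==> p ~= i ==> p ~= j ==> fst (y i) (col i p) = fst (y j) (col j p)"
  "s : nerve_seqs n ==> i \<notin> set s ==> j \<notin> set s ==> snd (y i) (map (col i) s) = snd (y j) (map (col j) s)"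
proof -
 note c = compat[OF i(1) j(1) i(2) j(2) ij]
 have cc: "dl i (col i (col j p)) = col j p" "dl (j - 1) (col i (col j p)) = col i p" if "p ~= i" "p ~= j" for p
  using that ij by (auto simp: dl_def col_def)
 have cn: "col i (col j p) <= n - 1 - 1" if "p <= n" "p ~= i" "p ~= j" for p
  using that ij j n2 by (auto simp: col_def)
 show "fst (y i) (col i p) = fst (y j) (col j p)" if p: "p <= n" "p ~= i" "p ~= j"
  using arg_cong[OF c, of "%x. fst x (col i (col j p))"] cn[OF p] cc[OF p(2,3)] by (simp add: nerve_pullback_def)
 show "snd (y i) (map (col i) s) = snd (y j) (map (col j) s)" if s: "s : nerve_seqs n" "i \<notin> set s" "j \<notin> set s"
 proof -
  let ?t = "map (%p. col i (col j p)) s"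
  have t: "?t : nerve_seqs (n - 1 - 1)"
  proof (rule map_mono_seqs[OF s(1)])
   show "col i (col j p) <= n - 1 - 1" if "p : set s" for p
    using that s nerve_seqsD(3)[OF s(1)] by (intro cn) auto
  qed (auto simp: col_def)
  have ne: "p ~= i" "p ~= j" if "p : set s" for p using that s(2,3) by auto
  have "map (dl i) ?t = map (col j) s" "map (dl (j - 1)) ?t = map (col i) s"
   using cc(1)[OF ne(1) ne(2)] cc(2)[OF ne(1) ne(2)] by auto
  moreover have "snd (y j) (map (dl i) ?t) = snd (y i) (map (dl (j - 1)) ?t)"
   using arg_cong[OF c, of "%x. snd x ?t"] t unfolding nerve_pullback_def snd_conv by (simp only: restrict_apply if_True)
  ultimately show ?thesis by (simp only:)
 qed
qed

lemma glue_obj: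
 assumes i: "i <= n" "i ~= k" and p: "p <= n" "p ~= i"
 shows "hX n k y p = fst (y i) (col i p)"
proof -
 define j where "j = (SOME i. i <= n & i ~= k & i ~= p)"
 have j: "j <= n & j ~= k & j ~= p" unfolding j_def by (rule someI[of _ i]) (use i p in auto)
 have "fst (y j) (col j p) = fst (y i) (col i p)"
 proof (cases i j rule: linorder_cases)
  case less
  show ?thesis by (rule compat_lt(1)[OF i _ _ less, symmetric]) (use j p in auto)
 next
  case greater
  show ?thesis by (rule compat_lt(1)[OF _ _ i greater]) (use j p in auto)
 qed simp
 then show ?thesis unfolding hX_def Let_def j_def[symmetric] .
qed

lemma glue_mor:
 assumes i: "i <= n" "i ~= k" and s: "s : nerve_seqs n" "i \<notin> set s"
 shows "hA A n k y s = snd (y i) (map (col i) s)"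
proof -
 have h: "s : horn n k" using i s by (auto simp: horn_def)
 define j where "j = (SOME i. i <= n & i ~= k & i \<notin> set s)"
 have j: "j <= n & j ~= k & j \<notin> set s" unfolding j_def by (rule someI[of _ i]) (use i s in auto)
 have "snd (y j) (map (col j) s) = snd (y i) (map (col i) s)"
 proof (cases i j rule: linorder_cases)
  case less
  show ?thesis by (rule compat_lt(2)[OF i _ _ less s(1), symmetric]) (use j s in auto)
 next
  case greater
  show ?thesis by (rule compat_lt(2)[OF _ _ i greater s(1)]) (use j s in auto)
 qed simp
 then show ?thesis unfolding hA_def Let_def j_def[symmetric] using h by simp
qed

text \<open>Every vertex lies on a face belonging to the horn: of the vertices 0, 1, 2 at most two
  are excluded.\<close>

lemma other: obtains i where "i <= n" "i ~= k" "i ~= p"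
proof -
 have "card {0, 1, 2::nat} = 3" "card {k, p} <= 2" by (auto simp: card_insert_if)
 then have "\<not> {0, 1, 2} \<subseteq> {k, p}" using card_mono[of "{k, p}" "{0, 1, 2}"] by auto
 then obtain i where i: "i : {0, 1, 2}" "i \<notin> {k, p}" by blast
 show thesis by (rule that[of i]) (use i n2 in auto)
qed

lemma y_family: "i <= n ==> i ~= k ==> nerve_family A (n - 1) (fst (y i)) (snd (y i))"
 using nerve_family_of y by simp

lemma glue_ends:
 assumes i: "i <= n" "i ~= k" and s: "s : nerve_seqs n" "i \<notin> set s"
 shows "hX n k y (hd s) = fst (y i) (hd (map (col i) s))" "hX n k y (last s) = fst (y i) (last (map (col i) s))"
proof -
 have ne: "s ~= []" by (rule nerve_seqsD(7)[OF s(1)])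
 have "hd s ~= i" "last s ~= i" using s(2) hd_in_set[OF ne] last_in_set[OF ne] by auto
 then show "hX n k y (hd s) = fst (y i) (hd (map (col i) s))" "hX n k y (last s) = fst (y i) (last (map (col i) s))"
  using glue_obj[OF i nerve_seqsD(5)[OF s(1)]] glue_obj[OF i nerve_seqsD(6)[OF s(1)]] ne by (simp_all add: hd_map last_map)
qed

lemma hX_Ob: "p <= n ==> hX n k y p : Ob A"
proof -
 assume p: "p <= n"
 obtain i where i: "i <= n" "i ~= k" "i ~= p" by (rule other)
 have c: "col i p <= n - 1" using p i by (auto simp: col_def)
 show ?thesis unfolding glue_obj[OF i(1,2) p i(3)[symmetric]]
  by (rule nerve_family.X[OF y_family[OF i(1,2)] c])
qed

lemma hA_closed:
 assumes s: "s : nerve_seqs n"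
 shows "hA A n k y s : mor A (hX n k y (hd s)) (hX n k y (last s)) (seq_deg s)"
proof (cases "s : horn n k")
 case True
 then obtain i where i: "i <= n" "i ~= k" "i \<notin> set s" by (auto simp: horn_def)
 show ?thesis unfolding glue_mor[OF i(1,2) s i(3)] glue_ends[OF i(1,2) s i(3)]
  using nerve_family.aa[OF y_family[OF i(1,2)] col_mem[OF s i(1,3)]] by (simp add: seq_deg_map)
next
 case False
 interpret M: abelian_group "Hom A (hX n k y (hd s)) (hX n k y (last s)) (seq_deg s)"
  using hom_group hX_Ob nerve_seqsD(5,6)[OF s] by blast
 show ?thesis using False by (simp add: hA_def)
qed

lemma glue_family: "nerve_family A n (hX n k y) (hA A n k y)"
 by unfold_locales (auto intro: hX_Ob hA_closed)

text \<open>Each condition on a sequence of the horn involves only its segments and deletions. These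
  stay in one face, where the condition is part of the simplex given there.\<close>

lemma horn_glue: "horn_family A n (hX n k y) (hA A n k y) k"
proof -
 interpret G: nerve_family A n "hX n k y" "hA A n k y" by (rule glue_family)
 show ?thesis
 proof (intro horn_family.intro glue_family horn_family_axioms.intro n2 kn)
  fix p assume p: "p <= n"
  obtain i where i: "i <= n" "i ~= k" "i ~= p" by (rule other)
  have m: "[p, p] : nerve_seqs n" using p by (simp add: nerve_seqs_def)
  have "col i p <= n - 1" using p i by (auto simp: col_def)
  then have "snd (y i) [col i p, col i p] = idn A (fst (y i) (col i p))"
   using y[OF i(1,2)] by (cases "y i") (auto simp: coherent_nerve_iff)
  then show "hA A n k y [p, p] = idn A (hX n k y p)"
   using glue_mor[OF i(1,2) m] glue_obj[OF i(1,2) p] i by simp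
 next
  fix s j assume s: "s : nerve_seqs n" "3 <= length s" "Suc j < length s" "s ! j = s ! Suc j"
  show "hA A n k y s = \<zero>[Hom A (hX n k y (hd s)) (hX n k y (last s)) (seq_deg s)]"
  proof (cases "s : horn n k")
   case True
   then obtain i where i: "i <= n" "i ~= k" "i \<notin> set s" by (auto simp: horn_def)
   let ?t = "map (col i) s"
   have "3 <= length ?t & (\<exists>j. Suc j < length ?t & ?t ! j = ?t ! Suc j)" using s by auto
   then have "snd (y i) ?t = \<zero>[Hom A (fst (y i) (hd ?t)) (fst (y i) (last ?t)) (seq_deg ?t)]"
    using y[OF i(1,2)] col_mem[OF s(1) i(1,3)] by (cases "y i") (simp add: coherent_nerve_iff)
   then show ?thesis unfolding glue_mor[OF i(1,2) s(1) i(3)] glue_ends[OF i(1,2) s(1) i(3)] by (simp add: seq_deg_map)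
  qed (simp add: hA_def)
 next
  fix s assume h: "s : horn n k"
  then obtain i where i: "i <= n" "i ~= k" "i \<notin> set s" and s: "s : nerve_seqs n" by (auto simp: horn_def)
  let ?t = "map (col i) s"
  note t = col_mem[OF s i(1,3)]
  have "dif A (fst (y i) (hd ?t)) (fst (y i) (last ?t)) (seq_deg ?t) (snd (y i) ?t) = bnd A (fst (y i)) (snd (y i)) ?t"
   using y[OF i(1,2)] t by (cases "y i") (simp add: coherent_nerve_iff)
  also have "\<dots> = bnd A (%p. fst (y i) (col i p)) (%t. snd (y i) (map (col i) t)) s"
   by (rule bnd_map[OF y_family[OF i(1,2)] s t])
  also have "\<dots> = bnd A (hX n k y) (hA A n k y) s"
  proof -
   interpret M: abelian_group "Hom A (hX n k y (hd s)) (hX n k y (last s)) (seq_deg s + 1)"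
    by (rule hom_group[OF G.seq_Ob(1)[OF s] G.seq_Ob(2)[OF s]])
   have e: "fst (y i) (col i (hd s)) = hX n k y (hd s)" "fst (y i) (col i (last s)) = hX n k y (last s)"
    using glue_ends[OF i(1,2) s i(3)] nerve_seqsD(7)[OF s] by (simp_all add: hd_map last_map)
   have "bterm A (%p. fst (y i) (col i p)) (%t. snd (y i) (map (col i) t)) s j = bterm A (hX n k y) (hA A n k y) s j"
    if j: "0 < j" "j < length s - 1" for j
   proof (rule bterm_cong)
    note m = sub_seq_mem[OF s j]
    have ns: "i \<notin> set (drop j s)" "i \<notin> set (take (Suc j) s)" "i \<notin> set (take j s @ drop (Suc j) s)"
     using i(3) set_drop_subset[of j s] set_take_subset[of "Suc j" s] set_take_subset[of j s] set_drop_subset[of "Suc j" s] by auto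
    show "snd (y i) (map (col i) (drop j s)) = hA A n k y (drop j s)"
     "snd (y i) (map (col i) (take (Suc j) s)) = hA A n k y (take (Suc j) s)"
     "snd (y i) (map (col i) (take j s @ drop (Suc j) s)) = hA A n k y (take j s @ drop (Suc j) s)"
     using glue_mor[OF i(1,2) m(1) ns(1)] glue_mor[OF i(1,2) m(2) ns(2)] glue_mor[OF i(1,2) m(3) ns(3)] by simp_all
    have jl: "j < length s" using j by simp
    then have "s ! j ~= i" using i(3) nth_mem[of j s] by metis
    then show "fst (y i) (col i (s ! j)) = hX n k y (s ! j)"
     by (rule glue_obj[OF i(1,2) nerve_seqsD(4)[OF s jl], symmetric])
   qed (use e in auto)
   then show ?thesis unfolding bnd_def e using G.bterm_closed[OF s] by (intro M.finsum_cong') auto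
  qed
  finally show "dif A (hX n k y (hd s)) (hX n k y (last s)) (seq_deg s) (hA A n k y s) = bnd A (hX n k y) (hA A n k y) s"
   unfolding glue_mor[OF i(1,2) s i(3)] glue_ends[OF i(1,2) s i(3)] by (simp add: seq_deg_map)
 qed
qed

lemma match_iff:
 "(\<forall>i\<le>n. i ~= k --> facet n i x = y i) \<longleftrightarrow>
  (\<forall>p\<le>n. fst x p = hX n k y p) & (\<forall>s\<in>horn n k. snd x s = hA A n k y s)"
proof -
 have n1: "1 <= n" using n2 by simp
 have 1: "facet n i x = y i \<longleftrightarrow> (\<forall>p\<le>n. p ~= i --> fst x p = fst (y i) (col i p)) &
  (\<forall>s\<in>nerve_seqs n. i \<notin> set s --> snd x s = snd (y i) (map (col i) s))" if "i <= n" "i ~= k" for i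
  by (rule pullback_face_iff[OF n1 that(1) coherent_nerve_ext[OF y[OF that]]])
 show ?thesis
 proof
  assume a: "\<forall>i\<le>n. i ~= k --> facet n i x = y i"
  show "(\<forall>p\<le>n. fst x p = hX n k y p) & (\<forall>s\<in>horn n k. snd x s = hA A n k y s)"
  proof (intro conjI allI impI ballI)
   fix p assume p: "p <= n"
   obtain i where i: "i <= n" "i ~= k" "i ~= p" by (rule other)
   show "fst x p = hX n k y p" using a 1[OF i(1,2)] glue_obj[OF i(1,2) p] i p by auto
  next
   fix s assume "s : horn n k"
   then obtain i where i: "i <= n" "i ~= k" "i \<notin> set s" and s: "s : nerve_seqs n" by (auto simp: horn_def)
   show "snd x s = hA A n k y s" using a 1[OF i(1,2)] glue_mor[OF i(1,2) s i(3)] i s by auto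
  qed
 next
  assume a: "(\<forall>p\<le>n. fst x p = hX n k y p) & (\<forall>s\<in>horn n k. snd x s = hA A n k y s)"
  show "\<forall>i\<le>n. i ~= k --> facet n i x = y i"
  proof (intro allI impI)
   fix i assume i: "i <= n" "i ~= k"
   show "facet n i x = y i" unfolding 1[OF i]
    using a glue_obj[OF i] glue_mor[OF i] i by (auto simp: horn_def)
  qed
 qed
qed

end

subsection \<open>Functoriality of the nerve\<close>

definition nmap :: "('o => 'p) => ('o => 'o => int => 'm => 'n) => nat => ('o, 'm) simplex => ('p, 'n) simplex" where
 "nmap Fo Fm n x = (\<lambda>i\<in>{..n}. Fo (fst x i), \<lambda>s\<in>nerve_seqs n. Fm (fst x (hd s)) (fst x (last s)) (seq_deg s) (snd x s))"

locale adgfun = dgfun A B Fo Fm + A: adg A + B: adg B for A B Fo Fm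
begin

abbreviation "imX X \<equiv> %i. Fo (X i)"
abbreviation "imA X aa \<equiv> %t. Fm (X (hd t)) (X (last t)) (seq_deg t) (aa t)"

lemma im_family: "nerve_family A n X aa ==> nerve_family B n (imX X) (imA X aa)"
proof -
 assume "nerve_family A n X aa"
 then interpret N: nerve_family A n X aa .
 show ?thesis using Fo_Ob N.X Fm_closed[OF N.seq_Ob(1) N.seq_Ob(2) N.aa] by unfold_locales auto
qed

lemma Fm_bnd:
 assumes N: "nerve_family A n X aa" and s: "s : nerve_seqs n"
 shows "Fm (X (hd s)) (X (last s)) (seq_deg s + 1) (bnd A X aa s) = bnd B (imX X) (imA X aa) s"
proof -
 interpret N: nerve_family A n X aa by (rule N)
 interpret N': nerve_family B n "imX X" "imA X aa" by (rule im_family[OF N])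
 note o = N.seq_Ob(1)[OF s] N.seq_Ob(2)[OF s]
 note am = Fm_amap[OF o]
 interpret M: abelian_group "Hom B (Fo (X (hd s))) (Fo (X (last s))) (seq_deg s + 1)"
  by (rule B.hom_group[OF Fo_Ob[OF o(1)] Fo_Ob[OF o(2)]])
 interpret MA: abelian_group "sHom A X s (seq_deg s + 1)" by (rule A.hom_group[OF o])
 have "Fm (X (hd s)) (X (last s)) (seq_deg s + 1) (bnd A X aa s) =
  finsum (Hom B (Fo (X (hd s))) (Fo (X (last s))) (seq_deg s + 1))
   (%j. Fm (X (hd s)) (X (last s)) (seq_deg s + 1) (bterm A X aa s j)) {1..<length s - 1}"
  unfolding bnd_def using N.bterm_closed[OF s] by (intro amap_finsum[OF am]) auto
 also have "\<dots> = bnd B (imX X) (imA X aa) s"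
  unfolding bnd_def
 proof (rule M.finsum_cong')
  show "bterm B (imX X) (imA X aa) s : {1..<length s - 1} \<rightarrow> mor B (Fo (X (hd s))) (Fo (X (last s))) (seq_deg s + 1)"
   using N'.bterm_closed[OF s] by auto
  fix j assume "j : {1..<length s - 1}"
  then have j: "0 < j" "j < length s - 1" by auto
  then have "j < length s" by simp
  note oj = N.seq_Ob(3)[OF s this]
  note a = N.aa_sub[OF s j]
  note c = N.seq_cmp_closed[OF s j a(1,2) N.deg_sum(1)[OF j]]
  show "Fm (X (hd s)) (X (last s)) (seq_deg s + 1) (bterm A X aa s j) = bterm B (imX X) (imA X aa) s j"
   unfolding bterm_def Let_def Suc_eq_plus1[symmetric] sub_seq_simps[OF j] seq_deg_sub(3)[OF j]
    amap_sgn_act[OF am MA.minus_closed[OF c a(3)]] amap_minus[OF am c a(3)]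
    Fm_cmp[OF o(1) oj o(2) a(1,2) N.deg_sum(1)[OF j]] ..
 qed simp
 finally show ?thesis .
qed

lemma nmap_mem:
 assumes x: "x : coherent_nerve A n" shows "nmap Fo Fm n x : coherent_nerve B n"
proof -
 obtain Y \<beta> where xe: "x = (Y, \<beta>)" by (cases x)
 note nv = x[unfolded xe coherent_nerve_iff]
 have N: "nerve_family A n Y \<beta>" by (rule A.nerve_family_of[OF x[unfolded xe]])
 interpret N: nerve_family A n Y \<beta> by (rule N)
 interpret N': nerve_family B n "imX Y" "imA Y \<beta>" by (rule im_family[OF N])
 let ?Y = "\<lambda>i\<in>{..n}. Fo (Y i)" and ?b = "\<lambda>s\<in>nerve_seqs n. imA Y \<beta> s"
 have Ys: "?Y (hd s) = Fo (Y (hd s))" "?Y (last s) = Fo (Y (last s))" if "s : nerve_seqs n" for s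
  using nerve_seqsD(5,6)[OF that] by auto
 have "(?Y, ?b) : coherent_nerve B n"
  unfolding coherent_nerve_iff
 proof (intro conjI ballI allI impI)
  show "?Y : {..n} \<rightarrow>\<^sub>E Ob B" using N'.X by auto
  show "?b : (\<Pi>\<^sub>E s\<in>nerve_seqs n. mor B (?Y (hd s)) (?Y (last s)) (seq_deg s))"
   using N'.aa Ys by auto
  show "?b [i, i] = idn B (?Y i)" if i: "i <= n" for i
   using nv i Fm_idn[OF N.X[OF i]] by (simp add: nerve_seqs_def seq_deg_def)
  fix s assume s: "s : nerve_seqs n"
  note o = N.seq_Ob(1)[OF s] N.seq_Ob(2)[OF s]
  show "?b s = \<zero>[Hom B (?Y (hd s)) (?Y (last s)) (seq_deg s)]"
   if d: "3 <= length s & (\<exists>j. Suc j < length s & s ! j = s ! Suc j)"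
  proof -
   have "\<beta> s = \<zero>[sHom A Y s (seq_deg s)]" using nv s d by blast
   then show ?thesis unfolding Ys[OF s] using s amap_zero[OF Fm_amap[OF o]] by simp
  qed
  have b: "bnd B (imX Y) (imA Y \<beta>) s = bnd B ?Y ?b s"
   by (rule N'.bnd_cong[OF s]) (use sub_seq_mem[OF s] in auto)
  have "dif A (Y (hd s)) (Y (last s)) (seq_deg s) (\<beta> s) = bnd A Y \<beta> s" using nv s by blast
  then show "dif B (?Y (hd s)) (?Y (last s)) (seq_deg s) (?b s) = bnd B ?Y ?b s"
   unfolding Ys[OF s] using s Fm_bnd[OF N s] b Fm_dif[OF o N.aa[OF s] refl] by simp
 qed
 then show ?thesis by (simp add: nmap_def xe)
qed

lemma nmap_eq_mem:
 assumes x: "x : coherent_nerve_eq A n" shows "nmap Fo Fm n x : coherent_nerve_eq B n"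
proof -
 have c: "x : coherent_nerve A n" using x by (simp add: coherent_nerve_eq_iff)
 have o: "i <= n ==> fst x i : Ob A" for i using c by (cases x) (auto simp: coherent_nerve_iff)
 show ?thesis unfolding coherent_nerve_eq_iff
 proof (intro conjI allI impI nmap_mem[OF c])
  fix i j assume ij: "i <= j & j <= n"
  then have "[i, j] : nerve_seqs n" by (simp add: nerve_seqs_def)
  moreover have "equivalence B (Fo (fst x i)) (Fo (fst x j)) (Fm (fst x i) (fst x j) 0 (snd x [i, j]))"
   using x ij o by (intro Fm_equivalence) (auto simp: coherent_nerve_eq_iff)
  ultimately show "equivalence B (fst (nmap Fo Fm n x) i) (fst (nmap Fo Fm n x) j) (snd (nmap Fo Fm n x) [i, j])"
   using ij by (simp add: nmap_def seq_deg_def)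
 qed
qed

lemma nmap_pullback:
 assumes \<theta>: "\<theta> : ord_map p n"
 shows "nerve_pullback p \<theta> (nmap Fo Fm n x) = nmap Fo Fm p (nerve_pullback p \<theta> x)"
proof -
 have t: "\<theta> i <= n" if "i <= p" for i using \<theta> that by (auto simp: ord_map_def)
 show ?thesis unfolding nerve_pullback_def nmap_def prod_eq_iff fst_conv snd_conv
  using ord_map_mem[OF \<theta>] t nerve_seqsD(5-7)
  by (auto intro!: restrict_ext simp: hd_map last_map seq_deg_map)
qed

lemma im_horn:
 assumes H: "horn_family A n X aa k" shows "horn_family B n (imX X) (imA X aa) k"
proof -
 interpret H: horn_family A n X aa k by (rule H)
 note fam = H.nerve_family_axioms
 show ?thesis
 proof (intro horn_family.intro im_family[OF fam] horn_family_axioms.intro H.n2 H.kn)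
  show "imA X aa [i, i] = idn B (imX X i)" if "i <= n" for i
   using H.ids[OF that] Fm_idn[OF H.X[OF that]] by (simp add: seq_deg_def)
  show "imA X aa s = \<zero>[Hom B (imX X (hd s)) (imX X (last s)) (seq_deg s)]"
   if "s : nerve_seqs n" "3 <= length s" "Suc j < length s" "s ! j = s ! Suc j" for s j
   using H.deg[OF that] amap_zero[OF Fm_amap[OF H.seq_Ob(1)[OF that(1)] H.seq_Ob(2)[OF that(1)]]] by simp
  fix s assume s: "s : horn n k"
  note m = H.horn_mem[OF s]
  show "dif B (imX X (hd s)) (imX X (last s)) (seq_deg s) (imA X aa s) = bnd B (imX X) (imA X aa) s"
   using H.eq[OF s] Fm_bnd[OF fam m] Fm_dif[OF H.seq_Ob(1)[OF m] H.seq_Ob(2)[OF m] H.aa[OF m] refl] by simp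
 qed
qed

text \<open>This and the next two lemmas make the filler equations natural, so that they can be
  tested before or after applying the functor.\<close>

lemma im_face_bnd:
 assumes H: "horn_family A n X aa k"
 shows "Fm (X (hd (omit n k))) (X (last (omit n k))) (3 - int n) (horn_family.face_bnd A n X aa k) =
  horn_family.face_bnd B n (imX X) (imA X aa) k"
proof -
 interpret H: horn_family A n X aa k by (rule H)
 interpret H': horn_family B n "imX X" "imA X aa" k by (rule im_horn[OF H])
 show ?thesis using Fm_bnd[OF H.nerve_family_axioms H.om_mem]
  unfolding H.face_bnd_def H'.face_bnd_def H.om_deg by simp
qed

lemma im_top_bnd:
 assumes H: "horn_family A n X aa k"
 shows "Fm (X 0) (X n) (2 - int n) (horn_family.top_bnd A n X aa k) = horn_family.top_bnd B n (imX X) (imA X aa) k"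
proof -
 interpret H: horn_family A n X aa k by (rule H)
 interpret H': horn_family B n "imX X" "imA X aa" k by (rule im_horn[OF H])
 have "imA X H.zero_face = H'.zero_face"
  using amap_zero[OF Fm_amap[OF H.om_Ob]] unfolding H.zero_face_def H'.zero_face_def by (auto simp: H.om_deg)
 then show ?thesis using Fm_bnd[OF H.zero_face_family H.tp_mem]
  unfolding H.top_bnd_def H'.top_bnd_def H.tp_deg top_seq_simps by simp
qed

lemma im_Tm:
 assumes H: "horn_family A n X aa k" and x: "x : smor A X (omit n k) i"
 shows "Fm (X 0) (X n) i (horn_family.Tm A n X aa k i x) =
  horn_family.Tm B n (imX X) (imA X aa) k i (Fm (X (hd (omit n k))) (X (last (omit n k))) i x)"
proof -
 interpret H: horn_family A n X aa k by (rule H)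
 interpret H': horn_family B n "imX X" "imA X aa" k by (rule im_horn[OF H])
 note am = Fm_amap[OF H.tp_Ob, of i]
 consider (0) "k = 0" | (n) "k ~= 0" "k = n" | (m) "k ~= 0" "k ~= n" by blast
 then show ?thesis
 proof cases
  case 0
  have o: "X 0 : Ob A" "X 1 : Ob A" "X n : Ob A" using H.n2 by (auto intro: H.X_Ob)
  note e = H.edge_closed(1)[OF H.edge_facts(1)[OF 0]]
  have x': "x : mor A (X 1) (X n) i" using x H.om_ends(1)[OF 0] H.om_ends(2)[OF 0] by simp
  have i: "i = i + 0" by simp
  show ?thesis
   using amap_sgn_act[OF am A.cmp_closed[OF o x' e i]] Fm_cmp[OF o x' e i] H.om_ends(1)[OF 0] H.om_ends(2)[OF 0]
   unfolding H.Tm_def H'.Tm_def by (simp add: 0 seq_deg_def)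
 next
  case n
  have o: "X 0 : Ob A" "X (n - 1) : Ob A" "X n : Ob A" using H.n2 by (auto intro: H.X_Ob)
  note e = H.edge_closed(1)[OF H.edge_facts(2)[OF n(2)]]
  have x': "x : mor A (X 0) (X (n - 1)) i" using x H.om_ends(3)[OF n(2)] H.om_ends(4)[OF n(2)] by simp
  have i: "i = 0 + i" by simp
  show ?thesis
   using Fm_cmp[OF o e x' i] H.om_ends(3)[OF n(2)] H.om_ends(4)[OF n(2)] n H.n2
   unfolding H.Tm_def H'.Tm_def by (simp add: seq_deg_def)
 next
  case m
  then have k: "0 < k" "k < n" using H.kn by auto
  show ?thesis using amap_sgn_act[OF am] x H.om_ends(5)[OF k(1)] H.om_ends(6)[OF k(2)] m
   unfolding H.Tm_def H'.Tm_def by simp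
 qed
qed

text \<open>The image horn is described through the gluing of the original one, so its own gluing
  need not be compared with the image.\<close>

lemma match_im_iff:
 assumes M: "match_data A n k y"
 shows "(\<forall>i\<le>n. i ~= k --> facet n i x = nmap Fo Fm (n - 1) (y i)) \<longleftrightarrow>
  (\<forall>p\<le>n. fst x p = imX (hX n k y) p) & (\<forall>s\<in>horn n k. snd x s = imA (hX n k y) (hA A n k y) s)"
proof -
 interpret M: match_data A n k y by (rule M)
 have n1: "1 <= n" using M.n2 by simp
 have 1: "facet n i x = nmap Fo Fm (n - 1) (y i) \<longleftrightarrow>
  (\<forall>p\<le>n. p ~= i --> fst x p = imX (hX n k y) p) &
  (\<forall>s\<in>nerve_seqs n. i \<notin> set s --> snd x s = imA (hX n k y) (hA A n k y) s)" if i: "i <= n" "i ~= k" for i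
 proof -
  have p: "fst (nmap Fo Fm (n - 1) (y i)) (col i p) = imX (hX n k y) p" if "p <= n" "p ~= i" for p
   using M.glue_obj[OF i that] that i by (auto simp: nmap_def col_def)
  have s: "snd (nmap Fo Fm (n - 1) (y i)) (map (col i) s) = imA (hX n k y) (hA A n k y) s"
   if "s : nerve_seqs n" "i \<notin> set s" for s
   using M.glue_mor[OF i that] M.glue_ends[OF i that] col_mem[OF that(1) i(1) that(2)]
   by (simp add: nmap_def seq_deg_map)
  show ?thesis
   unfolding pullback_face_iff[OF n1 i(1) coherent_nerve_ext[OF nmap_mem[OF M.y[OF i]]]] using p s by auto
 qed
 show ?thesis
 proof
  assume a: "\<forall>i\<le>n. i ~= k --> facet n i x = nmap Fo Fm (n - 1) (y i)"
  show "(\<forall>p\<le>n. fst x p = imX (hX n k y) p) & (\<forall>s\<in>horn n k. snd x s = imA (hX n k y) (hA A n k y) s)"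
  proof (intro conjI allI impI ballI)
   fix p assume p: "p <= n"
   obtain i where i: "i <= n" "i ~= k" "i ~= p" by (rule M.other)
   show "fst x p = imX (hX n k y) p" using a[rule_format, OF i(1,2), unfolded 1[OF i(1,2)]] i(3) p by simp
  next
   fix s assume "s : horn n k"
   then obtain i where i: "i <= n" "i ~= k" "i \<notin> set s" and s: "s : nerve_seqs n" by (auto simp: horn_def)
   show "snd x s = imA (hX n k y) (hA A n k y) s" using a[rule_format, OF i(1,2), unfolded 1[OF i(1,2)]] i(3) s by simp
  qed
 next
  assume a: "(\<forall>p\<le>n. fst x p = imX (hX n k y) p) & (\<forall>s\<in>horn n k. snd x s = imA (hX n k y) (hA A n k y) s)"
  have h: "s : horn n k" if "i <= n" "i ~= k" "s : nerve_seqs n" "i \<notin> set s" for i s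
   using that by (auto simp: horn_def)
  show "\<forall>i\<le>n. i ~= k --> facet n i x = nmap Fo Fm (n - 1) (y i)"
  proof (intro allI impI)
   fix i assume i: "i <= n" "i ~= k"
   show "facet n i x = nmap Fo Fm (n - 1) (y i)" unfolding 1[OF i]
    using a h[OF i] by simp
  qed
 qed
qed

end

lemma nerve_pullback_id:
 assumes "x : coherent_nerve A n" "\<forall>i\<le>n. \<theta> i = i" shows "nerve_pullback n \<theta> x = x"
proof -
 have "(\<lambda>i\<in>{..n}. fst x (\<theta> i)) = fst x"
  by (rule extensionalityI[OF _ coherent_nerve_ext(1)[OF assms(1)]]) (use assms(2) in auto)
 moreover have "(\<lambda>s\<in>nerve_seqs n. snd x (map \<theta> s)) = snd x"
 proof (rule extensionalityI[OF _ coherent_nerve_ext(2)[OF assms(1)]])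
  fix s assume s: "s : nerve_seqs n"
  have "map \<theta> s = s" by (rule map_idI) (use assms(2) nerve_seqsD(3)[OF s] in auto)
  then show "(\<lambda>s\<in>nerve_seqs n. snd x (map \<theta> s)) s = snd x s" using s by simp
 qed simp
 ultimately show ?thesis by (simp add: nerve_pullback_def)
qed

lemma nerve_pullback_comp:
 assumes "\<rho> : ord_map q p"
 shows "nerve_pullback q (\<theta> \<circ> \<rho>) x = nerve_pullback q \<rho> (nerve_pullback p \<theta> x)"
proof -
 have "(\<lambda>i\<in>{..q}. fst x ((\<theta> \<circ> \<rho>) i)) = (\<lambda>i\<in>{..q}. (\<lambda>i\<in>{..p}. fst x (\<theta> i)) (\<rho> i))"
  using assms by (intro restrict_ext) (auto simp: ord_map_def)
 moreover have "(\<lambda>s\<in>nerve_seqs q. snd x (map (\<theta> \<circ> \<rho>) s)) =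
   (\<lambda>s\<in>nerve_seqs q. (\<lambda>s\<in>nerve_seqs p. snd x (map \<theta> s)) (map \<rho> s))"
  using ord_map_mem[OF assms] by (intro restrict_ext) simp
 ultimately show ?thesis by (simp add: nerve_pullback_def)
qed

lemma edge_seq: "p <= q ==> q <= n ==> [p, q] : nerve_seqs n"
 by (simp add: nerve_seqs_def)

section \<open>Simplices of low dimension, and edges that are equivalences\<close>

context adg
begin

lemma nerve_Ob: "x : coherent_nerve A n ==> i <= n ==> fst x i : Ob A"
 by (cases x) (auto simp: coherent_nerve_iff)

lemma nerve_mor: "x : coherent_nerve A n ==> s : nerve_seqs n ==>
  snd x s : mor A (fst x (hd s)) (fst x (last s)) (seq_deg s)"
 by (cases x) (auto simp: coherent_nerve_iff)

lemma nerve_dif: "x : coherent_nerve A n ==> s : nerve_seqs n ==>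
  dif A (fst x (hd s)) (fst x (last s)) (seq_deg s) (snd x s) = bnd A (fst x) (snd x) s"
 by (cases x) (auto simp: coherent_nerve_iff)

lemma nerve_edge_cocycle:
 assumes x: "x : coherent_nerve A n" and pq: "p <= q" "q <= n"
 shows "snd x [p, q] : cocycle0 A (fst x p) (fst x q)"
 using nerve_mor[OF x edge_seq[OF pq]] nerve_dif[OF x edge_seq[OF pq]]
  abelian_monoid.finsum_empty[OF abelian_group.axioms(1)[OF hom_group[OF nerve_Ob[OF x] nerve_Ob[OF x]]], of p q] pq
 by (simp add: cocycle0_def bnd_def seq_deg_def)

text \<open>The 2-cell is itself the homotopy.\<close>

lemma nerve_triangle:
 assumes x: "x : coherent_nerve A 2"
 shows "homologous0 A (fst x 0) (fst x 2)
  (cmp A (fst x 0) (fst x 1) (fst x 2) 0 0 (snd x [1, 2]) (snd x [0, 1])) (snd x [0, 2])"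
proof -
 have s: "[0, 1, 2] : nerve_seqs 2" by (simp add: nerve_seqs_def)
 have o: "fst x 0 : Ob A" "fst x 1 : Ob A" "fst x 2 : Ob A" using nerve_Ob[OF x] by auto
 have c: "snd x [0, 1] : mor A (fst x 0) (fst x 1) 0"
  "snd x [1, 2] : mor A (fst x 1) (fst x 2) 0" "snd x [0, 2] : mor A (fst x 0) (fst x 2) 0"
  by (rule cocycle0_closed[OF nerve_edge_cocycle[OF x]]; simp)+
 interpret M: abelian_group "Hom A (fst x 0) (fst x 2) 0" by (rule hom_group[OF o(1,3)])
 have cc: "cmp A (fst x 0) (fst x 1) (fst x 2) 0 0 (snd x [1, 2]) (snd x [0, 1]) : mor A (fst x 0) (fst x 2) 0"
  by (rule cmp_closed[OF o c(2,1)]) simp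
 have "{1..<length [0::nat, 1, 2] - 1} = {1}" by auto
 then have "bnd A (fst x) (snd x) [0, 1, 2] =
  cmp A (fst x 0) (fst x 1) (fst x 2) 0 0 (snd x [1, 2]) (snd x [0, 1]) \<ominus>[Hom A (fst x 0) (fst x 2) 0] snd x [0, 2]"
  using M.minus_closed[OF cc c(3)] by (simp add: bnd_def bterm_def seq_deg_def sgn_act_def)
 then show ?thesis using nerve_mor[OF x s] nerve_dif[OF x s] unfolding homologous0_def
  by (intro bexI[of _ "snd x [0, 1, 2]"]) (simp_all add: seq_deg_def)
qed

lemma nerve_edge_of_face:
 assumes n: "1 <= n" and i: "i <= n" and f: "facet n i x : coherent_nerve_eq A (n - 1)"
  and pq: "p <= q" "q <= n" "p ~= i" "q ~= i"
 shows "equivalence A (fst x p) (fst x q) (snd x [p, q])"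
proof -
 have "[p, q] : nerve_seqs n" "i \<notin> set [p, q]" using pq by (auto simp: nerve_seqs_def)
 from col_mem[OF this(1) i this(2)] have m: "[col i p, col i q] : nerve_seqs (n - 1)" by simp
 then have c: "col i p <= col i q" "col i q <= n - 1" "col i p <= n - 1" by (auto simp: nerve_seqs_def)
 have "equivalence A (fst (facet n i x) (col i p)) (fst (facet n i x) (col i q))
  (snd (facet n i x) [col i p, col i q])"
  using f c by (simp add: coherent_nerve_eq_iff)
 then show ?thesis using m c pq by (simp add: nerve_pullback_def dl_col)
qed

text \<open>An edge lies in some face other than the \<open>k\<close>-th unless \<open>k\<close> and
  its two ends exhaust all vertices. Then \<open>n\<close> = 2 and the edge is opposite to
  \<open>k\<close>; the triangle and two out of three, or composition for \<open>k\<close> = 1,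
  finish the argument.\<close>

lemma coherent_nerve_eq_of_faces:
 assumes n: "2 <= n" and k: "k <= n" and x: "x : coherent_nerve A n"
  and f: "!!i. i <= n ==> i ~= k ==> facet n i x : coherent_nerve_eq A (n - 1)"
 shows "x : coherent_nerve_eq A n"
proof -
 have n1: "1 <= n" using n by simp
 have e: "equivalence A (fst x p) (fst x q) (snd x [p, q])"
  if "i <= n" "i ~= k" "p <= q" "q <= n" "p ~= i" "q ~= i" for i p q
  by (rule nerve_edge_of_face[OF n1 that(1) f[OF that(1,2)] that(3-6)])
 have "equivalence A (fst x p) (fst x q) (snd x [p, q])" if pq: "p <= q" "q <= n" for p q
 proof (cases "\<exists>i\<le>n. i ~= k & i ~= p & i ~= q")
  case True
  then obtain i where "i <= n" "i ~= k" "i ~= p" "i ~= q" by blast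
  then show ?thesis using e[of i p q] pq by blast
 next
  case False
  then have sub: "{..n} \<subseteq> {k, p, q}" by auto
  have "card {k, p, q} <= 3" by (auto simp: card_insert_if)
  then have "card {..n} <= 3" using card_mono[OF _ sub] by simp
  then have n2: "n = 2" using n by simp
  have "0 : {k, p, q}" "1 : {k, p, q}" "2 : {k, p, q}" by (rule subsetD[OF sub]; simp add: n2)+
  then have cases: "(k = 0 & p = 1 & q = 2) \<or> (k = 1 & p = 0 & q = 2) \<or> (k = 2 & p = 0 & q = 1)"
   using pq k n2 by (simp only: insert_iff empty_iff) presburger
  have x2: "x : coherent_nerve A 2" using x n2 by simp
  have o: "fst x 0 : Ob A" "fst x 1 : Ob A" "fst x 2 : Ob A" using nerve_Ob[OF x2] by auto
  have c: "snd x [0, 1] : cocycle0 A (fst x 0) (fst x 1)" "snd x [1, 2] : cocycle0 A (fst x 1) (fst x 2)"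
   "snd x [0, 2] : cocycle0 A (fst x 0) (fst x 2)" using nerve_edge_cocycle[OF x2] by auto
  note t = nerve_triangle[OF x2]
  consider "k = 0" "p = 1" "q = 2" | "k = 1" "p = 0" "q = 2" | "k = 2" "p = 0" "q = 1" using cases by blast
  then show ?thesis
  proof cases
   case 1
   have "equivalence A (fst x 0) (fst x 1) (snd x [0, 1])" "equivalence A (fst x 0) (fst x 2) (snd x [0, 2])"
    using e[of 2 0 1] e[of 1 0 2] n2 1 by auto
   from equivalence_cancel_right[OF o this c(2) t] show ?thesis using 1 by simp
  next
   case 2
   have "equivalence A (fst x 0) (fst x 1) (snd x [0, 1])" "equivalence A (fst x 1) (fst x 2) (snd x [1, 2])"
    using e[of 2 0 1] e[of 0 1 2] n2 2 by auto
   note q = equivalence_cmp[OF o this]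
   note qc = cocycle0_closed[OF equivalence_cocycle[OF q]]
   have "homologous0 A (fst x 0) (fst x 2) (snd x [0, 2])
     (cmp A (fst x 0) (fst x 1) (fst x 2) 0 0 (snd x [1, 2]) (snd x [0, 1]))"
    by (rule homologous0_sym[OF o(1,3) qc cocycle0_closed[OF c(3)] t])
   from equivalence_homologous[OF o(1,3) q c(3) this] show ?thesis using 2 by simp
  next
   case 3
   have "equivalence A (fst x 1) (fst x 2) (snd x [1, 2])" "equivalence A (fst x 0) (fst x 2) (snd x [0, 2])"
    using e[of 0 1 2] e[of 1 0 2] n2 3 by auto
   from equivalence_cancel_left[OF o this c(1) t] show ?thesis using 3 by simp
  qed
 qed
 then show ?thesis using x by (simp add: coherent_nerve_eq_iff)
qed

lemma seqs_1_cases: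
 assumes "s : nerve_seqs 1"
 shows "s : {[0, 0], [0, 1], [1, 1]} \<or> 3 <= length s & (\<exists>j. Suc j < length s & s ! j = s ! Suc j)"
proof (cases "3 <= length s")
 case True
 have "\<not> distinct s"
 proof
  assume "distinct s"
  then have "length s = card (set s)" by (simp add: distinct_card)
  also have "\<dots> <= card {..1::nat}" using nerve_seqsD(3)[OF assms] by (intro card_mono) auto
  finally show False using True by simp
 qed
 then show ?thesis using sorted_not_distinct[OF nerve_seqsD(2)[OF assms]] True by blast
next
 case False
 then have "length s = 2" using nerve_seqsD(1)[OF assms] by simp
 then obtain p q where s: "s = [p, q]" by (auto simp: numeral_2_eq_2 length_Suc_conv)
 then have "p <= q" "q <= 1" using assms by (auto simp: nerve_seqs_def)
 then show ?thesis using s by (cases "p = 0"; cases "q = 0") auto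
qed

lemma nerve_1_eqI:
 assumes x: "x : coherent_nerve A 1" and y: "y : coherent_nerve A 1"
  and o: "!!i. i <= 1 ==> fst x i = fst y i" and e: "snd x [0, 1] = snd y [0, 1]"
 shows "x = y"
proof -
 obtain X aa Y \<beta> where xy: "x = (X, aa)" "y = (Y, \<beta>)" by (cases x, cases y)
 note xn = x[unfolded xy coherent_nerve_iff] and yn = y[unfolded xy coherent_nerve_iff]
 have XY: "X i = Y i" if "i <= 1" for i using o[OF that] by (simp add: xy)
 have "X = Y" by (rule extensionalityI[of _ "{..1}"]) (use xn yn XY in \<open>auto simp: PiE_iff\<close>)
 moreover have "aa = \<beta>"
 proof (rule extensionalityI[of _ "nerve_seqs 1"])
  fix s assume s: "s : nerve_seqs 1"
  from seqs_1_cases[OF s] show "aa s = \<beta> s"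
  proof
   assume "s : {[0, 0], [0, 1], [1, 1]}"
   moreover have "aa [i, i] = \<beta> [i, i]" if "i <= 1" for i
   proof -
    have "aa [i, i] = idn A (X i)" "\<beta> [i, i] = idn A (Y i)" using xn yn that by blast+
    then show ?thesis using XY[OF that] by simp
   qed
   ultimately show ?thesis using e by (auto simp: xy)
  next
   assume d: "3 <= length s & (\<exists>j. Suc j < length s & s ! j = s ! Suc j)"
   have "aa s = \<zero>[sHom A X s (seq_deg s)]" "\<beta> s = \<zero>[sHom A Y s (seq_deg s)]"
    using xn yn s d by blast+
   then show ?thesis using XY nerve_seqsD(5,6)[OF s] by simp
  qed
 qed (use xn yn in \<open>auto simp: PiE_iff\<close>)
 ultimately show ?thesis by (simp add: xy)
qed

text \<open>A vertex is recovered from its degenerate edge, and edges are determined by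
  \<open>nerve_1_eqI\<close>; this avoids a separate analysis of the constant sequences.\<close>

lemma nerve_0_eqI:
 assumes x: "x : coherent_nerve A 0" and y: "y : coherent_nerve A 0" and o: "fst x 0 = fst y 0"
 shows "x = y"
proof -
 have t: "(%_. 0) : ord_map 1 0" "(%_. 0) : ord_map 0 1" by (auto simp: ord_map_def mono_on_def)
 have a: "snd (nerve_pullback 1 (%_. 0) z) [0, 1] = idn A (fst z 0)" if "z : coherent_nerve A 0" for z
  using that by (cases z) (simp add: nerve_pullback_def coherent_nerve_iff nerve_seqs_def)
 have "nerve_pullback 1 (%_. 0) x = nerve_pullback 1 (%_. 0) y"
  by (rule nerve_1_eqI[OF nerve_pullback_mem[OF t(1) x] nerve_pullback_mem[OF t(1) y]])
   (use o a[OF x] a[OF y] in \<open>auto simp: nerve_pullback_def\<close>)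
 then have "nerve_pullback 0 ((%_::nat. 0) \<circ> (%_. 0)) x = nerve_pullback 0 ((%_::nat. 0) \<circ> (%_. 0)) y"
  using nerve_pullback_comp[OF t(2), of "%_. 0" x] nerve_pullback_comp[OF t(2), of "%_. 0" y] by simp
 then show ?thesis using nerve_pullback_id[OF x, of "%_. 0"] nerve_pullback_id[OF y, of "%_. 0"] by (simp add: comp_def)
qed

lemma ex_edge_simplex:
 assumes e: "equivalence A (Z 0) (Z 1) f" and o: "!!i. i <= 1 ==> Z i : Ob A"
 obtains x where "x : coherent_nerve_eq A 1" "!!i. i <= 1 ==> fst x i = Z i" "snd x [0, 1] = f"
proof -
 let ?X = "\<lambda>i\<in>{..1}. Z i"
 let ?a = "\<lambda>s\<in>nerve_seqs 1. if s = [0, 1] then f else if length s = 2 then idn A (Z (hd s))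
  else \<zero>[sHom A Z s (seq_deg s)]"
 have o': "Z 0 : Ob A" "Z 1 : Ob A" using o by auto
 note f = equivalence_cocycle[OF e]
 have mem: "[0, 0] : nerve_seqs 1" "[0, 1] : nerve_seqs 1" "[1, 1] : nerve_seqs 1" by (auto simp: nerve_seqs_def)
 have X: "?X : {..1} \<rightarrow>\<^sub>E Ob A" using o by auto
 have zc: "\<zero>[Hom A (Z p) (Z q) i] : mor A (Z p) (Z q) i" if "p <= 1" "q <= 1" for p q i
  by (rule abelian_monoid.zero_closed[OF abelian_group.axioms(1)[OF hom_group[OF o[OF that(1)] o[OF that(2)]]]])
 have ac: "?a s : mor A (?X (hd s)) (?X (last s)) (seq_deg s)" if s: "s : nerve_seqs 1" for s
  using seqs_1_cases[OF s]
 proof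
  assume "s : {[0, 0], [0, 1], [1, 1]}"
  then show ?thesis using mem cocycle0_closed[OF f] idn_closed[OF o'(1)] idn_closed[OF o'(2)]
   by (auto simp: seq_deg_def)
 next
  assume d: "3 <= length s & (\<exists>j. Suc j < length s & s ! j = s ! Suc j)"
  then have "s ~= [0, 1]" "length s ~= 2" by auto
  then show ?thesis using s zc nerve_seqsD(5,6)[OF s] by simp
 qed
 have n: "(?X, ?a) : coherent_nerve A 1"
 proof (rule nerveI[OF X])
  show "?a : (\<Pi>\<^sub>E s\<in>nerve_seqs 1. mor A (?X (hd s)) (?X (last s)) (seq_deg s))"
   by (rule PiE_I, rule ac) auto
  show "?a [i, i] = idn A (?X i)" if "i <= 1" for i
   using that edge_seq[of i i 1] by auto
  show "?a s = \<zero>[Hom A (?X (hd s)) (?X (last s)) (seq_deg s)]"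
   if s: "s : nerve_seqs 1" "3 <= length s" "Suc j < length s" "s ! j = s ! Suc j" for s j
   using s nerve_seqsD(5,6)[OF s(1)] by auto
  fix s assume s: "s : nerve_seqs 1" "distinct s"
  have "s = [0, 1]" using seqs_1_cases[OF s(1)] s(2) nth_eq_iff_index_eq[OF s(2)] by fastforce
  then show "dif A (?X (hd s)) (?X (last s)) (seq_deg s) (?a s) = bnd A ?X ?a s"
   using f mem(2)
   by (simp add: bnd_def seq_deg_def cocycle0_def abelian_monoid.finsum_empty[OF abelian_group.axioms(1)[OF hom_group[OF o']], simplified])
 qed
 have "(?X, ?a) : coherent_nerve_eq A 1"
  unfolding coherent_nerve_eq_iff
 proof (intro conjI n allI impI)
  fix i j :: nat assume ij: "i <= j & j <= 1"
  have d: "equivalence A (Z i) (Z i) (idn A (Z i))" if "i <= 1" for i by (rule equivalence_idn[OF o[OF that]])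
  have "(i = 0 & j = 0) \<or> (i = 0 & j = 1) \<or> (i = 1 & j = 1)" using ij by auto
  then show "equivalence A (fst (?X, ?a) i) (fst (?X, ?a) j) (snd (?X, ?a) [i, j])"
   using mem e d[of 0] d[of 1] by auto
 qed
 from that[OF this] show thesis using mem(2) by simp
qed

end

context match_data
begin

lemma glue_edge:
 assumes "!!i. i <= n ==> i ~= k ==> y i : coherent_nerve_eq A (n - 1)" and h: "[p, q] : horn n k"
 shows "equivalence A (hX n k y p) (hX n k y q) (hA A n k y [p, q])"
proof -
 obtain i where i: "i <= n" "i ~= k" "i \<notin> set [p, q]" and s: "[p, q] : nerve_seqs n" using h by (auto simp: horn_def)
 have m: "[col i p, col i q] : nerve_seqs (n - 1)" using col_mem[OF s i(1,3)] by simp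
 then have c: "col i p <= col i q" "col i q <= n - 1" by (auto simp: nerve_seqs_def)
 show ?thesis using assms(1)[OF i(1,2)] c glue_mor[OF i(1,2) s i(3)] glue_ends[OF i(1,2) s i(3)]
  by (simp add: coherent_nerve_eq_iff)
qed

lemma match_ext:
 assumes x: "x : coherent_nerve A n" "\<forall>i\<le>n. i ~= k --> facet n i x = y i"
  and x': "x' : coherent_nerve A n" "\<forall>i\<le>n. i ~= k --> facet n i x' = y i"
  and e: "snd x (omit n k) = snd x' (omit n k)" "snd x (top_seq n) = snd x' (top_seq n)"
 shows "x = x'"
proof -
 interpret H: horn_family A n "hX n k y" "hA A n k y" k by (rule horn_glue)
 have "H.fill (snd x (omit n k)) (snd x (top_seq n)) = x"
  using x(2)[unfolded match_iff] by (intro H.nerve_fill(5)[OF x(1)]) auto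
 moreover have "H.fill (snd x' (omit n k)) (snd x' (top_seq n)) = x'"
  using x'(2)[unfolded match_iff] by (intro H.nerve_fill(5)[OF x'(1)]) auto
 ultimately show ?thesis unfolding e by simp
qed

lemma fill_match:
 assumes z: "z : coherent_nerve A n" "!!i. i <= n ==> fst z i = hX n k y i" "!!s. s : horn n k ==> snd z s = hA A n k y s"
  and e: "!!i. i <= n ==> i ~= k ==> y i : coherent_nerve_eq A (n - 1)"
 shows "z : coherent_nerve_eq A n" "\<forall>i\<le>n. i ~= k --> facet n i z = y i"
proof -
 show *: "\<forall>i\<le>n. i ~= k --> facet n i z = y i" unfolding match_iff using z by blast
 show "z : coherent_nerve_eq A n"
  by (rule coherent_nerve_eq_of_faces[OF n2 kn z(1)]) (use * e in auto)
qed

lemma ex_filler: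
 assumes e: "!!i. i <= n ==> i ~= k ==> y i : coherent_nerve_eq A (n - 1)"
 shows "\<exists>z\<in>coherent_nerve_eq A n. \<forall>i\<le>n. i ~= k --> facet n i z = y i"
proof -
 interpret H: horn_family A n "hX n k y" "hA A n k y" k by (rule horn_glue)
 \<comment> \<open>With \<open>N\<close> everything, any pair is an approximate filler, so the
   correction can start from zero.\<close>
 let ?u = "\<zero>[H.HO (2 - int n)]" and ?v = "\<zero>[H.HT (1 - int n)]"
 interpret O2: abelian_group "H.HO (2 - int n)" by (rule hom_group[OF H.om_Ob])
 interpret O3: abelian_group "H.HO (3 - int n)" by (rule hom_group[OF H.om_Ob])
 interpret T1: abelian_group "H.HT (1 - int n)" by (rule hom_group[OF H.tp_Ob])
 interpret T2: abelian_group "H.HT (2 - int n)" by (rule hom_group[OF H.tp_Ob])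
 have c: "cone_solvable A (%E F i. mor A E F i) H.Tm (hX n k y (hd H.om)) (hX n k y (last H.om)) (hX n k y 0) (hX n k y n)"
 proof (rule H.Tm_cone[OF ann_pair_all])
  fix p q assume h: "[p, q] : horn n k"
  have "hX n k y p : Ob A" "hX n k y q : Ob A" using H.seq_Ob[OF H.horn_mem[OF h]] by auto
  then show "equiv_mod A (%E F i. {\<zero>[Hom A E F i]}) (hX n k y p) (hX n k y q) (hA A n k y [p, q])"
   by (rule equivalence_equiv_mod) (rule glue_edge[OF e h])
 qed
 obtain u v where uv: "u : carrier (H.HO (2 - int n))" "v : carrier (H.HT (1 - int n))"
  "dif A (hX n k y (hd H.om)) (hX n k y (last H.om)) (2 - int n) (?u \<oplus>[H.HO (2 - int n)] u) = H.face_bnd"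
  "dif A (hX n k y 0) (hX n k y n) (1 - int n) (?v \<oplus>[H.HT (1 - int n)] v) =
   H.top_bnd \<oplus>[H.HT (2 - int n)] H.Tm (2 - int n) (?u \<oplus>[H.HO (2 - int n)] u)"
  using H.correct_filler[OF ann_pair_all c O2.zero_closed T1.zero_closed]
   O3.minus_closed[OF H.face_bnd_closed dif_closed[OF H.om_Ob O2.zero_closed, of "3 - int n"]]
   T2.minus_closed[OF dif_closed[OF H.tp_Ob T1.zero_closed, of "2 - int n"]
    T2.a_closed[OF H.top_bnd_closed amap_closed[OF H.Tm_amap O2.zero_closed]]] by auto
 have z: "H.fill (?u \<oplus>[H.HO (2 - int n)] u) (?v \<oplus>[H.HT (1 - int n)] v) : coherent_nerve A n"
  by (rule H.fill_nerve[OF _ _ uv(3,4)]) (use uv in auto)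
 show ?thesis using fill_match[OF z H.fill_simps(1) H.fill_simps(2) e] by blast
qed

end

section \<open>Fillers and functors\<close>

context adgfun
begin

lemma im_match:
 assumes M: "match_data A n k y" shows "match_data B n k (%i. nmap Fo Fm (n - 1) (y i))"
proof -
 interpret M: match_data A n k y by (rule M)
 have n1: "1 <= n - 1" using M.n2 by simp
 show ?thesis
 proof
  show "2 <= n" "k <= n" by (rule M.n2 M.kn)+
  show "nmap Fo Fm (n - 1) (y i) : coherent_nerve B (n - 1)" if "i <= n" "i ~= k" for i
   by (rule nmap_mem[OF M.y[OF that]])
  show "nerve_pullback (n - 1 - 1) (dl i) (nmap Fo Fm (n - 1) (y j)) =
    nerve_pullback (n - 1 - 1) (dl (j - 1)) (nmap Fo Fm (n - 1) (y i))"
   if "i <= n" "j <= n" "i ~= k" "j ~= k" "i < j" for i j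
   unfolding nmap_pullback[OF dl_ord_map[OF n1]] M.compat[OF that] ..
 qed
qed

text \<open>Shared by the two kinds of descent: for a surjection it says that the errors of lifted
  values lie in the kernel, for a directed system that they vanish in the colimit.\<close>

lemma match_lift_eqs:
 fixes n k y
 defines "X \<equiv> hX n k y" and "aa \<equiv> hA A n k y"
 assumes M: "match_data A n k y" and x: "x : coherent_nerve B n"
  and m: "\<forall>i\<le>n. i ~= k --> facet n i x = nmap Fo Fm (n - 1) (y i)"
  and u: "u : smor A X (omit n k) (2 - int n)"
   "Fm (X (hd (omit n k))) (X (last (omit n k))) (2 - int n) u = snd x (omit n k)"
  and v: "v : mor A (X 0) (X n) (1 - int n)" "Fm (X 0) (X n) (1 - int n) v = snd x (top_seq n)"
 shows "Fm (X (hd (omit n k))) (X (last (omit n k))) (3 - int n) (dif A (X (hd (omit n k))) (X (last (omit n k))) (2 - int n) u) =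
   Fm (X (hd (omit n k))) (X (last (omit n k))) (3 - int n) (horn_family.face_bnd A n X aa k)"
  "Fm (X 0) (X n) (2 - int n) (dif A (X 0) (X n) (1 - int n) v) = Fm (X 0) (X n) (2 - int n)
   (horn_family.top_bnd A n X aa k \<oplus>[Hom A (X 0) (X n) (2 - int n)] horn_family.Tm A n X aa k (2 - int n) u)"
proof -
 interpret M: match_data A n k y by (rule M)
 have H: "horn_family A n X aa k" unfolding X_def aa_def by (rule M.horn_glue)
 interpret H: horn_family A n X aa k by (rule H)
 interpret H': horn_family B n "imX X" "imA X aa" k by (rule im_horn[OF H])
 note e = m[unfolded match_im_iff[OF M], folded X_def aa_def]
 note f = H'.nerve_fill(3,4)[OF x e[THEN conjunct1, rule_format] e[THEN conjunct2, rule_format]]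
 show "Fm (X (hd H.om)) (X (last H.om)) (3 - int n) (dif A (X (hd H.om)) (X (last H.om)) (2 - int n) u) =
   Fm (X (hd H.om)) (X (last H.om)) (3 - int n) H.face_bnd"
  using Fm_dif[OF H.om_Ob u(1), of "3 - int n"] f(1) im_face_bnd[OF H] u(2) by simp
 show "Fm (X 0) (X n) (2 - int n) (dif A (X 0) (X n) (1 - int n) v) = Fm (X 0) (X n) (2 - int n)
   (H.top_bnd \<oplus>[Hom A (X 0) (X n) (2 - int n)] H.Tm (2 - int n) u)"
  using Fm_dif[OF H.tp_Ob v(1), of "2 - int n"] f(2) im_top_bnd[OF H] im_Tm[OF H u(1)] u(2) v(2)
   amap_add[OF Fm_amap[OF H.tp_Ob] H.top_bnd_closed amap_closed[OF H.Tm_amap u(1)]] by simp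
qed

text \<open>The equations are required only after applying the functor. Thus \<open>u\<close> and
  \<open>v\<close> may come from a stage where they do not yet hold, and their images fill the horn
  at a later one.\<close>

lemma match_fill_image:
 fixes n k y
 defines "X \<equiv> hX n k y" and "aa \<equiv> hA A n k y"
 assumes M: "match_data A n k y" and y: "!!i. i <= n ==> i ~= k ==> y i : coherent_nerve_eq A (n - 1)"
  and u: "u : smor A X (omit n k) (2 - int n)"
  and v: "v : mor A (X 0) (X n) (1 - int n)"
  and du: "Fm (X (hd (omit n k))) (X (last (omit n k))) (3 - int n) (dif A (X (hd (omit n k))) (X (last (omit n k))) (2 - int n) u) =
   Fm (X (hd (omit n k))) (X (last (omit n k))) (3 - int n) (horn_family.face_bnd A n X aa k)"
  and dv: "Fm (X 0) (X n) (2 - int n) (dif A (X 0) (X n) (1 - int n) v) = Fm (X 0) (X n) (2 - int n)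
   (horn_family.top_bnd A n X aa k \<oplus>[Hom A (X 0) (X n) (2 - int n)] horn_family.Tm A n X aa k (2 - int n) u)"
 obtains z where "z : coherent_nerve_eq B n"
  "\<forall>i\<le>n. i ~= k --> facet n i z = nmap Fo Fm (n - 1) (y i)"
  "snd z (omit n k) = Fm (X (hd (omit n k))) (X (last (omit n k))) (2 - int n) u"
  "snd z (top_seq n) = Fm (X 0) (X n) (1 - int n) v"
proof -
 interpret M: match_data A n k y by (rule M)
 interpret M': match_data B n k "%i. nmap Fo Fm (n - 1) (y i)" by (rule im_match[OF M])
 have H: "horn_family A n X aa k" unfolding X_def aa_def by (rule M.horn_glue)
 interpret H: horn_family A n X aa k by (rule H)
 interpret H': horn_family B n "imX X" "imA X aa" k by (rule im_horn[OF H])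
 let ?u = "Fm (X (hd H.om)) (X (last H.om)) (2 - int n) u" and ?v = "Fm (X 0) (X n) (1 - int n) v"
 define z where "z = H'.fill ?u ?v"
 have z: "z : coherent_nerve B n" unfolding z_def
 proof (rule H'.fill_nerve)
  show "dif B (imX X (hd H.om)) (imX X (last H.om)) (2 - int n) ?u = H'.face_bnd"
   using Fm_dif[OF H.om_Ob u(1), of "3 - int n"] du im_face_bnd[OF H] by simp
  show "dif B (imX X 0) (imX X n) (1 - int n) ?v = H'.top_bnd \<oplus>[Hom B (imX X 0) (imX X n) (2 - int n)] H'.Tm (2 - int n) ?u"
   using Fm_dif[OF H.tp_Ob v(1), of "2 - int n"] dv im_top_bnd[OF H] im_Tm[OF H u(1)]
    amap_add[OF Fm_amap[OF H.tp_Ob] H.top_bnd_closed amap_closed[OF H.Tm_amap u(1)]] by simp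
 qed (use u v H.om_Ob H.tp_Ob Fm_closed in auto)
 have m: "\<forall>i\<le>n. i ~= k --> facet n i z = nmap Fo Fm (n - 1) (y i)"
  unfolding match_im_iff[OF M] z_def using H'.fill_simps(1) H'.fill_simps(2) by (auto simp: X_def aa_def)
 have "z : coherent_nerve_eq B n"
  by (rule B.coherent_nerve_eq_of_faces[OF M.n2 M.kn z]) (use m nmap_eq_mem[OF y] in auto)
 from that[OF this m] show thesis using H'.fill_simps(3,4) unfolding z_def by blast
qed

text \<open>Lifts of the two values form an approximate filler with errors in the kernel. The edges
  of the horn upstairs are true equivalences, so the cone is acyclic on the kernel with
  \<open>J\<close> = 0; the correction lies in the kernel and leaves the image unchanged.\<close>

lemma match_lift:
 assumes M: "match_data A n k y" and y: "!!i. i <= n ==> i ~= k ==> y i : coherent_nerve_eq A (n - 1)"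
  and surj: "!!E F i y. [|E : Ob A; F : Ob A; y : mor B (Fo E) (Fo F) i|] ==>
   \<exists>x\<in>mor A E F i. Fm E F i x = y"
  and x: "x : coherent_nerve B n"
  and m: "\<forall>i\<le>n. i ~= k --> facet n i x = nmap Fo Fm (n - 1) (y i)"
 shows "\<exists>z\<in>coherent_nerve_eq A n. nmap Fo Fm n z = x & (\<forall>i\<le>n. i ~= k --> facet n i z = y i)"
proof -
 interpret M: match_data A n k y by (rule M)
 interpret M': match_data B n k "%i. nmap Fo Fm (n - 1) (y i)" by (rule im_match[OF M])
 define X where "X = hX n k y"
 define aa where "aa = hA A n k y"
 have H: "horn_family A n X aa k" unfolding X_def aa_def by (rule M.horn_glue)
 interpret H: horn_family A n X aa k by (rule H)
 interpret H': horn_family B n "imX X" "imA X aa" k by (rule im_horn[OF H])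
 note e = m[unfolded match_im_iff[OF M], folded X_def aa_def]
 note f = H'.nerve_fill(1,2)[OF x e[THEN conjunct1, rule_format] e[THEN conjunct2, rule_format]]
 obtain u where u: "u : carrier (H.HO (2 - int n))" "Fm (X (hd H.om)) (X (last H.om)) (2 - int n) u = snd x H.om"
  using surj[OF H.om_Ob f(1)] by blast
 obtain v where v: "v : carrier (H.HT (1 - int n))" "Fm (X 0) (X n) (1 - int n) v = snd x H.tp"
  using surj[OF H.tp_Ob f(2)] by blast
 note q = match_lift_eqs[OF M x m, folded X_def aa_def, OF u v]
 interpret O3: abelian_group "H.HO (3 - int n)" by (rule A.hom_group[OF H.om_Ob])
 interpret T2: abelian_group "H.HT (2 - int n)" by (rule A.hom_group[OF H.tp_Ob])
 interpret O3': abelian_group "H'.HO (3 - int n)" by (rule B.hom_group[OF H'.om_Ob])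
 interpret T2': abelian_group "H'.HT (2 - int n)" by (rule B.hom_group[OF H'.tp_Ob])
 interpret O2': abelian_group "H'.HO (2 - int n)" by (rule B.hom_group[OF H'.om_Ob])
 interpret T1': abelian_group "H'.HT (1 - int n)" by (rule B.hom_group[OF H'.tp_Ob])
 have duc: "dif A (X (hd H.om)) (X (last H.om)) (2 - int n) u : carrier (H.HO (3 - int n))"
  by (rule A.dif_closed[OF H.om_Ob u(1)]) simp
 have dvc: "dif A (X 0) (X n) (1 - int n) v : carrier (H.HT (2 - int n))"
  by (rule A.dif_closed[OF H.tp_Ob v(1)]) simp
 have tc: "H.top_bnd \<oplus>[H.HT (2 - int n)] H.Tm (2 - int n) u : carrier (H.HT (2 - int n))"
  by (rule T2.a_closed[OF H.top_bnd_closed amap_closed[OF H.Tm_amap u(1)]])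
 have du: "H.face_bnd \<ominus>[H.HO (3 - int n)] dif A (X (hd H.om)) (X (last H.om)) (2 - int n) u
   : kern (X (hd H.om)) (X (last H.om)) (3 - int n)"
  using O3.minus_closed[OF H.face_bnd_closed duc]
   amap_minus[OF Fm_amap[OF H.om_Ob] H.face_bnd_closed duc] q(1)
   O3'.minus_self[OF Fm_closed[OF H.om_Ob H.face_bnd_closed]] by (intro kernI) simp_all
 have dv: "dif A (X 0) (X n) (1 - int n) v \<ominus>[H.HT (2 - int n)] (H.top_bnd \<oplus>[H.HT (2 - int n)] H.Tm (2 - int n) u)
   : kern (X 0) (X n) (2 - int n)"
  using T2.minus_closed[OF dvc tc] amap_minus[OF Fm_amap[OF H.tp_Ob] dvc tc] q(2)
   T2'.minus_self[OF Fm_closed[OF H.tp_Ob tc]] by (intro kernI) simp_all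
 have c: "cone_solvable A kern H.Tm (X (hd H.om)) (X (last H.om)) (X 0) (X n)"
 proof (rule H.Tm_cone[OF ann_pair_kern_zero])
  fix p q assume h: "[p, q] : horn n k"
  have "X p : Ob A" "X q : Ob A" using H.seq_Ob[OF H.horn_mem[OF h]] by auto
  then show "equiv_mod A (%E F i. {\<zero>[Hom A E F i]}) (X p) (X q) (aa [p, q])"
   unfolding X_def aa_def by (rule A.equivalence_equiv_mod) (rule M.glue_edge[OF y h])
 qed
 obtain u' v' where uv: "u' : kern (X (hd H.om)) (X (last H.om)) (2 - int n)" "v' : kern (X 0) (X n) (1 - int n)"
  "dif A (X (hd H.om)) (X (last H.om)) (2 - int n) (u \<oplus>[H.HO (2 - int n)] u') = H.face_bnd"
  "dif A (X 0) (X n) (1 - int n) (v \<oplus>[H.HT (1 - int n)] v') =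
   H.top_bnd \<oplus>[H.HT (2 - int n)] H.Tm (2 - int n) (u \<oplus>[H.HO (2 - int n)] u')"
  by (rule H.correct_filler[OF ann_pair_kern_zero c u(1) v(1) du dv])
 note us = kernD[OF uv(1)] and vs = kernD[OF uv(2)]
 let ?u = "u \<oplus>[H.HO (2 - int n)] u'" and ?v = "v \<oplus>[H.HT (1 - int n)] v'"
 interpret O2: abelian_group "H.HO (2 - int n)" by (rule A.hom_group[OF H.om_Ob])
 interpret T1: abelian_group "H.HT (1 - int n)" by (rule A.hom_group[OF H.tp_Ob])
 define z where "z = H.fill ?u ?v"
 have zn: "z : coherent_nerve A n" unfolding z_def
  by (rule H.fill_nerve[OF O2.a_closed[OF u(1) us(1)] T1.a_closed[OF v(1) vs(1)] uv(3,4)])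
 have zf: "!!i. i <= n ==> fst z i = hX n k y i" "!!s. s : horn n k ==> snd z s = hA A n k y s"
  using H.fill_simps(1) H.fill_simps(2) by (simp_all add: z_def X_def aa_def)
 note zm = M.fill_match[OF zn zf y]
 have "nmap Fo Fm n z = x"
 proof (rule M'.match_ext[OF nmap_mem[OF zn] _ x m])
  show "\<forall>i\<le>n. i ~= k --> facet n i (nmap Fo Fm n z) = nmap Fo Fm (n - 1) (y i)"
   using zm(2) nmap_pullback[OF dl_ord_map] H.n2 by simp
  have zX: "fst z p = X p" if "p <= n" for p using zf(1)[OF that] by (simp add: X_def)
  have zs: "snd z H.om = ?u" "snd z H.tp = ?v" using H.fill_simps(3,4) by (auto simp: z_def)
  show "snd (nmap Fo Fm n z) H.om = snd x H.om"
   using amap_add[OF Fm_amap[OF H.om_Ob] u(1) us(1)] us(2) u(2) f(1) zX nerve_seqsD(5,6)[OF H.om_mem] H.om_mem zs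
   by (simp add: nmap_def H.om_deg)
  show "snd (nmap Fo Fm n z) H.tp = snd x H.tp"
   using amap_add[OF Fm_amap[OF H.tp_Ob] v(1) vs(1)] vs(2) v(2) f(2) zX H.tp_mem zs
   by (simp add: nmap_def H.tp_deg top_seq_simps)
 qed
 then show ?thesis using zm by blast
qed

end

section \<open>The simplicial scheme of Maurer-Cartan objects\<close>

text \<open>The face omitting vertex 1 - k of an edge is its vertex \<open>k\<close>, and a vertex
  is determined by its object. So a horn for \<open>n\<close> = 1 just prescribes one end of the
  edge.\<close>

lemma (in adg) face_1_iff:
 assumes k: "k <= 1" and x: "x : coherent_nerve A 1" and z: "z : coherent_nerve A 0"
 shows "nerve_pullback 0 (dl (1 - k)) x = z \<longleftrightarrow> fst x k = fst z 0"
proof -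
 have "dl (1 - k) 0 = k" using k by (auto simp: dl_def)
 then have v: "fst (nerve_pullback 0 (dl (1 - k)) x) 0 = fst x k" by (simp add: nerve_pullback_def)
 have "nerve_pullback 0 (dl (1 - k)) x : coherent_nerve A 0"
  using nerve_pullback_mem[OF dl_ord_map[of 1] x] by simp
 from nerve_0_eqI[OF this z] v show ?thesis by auto
qed

text \<open>With inverse and homotopies named, being an equivalence becomes four elements subject to
  four equations in hom groups, the form in which it can be moved to a stage of a directed
  system.\<close>

definition eqv_data :: "('k, 'o, 'm) dgcat => 'o => 'o => 'm => 'm => 'm => 'm => bool" where
 "eqv_data A X Y f g h h' \<longleftrightarrow>
  f : mor A X Y 0 & g : mor A Y X 0 &
  h : mor A X X (-1) & h' : mor A Y Y (-1) &
  dif A X Y 0 f = \<zero>[Hom A X Y 1] & dif A Y X 0 g = \<zero>[Hom A Y X 1] &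
  cmp A X Y X 0 0 g f \<ominus>[Hom A X X 0] idn A X = dif A X X (-1) h &
  cmp A Y X Y 0 0 f g \<ominus>[Hom A Y Y 0] idn A Y = dif A Y Y (-1) h'"

lemma equivalence_iff_data: "equivalence A X Y f \<longleftrightarrow> (\<exists>g h h'. eqv_data A X Y f g h h')"
 unfolding equivalence_def cocycle0_def homologous0_def eqv_data_def by blast

text \<open>Used in both directions: to read off equations that hold in the colimit, and to assemble
  an equivalence at the stage where they have become true.\<close>

lemma (in dgfun) eqv_data_image:
 assumes o: "X : Ob A" "Y : Ob A"
  and c: "f : mor A X Y 0" "g : mor A Y X 0"
   "h : mor A X X (-1)" "h' : mor A Y Y (-1)"
 shows "eqv_data B (Fo X) (Fo Y) (Fm X Y 0 f) (Fm Y X 0 g) (Fm X X (-1) h) (Fm Y Y (-1) h') \<longleftrightarrow>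
  Fm X Y 1 (dif A X Y 0 f) = Fm X Y 1 \<zero>[Hom A X Y 1] &
  Fm Y X 1 (dif A Y X 0 g) = Fm Y X 1 \<zero>[Hom A Y X 1] &
  Fm X X 0 (cmp A X Y X 0 0 g f \<ominus>[Hom A X X 0] idn A X) = Fm X X 0 (dif A X X (-1) h) &
  Fm Y Y 0 (cmp A Y X Y 0 0 f g \<ominus>[Hom A Y Y 0] idn A Y) = Fm Y Y 0 (dif A Y Y (-1) h')"
proof -
 have i: "(1::int) = 0 + 1" "(0::int) = -1 + 1" "(0::int) = 0 + 0" by simp_all
 have cc: "cmp A X Y X 0 0 g f : mor A X X 0" "cmp A Y X Y 0 0 f g : mor A Y Y 0"
  by (rule A.cmp_closed[OF o(1,2,1) c(2,1) i(3)] A.cmp_closed[OF o(2,1,2) c(1,2) i(3)])+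
 show ?thesis
  unfolding eqv_data_def Fm_dif[OF o c(1) i(1)] Fm_dif[OF o(2,1) c(2) i(1)] Fm_dif[OF o(1,1) c(3) i(2)]
   Fm_dif[OF o(2,2) c(4) i(2)] amap_minus[OF Fm_amap[OF o(1,1)] cc(1) A.idn_closed[OF o(1)]]
   amap_minus[OF Fm_amap[OF o(2,2)] cc(2) A.idn_closed[OF o(2)]] Fm_cmp[OF o(1,2,1) c(2,1) i(3)]
   Fm_cmp[OF o(2,1,2) c(1,2) i(3)] Fm_idn[OF o(1)] Fm_idn[OF o(2)] amap_zero[OF Fm_amap[OF o]]
   amap_zero[OF Fm_amap[OF o(2,1)]]
  using Fm_closed[OF o c(1)] Fm_closed[OF o(2,1) c(2)] Fm_closed[OF o(1,1) c(3)] Fm_closed[OF o(2,2) c(4)] by blast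
qed

section \<open>Conditions that hold from some stage on\<close>

context colimit
begin

text \<open>Asking for all stages beyond some point, and not just one, makes the notion stable under
  conjunction, so that finitely many lifts and equations are met at once.\<close>

definition ev :: "'i => ('i => bool) => bool" where
 "ev i Q \<longleftrightarrow> (\<exists>j\<in>I. po i j & (\<forall>l\<in>I. po j l --> Q l))"

lemma ev_conj:
 assumes i: "i : I" and ev: "ev i P" "ev i Q" shows "ev i (%l. P l & Q l)"
proof -
 obtain j where j: "j : I" "po i j" "!!l. l : I ==> po j l ==> P l" using ev(1) by (auto simp: ev_def)
 obtain j' where j': "j' : I" "po i j'" "!!l. l : I ==> po j' l ==> Q l" using ev(2) by (auto simp: ev_def)
 obtain m where m: "m : I" "po j m" "po j' m" using po_bound[OF j(1) j'(1)] by blast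
 have "P l & Q l" if "l : I" "po m l" for l
  using j(3)[OF that(1) po_trans[OF j(1) m(1) that(1) m(2) that(2)]]
   j'(3)[OF that(1) po_trans[OF j'(1) m(1) that(1) m(3) that(2)]] by simp
 then show ?thesis unfolding ev_def using m(1) po_trans[OF i j(1) m(1) j(2) m(2)] by blast
qed

lemma ev_obtain: assumes "ev i P" obtains l where "l : I" "po i l" "P l"
 using assms po_refl unfolding ev_def by blast

lemma ev_eq:
 assumes V: "module K V" and fV: "fin_dim K V" and i: "i : I"
  and X: "X : tens K V (D i)" and Y: "Y : tens K V (D i)"
  and eq: "tensor_base K V (D i) B (g i) X = tensor_base K V (D i) B (g i) Y"
 shows "ev i (%l. tensor_base K V (D i) (D l) (f i l) X = tensor_base K V (D i) (D l) (f i l) Y)"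
proof -
 obtain j where j: "j : I" "po i j"
  "tensor_base K V (D i) (D j) (f i j) X = tensor_base K V (D i) (D j) (f i j) Y"
  using stage_eq[OF assms] by blast
 have "tensor_base K V (D i) (D l) (f i l) X = tensor_base K V (D i) (D l) (f i l) Y" if "l : I" "po j l" for l
  using base_f_f[OF V i j(1) that(1) j(2) that(2) X] base_f_f[OF V i j(1) that(1) j(2) that(2) Y] j(3) by simp
 then show ?thesis unfolding ev_def using j by blast
qed

lemma ev_lift:
 assumes V: "module K V" and i: "i : I" and X: "X : tens K V B"
 shows "ev i (%l. \<exists>Y\<in>tens K V (D l). tensor_base K V (D l) B (g l) Y = X)"
proof -
 obtain j Y where j: "j : I" and Y: "Y : tens K V (D j)" "tensor_base K V (D j) B (g j) Y = X"
  using stage_lift[OF V X] by blast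
 obtain m where m: "m : I" "po i m" "po j m" using po_bound[OF i j] by blast
 have "\<exists>Y\<in>tens K V (D l). tensor_base K V (D l) B (g l) Y = X" if l: "l : I" "po m l" for l
 proof
  have jl: "po j l" by (rule po_trans[OF j m(1) l(1) m(3) l(2)])
  show "tensor_base K V (D j) (D l) (f j l) Y : tens K V (D l)"
   by (rule amap_closed[OF tensor_base_amap[OF V D[OF j] D[OF l(1)] f[OF j l(1) jl]] Y(1)])
  show "tensor_base K V (D l) B (g l) (tensor_base K V (D j) (D l) (f j l) Y) = X"
   using base_g_f[OF V j l(1) jl Y(1)] Y(2) by simp
 qed
 then show ?thesis unfolding ev_def using m by blast
qed

end

locale MC_data =
 fixes K :: "'k ring" and P :: "('k, 'o, 'm) dgcat"
 assumes K: "field K" and P: "dg_category K P"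
  and fd: "!!E F i. E : Ob P ==> F : Ob P ==> fin_dim K (Hom P E F i)"
begin

abbreviation "RB B \<equiv> MC (dg_tensor K P B)"
abbreviation "fo B C \<phi> \<equiv> %X. (fst X, hbase K P (fst X) (fst X) 1 B C \<phi> (snd X))"
abbreviation "fm B C \<phi> \<equiv> %X Y i. hbase K P (fst X) (fst Y) i B C \<phi>"

text \<open>Base change of simplices is the image under a functor of dg-categories, so all that is
  known about \<open>nmap\<close> applies to it.\<close>

lemma base_change_nmap: "base_change K P n B C \<phi> = nmap (fo B C \<phi>) (fm B C \<phi>) n"
 by (rule ext) (simp add: base_change_def nmap_def)

lemma Hom_module: "E : Ob P ==> F : Ob P ==> module K (Hom P E F i)"
 by (rule dg_category.hom_module[OF P])

lemma R_adg: "algebra K B ==> adg (RB B)"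
 by (rule adg.MC_adg[OF dg_tensor_adg[OF P]])

lemma R_fun:
 assumes "algebra K B" "algebra K C" "\<phi> : alg_hom K B C"
 shows "adgfun (RB B) (RB C) (fo B C \<phi>) (fm B C \<phi>)"
 by (intro adgfun.intro MC_dgfun[OF dg_tensor_adg[OF P assms(1)] dg_tensor_adg[OF P assms(2)] dg_tensor_dgfun[OF P assms]]
   R_adg assms(1,2))

lemma R_Hom: "Hom (RB B) X Y i = tensor K (Hom P (fst X) (fst Y) i) B"
 by (simp add: MC_simps dg_tensor_def)

lemma R_ObD:
 assumes "X : Ob (RB B)"
 shows "fst X : Ob P" "snd X : tens K (Hom P (fst X) (fst X) 1) B"
 using assms by (auto simp: MC_def dg_tensor_def)

lemma fo_comp:
 assumes a: "algebra K B" "algebra K C" "algebra K D" and h: "\<phi> : alg_hom K B C" "\<psi> : alg_hom K C D" "\<chi> : alg_hom K B D"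
  and c: "!!b. b : carrier B ==> \<psi> (\<phi> b) = \<chi> b" and X: "X : Ob (RB B)"
 shows "fo C D \<psi> (fo B C \<phi> X) = fo B D \<chi> X"
 using tensor_base_comp[OF Hom_module[OF R_ObD(1)[OF X] R_ObD(1)[OF X]] a h c R_ObD(2)[OF X]] by simp

lemma base_change_comp:
 assumes a: "algebra K B" "algebra K C" "algebra K D" and h: "\<phi> : alg_hom K B C" "\<psi> : alg_hom K C D" "\<chi> : alg_hom K B D"
  and c: "!!b. b : carrier B ==> \<psi> (\<phi> b) = \<chi> b" and x: "x : coherent_nerve (RB B) n"
 shows "base_change K P n C D \<psi> (base_change K P n B C \<phi> x) = base_change K P n B D \<chi> x"
proof -
 interpret A: adg "RB B" by (rule R_adg[OF a(1)])
 have o: "fst x i : Ob (RB B)" if "i <= n" for i by (rule A.nerve_Ob[OF x that])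
 have "(\<lambda>i\<in>{..n}. fo C D \<psi> ((\<lambda>i\<in>{..n}. fo B C \<phi> (fst x i)) i)) = (\<lambda>i\<in>{..n}. fo B D \<chi> (fst x i))"
  using fo_comp[OF a h c o] by (intro restrict_ext) simp
 moreover have "hbase K P (fst (fst x (hd s))) (fst (fst x (last s))) (seq_deg s) C D \<psi>
   (hbase K P (fst (fst x (hd s))) (fst (fst x (last s))) (seq_deg s) B C \<phi> (snd x s)) =
   hbase K P (fst (fst x (hd s))) (fst (fst x (last s))) (seq_deg s) B D \<chi> (snd x s)"
  if s: "s : nerve_seqs n" for s
  using tensor_base_comp[OF Hom_module[OF R_ObD(1)[OF o] R_ObD(1)[OF o]] a h c] A.nerve_mor[OF x s] nerve_seqsD(5,6)[OF s]
  by (simp add: R_Hom)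
 ultimately show ?thesis
  unfolding base_change_nmap nmap_def prod_eq_iff fst_conv snd_conv
  by (auto intro!: restrict_ext simp: nerve_seqsD(5,6))
qed

lemma base_change_id:
 assumes B: "algebra K B" and h: "\<phi> : alg_hom K B B" and c: "!!b. b : carrier B ==> \<phi> b = b"
  and x: "x : coherent_nerve (RB B) n"
 shows "base_change K P n B B \<phi> x = x"
proof -
 interpret A: adg "RB B" by (rule R_adg[OF B])
 have o: "fst x i : Ob (RB B)" if "i <= n" for i by (rule A.nerve_Ob[OF x that])
 have "(\<lambda>i\<in>{..n}. fo B B \<phi> (fst x i)) = fst x"
 proof (rule extensionalityI[OF _ coherent_nerve_ext(1)[OF x]])
  fix i assume "i : {..n}"
  then show "(\<lambda>i\<in>{..n}. fo B B \<phi> (fst x i)) i = fst x i"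
   using tensor_base_id[OF Hom_module[OF R_ObD(1)[OF o] R_ObD(1)[OF o]] B h c R_ObD(2)[OF o]] by simp
 qed simp
 moreover have "(\<lambda>s\<in>nerve_seqs n. fm B B \<phi> (fst x (hd s)) (fst x (last s)) (seq_deg s) (snd x s)) = snd x"
 proof (rule extensionalityI[OF _ coherent_nerve_ext(2)[OF x]])
  fix s assume s: "s : nerve_seqs n"
  then show "(\<lambda>s\<in>nerve_seqs n. fm B B \<phi> (fst x (hd s)) (fst x (last s)) (seq_deg s) (snd x s)) s = snd x s"
   using tensor_base_id[OF Hom_module[OF R_ObD(1)[OF o] R_ObD(1)[OF o]] B h c] A.nerve_mor[OF x s] nerve_seqsD(5,6)[OF s]
   by (simp add: R_Hom)
 qed simp
 ultimately show ?thesis unfolding base_change_nmap nmap_def by simp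
qed

abbreviation "MS \<equiv> MC_scheme K P"

lemma MS_simps: "points (level MS n) B = coherent_nerve_eq (RB B) n" "pmap (level MS n) = base_change K P n"
  "act MS n p \<theta> B = nerve_pullback p \<theta>" "face MS n i B = facet n i"
 by (simp_all add: MC_scheme_def R_dgcat_def face_def dl_def)

lemma eq_sub: "x : coherent_nerve_eq A n ==> x : coherent_nerve A n"
 by (simp add: coherent_nerve_eq_iff)

lemma id_hom: "algebra K B ==> (%b. b) : alg_hom K B B"
 by (simp add: alg_hom_def ring_hom_def)

lemma comp_hom: "\<phi> : alg_hom K B C ==> \<psi> : alg_hom K C D ==> (%b. \<psi> (\<phi> b)) : alg_hom K B D"
 by (auto simp: alg_hom_def ring_hom_def Pi_iff)

lemma MS_simplicial: "simplicial_kfunctor K MS"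
 unfolding simplicial_kfunctor_def kfunctor_def MS_simps
proof (intro conjI allI impI; (elim conjE)?)
 fix n and B C :: "('k, 'b) module" and \<phi>
 assume "algebra K B" "algebra K C" "\<phi> : alg_hom K B C"
 then show "base_change K P n B C \<phi> : coherent_nerve_eq (RB B) n \<rightarrow> coherent_nerve_eq (RB C) n"
  unfolding base_change_nmap using adgfun.nmap_eq_mem[OF R_fun] by blast
next
 fix n and B :: "('k, 'b) module" and x
 assume B: "algebra K B" and x: "x : coherent_nerve_eq (RB B) n"
 show "base_change K P n B B (%b. b) x = x" by (rule base_change_id[OF B id_hom[OF B] refl eq_sub[OF x]])
next
 fix n and B C D :: "('k, 'b) module" and \<phi> \<psi> x
 assume a: "algebra K B" "algebra K C" "algebra K D" and h: "\<phi> : alg_hom K B C" "\<psi> : alg_hom K C D"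
  and x: "x : coherent_nerve_eq (RB B) n"
 show "base_change K P n B D (%b. \<psi> (\<phi> b)) x = base_change K P n C D \<psi> (base_change K P n B C \<phi> x)"
  by (rule base_change_comp[OF a h comp_hom[OF h] refl eq_sub[OF x], symmetric])
next
 fix n p \<theta> and B :: "('k, 'b) module"
 assume "\<theta> : ord_map p n" "algebra K B"
 then show "nerve_pullback p \<theta> : coherent_nerve_eq (RB B) n \<rightarrow> coherent_nerve_eq (RB B) p"
  using adg.nerve_pullback_eq_mem[OF R_adg] by blast
next
 fix n p \<theta> and B C :: "('k, 'b) module" and \<phi> x
 assume "\<theta> : ord_map p n" "algebra K B" "algebra K C" "\<phi> : alg_hom K B C"
 then show "nerve_pullback p \<theta> (base_change K P n B C \<phi> x) = base_change K P p B C \<phi> (nerve_pullback p \<theta> x)"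
  unfolding base_change_nmap by (intro adgfun.nmap_pullback[OF R_fun])
next
 fix n \<theta> and B :: "('k, 'b) module" and x
 assume t: "\<forall>i\<le>n. \<theta> i = i" and x: "x : coherent_nerve_eq (RB B) n"
 show "nerve_pullback n \<theta> x = x" by (rule nerve_pullback_id[OF eq_sub[OF x] t])
next
 fix n p q \<theta> \<rho> and B :: "('k, 'b) module" and x :: "('o \<times> ('m => 'b) set, ('m => 'b) set) simplex"
 assume "\<rho> : ord_map q p"
 then show "nerve_pullback q (\<theta> \<circ> \<rho>) x = nerve_pullback q \<rho> (nerve_pullback p \<theta> x)" by (rule nerve_pullback_comp)
qed

subsection \<open>Matching objects\<close>

lemma match_pointsD:
 assumes "y : points (Match MS n k) B"
 shows "i <= n ==> i ~= k ==> y i : coherent_nerve_eq (RB B) (n - 1)" "y : extensional ({..n} - {k})"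
  "[|i <= n; j <= n; i ~= k; j ~= k; i < j|] ==>
   nerve_pullback (n - 1 - 1) (dl i) (y j) = nerve_pullback (n - 1 - 1) (dl (j - 1)) (y i)"
 using assms by (auto simp: Match_def MS_simps PiE_iff)

lemma match_points_data:
 assumes B: "algebra K B" and n: "2 <= n" "k <= n" and y: "y : points (Match MS n k) B"
 shows "match_data (RB B) n k y"
 by (intro match_data.intro match_data_axioms.intro R_adg B n eq_sub match_pointsD(1)[OF y] match_pointsD(3)[OF y])

lemma match_map_iff:
 assumes "y : extensional ({..n} - {k})"
 shows "match_map MS n k B x = y \<longleftrightarrow> (\<forall>i\<le>n. i ~= k --> facet n i x = y i)"
 using assms unfolding match_map_def MS_simps by (auto simp: fun_eq_iff extensional_def)

lemma match_map_pmap_iff: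
 "match_map MS n k C x = pmap (Match MS n k) B C \<phi> y \<longleftrightarrow>
  (\<forall>i\<le>n. i ~= k --> facet n i x = nmap (fo B C \<phi>) (fm B C \<phi>) (n - 1) (y i))"
proof -
 have "pmap (Match MS n k) B C \<phi> y : extensional ({..n} - {k})" by (simp add: Match_def)
 from match_map_iff[OF this] show ?thesis by (auto simp: Match_def MS_simps base_change_nmap)
qed

lemma match_1_iff:
 assumes B: "algebra K B" and k: "k <= 1" and x: "x : coherent_nerve (RB B) 1"
  and y: "y (1 - k) : coherent_nerve (RB B) 0"
 shows "(\<forall>i\<le>1. i ~= k --> nerve_pullback (1 - 1) (dl i) x = y i) \<longleftrightarrow> fst x k = fst (y (1 - k)) 0"
proof -
 have "i <= 1 & i ~= k \<longleftrightarrow> i = 1 - k" for i using k by arith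
 then have e: "(\<forall>i\<le>1. i ~= k --> Q i) \<longleftrightarrow> Q (1 - k)" for Q by metis
 show ?thesis unfolding e diff_self_eq_0 by (rule adg.face_1_iff[OF R_adg[OF B] k x y])
qed

subsection \<open>Surjectivity and infinitesimal lifting\<close>

lemma match_surj:
 assumes B: "algebra K B" and n: "1 <= n" "k <= n" and y: "y : points (Match MS n k) B"
 shows "\<exists>x\<in>coherent_nerve_eq (RB B) n. match_map MS n k B x = y"
proof (cases "n = 1")
 case False
 then have n2: "2 <= n" using n by simp
 show ?thesis unfolding match_map_iff[OF match_pointsD(2)[OF y]]
  by (rule match_data.ex_filler[OF match_points_data[OF B n2 n(2) y] match_pointsD(1)[OF y]])
next
 case True
 interpret A: adg "RB B" by (rule R_adg[OF B])
 have k1: "k <= 1" using n True by simp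
 then have k: "1 - k <= n" "1 - k ~= k" using True by arith+
 note w = match_pointsD(1)[OF y k, unfolded True]
 have w: "y (1 - k) : coherent_nerve_eq (RB B) 0" using w by simp
 \<comment> \<open>For \<open>n\<close> = 1 the horn is a single vertex, filled by its degenerate
   edge.\<close>
 have t: "(%_. 0) : ord_map 1 0" by (auto simp: ord_map_def mono_on_def)
 define x where "x = nerve_pullback 1 (%_. 0) (y (1 - k))"
 have x: "x : coherent_nerve_eq (RB B) 1" unfolding x_def by (rule A.nerve_pullback_eq_mem[OF t w])
 have "fst x k = fst (y (1 - k)) 0" using k1 by (simp add: x_def nerve_pullback_def)
 then have m: "\<forall>i\<le>1. i ~= k --> nerve_pullback (1 - 1) (dl i) x = y i"
  unfolding match_1_iff[where y = y, OF B k1 eq_sub[OF x] eq_sub[OF w]] .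
 have "match_map MS n k B x = y"
  by (rule match_map_iff[OF match_pointsD(2)[OF y], THEN iffD2]) (simp only: True, rule m)
 then show ?thesis using x True by blast
qed

text \<open>The vertex \<open>k\<close> is the one given over \<open>B\<close>. For \<open>k\<close>
  = 0 the target of the edge has to be lifted, for \<open>k\<close> = 1 its source.\<close>

lemma smooth_1:
 assumes B: "algebra K B" and C: "algebra K C" and \<phi>: "\<phi> : alg_hom K B C" and surj: "\<phi> ` carrier B = carrier C"
  and sq: "\<forall>a\<in>a_kernel B C \<phi>. \<forall>b\<in>a_kernel B C \<phi>. a \<otimes>[B] b = \<zero>[B]"
  and k: "k <= 1" and x: "x : coherent_nerve_eq (RB C) 1" and U: "U : Ob (RB B)" "fst x k = fo B C \<phi> U"
 shows "\<exists>z\<in>coherent_nerve_eq (RB B) 1. base_change K P 1 B C \<phi> z = x & fst z k = U"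
proof -
 interpret P: dg_category K P by (rule P)
 interpret S: square_zero "dg_tensor K P B" "dg_tensor K P C" "%E. E" "%E F i. hbase K P E F i B C \<phi>"
 proof (intro square_zero.intro square_zero_axioms.intro dg_tensor_dgfun[OF P B C \<phi>] dg_tensor_adg[OF P] B C)
  fix E F i y assume "E : Ob (dg_tensor K P B)" "F : Ob (dg_tensor K P B)" "y : mor (dg_tensor K P C) E F i"
  then show "\<exists>x\<in>mor (dg_tensor K P B) E F i. hbase K P E F i B C \<phi> x = y"
   using tensor_base_surj[OF Hom_module B C \<phi> surj] by (simp add: dg_tensor_def)
 next
  interpret D: dgfun "dg_tensor K P B" "dg_tensor K P C" "%E. E" "%E F i. hbase K P E F i B C \<phi>"
   by (rule dg_tensor_dgfun[OF P B C \<phi>])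
  fix E F G g f and i j k :: int
  assume "E : Ob (dg_tensor K P B)" "F : Ob (dg_tensor K P B)" "G : Ob (dg_tensor K P B)"
   and g: "g : D.kern F G i" and f: "f : D.kern E F j" and ij: "k = i + j"
  then have o: "E : Ob P" "F : Ob P" "G : Ob P" by (simp_all add: dg_tensor_def)
  have s: "a \<otimes>[B] b = \<zero>[B]" if "a : carrier B" "b : carrier B" "\<phi> a = \<zero>[C]" "\<phi> b = \<zero>[C]" for a b
   using sq that by (simp add: a_kernel_def kernel_def)
  have gk: "g : tens K (Hom P F G i) B" "hbase K P F G i B C \<phi> g = \<zero>[tensor K (Hom P F G i) C]"
   and fk: "f : tens K (Hom P E F j) B" "hbase K P E F j B C \<phi> f = \<zero>[tensor K (Hom P E F j) C]"
   using D.kernD[OF g] D.kernD[OF f] unfolding dg_tensor_simps[OF P B] dg_tensor_simps[OF P C] by auto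
  show "cmp (dg_tensor K P B) E F G i j g f = \<zero>[Hom (dg_tensor K P B) E G k]"
   unfolding dg_tensor_simps(3)[OF P B ij] dg_tensor_simps(2)[OF P B]
   by (rule tensor_kernel_mult[OF K Hom_module[OF o(2,3)] Hom_module[OF o(1,2)] Hom_module[OF o(1,3)]
     fd[OF o(2,3)] fd[OF o(1,2)] B C \<phi> P.cmp_bilin[OF o ij] s gk fk])
 qed
 interpret A: adg "RB B" by (rule R_adg[OF B])
 interpret C: adg "RB C" by (rule R_adg[OF C])
 interpret F: adgfun "RB B" "RB C" "fo B C \<phi>" "fm B C \<phi>" by (rule R_fun[OF B C \<phi>])
 note xo = C.nerve_Ob[OF eq_sub[OF x]]
 have e: "equivalence (RB C) (fst x 0) (fst x 1) (snd x [0, 1])" using x by (simp add: coherent_nerve_eq_iff)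
 define W where "W = fst x (1 - k)"
 have W: "W : Ob (RB C)" unfolding W_def using xo by simp
 have WP: "fst W : Ob (dg_tensor K P B)" using R_ObD(1)[OF W] by (simp add: dg_tensor_def)
 have "\<exists>Y f. Y : Ob (RB B) & fo B C \<phi> Y = W &
   equivalence (RB B) (if k = 0 then U else Y) (if k = 0 then Y else U) f &
   hbase K P (fst (if k = 0 then U else Y)) (fst (if k = 0 then Y else U)) 0 B C \<phi> f = snd x [0, 1]"
 proof (cases "k = 0")
  case True
  have "\<exists>\<zeta> f. (fst W, \<zeta>) : Ob (RB B) & hbase K P (fst W) (fst W) 1 B C \<phi> \<zeta> = snd W &
   f : mor (dg_tensor K P B) (fst U) (fst W) 0 &
   hbase K P (fst U) (fst W) 0 B C \<phi> f = snd x [0, 1] & equivalence (RB B) U (fst W, \<zeta>) f"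
   by (rule S.lift_target[OF U(1) WP]) (use W e U(2) True in \<open>auto simp: W_def\<close>)
  then obtain \<zeta> f where "(fst W, \<zeta>) : Ob (RB B)" "hbase K P (fst W) (fst W) 1 B C \<phi> \<zeta> = snd W"
   "hbase K P (fst U) (fst W) 0 B C \<phi> f = snd x [0, 1]" "equivalence (RB B) U (fst W, \<zeta>) f" by blast
  then show ?thesis using True by (intro exI[of _ "(fst W, \<zeta>)"] exI[of _ f]) simp
 next
  case False
  then have k1: "k = 1" using k by simp
  have "\<exists>\<zeta> f. (fst W, \<zeta>) : Ob (RB B) & hbase K P (fst W) (fst W) 1 B C \<phi> \<zeta> = snd W &
   f : mor (dg_tensor K P B) (fst W) (fst U) 0 &
   hbase K P (fst W) (fst U) 0 B C \<phi> f = snd x [0, 1] & equivalence (RB B) (fst W, \<zeta>) U f"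
   by (rule S.lift_source[OF U(1) WP]) (use W e U(2) k1 in \<open>auto simp: W_def\<close>)
  then obtain \<zeta> f where "(fst W, \<zeta>) : Ob (RB B)" "hbase K P (fst W) (fst W) 1 B C \<phi> \<zeta> = snd W"
   "hbase K P (fst W) (fst U) 0 B C \<phi> f = snd x [0, 1]" "equivalence (RB B) (fst W, \<zeta>) U f" by blast
  then show ?thesis using k1 by (intro exI[of _ "(fst W, \<zeta>)"] exI[of _ f]) simp
 qed
 then obtain Y f where Y: "Y : Ob (RB B)" "fo B C \<phi> Y = W"
  and f: "equivalence (RB B) (if k = 0 then U else Y) (if k = 0 then Y else U) f"
   "hbase K P (fst (if k = 0 then U else Y)) (fst (if k = 0 then Y else U)) 0 B C \<phi> f = snd x [0, 1]" by blast
 define Z where "Z = (%i. if i = k then U else Y)"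
 have Z01: "Z 0 = (if k = 0 then U else Y)" "Z 1 = (if k = 0 then Y else U)" using k by (auto simp: Z_def)
 have Zo: "Z i : Ob (RB B)" for i using U Y by (simp add: Z_def)
 have Zx: "fo B C \<phi> (Z i) = fst x i" if "i <= 1" for i
 proof (cases "i = k")
  case False
  then have "i = 1 - k" using that k by auto
  then show ?thesis using Y(2) False by (simp add: Z_def W_def)
 qed (simp add: Z_def U(2))
 have eZ: "equivalence (RB B) (Z 0) (Z 1) f" using f(1) unfolding Z01 .
 obtain z where z: "z : coherent_nerve_eq (RB B) 1" "!!i. i <= 1 ==> fst z i = Z i" "snd z [0, 1] = f"
  by (rule A.ex_edge_simplex[OF eZ Zo]) blast
 have "nmap (fo B C \<phi>) (fm B C \<phi>) 1 z = x"
 proof (rule C.nerve_1_eqI[OF F.nmap_mem[OF eq_sub[OF z(1)]] eq_sub[OF x]])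
  show "fst (nmap (fo B C \<phi>) (fm B C \<phi>) 1 z) i = fst x i" if "i <= 1" for i
   using that z(2)[OF that] Zx[OF that] by (simp add: nmap_def)
  show "snd (nmap (fo B C \<phi>) (fm B C \<phi>) 1 z) [0, 1] = snd x [0, 1]"
   using f(2) z(2)[of 0] z(2)[of 1] z(3) edge_seq[of 0 1 1] unfolding Z01[symmetric] by (simp add: nmap_def seq_deg_def)
 qed
 moreover have "fst z k = U" using z(2)[OF k] by (simp add: Z_def)
 ultimately show ?thesis using z(1) unfolding base_change_nmap by blast
qed

lemma match_formally_smooth:
 assumes n: "1 <= n" "k <= n"
 shows "formally_smooth K (level MS n) (Match MS n k) (match_map MS n k)"
 unfolding formally_smooth_def MS_simps
proof (intro allI impI; elim conjE)
 fix B C :: "('k, 'b) module" and \<phi> x y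
 assume B: "algebra K B" and C: "algebra K C" and \<phi>: "\<phi> : alg_hom K B C" and surj: "\<phi> ` carrier B = carrier C"
  and sq: "\<forall>a\<in>a_kernel B C \<phi>. \<forall>b\<in>a_kernel B C \<phi>. a \<otimes>[B] b = \<zero>[B]"
  and x: "x : coherent_nerve_eq (RB C) n" and y: "y : points (Match MS n k) B"
  and m: "match_map MS n k C x = pmap (Match MS n k) B C \<phi> y"
 note m = m[unfolded match_map_pmap_iff]
 interpret F: adgfun "RB B" "RB C" "fo B C \<phi>" "fm B C \<phi>" by (rule R_fun[OF B C \<phi>])
 show "\<exists>z\<in>coherent_nerve_eq (RB B) n. base_change K P n B C \<phi> z = x & match_map MS n k B z = y"
  unfolding match_map_iff[OF match_pointsD(2)[OF y]]
 proof (cases "n = 1")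
  case False
  then have n2: "2 <= n" using n by simp
  show "\<exists>z\<in>coherent_nerve_eq (RB B) n. base_change K P n B C \<phi> z = x &
    (\<forall>i\<le>n. i ~= k --> facet n i z = y i)"
   unfolding base_change_nmap
  proof (rule F.match_lift[OF match_points_data[OF B n2 n(2) y] match_pointsD(1)[OF y] _ eq_sub[OF x] m])
   fix X Y i f assume "X : Ob (RB B)" "Y : Ob (RB B)" "f : mor (RB C) (fo B C \<phi> X) (fo B C \<phi> Y) i"
   then show "\<exists>g\<in>mor (RB B) X Y i. hbase K P (fst X) (fst Y) i B C \<phi> g = f"
    using tensor_base_surj[OF Hom_module[OF R_ObD(1) R_ObD(1)] B C \<phi> surj] by (simp add: R_Hom)
  qed
 next
  case True
  have k1: "k <= 1" using n True by simp
  then have k: "1 - k <= n" "1 - k ~= k" using True by arith+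
  have w: "y (1 - k) : coherent_nerve_eq (RB B) 0" using match_pointsD(1)[OF y k] True by simp
  have x1: "x : coherent_nerve_eq (RB C) 1" using x True by simp
  have "fst x k = fst (nmap (fo B C \<phi>) (fm B C \<phi>) 0 (y (1 - k))) 0"
   using m match_1_iff[where y = "%i. nmap (fo B C \<phi>) (fm B C \<phi>) 0 (y i)", OF C k1 eq_sub[OF x1] F.nmap_mem[OF eq_sub[OF w]]]
   unfolding True by simp
  then have U: "fst x k = fo B C \<phi> (fst (y (1 - k)) 0)" by (simp add: nmap_def)
  have Uo: "fst (y (1 - k)) 0 : Ob (RB B)" using F.A.nerve_Ob[OF eq_sub[OF w]] by simp
  obtain z where z: "z : coherent_nerve_eq (RB B) 1" "base_change K P 1 B C \<phi> z = x" "fst z k = fst (y (1 - k)) 0"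
   using smooth_1[OF B C \<phi> surj sq k1 x1 Uo U] by blast
  show "\<exists>z\<in>coherent_nerve_eq (RB B) n. base_change K P n B C \<phi> z = x &
    (\<forall>i\<le>n. i ~= k --> facet n i z = y i)"
   unfolding True match_1_iff[where y = y, OF B k1 eq_sub[OF z(1)] eq_sub[OF w]]
   by (intro bexI[OF _ z(1)] conjI z(2) z(3)[folded match_1_iff[where y = y, OF B k1 eq_sub[OF z(1)] eq_sub[OF w]]])
 qed
qed

end

subsection \<open>Finite presentation\<close>

locale MC_colimit = MC_data K P + c: colimit K I po D f B g
 for K :: "'k ring" and P :: "('k, 'o, 'm) dgcat" and I :: "'i set" and po
  and D :: "'i => ('k, 'b) module" and f B g
begin

abbreviation "go i \<equiv> fo (D i) B (g i)"
abbreviation "gm i \<equiv> fm (D i) B (g i)"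
abbreviation "so i j \<equiv> fo (D i) (D j) (f i j)"
abbreviation "sm i j \<equiv> fm (D i) (D j) (f i j)"

lemma g_fun: "i : I ==> adgfun (RB (D i)) (RB B) (go i) (gm i)"
 by (rule R_fun[OF c.D c.B c.g])

lemma f_fun: "i : I ==> j : I ==> po i j ==> adgfun (RB (D i)) (RB (D j)) (so i j) (sm i j)"
 by (rule R_fun[OF c.D c.D c.f])

lemma go_so:
 assumes i: "i : I" "j : I" "po i j" and X: "X : Ob (RB (D i))" shows "go j (so i j X) = go i X"
 by (rule fo_comp[OF c.D[OF i(1)] c.D[OF i(2)] c.B c.f[OF i] c.g[OF i(2)] c.g[OF i(1)] c.gf[OF i] X])

lemma nmap_g_f:
 assumes i: "i : I" "j : I" "po i j" and x: "x : coherent_nerve (RB (D i)) n"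
 shows "nmap (go j) (gm j) n (nmap (so i j) (sm i j) n x) = nmap (go i) (gm i) n x"
 unfolding base_change_nmap[symmetric]
 by (rule base_change_comp[OF c.D[OF i(1)] c.D[OF i(2)] c.B c.f[OF i] c.g[OF i(2)] c.g[OF i(1)] c.gf[OF i] x])

lemma nmap_f_f:
 assumes i: "i : I" "j : I" "l : I" "po i j" "po j l" and x: "x : coherent_nerve (RB (D i)) n"
 shows "nmap (so j l) (sm j l) n (nmap (so i j) (sm i j) n x) = nmap (so i l) (sm i l) n x"
proof -
 have il: "po i l" by (rule c.po_trans[OF i])
 show ?thesis unfolding base_change_nmap[symmetric]
  by (rule base_change_comp[OF c.D[OF i(1)] c.D[OF i(2)] c.D[OF i(3)] c.f[OF i(1,2,4)] c.f[OF i(2,3,5)] c.f[OF i(1,3) il]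
     c.ff[OF i] x])
qed

lemma Hom_data: "X : Ob (RB C) ==> Y : Ob (RB C) ==> module K (Hom P (fst X) (fst Y) d)"
  "X : Ob (RB C) ==> Y : Ob (RB C) ==> fin_dim K (Hom P (fst X) (fst Y) d)"
 using Hom_module fd R_ObD(1) by blast+

lemma ev_eq_R:
 assumes i: "i : I" and o: "X : Ob (RB (D i))" "Y : Ob (RB (D i))"
  and a: "a : mor (RB (D i)) X Y d" "b : mor (RB (D i)) X Y d"
  and e: "gm i X Y d a = gm i X Y d b"
 shows "c.ev i (%l. sm i l X Y d a = sm i l X Y d b)"
 by (rule c.ev_eq[OF Hom_data[OF o] i a[unfolded R_Hom] e])

text \<open>The equations of the lifted pair hold over the colimit, hence at some later stage, where
  the images of the pair form the filler.\<close>

lemma filler_at_stage: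
 fixes i n k y
 defines "X \<equiv> hX n k y"
 assumes i: "i : I" and M: "match_data (RB (D i)) n k y"
  and y: "!!p. p <= n ==> p ~= k ==> y p : coherent_nerve_eq (RB (D i)) (n - 1)"
  and x: "x : coherent_nerve (RB B) n"
  and m: "\<forall>p\<le>n. p ~= k --> facet n p x = nmap (go i) (gm i) (n - 1) (y p)"
  and u: "u : mor (RB (D i)) (X (hd (omit n k))) (X (last (omit n k))) (2 - int n)"
   "gm i (X (hd (omit n k))) (X (last (omit n k))) (2 - int n) u = snd x (omit n k)"
  and v: "v : mor (RB (D i)) (X 0) (X n) (1 - int n)" "gm i (X 0) (X n) (1 - int n) v = snd x (top_seq n)"
 shows "\<exists>l\<in>I. po i l & (\<exists>z\<in>coherent_nerve_eq (RB (D l)) n. nmap (go l) (gm l) n z = x &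
  (\<forall>p\<le>n. p ~= k --> facet n p z = nmap (so i l) (sm i l) (n - 1) (y p)))"
proof -
 interpret M: match_data "RB (D i)" n k y by (rule M)
 interpret G: adgfun "RB (D i)" "RB B" "go i" "gm i" by (rule g_fun[OF i])
 define aa where "aa = hA (RB (D i)) n k y"
 have H: "horn_family (RB (D i)) n X aa k" unfolding X_def aa_def by (rule M.horn_glue)
 interpret H: horn_family "RB (D i)" n X aa k by (rule H)
 interpret MB: match_data "RB B" n k "%p. nmap (go i) (gm i) (n - 1) (y p)" by (rule G.im_match[OF M])
 note eqs = G.match_lift_eqs[OF M x m, folded X_def aa_def, OF u v]
 interpret T2: abelian_group "H.HT (2 - int n)" by (rule M.hom_group[OF H.tp_Ob])
 have duc: "dif (RB (D i)) (X (hd H.om)) (X (last H.om)) (2 - int n) u : carrier (H.HO (3 - int n))"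
  by (rule M.dif_closed[OF H.om_Ob u(1)]) simp
 have dvc: "dif (RB (D i)) (X 0) (X n) (1 - int n) v : carrier (H.HT (2 - int n))"
  by (rule M.dif_closed[OF H.tp_Ob v(1)]) simp
 have tc: "H.top_bnd \<oplus>[H.HT (2 - int n)] H.Tm (2 - int n) u : carrier (H.HT (2 - int n))"
  by (rule T2.a_closed[OF H.top_bnd_closed amap_closed[OF H.Tm_amap u(1)]])
 let ?eu = "%l. sm i l (X (hd H.om)) (X (last H.om)) (3 - int n) (dif (RB (D i)) (X (hd H.om)) (X (last H.om)) (2 - int n) u) =
    sm i l (X (hd H.om)) (X (last H.om)) (3 - int n) H.face_bnd"
  and ?ev = "%l. sm i l (X 0) (X n) (2 - int n) (dif (RB (D i)) (X 0) (X n) (1 - int n) v) =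
    sm i l (X 0) (X n) (2 - int n) (H.top_bnd \<oplus>[H.HT (2 - int n)] H.Tm (2 - int n) u)"
 have eu: "c.ev i ?eu"
  by (rule ev_eq_R[OF i H.om_Ob duc H.face_bnd_closed eqs(1)])
 have ev: "c.ev i ?ev"
  by (rule ev_eq_R[OF i H.tp_Ob dvc tc eqs(2)])
 obtain l where l: "l : I" "po i l" and e: "?eu l & ?ev l"
  by (rule c.ev_obtain[OF c.ev_conj[OF i eu ev]])
 interpret F: adgfun "RB (D i)" "RB (D l)" "so i l" "sm i l" by (rule f_fun[OF i l])
 interpret L: adgfun "RB (D l)" "RB B" "go l" "gm l" by (rule g_fun[OF l(1)])
 obtain z where z: "z : coherent_nerve_eq (RB (D l)) n"
  "\<forall>p\<le>n. p ~= k --> facet n p z = nmap (so i l) (sm i l) (n - 1) (y p)"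
  "snd z H.om = sm i l (X (hd H.om)) (X (last H.om)) (2 - int n) u" "snd z H.tp = sm i l (X 0) (X n) (1 - int n) v"
  by (rule F.match_fill_image[OF M y, folded X_def aa_def, OF _ _ u(1) v(1) e[THEN conjunct1] e[THEN conjunct2]])
 have zn: "z : coherent_nerve (RB (D l)) n" by (rule eq_sub[OF z(1)])
 have zX: "fst z p = so i l (X p)" if "p <= n" for p
  using z(2)[unfolded F.match_im_iff[OF M], folded X_def] that by blast
 have "nmap (go l) (gm l) n z = x"
 proof (rule MB.match_ext[OF L.nmap_mem[OF zn] _ x m])
  show "\<forall>p\<le>n. p ~= k --> facet n p (nmap (go l) (gm l) n z) = nmap (go i) (gm i) (n - 1) (y p)"
  proof (intro allI impI)
   fix p assume p: "p <= n" "p ~= k"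
   have n1: "1 <= n" using M.n2 by simp
   have "facet n p (nmap (go l) (gm l) n z) = nmap (go l) (gm l) (n - 1) (nmap (so i l) (sm i l) (n - 1) (y p))"
    unfolding L.nmap_pullback[OF dl_ord_map[OF n1]] using z(2) p by simp
   then show "facet n p (nmap (go l) (gm l) n z) = nmap (go i) (gm i) (n - 1) (y p)"
    using nmap_g_f[OF i l eq_sub[OF y[OF p]]] by simp
  qed
  show "snd (nmap (go l) (gm l) n z) H.om = snd x H.om"
   using c.base_g_f[OF Hom_data(1)[OF H.om_Ob] i l, of u "2 - int n"] u zX nerve_seqsD(5,6)[OF H.om_mem] H.om_mem z(3)
   by (simp add: nmap_def H.om_deg R_Hom)
  show "snd (nmap (go l) (gm l) n z) H.tp = snd x H.tp"
   using c.base_g_f[OF Hom_data(1)[OF H.tp_Ob] i l, of v "1 - int n"] v zX H.tp_mem z(4)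
   by (simp add: nmap_def H.tp_deg top_seq_simps R_Hom)
 qed
 then show ?thesis using l z(1,2) by blast
qed

text \<open>The two values of the filler are lifted to a common stage and the horn is moved there as
  well; the equations are then left to \<open>filler_at_stage\<close>.\<close>

lemma match_at_stage:
 assumes i: "i : I" and M: "match_data (RB (D i)) n k y"
  and y: "!!p. p <= n ==> p ~= k ==> y p : coherent_nerve_eq (RB (D i)) (n - 1)"
  and x: "x : coherent_nerve (RB B) n"
  and m: "\<forall>p\<le>n. p ~= k --> facet n p x = nmap (go i) (gm i) (n - 1) (y p)"
 shows "\<exists>l\<in>I. po i l & (\<exists>z\<in>coherent_nerve_eq (RB (D l)) n. nmap (go l) (gm l) n z = x &
  (\<forall>p\<le>n. p ~= k --> facet n p z = nmap (so i l) (sm i l) (n - 1) (y p)))"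
proof -
 interpret M: match_data "RB (D i)" n k y by (rule M)
 interpret B: adg "RB B" by (rule R_adg[OF c.B])
 have om: "omit n k : nerve_seqs n" "seq_deg (omit n k) = 2 - int n" "hd (omit n k) <= n" "last (omit n k) <= n"
  and tp: "top_seq n : nerve_seqs n"
  using horn_family.om_mem[OF M.horn_glue] horn_family.tp_mem[OF M.horn_glue] omit_simps(6)[OF M.kn M.n2]
   nerve_seqsD(5,6)[OF horn_family.om_mem[OF M.horn_glue]] by auto
 note xo = B.nerve_Ob[OF x]
 have uc: "snd x (omit n k) : tens K (Hom P (fst (fst x (hd (omit n k)))) (fst (fst x (last (omit n k)))) (2 - int n)) B"
  using B.nerve_mor[OF x om(1)] by (simp add: R_Hom om)
 have vc: "snd x (top_seq n) : tens K (Hom P (fst (fst x 0)) (fst (fst x n)) (1 - int n)) B"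
  using B.nerve_mor[OF x tp] by (simp add: R_Hom top_seq_simps)
 obtain j where j: "j : I" "po i j"
  and "(\<exists>u\<in>tens K (Hom P (fst (fst x (hd (omit n k)))) (fst (fst x (last (omit n k)))) (2 - int n)) (D j).
    hbase K P (fst (fst x (hd (omit n k)))) (fst (fst x (last (omit n k)))) (2 - int n) (D j) B (g j) u = snd x (omit n k)) &
   (\<exists>v\<in>tens K (Hom P (fst (fst x 0)) (fst (fst x n)) (1 - int n)) (D j).
    hbase K P (fst (fst x 0)) (fst (fst x n)) (1 - int n) (D j) B (g j) v = snd x (top_seq n))"
  by (rule c.ev_obtain[OF c.ev_conj[OF i c.ev_lift[OF Hom_data(1)[OF xo[OF om(3)] xo[OF om(4)]] i uc]
    c.ev_lift[OF Hom_data(1)[OF xo[OF le0] xo[OF order_refl]] i vc]]])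
 then obtain u v where
  u: "u : tens K (Hom P (fst (fst x (hd (omit n k)))) (fst (fst x (last (omit n k)))) (2 - int n)) (D j)"
   "hbase K P (fst (fst x (hd (omit n k)))) (fst (fst x (last (omit n k)))) (2 - int n) (D j) B (g j) u = snd x (omit n k)"
  and v: "v : tens K (Hom P (fst (fst x 0)) (fst (fst x n)) (1 - int n)) (D j)"
   "hbase K P (fst (fst x 0)) (fst (fst x n)) (1 - int n) (D j) B (g j) v = snd x (top_seq n)" by blast
 interpret F: adgfun "RB (D i)" "RB (D j)" "so i j" "sm i j" by (rule f_fun[OF i j])
 interpret G: adgfun "RB (D j)" "RB B" "go j" "gm j" by (rule g_fun[OF j(1)])
 define y' where "y' = (%p. nmap (so i j) (sm i j) (n - 1) (y p))"
 have M': "match_data (RB (D j)) n k y'" unfolding y'_def by (rule F.im_match[OF M])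
 have y': "y' p : coherent_nerve_eq (RB (D j)) (n - 1)" if "p <= n" "p ~= k" for p
  unfolding y'_def by (rule F.nmap_eq_mem[OF y[OF that]])
 have m': "\<forall>p\<le>n. p ~= k --> facet n p x = nmap (go j) (gm j) (n - 1) (y' p)"
  using m nmap_g_f[OF i j eq_sub[OF y]] unfolding y'_def by simp
 have X: "fst (fst x p) = fst (hX n k y' p)" if "p <= n" for p
  using m'[unfolded G.match_im_iff[OF M']] that by simp
 note X' = X[OF om(3)] X[OF om(4)] X[OF le0] X[OF order_refl]
 obtain l z where l: "l : I" "po j l" and z: "z : coherent_nerve_eq (RB (D l)) n" "nmap (go l) (gm l) n z = x"
  "\<forall>p\<le>n. p ~= k --> facet n p z = nmap (so j l) (sm j l) (n - 1) (y' p)"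
  using filler_at_stage[OF j(1) M' y' x m', unfolded R_Hom, OF _ _ u[unfolded X'] v[unfolded X']] by blast
 have "\<forall>p\<le>n. p ~= k --> facet n p z = nmap (so i l) (sm i l) (n - 1) (y p)"
  using z(3) nmap_f_f[OF i j(1) l(1) j(2) l(2) eq_sub[OF y]] unfolding y'_def by simp
 then show ?thesis using l(1) c.po_trans[OF i j(1) l(1) j(2) l(2)] z(1,2) by blast
qed

text \<open>Simplices over the same horn can differ only at the missing face and at the top, so only
  two equalities have to become true.\<close>

lemma match_inj:
 assumes i: "i : I" and M: "match_data (RB (D i)) n k y"
  and z: "z : coherent_nerve (RB (D i)) n" "\<forall>p\<le>n. p ~= k --> facet n p z = y p"
  and z': "z' : coherent_nerve (RB (D i)) n" "\<forall>p\<le>n. p ~= k --> facet n p z' = y p"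
  and e: "nmap (go i) (gm i) n z = nmap (go i) (gm i) n z'"
 shows "\<exists>l\<in>I. po i l & nmap (so i l) (sm i l) n z = nmap (so i l) (sm i l) n z'"
proof -
 interpret M: match_data "RB (D i)" n k y by (rule M)
 interpret H: horn_family "RB (D i)" n "hX n k y" "hA (RB (D i)) n k y" k by (rule M.horn_glue)
 have X: "fst z p = hX n k y p" "fst z' p = hX n k y p" if "p <= n" for p
  using z(2) z'(2) that unfolding M.match_iff by auto
 have c1: "c.ev i (%l. sm i l (hX n k y (hd s)) (hX n k y (last s)) (seq_deg s) (snd z s) =
   sm i l (hX n k y (hd s)) (hX n k y (last s)) (seq_deg s) (snd z' s))" if s: "s : nerve_seqs n" for s
 proof -
  note Xs = X[OF nerve_seqsD(5)[OF s]] X[OF nerve_seqsD(6)[OF s]]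
  have "snd (nmap (go i) (gm i) n z) s = snd (nmap (go i) (gm i) n z') s" using e by simp
  then have "gm i (hX n k y (hd s)) (hX n k y (last s)) (seq_deg s) (snd z s) =
    gm i (hX n k y (hd s)) (hX n k y (last s)) (seq_deg s) (snd z' s)" using s by (simp add: nmap_def Xs)
  moreover have "snd z s : mor (RB (D i)) (hX n k y (hd s)) (hX n k y (last s)) (seq_deg s)"
   "snd z' s : mor (RB (D i)) (hX n k y (hd s)) (hX n k y (last s)) (seq_deg s)"
   using M.nerve_mor[OF z(1) s] M.nerve_mor[OF z'(1) s] unfolding Xs by simp_all
  ultimately show ?thesis using ev_eq_R[OF i H.seq_Ob(1)[OF s] H.seq_Ob(2)[OF s]] by simp
 qed
 let ?e = "%s l. sm i l (hX n k y (hd s)) (hX n k y (last s)) (seq_deg s) (snd z s) =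
   sm i l (hX n k y (hd s)) (hX n k y (last s)) (seq_deg s) (snd z' s)"
 obtain l where l: "l : I" "po i l" and el: "?e H.om l & ?e H.tp l"
  by (rule c.ev_obtain[OF c.ev_conj[OF i c1[OF H.om_mem] c1[OF H.tp_mem]]])
 interpret F: adgfun "RB (D i)" "RB (D l)" "so i l" "sm i l" by (rule f_fun[OF i l(1,2)])
 interpret M': match_data "RB (D l)" n k "%p. nmap (so i l) (sm i l) (n - 1) (y p)" by (rule F.im_match[OF M])
 have n1: "1 <= n" using M.n2 by simp
 have mm: "\<forall>p\<le>n. p ~= k --> facet n p (nmap (so i l) (sm i l) n w) = nmap (so i l) (sm i l) (n - 1) (y p)"
  if "\<forall>p\<le>n. p ~= k --> facet n p w = y p" for w
  unfolding F.nmap_pullback[OF dl_ord_map[OF n1]] using that by simp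
 have "nmap (so i l) (sm i l) n z = nmap (so i l) (sm i l) n z'"
 proof (rule M'.match_ext[OF F.nmap_mem[OF z(1)] mm[OF z(2)] F.nmap_mem[OF z'(1)] mm[OF z'(2)]])
  show "snd (nmap (so i l) (sm i l) n z) H.om = snd (nmap (so i l) (sm i l) n z') H.om"
   using el X[OF nerve_seqsD(5)[OF H.om_mem]] X[OF nerve_seqsD(6)[OF H.om_mem]] H.om_mem by (simp add: nmap_def)
  show "snd (nmap (so i l) (sm i l) n z) H.tp = snd (nmap (so i l) (sm i l) n z') H.tp"
   using el X[OF nerve_seqsD(5)[OF H.tp_mem]] X[OF nerve_seqsD(6)[OF H.tp_mem]] H.tp_mem by (simp add: nmap_def)
 qed
 then show ?thesis using l(1,2) by blast
qed

text \<open>The element is lifted to some stage. Its curvature there vanishes in the colimit, hence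
  already at a later stage.\<close>

lemma object_at_stage:
 assumes i: "i : I" and W: "W : Ob (RB B)"
 shows "\<exists>l\<in>I. po i l & (\<exists>Y\<in>Ob (RB (D l)). go l Y = W)"
proof -
 obtain F \<zeta>' where We: "W = (F, \<zeta>')" by (cases W)
 have F: "F : Ob P" and \<zeta>': "\<zeta>' : tens K (Hom P F F 1) B" using R_ObD[OF W] by (simp_all add: We)
 note V = Hom_module[OF F F]
 obtain j \<zeta> where j: "j : I" "po i j" and \<zeta>: "\<zeta> : tens K (Hom P F F 1) (D j)"
  "hbase K P F F 1 (D j) B (g j) \<zeta> = \<zeta>'"
  using c.ev_obtain[OF c.ev_lift[OF V i \<zeta>']] by blast
 interpret J: adg "dg_tensor K P (D j)" by (rule dg_tensor_adg[OF P c.D[OF j(1)]])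
 interpret G: dgfun "dg_tensor K P (D j)" "dg_tensor K P B" "%E. E" "%E F i. hbase K P E F i (D j) B (g j)"
  by (rule dg_tensor_dgfun[OF P c.D[OF j(1)] c.B c.g[OF j(1)]])
 have Y: "(F, \<zeta>) : Ob (pMC (dg_tensor K P (D j)))" using F \<zeta>(1) by (simp add: pMC_Ob dg_tensor_def)
 have FQ: "F : Ob (dg_tensor K P (D j))" using F by (simp add: dg_tensor_def)
 have cc: "curv (dg_tensor K P (D j)) (F, \<zeta>) : tens K (Hom P F F 2) (D j)"
  using J.curv_closed[OF Y] by (simp add: dg_tensor_def)
 have zc: "\<zero>[tensor K (Hom P F F 2) (D j)] : tens K (Hom P F F 2) (D j)"
  by (rule abelian_monoid.zero_closed[OF abelian_group.axioms(1)[OF tensor_pair.T_group[OF tensor_pair.intro[OF V c.D[OF j(1)]]]]])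
 have "hbase K P F F 2 (D j) B (g j) (curv (dg_tensor K P (D j)) (F, \<zeta>)) = \<zero>[tensor K (Hom P F F 2) B]"
  using G.Fm_curv[OF Y] W \<zeta>(2) by (simp add: We MC_Ob dg_tensor_def)
 also have "\<dots> = hbase K P F F 2 (D j) B (g j) \<zero>[tensor K (Hom P F F 2) (D j)]"
  by (rule amap_zero[OF tensor_base_amap[OF V c.D[OF j(1)] c.B c.g[OF j(1)]], symmetric])
 finally obtain l where l: "l : I" "po j l" and e:
  "hbase K P F F 2 (D j) (D l) (f j l) (curv (dg_tensor K P (D j)) (F, \<zeta>)) =
  hbase K P F F 2 (D j) (D l) (f j l) \<zero>[tensor K (Hom P F F 2) (D j)]"
  using c.ev_obtain[OF c.ev_eq[OF V fd[OF F F] j(1) cc zc]] by blast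
 interpret F: dgfun "dg_tensor K P (D j)" "dg_tensor K P (D l)" "%E. E" "%E F i. hbase K P E F i (D j) (D l) (f j l)"
  by (rule dg_tensor_dgfun[OF P c.D[OF j(1)] c.D[OF l(1)] c.f[OF j(1) l]])
 let ?\<zeta> = "hbase K P F F 1 (D j) (D l) (f j l) \<zeta>"
 note z0 = amap_zero[OF tensor_base_amap[OF V c.D[OF j(1)] c.D[OF l(1)] c.f[OF j(1) l]]]
 have zc': "?\<zeta> : tens K (Hom P F F 1) (D l)"
  by (rule amap_closed[OF tensor_base_amap[OF V c.D[OF j(1)] c.D[OF l(1)] c.f[OF j(1) l]] \<zeta>(1)])
 have "curv (dg_tensor K P (D l)) (F, ?\<zeta>) = \<zero>[tensor K (Hom P F F 2) (D l)]"
  using F.Fm_curv[OF Y] e z0 by simp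
 then have "(F, ?\<zeta>) : Ob (RB (D l))" using F zc' by (simp add: MC_Ob pMC_Ob dg_tensor_def)
 moreover have "go l (F, ?\<zeta>) = W" using c.base_g_f[OF V j(1) l \<zeta>(1)] \<zeta>(2) by (simp add: We)
 ultimately show ?thesis using l(1) c.po_trans[OF i j(1) l(1) j(2) l(2)] by blast
qed

text \<open>The map, its inverse and the two homotopies are lifted to one stage; the four equations
  between them hold from a later stage on.\<close>

lemma equivalence_at_stage:
 assumes i: "i : I" and o: "X : Ob (RB (D i))" "Y : Ob (RB (D i))"
  and e: "equivalence (RB B) (go i X) (go i Y) e"
 shows "\<exists>l\<in>I. po i l & (\<exists>a. equivalence (RB (D l)) (so i l X) (so i l Y) a &
  hbase K P (fst X) (fst Y) 0 (D l) B (g l) a = e)"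
proof -
 let ?T = "%X Y d. tensor K (Hom P (fst X) (fst Y) d)"
 let ?b = "%X Y d l. hbase K P (fst X) (fst Y) d (D l) B (g l)"
 obtain e' h h' where eqv: "eqv_data (RB B) (go i X) (go i Y) e e' h h'" using e unfolding equivalence_iff_data by blast
 then have cl: "e : carrier (?T X Y 0 B)" "e' : carrier (?T Y X 0 B)"
  "h : carrier (?T X X (-1) B)" "h' : carrier (?T Y Y (-1) B)" unfolding eqv_data_def R_Hom by simp_all
 obtain j where j: "j : I" "po i j" and
  "(\<exists>a\<in>carrier (?T X Y 0 (D j)). ?b X Y 0 j a = e) & (\<exists>a\<in>carrier (?T Y X 0 (D j)). ?b Y X 0 j a = e') &
  (\<exists>a\<in>carrier (?T X X (-1) (D j)). ?b X X (-1) j a = h) & (\<exists>a\<in>carrier (?T Y Y (-1) (D j)). ?b Y Y (-1) j a = h')"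
  by (rule c.ev_obtain[OF c.ev_conj[OF i c.ev_lift[OF Hom_data(1)[OF o] i cl(1)]
   c.ev_conj[OF i c.ev_lift[OF Hom_data(1)[OF o(2,1)] i cl(2)]
   c.ev_conj[OF i c.ev_lift[OF Hom_data(1)[OF o(1,1)] i cl(3)] c.ev_lift[OF Hom_data(1)[OF o(2,2)] i cl(4)]]]]])
 then obtain a a' q q' where a: "a : carrier (?T X Y 0 (D j))" "a' : carrier (?T Y X 0 (D j))"
   "q : carrier (?T X X (-1) (D j))" "q' : carrier (?T Y Y (-1) (D j))"
  and ab: "?b X Y 0 j a = e" "?b Y X 0 j a' = e'" "?b X X (-1) j q = h" "?b Y Y (-1) j q' = h'" by blast
 interpret J: adg "RB (D j)" by (rule R_adg[OF c.D[OF j(1)]])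
 interpret S: adgfun "RB (D i)" "RB (D j)" "so i j" "sm i j" by (rule f_fun[OF i j])
 interpret G: adgfun "RB (D j)" "RB B" "go j" "gm j" by (rule g_fun[OF j(1)])
 define X' Y' where XY: "X' = so i j X" "Y' = so i j Y"
 have o': "X' : Ob (RB (D j))" "Y' : Ob (RB (D j))" unfolding XY by (rule S.Fo_Ob[OF o(1)] S.Fo_Ob[OF o(2)])+
 have f': "fst X' = fst X" "fst Y' = fst Y" by (simp_all add: XY)
 have ac: "a : mor (RB (D j)) X' Y' 0" "a' : mor (RB (D j)) Y' X' 0"
  "q : mor (RB (D j)) X' X' (-1)" "q' : mor (RB (D j)) Y' Y' (-1)"
  using a unfolding R_Hom f' by simp_all
 have gg: "go j X' = go i X" "go j Y' = go i Y" unfolding XY by (rule go_so[OF i j o(1)] go_so[OF i j o(2)])+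
 have "eqv_data (RB B) (go j X') (go j Y') (gm j X' Y' 0 a) (gm j Y' X' 0 a') (gm j X' X' (-1) q) (gm j Y' Y' (-1) q')"
  unfolding gg unfolding f' ab by (rule eqv)
 note E = this[unfolded G.eqv_data_image[OF o' ac]]
 have in_: "(1::int) = 0 + 1" "(0::int) = -1 + 1" "(0::int) = 0 + 0" by simp_all
 interpret X0: abelian_group "Hom (RB (D j)) X' X' 0" by (rule J.hom_group[OF o'(1,1)])
 interpret Y0: abelian_group "Hom (RB (D j)) Y' Y' 0" by (rule J.hom_group[OF o'(2,2)])
 interpret XY: abelian_group "Hom (RB (D j)) X' Y' 1" by (rule J.hom_group[OF o'(1,2)])
 interpret YX: abelian_group "Hom (RB (D j)) Y' X' 1" by (rule J.hom_group[OF o'(2,1)])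
 note k1 = J.dif_closed[OF o' ac(1) in_(1)] and k2 = J.dif_closed[OF o'(2,1) ac(2) in_(1)]
  and k3 = X0.minus_closed[OF J.cmp_closed[OF o'(1,2,1) ac(2,1) in_(3)] J.idn_closed[OF o'(1)]]
  and k4 = Y0.minus_closed[OF J.cmp_closed[OF o'(2,1,2) ac(1,2) in_(3)] J.idn_closed[OF o'(2)]]
  and k5 = J.dif_closed[OF o'(1,1) ac(3) in_(2)] and k6 = J.dif_closed[OF o'(2,2) ac(4) in_(2)]
 obtain l where l: "l : I" "po j l" and el:
  "sm j l X' Y' 1 (dif (RB (D j)) X' Y' 0 a) = sm j l X' Y' 1 \<zero>[Hom (RB (D j)) X' Y' 1] &
  sm j l Y' X' 1 (dif (RB (D j)) Y' X' 0 a') = sm j l Y' X' 1 \<zero>[Hom (RB (D j)) Y' X' 1] &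
  sm j l X' X' 0 (cmp (RB (D j)) X' Y' X' 0 0 a' a \<ominus>[Hom (RB (D j)) X' X' 0] idn (RB (D j)) X') =
   sm j l X' X' 0 (dif (RB (D j)) X' X' (-1) q) &
  sm j l Y' Y' 0 (cmp (RB (D j)) Y' X' Y' 0 0 a a' \<ominus>[Hom (RB (D j)) Y' Y' 0] idn (RB (D j)) Y') =
   sm j l Y' Y' 0 (dif (RB (D j)) Y' Y' (-1) q')"
  by (rule c.ev_obtain[OF c.ev_conj[OF j(1) ev_eq_R[OF j(1) o' k1 XY.zero_closed E[THEN conjunct1]]
   c.ev_conj[OF j(1) ev_eq_R[OF j(1) o'(2,1) k2 YX.zero_closed E[THEN conjunct2, THEN conjunct1]]
   c.ev_conj[OF j(1) ev_eq_R[OF j(1) o'(1,1) k3 k5 E[THEN conjunct2, THEN conjunct2, THEN conjunct1]]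
    ev_eq_R[OF j(1) o'(2,2) k4 k6 E[THEN conjunct2, THEN conjunct2, THEN conjunct2]]]]]])
 interpret F: adgfun "RB (D j)" "RB (D l)" "so j l" "sm j l" by (rule f_fun[OF j(1) l])
 have "eqv_data (RB (D l)) (so j l X') (so j l Y') (sm j l X' Y' 0 a) (sm j l Y' X' 0 a') (sm j l X' X' (-1) q) (sm j l Y' Y' (-1) q')"
  unfolding F.eqv_data_image[OF o' ac] by (rule el)
 then have "equivalence (RB (D l)) (so j l X') (so j l Y') (sm j l X' Y' 0 a)" unfolding equivalence_iff_data by blast
 moreover have il: "po i l" by (rule c.po_trans[OF i j(1) l(1) j(2) l(2)])
 moreover have "so j l (so i j Z) = so i l Z" if "Z : Ob (RB (D i))" for Z
  by (rule fo_comp[OF c.D[OF i] c.D[OF j(1)] c.D[OF l(1)] c.f[OF i j] c.f[OF j(1) l] c.f[OF i l(1) il] c.ff[OF i j(1) l(1) j(2) l(2)] that])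
 moreover have "?b X Y 0 l (sm j l X' Y' 0 a) = e"
  using c.base_g_f[OF Hom_data(1)[OF o] j(1) l a(1)] ab(1) by (simp add: f')
 ultimately show ?thesis using l(1) o unfolding XY by metis
qed

lemma edge_at_stage:
 assumes i: "i : I" and k: "k <= 1" and U: "U : Ob (RB (D i))"
  and x: "x : coherent_nerve_eq (RB B) 1" "fst x k = go i U"
 shows "\<exists>l\<in>I. po i l & (\<exists>z\<in>coherent_nerve_eq (RB (D l)) 1. nmap (go l) (gm l) 1 z = x & fst z k = so i l U)"
proof -
 interpret B: adg "RB B" by (rule R_adg[OF c.B])
 have W: "fst x (1 - k) : Ob (RB B)" by (rule B.nerve_Ob[OF eq_sub[OF x(1)]]) simp
 obtain j Y where j: "j : I" "po i j" and Y: "Y : Ob (RB (D j))" "go j Y = fst x (1 - k)"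
  using object_at_stage[OF i W] by blast
 interpret S: adgfun "RB (D i)" "RB (D j)" "so i j" "sm i j" by (rule f_fun[OF i j])
 define Z where "Z = (%p. if p = k then so i j U else Y)"
 have Zo: "Z p : Ob (RB (D j))" for p using S.Fo_Ob[OF U] Y by (simp add: Z_def)
 have Zx: "go j (Z p) = fst x p" if "p <= 1" for p
 proof (cases "p = k")
  case True
  have "Z p = so i j U" using True by (simp add: Z_def)
  then show ?thesis using go_so[OF i j U] x(2) unfolding True by (simp only:)
 next
  case False
  then have "p = 1 - k" using that k by arith
  moreover have "Z p = Y" using False by (simp add: Z_def)
  ultimately show ?thesis using Y(2) by (simp only:)
 qed
 have e: "equivalence (RB B) (fst x 0) (fst x 1) (snd x [0, 1])" using x(1) by (simp add: coherent_nerve_eq_iff)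
 obtain l a where l: "l : I" "po j l" and a: "equivalence (RB (D l)) (so j l (Z 0)) (so j l (Z 1)) a"
  "hbase K P (fst (Z 0)) (fst (Z 1)) 0 (D l) B (g l) a = snd x [0, 1]"
  using equivalence_at_stage[OF j(1) Zo Zo e[folded Zx[OF le0] Zx[OF order_refl]]] by blast
 interpret F: adgfun "RB (D j)" "RB (D l)" "so j l" "sm j l" by (rule f_fun[OF j(1) l])
 interpret L: adgfun "RB (D l)" "RB B" "go l" "gm l" by (rule g_fun[OF l(1)])
 obtain z where z: "z : coherent_nerve_eq (RB (D l)) 1" "!!p. p <= 1 ==> fst z p = so j l (Z p)" "snd z [0, 1] = a"
  by (rule F.B.ex_edge_simplex[where Z = "%p. so j l (Z p)", OF a(1) F.Fo_Ob[OF Zo]]) blast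
 have "nmap (go l) (gm l) 1 z = x"
 proof (rule B.nerve_1_eqI[OF L.nmap_mem[OF eq_sub[OF z(1)]] eq_sub[OF x(1)]])
  show "fst (nmap (go l) (gm l) 1 z) p = fst x p" if "p <= 1" for p
  proof -
   have "fst (nmap (go l) (gm l) 1 z) p = go l (so j l (Z p))" using that z(2)[OF that] by (simp add: nmap_def)
   then show ?thesis using go_so[OF j(1) l Zo, of p] Zx[OF that] by (simp only:)
  qed
  show "snd (nmap (go l) (gm l) 1 z) [0, 1] = snd x [0, 1]"
   using a(2) z(2)[of 0] z(2)[of 1] z(3) edge_seq[of 0 1 1] by (simp add: nmap_def seq_deg_def)
 qed
 moreover have il: "po i l" by (rule c.po_trans[OF i j(1) l(1) j(2) l(2)])
 moreover have "fst z k = so i l U"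
 proof -
  have "fst z k = so j l (so i j U)" using z(2)[OF k] by (simp add: Z_def)
  also have "\<dots> = so i l U"
   by (rule fo_comp[OF c.D[OF i] c.D[OF j(1)] c.D[OF l(1)] c.f[OF i j] c.f[OF j(1) l] c.f[OF i l(1) il]
     c.ff[OF i j(1) l(1) j(2) l(2)] U])
  finally show ?thesis .
 qed
 ultimately show ?thesis using l(1) z(1) by blast
qed

text \<open>Base change does not affect the underlying objects of \<open>P\<close>, so these agree
  from the start. What has to become equal are two Maurer-Cartan elements and one morphism.\<close>

lemma edge_inj:
 assumes i: "i : I" and z: "z : coherent_nerve (RB (D i)) 1" and z': "z' : coherent_nerve (RB (D i)) 1"
  and e: "nmap (go i) (gm i) 1 z = nmap (go i) (gm i) 1 z'"
 shows "\<exists>l\<in>I. po i l & nmap (so i l) (sm i l) 1 z = nmap (so i l) (sm i l) 1 z'"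
proof -
 interpret A: adg "RB (D i)" by (rule R_adg[OF c.D[OF i]])
 note zo = A.nerve_Ob[OF z] and zo' = A.nerve_Ob[OF z']
 have v: "go i (fst z p) = go i (fst z' p)" if "p <= 1" for p
 proof -
  have "(\<lambda>q\<in>{..1}. go i (fst z q)) p = (\<lambda>q\<in>{..1}. go i (fst z' q)) p"
   using e unfolding nmap_def prod_eq_iff fst_conv by metis
  then show ?thesis using that by (simp only: restrict_apply atMost_iff if_True)
 qed
 have f': "fst (fst z' p) = fst (fst z p)" if "p <= 1" for p using v[OF that] by simp
 have ev_v: "c.ev i (%l. so i l (fst z p) = so i l (fst z' p))" if p: "p <= 1" for p
 proof -
  obtain E \<eta> \<eta>' where zz: "fst z p = (E, \<eta>)" "fst z' p = (E, \<eta>')"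
   using v[OF p] by (cases "fst z p"; cases "fst z' p") auto
  have "c.ev i (%l. hbase K P E E 1 (D i) (D l) (f i l) \<eta> =
    hbase K P E E 1 (D i) (D l) (f i l) \<eta>')"
   using v[OF p] R_ObD(2)[OF zo[OF p]] R_ObD(2)[OF zo'[OF p]]
   by (intro c.ev_eq[OF Hom_data[OF zo[OF p] zo[OF p], unfolded zz fst_conv] i]) (simp_all add: zz)
  then show ?thesis by (simp add: zz)
 qed
 have s: "[0, 1] : nerve_seqs 1" by (rule edge_seq) auto
 have "snd (nmap (go i) (gm i) 1 z) [0, 1] = snd (nmap (go i) (gm i) 1 z') [0, 1]" using e by simp
 then have "hbase K P (fst (fst z 0)) (fst (fst z 1)) 0 (D i) B (g i) (snd z [0, 1]) =
   hbase K P (fst (fst z 0)) (fst (fst z 1)) 0 (D i) B (g i) (snd z' [0, 1])"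
  using s f'[of 0] f'[of 1] by (simp add: nmap_def seq_deg_def)
 then have "c.ev i (%l. hbase K P (fst (fst z 0)) (fst (fst z 1)) 0 (D i) (D l) (f i l) (snd z [0, 1]) =
   hbase K P (fst (fst z 0)) (fst (fst z 1)) 0 (D i) (D l) (f i l) (snd z' [0, 1]))"
  using A.nerve_mor[OF z s] A.nerve_mor[OF z' s] f'[of 0] f'[of 1]
  by (intro c.ev_eq Hom_data[OF zo zo] i) (simp_all add: R_Hom seq_deg_def)
 note ea = this
 obtain l where l: "l : I" "po i l" and el:
  "hbase K P (fst (fst z 0)) (fst (fst z 1)) 0 (D i) (D l) (f i l) (snd z [0, 1]) =
   hbase K P (fst (fst z 0)) (fst (fst z 1)) 0 (D i) (D l) (f i l) (snd z' [0, 1]) &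
  so i l (fst z 0) = so i l (fst z' 0) & so i l (fst z 1) = so i l (fst z' 1)"
  by (rule c.ev_obtain[OF c.ev_conj[OF i ea c.ev_conj[OF i ev_v[OF le0] ev_v[OF order_refl]]]])
 interpret F: adgfun "RB (D i)" "RB (D l)" "so i l" "sm i l" by (rule f_fun[OF i l(1,2)])
 have "nmap (so i l) (sm i l) 1 z = nmap (so i l) (sm i l) 1 z'"
 proof (rule F.B.nerve_1_eqI[OF F.nmap_mem[OF z] F.nmap_mem[OF z']])
  show "fst (nmap (so i l) (sm i l) 1 z) p = fst (nmap (so i l) (sm i l) 1 z') p" if "p <= 1" for p
  proof -
   have "p = 0 \<or> p = 1" using that by arith
   then have "so i l (fst z p) = so i l (fst z' p)" using el by (elim disjE) (simp_all only:)
   then show ?thesis unfolding nmap_def fst_conv using that by (simp only: restrict_apply atMost_iff if_True)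
  qed
  show "snd (nmap (so i l) (sm i l) 1 z) [0, 1] = snd (nmap (so i l) (sm i l) 1 z') [0, 1]"
   using el[THEN conjunct1] s f'[of 0] f'[of 1] by (simp add: nmap_def seq_deg_def)
 qed
 then show ?thesis using l(1,2) by blast
qed

end

context MC_data
begin

lemma match_locally_fin_pres:
 assumes n: "1 <= n" "k <= n"
 shows "locally_fin_pres TYPE('i) K (level MS n) (Match MS n k) (match_map MS n k)"
 unfolding locally_fin_pres_def MS_simps
proof (intro allI impI; elim conjE)
 fix I :: "'i set" and po D f and B :: "('k, 'b) module" and g A \<sigma> \<tau> y
 assume ds: "directed_system K I po D f" and dc: "directed_colimit K I po D f B g"
  and A: "algebra K A" and y: "y : points (Match MS n k) A" and \<tau>: "\<tau> : alg_hom K A B"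
  and "\<forall>i\<in>I. \<sigma> i : alg_hom K A (D i)"
  and "\<forall>i\<in>I. \<forall>j\<in>I. po i j --> (\<forall>a\<in>carrier A. f i j (\<sigma> i a) = \<sigma> j a)"
  and "\<forall>i\<in>I. \<forall>a\<in>carrier A. g i (\<sigma> i a) = \<tau> a"
 then have \<sigma>: "\<sigma> i : alg_hom K A (D i)" and f\<sigma>: "j : I ==> po i j ==> a : carrier A ==> f i j (\<sigma> i a) = \<sigma> j a"
  and g\<sigma>: "a : carrier A ==> g i (\<sigma> i a) = \<tau> a" if "i : I" for i j a using that by blast+
 interpret C: MC_colimit K P I po D f B g
  by (intro MC_colimit.intro MC_data_axioms colimit.intro K ds dc)
 \<comment> \<open>The horn over \<open>A\<close> is replaced by its images at the stages. They are
   compatible by \<open>wf\<close>, and the lemmas about a horn at a stage apply to them.\<close>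
 define w where "w = (%i p. nmap (fo A (D i) (\<sigma> i)) (fm A (D i) (\<sigma> i)) (n - 1) (y p))"
 have yn: "y p : coherent_nerve_eq (RB A) (n - 1)" if "p <= n" "p ~= k" for p by (rule match_pointsD(1)[OF y that])
 have S: "adgfun (RB A) (RB (D i)) (fo A (D i) (\<sigma> i)) (fm A (D i) (\<sigma> i))" if "i : I" for i
  by (rule R_fun[OF A C.c.D[OF that] \<sigma>[OF that]])
 have wn: "w i p : coherent_nerve_eq (RB (D i)) (n - 1)" if "i : I" "p <= n" "p ~= k" for i p
  unfolding w_def by (rule adgfun.nmap_eq_mem[OF S[OF that(1)] yn[OF that(2,3)]])
 have wB: "nmap (C.go i) (C.gm i) (n - 1) (w i p) = nmap (fo A B \<tau>) (fm A B \<tau>) (n - 1) (y p)"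
  if "i : I" "p <= n" "p ~= k" for i p
  unfolding w_def base_change_nmap[symmetric]
  by (rule base_change_comp[OF A C.c.D[OF that(1)] C.c.B \<sigma>[OF that(1)] C.c.g[OF that(1)] \<tau> g\<sigma>[OF that(1)] eq_sub[OF yn[OF that(2,3)]]])
 have wf: "nmap (C.so i j) (C.sm i j) (n - 1) (w i p) = w j p" if "i : I" "j : I" "po i j" "p <= n" "p ~= k" for i j p
  unfolding w_def base_change_nmap[symmetric]
  by (rule base_change_comp[OF A C.c.D[OF that(1)] C.c.D[OF that(2)] \<sigma>[OF that(1)] C.c.f[OF that(1-3)] \<sigma>[OF that(2)]
     f\<sigma>[OF that(1-3)] eq_sub[OF yn[OF that(4,5)]]])
 have Md: "match_data (RB (D i)) n k (w i)" if "2 <= n" "i : I" for i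
  unfolding w_def by (rule adgfun.im_match[OF S[OF that(2)] match_points_data[OF A that(1) n(2) y]])
 have one: "k <= 1" "1 - k <= n" "1 - k ~= k" if "n = 1" using n that by arith+
 have w1: "w i (1 - k) : coherent_nerve_eq (RB (D i)) 0" if "n = 1" "i : I" for i
  using wn[OF that(2) one(2,3)[OF that(1)]] that(1) by simp
 have mD: "match_map MS n k (D i) z = pmap (Match MS n k) A (D i) (\<sigma> i) y \<longleftrightarrow>
   (\<forall>p\<le>n. p ~= k --> facet n p z = w i p)" for i z
  unfolding match_map_pmap_iff w_def ..
 have "I ~= {}" using ds by (simp add: directed_system_def)
 \<comment> \<open>Any stage can serve as the starting point, since the stages found later are
   chosen above it.\<close>
 then obtain i0 where i0: "i0 : I" by blast
 have lift: "\<exists>i\<in>I. \<exists>z\<in>coherent_nerve_eq (RB (D i)) n.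
    match_map MS n k (D i) z = pmap (Match MS n k) A (D i) (\<sigma> i) y & base_change K P n (D i) B (g i) z = x"
  if x: "x : coherent_nerve_eq (RB B) n" and m: "match_map MS n k B x = pmap (Match MS n k) A B \<tau> y" for x
 proof -
  have m': "\<forall>p\<le>n. p ~= k --> facet n p x = nmap (C.go i0) (C.gm i0) (n - 1) (w i0 p)"
   using m[unfolded match_map_pmap_iff] wB[OF i0] by simp
  have "\<exists>l\<in>I. \<exists>z\<in>coherent_nerve_eq (RB (D l)) n. nmap (C.go l) (C.gm l) n z = x &
    (\<forall>p\<le>n. p ~= k --> facet n p z = w l p)"
  proof (cases "n = 1")
   case False
   then have n2: "2 <= n" using n by simp
   obtain l z where l: "l : I" "po i0 l" and z: "z : coherent_nerve_eq (RB (D l)) n" "nmap (C.go l) (C.gm l) n z = x"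
    "\<forall>p\<le>n. p ~= k --> facet n p z = nmap (C.so i0 l) (C.sm i0 l) (n - 1) (w i0 p)"
    using C.match_at_stage[OF i0 Md[OF n2 i0] wn[OF i0] eq_sub[OF x] m'] by blast
   have "\<forall>p\<le>n. p ~= k --> facet n p z = w l p" using z(3) wf[OF i0 l] by simp
   then show ?thesis using l(1) z(1,2) by blast
  next
   case True
   note o = one[OF True]
   have x1: "x : coherent_nerve_eq (RB B) 1" using x True by simp
   interpret G: adgfun "RB (D i0)" "RB B" "C.go i0" "C.gm i0" by (rule C.g_fun[OF i0])
   have "fst x k = fst (nmap (C.go i0) (C.gm i0) 0 (w i0 (1 - k))) 0"
    using m' match_1_iff[where y = "%p. nmap (C.go i0) (C.gm i0) 0 (w i0 p)",
      OF C.c.B o(1) eq_sub[OF x1] G.nmap_mem[OF eq_sub[OF w1[OF True i0]]]] unfolding True by simp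
   then have U: "fst x k = C.go i0 (fst (w i0 (1 - k)) 0)" by (simp add: nmap_def)
   have Uo: "fst (w i0 (1 - k)) 0 : Ob (RB (D i0))" using G.A.nerve_Ob[OF eq_sub[OF w1[OF True i0]]] by simp
   obtain l z where l: "l : I" "po i0 l" and z: "z : coherent_nerve_eq (RB (D l)) 1" "nmap (C.go l) (C.gm l) 1 z = x"
    "fst z k = C.so i0 l (fst (w i0 (1 - k)) 0)"
    using C.edge_at_stage[OF i0 o(1) Uo x1 U] by blast
   have "fst z k = fst (nmap (C.so i0 l) (C.sm i0 l) 0 (w i0 (1 - k))) 0" using z(3) by (simp add: nmap_def)
   also have "\<dots> = fst (w l (1 - k)) 0" using wf[OF i0 l o(2,3)] unfolding True by simp
   finally have "\<forall>p\<le>1. p ~= k --> nerve_pullback (1 - 1) (dl p) z = w l p"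
    unfolding match_1_iff[where y = "w l", OF C.c.D[OF l(1)] o(1) eq_sub[OF z(1)] eq_sub[OF w1[OF True l(1)]]] .
   then show ?thesis using l(1) z(1,2) unfolding True by blast
  qed
  then show ?thesis unfolding mD base_change_nmap by blast
 qed
 have inj: "\<exists>j\<in>I. po i j & base_change K P n (D i) (D j) (f i j) z = base_change K P n (D i) (D j) (f i j) z'"
  if i: "i : I" and z: "z : coherent_nerve_eq (RB (D i)) n" "z' : coherent_nerve_eq (RB (D i)) n"
   and m: "match_map MS n k (D i) z = pmap (Match MS n k) A (D i) (\<sigma> i) y"
    "match_map MS n k (D i) z' = pmap (Match MS n k) A (D i) (\<sigma> i) y"
   and e: "base_change K P n (D i) B (g i) z = base_change K P n (D i) B (g i) z'" for i z z'
 proof (cases "n = 1")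
  case False
  then have n2: "2 <= n" using n by simp
  show ?thesis unfolding base_change_nmap
   by (rule C.match_inj[OF i Md[OF n2 i] eq_sub[OF z(1)] m(1)[unfolded mD] eq_sub[OF z(2)] m(2)[unfolded mD]
      e[unfolded base_change_nmap]])
 next
  case True
  show ?thesis unfolding base_change_nmap True
   by (rule C.edge_inj[OF i eq_sub[OF z(1)[unfolded True]] eq_sub[OF z(2)[unfolded True]] e[unfolded base_change_nmap True]])
 qed
 show "(\<forall>x\<in>coherent_nerve_eq (RB B) n. match_map MS n k B x = pmap (Match MS n k) A B \<tau> y -->
   (\<exists>i\<in>I. \<exists>z\<in>coherent_nerve_eq (RB (D i)) n.
    match_map MS n k (D i) z = pmap (Match MS n k) A (D i) (\<sigma> i) y & base_change K P n (D i) B (g i) z = x)) &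
  (\<forall>i\<in>I. \<forall>z\<in>coherent_nerve_eq (RB (D i)) n. \<forall>z'\<in>coherent_nerve_eq (RB (D i)) n.
   match_map MS n k (D i) z = pmap (Match MS n k) A (D i) (\<sigma> i) y &
   match_map MS n k (D i) z' = pmap (Match MS n k) A (D i) (\<sigma> i) y &
   base_change K P n (D i) B (g i) z = base_change K P n (D i) B (g i) z' -->
   (\<exists>j\<in>I. po i j & base_change K P n (D i) (D j) (f i j) z = base_change K P n (D i) (D j) (f i j) z'))"
  by (intro conjI ballI impI; (elim conjE)?) (rule lift inj; assumption)+
qed

text \<open>A horn over a field is filled over the same field, so the common extension in
  \<open>same_point\<close> is that field itself.\<close>

lemma match_surjective:
 assumes n: "1 <= n" "k <= n"
 shows "surjective_morphism K (level MS n) (Match MS n k) (match_map MS n k)"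
 unfolding surjective_morphism_def MS_simps
proof (intro allI impI; elim conjE)
 fix L y assume L: "field L" "algebra K L" and y: "y : points (Match MS n k) L"
 obtain x where x: "x : coherent_nerve_eq (RB L) n" "match_map MS n k L x = y"
  using match_surj[OF L(2) n y] by blast
 have "same_point K (Match MS n k) L (match_map MS n k L x) L y"
  unfolding same_point_def x(2) using L id_hom[OF L(2)] by blast
 then show "\<exists>L' x. field L' & algebra K L' & x : coherent_nerve_eq (RB L') n &
   same_point K (Match MS n k) L' (match_map MS n k L' x) L y" using L x(1) by blast
qed

end

theorem mainTheorem1:
  fixes K :: "'k ring" and P :: "('k, 'o, 'm) dgcat" and m :: int
  assumes "field K"
    and "dg_category K P"
    and "finite (Ob P)"
    and "\<And>E F i. E \<in> Ob P \<Longrightarrow> F \<in> Ob P \<Longrightarrow> fin_dim K (Hom P E F i)"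
    and "m > 0"
    and "\<And>E F i. E \<in> Ob P \<Longrightarrow> F \<in> Ob P \<Longrightarrow> i < - m \<Longrightarrow> carrier (Hom P E F i) = {\<zero>\<^bsub>Hom P E F i\<^esub>}"
  shows "Grothendieck_Pridham TYPE('i) K
    (MC_scheme K P ::
      ('k, 'b, ('o \<times> ('m \<Rightarrow> 'b) set, ('m \<Rightarrow> 'b) set) simplex) simplicial_kfun)"
proof -
 interpret MC_data K P by (rule MC_data.intro[OF assms(1,2,4)])
 show ?thesis unfolding Grothendieck_Pridham_def GP_condition_def smooth_morphism_def
  using MS_simplicial match_locally_fin_pres match_formally_smooth match_surjective by blast
qed

end
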